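(* Let $\alpha,\beta,\gamma,\Gamma\in\mathbb{R}$ and $\lambda>0$. Let $u_0\in H^s(\mathbb{R})$ with $s>\frac32$, and let $u(t,x)$ be the corresponding solution of $$u_t+(u+\Gamma)u_x+\lambda u=\Lambda^{-2}\partial_x\Big(h(u)-u^2-\tfrac12u_x^2\Big),\quad x\in\mathbb{R},\ t>0,\qquad u(0,x)=u_0(x).$$ Let $n\in\mathbb{N}\setminus\{0\}$ and suppose that the slope of $u_0$ satisfies $$f(0):=\int_{\mathbb{R}}u_{0x}^{2n+1}\,dx<-\left(\frac{8cK^2\|u_0\|_{H^1}^{\frac{2}{2n-1}}}{2n-1}\right)^{\frac{2n-1}{2n}},$$ where $$K^2=\frac{\lambda(n+1)\Big(4c\lambda(n+1)\|u_0\|_{H^1}^{\frac{2}{2n-1}}\Big)^{2n-1}}{2n^{2n}}+\frac{(2n+1)(C_1+C_3)}{n+1}\left(\frac{8n(2n+1)C_2}{(2n-1)(n+1)}\right)^n,$$ $$C_1+C_3=\frac{2(|\alpha|+|\Gamma|)\|u_0\|_{H^1}^{n+1}}{(\sqrt2)^{n-1}}+\frac{|\beta|\big(\|u_0\|_{H^1}^{3(n+1)}+\|u_0\|_{H^1}^{3n+5}\big)}{3(\sqrt2)^{3n+1}}+\frac{|\gamma|\,\|u_0\|_{H^1}^{4n+4}}{2^{2(n+1)}}+\frac{\|u_0\|_{H^1}^{2(n+1)}}{2^n},$$ $$C_2=|\alpha|+|\Gamma|+\frac{|\beta|}{3}+\frac{|\gamma|}{4}+\frac12,$$ and $c$ is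 the Gagliardo–Nirenberg constant. Then there exists a lifespan $T<\infty$ such that the solution $u$ blows up in finite time $T$. Moreover, the lifespan $T$ satisfies $$T\le\int_{-f(0)}^{\infty}\frac{dy}{\frac{2n-1}{8c}\|u_0\|_{H^1}^{-\frac{2}{2n-1}}\,y^{\frac{2n}{2n-1}}-K^2}.$$
   Context: Here $h(u)=(\alpha+\Gamma)u+\frac{\beta}{3}u^3+\frac{\gamma}{4}u^4$ and $\Lambda^{-2}=(1-\partial_{xx})^{-1}$, i.e. convolution with $\frac12e^{-|x|}$ on $\mathbb{R}$. The Gagliardo–Nirenberg constant $c>0$ is the universal constant in the inequality $$\left|\int_{\mathbb{R}}v_x^{2n+1}dx\right|^{\frac{2n}{2n-1}}\le c\left(\int_{\mathbb{R}}v_x^2dx\right)^{\frac{1}{2n-1}}\int_{\mathbb{R}}v_x^{2n+2}dx .$$ For $u_0\in H^s$, $s>\frac32$, there is a unique local solution in $C([0,T_0];H^s)\cap C^1([0,T_0];H^{s-1})$ for some $T_0>0$; the lifespan is the supremum of its existence times, and "blows up in finite time $T$" means that this lifespan equals $T<\infty$. *)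

theory Defs
  imports "HOL-Analysis.Analysis"
begin

section \<open>Sobolev spaces on the real line\<close>

text \<open>Elements of \<open>L\<^sup>2\<close> and \<open>H\<^sup>s\<close> are represented by Borel functions; nothing below depends on the
  choice of a representative up to null sets.

  The \<open>L\<^sup>2\<close> Fourier transform is the limit in the mean of the truncated integrals.
  The nonnegative integral is used because it takes the value \<open>\<infinity>\<close>, and not \<open>0\<close>, on a function
  that is not square integrable.\<close>

definition is_fourier_transform :: "(real \<Rightarrow> real) \<Rightarrow> (real \<Rightarrow> complex) \<Rightarrow> bool" where
  "is_fourier_transform f F \<longleftrightarrow>
     F \<in> borel_measurable borel \<and>
     ((\<lambda>R. \<integral>\<^sup>+ \<xi>. ennreal ((cmod ((LBINT x:{- R..R}. cis (- (\<xi> * x)) * complex_of_real (f x)) - F \<xi>))\<^sup>2) \<partial>lborel)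
        \<longlongrightarrow> 0) at_top"

definition fourier :: "(real \<Rightarrow> real) \<Rightarrow> real \<Rightarrow> complex" where
  "fourier f = (SOME F. is_fourier_transform f F)"

text \<open>Intended for \<open>s \<ge> 0\<close>, where \<open>H\<^sup>s \<subseteq> L\<^sup>2\<close>.\<close>

definition sobolev :: "real \<Rightarrow> (real \<Rightarrow> real) set" where
  "sobolev s = {f. f \<in> borel_measurable borel \<and> integrable lborel (\<lambda>x. (f x)\<^sup>2) \<and>
     integrable lborel (\<lambda>\<xi>. (1 + \<xi>\<^sup>2) powr s * (cmod (fourier f \<xi>))\<^sup>2)}"

text \<open>The factor \<open>1/(2\<pi>)\<close> makes the square of the \<open>H\<^sup>1\<close> norm equal to \<open>\<integral> u\<^sup>2 + u\<^sub>x\<^sup>2\<close>.\<close>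

definition sobolev_norm :: "real \<Rightarrow> (real \<Rightarrow> real) \<Rightarrow> real" where
  "sobolev_norm s f =
     sqrt (1 / (2 * pi) * (\<integral>\<xi>. (1 + \<xi>\<^sup>2) powr s * (cmod (fourier f \<xi>))\<^sup>2 \<partial>lborel))"

text \<open>Weak derivative, tested against compactly supported \<open>C\<^sup>1\<close> functions \<open>\<phi>\<close>.\<close>

definition has_weak_deriv :: "(real \<Rightarrow> real) \<Rightarrow> (real \<Rightarrow> real) \<Rightarrow> bool" where
  "has_weak_deriv f g \<longleftrightarrow>
     f \<in> borel_measurable borel \<and> g \<in> borel_measurable borel \<and>
     (\<forall>R. set_integrable lborel {- R..R} f \<and> set_integrable lborel {- R..R} g) \<and>
     (\<forall>\<phi> \<phi>'. (\<forall>x. (\<phi> has_real_derivative \<phi>' x) (at x)) \<longrightarrow> continuous_on UNIV \<phi>' \<longrightarrow>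
        (\<exists>R. \<forall>x. \<bar>x\<bar> > R \<longrightarrow> \<phi> x = 0) \<longrightarrow>
        (LBINT x. f x * \<phi>' x) = - (LBINT x. g x * \<phi> x))"

definition weak_deriv :: "(real \<Rightarrow> real) \<Rightarrow> real \<Rightarrow> real" where
  "weak_deriv f = (SOME g. has_weak_deriv f g)"

definition continuous_into_sobolev :: "real \<Rightarrow> real \<Rightarrow> (real \<Rightarrow> real \<Rightarrow> real) \<Rightarrow> bool" where
  "continuous_into_sobolev r T u \<longleftrightarrow>
     (\<forall>t\<in>{0..T}. u t \<in> sobolev r \<and>
        ((\<lambda>\<tau>. sobolev_norm r (\<lambda>x. u \<tau> x - u t x)) \<longlongrightarrow> 0) (at t within {0..T}))"

text \<open>\<open>u \<in> C\<^sup>1([0,T]; H\<^sup>r)\<close> with time derivative \<open>v\<close>.\<close>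

definition C1_into_sobolev ::
    "real \<Rightarrow> real \<Rightarrow> (real \<Rightarrow> real \<Rightarrow> real) \<Rightarrow> (real \<Rightarrow> real \<Rightarrow> real) \<Rightarrow> bool" where
  "C1_into_sobolev r T u v \<longleftrightarrow>
     continuous_into_sobolev r T u \<and> continuous_into_sobolev r T v \<and>
     (\<forall>t\<in>{0..T}.
        ((\<lambda>\<tau>. sobolev_norm r (\<lambda>x. (u \<tau> x - u t x) / (\<tau> - t) - v t x)) \<longlongrightarrow> 0) (at t within {0..T}))"

section \<open>The equation, its solutions and their lifespan\<close>

definition h :: "real \<Rightarrow> real \<Rightarrow> real \<Rightarrow> real \<Rightarrow> real \<Rightarrow> real" where
  "h \<alpha> \<beta> \<gamma> \<Gamma> r = (\<alpha> + \<Gamma>) * r + \<beta> / 3 * r ^ 3 + \<gamma> / 4 * r ^ 4"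

text \<open>\<open>\<Lambda>\<^sup>-\<^sup>2 = (1 - \<partial>\<^sub>x\<^sub>x)\<^sup>-\<^sup>1\<close>.\<close>

definition Lambda_inv2 :: "(real \<Rightarrow> real) \<Rightarrow> real \<Rightarrow> real" where
  "Lambda_inv2 F x = (LBINT y. 1 / 2 * exp (- \<bar>x - y\<bar>) * F y)"

text \<open>A solution on \<open>[0,T]\<close> in \<open>C([0,T]; H\<^sup>s) \<inter> C\<^sup>1([0,T]; H\<^sup>s\<^sup>-\<^sup>1)\<close>. The operator
  \<open>\<Lambda>\<^sup>-\<^sup>2\<partial>\<^sub>x\<close> is written as \<open>\<partial>\<^sub>x\<Lambda>\<^sup>-\<^sup>2\<close>: the two agree (convolution commutes with \<open>\<partial>\<^sub>x\<close>), but for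
  \<open>s < 2\<close> the derivative of \<open>h(u) - u\<^sup>2 - u\<^sub>x\<^sup>2/2 \<in> H\<^sup>s\<^sup>-\<^sup>1\<close> need not be a function.\<close>

definition solution_on ::
    "real \<Rightarrow> real \<Rightarrow> real \<Rightarrow> real \<Rightarrow> real \<Rightarrow> real \<Rightarrow> (real \<Rightarrow> real) \<Rightarrow> real
      \<Rightarrow> (real \<Rightarrow> real \<Rightarrow> real) \<Rightarrow> bool" where
  "solution_on \<alpha> \<beta> \<gamma> \<Gamma> lam s u0 T u \<longleftrightarrow>
     0 < T \<and>
     continuous_into_sobolev s T u \<and>
     (AE x in lborel. u 0 x = u0 x) \<and>
     (\<exists>u_t. C1_into_sobolev (s - 1) T u u_t \<and>
       (\<forall>t\<in>{0<..T}. AE x in lborel.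
          u_t t x + (u t x + \<Gamma>) * weak_deriv (u t) x + lam * u t x =
          weak_deriv (Lambda_inv2
            (\<lambda>y. h \<alpha> \<beta> \<gamma> \<Gamma> (u t y) - (u t y)\<^sup>2 - 1 / 2 * (weak_deriv (u t) y)\<^sup>2)) x))"

definition lifespan ::
    "real \<Rightarrow> real \<Rightarrow> real \<Rightarrow> real \<Rightarrow> real \<Rightarrow> real \<Rightarrow> (real \<Rightarrow> real) \<Rightarrow> ereal" where
  "lifespan \<alpha> \<beta> \<gamma> \<Gamma> lam s u0 =
     Sup {ereal T |T. \<exists>u. solution_on \<alpha> \<beta> \<gamma> \<Gamma> lam s u0 T u}"

text \<open>The solution with initial value \<open>u0\<close>, continued up to its lifespan; the values \<open>u t\<close> for
  \<open>t\<close> beyond the lifespan are irrelevant.\<close>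

definition corresponding_solution ::
    "real \<Rightarrow> real \<Rightarrow> real \<Rightarrow> real \<Rightarrow> real \<Rightarrow> real \<Rightarrow> (real \<Rightarrow> real)
      \<Rightarrow> (real \<Rightarrow> real \<Rightarrow> real) \<Rightarrow> bool" where
  "corresponding_solution \<alpha> \<beta> \<gamma> \<Gamma> lam s u0 u \<longleftrightarrow>
     0 < lifespan \<alpha> \<beta> \<gamma> \<Gamma> lam s u0 \<and>
     (\<forall>T. 0 < T \<and> ereal T < lifespan \<alpha> \<beta> \<gamma> \<Gamma> lam s u0 \<longrightarrow>
        solution_on \<alpha> \<beta> \<gamma> \<Gamma> lam s u0 T u)"

definition blows_up_in_finite_time ::
    "real \<Rightarrow> real \<Rightarrow> real \<Rightarrow> real \<Rightarrow> real \<Rightarrow> real \<Rightarrow> (real \<Rightarrow> real)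
      \<Rightarrow> (real \<Rightarrow> real \<Rightarrow> real) \<Rightarrow> real \<Rightarrow> bool" where
  "blows_up_in_finite_time \<alpha> \<beta> \<gamma> \<Gamma> lam s u0 u T \<longleftrightarrow>
     corresponding_solution \<alpha> \<beta> \<gamma> \<Gamma> lam s u0 u \<and>
     lifespan \<alpha> \<beta> \<gamma> \<Gamma> lam s u0 = ereal T"

section \<open>Constants\<close>

text \<open>\<open>c\<close> is any admissible constant in the inequality for the exponent \<open>n\<close>, in particular the
  optimal one or one that is admissible for all \<open>n\<close>.\<close>

definition gagliardo_nirenberg_constant :: "nat \<Rightarrow> real \<Rightarrow> bool" where
  "gagliardo_nirenberg_constant n c \<longleftrightarrow>
     0 < c \<and>
     (\<forall>v\<in>sobolev 1. integrable lborel (\<lambda>x. weak_deriv v x ^ (2 * n + 2)) \<longrightarrow>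
        \<bar>LBINT x. weak_deriv v x ^ (2 * n + 1)\<bar> powr (2 * real n / (2 * real n - 1))
          \<le> c * (LBINT x. (weak_deriv v x)\<^sup>2) powr (1 / (2 * real n - 1))
              * (LBINT x. weak_deriv v x ^ (2 * n + 2)))"

text \<open>In the following definitions \<open>N\<close> stands for the \<open>H\<^sup>1\<close> norm of the initial value;
  \<open>const_C13\<close> is \<open>C\<^sub>1 + C\<^sub>3\<close> and \<open>const_Ksq\<close> is \<open>K\<^sup>2\<close>.\<close>

definition const_C13 :: "real \<Rightarrow> real \<Rightarrow> real \<Rightarrow> real \<Rightarrow> nat \<Rightarrow> real \<Rightarrow> real" where
  "const_C13 \<alpha> \<beta> \<gamma> \<Gamma> n N =
     2 * (\<bar>\<alpha>\<bar> + \<bar>\<Gamma>\<bar>) * N ^ (n + 1) / sqrt 2 ^ (n - 1)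
     + \<bar>\<beta>\<bar> * (N ^ (3 * (n + 1)) + N ^ (3 * n + 5)) / (3 * sqrt 2 ^ (3 * n + 1))
     + \<bar>\<gamma>\<bar> * N ^ (4 * n + 4) / 2 ^ (2 * (n + 1))
     + N ^ (2 * (n + 1)) / 2 ^ n"

definition const_C2 :: "real \<Rightarrow> real \<Rightarrow> real \<Rightarrow> real \<Rightarrow> real" where
  "const_C2 \<alpha> \<beta> \<gamma> \<Gamma> = \<bar>\<alpha>\<bar> + \<bar>\<Gamma>\<bar> + \<bar>\<beta>\<bar> / 3 + \<bar>\<gamma>\<bar> / 4 + 1 / 2"

definition const_Ksq ::
    "real \<Rightarrow> real \<Rightarrow> real \<Rightarrow> real \<Rightarrow> real \<Rightarrow> real \<Rightarrow> nat \<Rightarrow> real \<Rightarrow> real" where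
  "const_Ksq \<alpha> \<beta> \<gamma> \<Gamma> lam c n N =
     lam * (real n + 1) * (4 * c * lam * (real n + 1) * N powr (2 / (2 * real n - 1))) ^ (2 * n - 1)
       / (2 * real n ^ (2 * n))
     + (2 * real n + 1) * const_C13 \<alpha> \<beta> \<gamma> \<Gamma> n N / (real n + 1)
       * (8 * real n * (2 * real n + 1) * const_C2 \<alpha> \<beta> \<gamma> \<Gamma> / ((2 * real n - 1) * (real n + 1))) ^ n"

end

theory Submission
  imports Defs "HOL-Probability.Probability"
begin

text \<open>The idea is a Riccati inequality for \<open>f t = \<integral> u\<^sub>x ^ (2n + 1)\<close>. Testing the equation for \<open>u\<^sub>x\<close> with
  \<open>u\<^sub>x ^ (2n)\<close>, bounding the nonlocal term in the sup norm by the \<open>H\<^sup>1\<close> norm of \<open>u\<close>, which does not increase, and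
  absorbing lower order terms by Young's inequality leaves \<open>f' \<le> K\<^sup>2 - \<epsilon> \<integral> u\<^sub>x ^ (2n + 2)\<close>. The
  Gagliardo--Nirenberg inequality turns the last integral into a multiple of \<open>\<bar>f\<bar> powr (2n / (2n - 1))\<close>, and
  comparison with the corresponding differential equation bounds the existence time.

  As \<open>s > 3/2\<close> gives only one continuous derivative in \<open>x\<close>, the evolution of \<open>f\<close> cannot be
  computed by differentiating the equation. Instead the difference quotients of \<open>u\<close> satisfy an exact
  transport identity, whose time integral passes to the limit by continuity of translations in \<open>L\<^sup>2\<close>;
  no commutator estimates are needed.\<close>

section \<open>Square integrable functions\<close>

text \<open>With s > 3/2 the slope \<open>V\<close> is continuous and square integrable but need not
  have a derivative, so u u_xx has no meaning. The difference quotient w of u has the x-derivative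
  \<open>diffquot d V\<close>: its transport term can be integrated by parts, and what remains
  involves only \<open>V\<close>, w and the quotient of the nonlocal term, bounded independently of
  d. In return f is known only as a time integral of its rate, so the comparison has to work with
  integrals too.

  The factor (2n - 1) / (8c) comes from a budget. Transport contributes -2n times the integral of
  u_x^(2n + 2), the local part u_x^2 / 2 of the nonlocal term (2n + 1) / 2 times it, together -(2n -
  1) / 2. A quarter of this is kept for the comparison; three quarters absorb the damping and the
  source terms, and each summand of K^2 is what Young's inequality leaves over in one of the two.
  Since K^2 is prescribed, crude estimates do not fit: sup u^2 <= N^2 / 2 and the differences of u^k
  and its average must be bounded with the right constants.\<close>

definition square_integrable :: "(real \<Rightarrow> real) \<Rightarrow> bool" where
  "square_integrable f \<longleftrightarrow> f \<in> borel_measurable borel \<and> integrable lborel (\<lambda>x. (f x)\<^sup>2)"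

text \<open>The integral of a function that is not integrable is 0, so this is a norm only together
  with \<open>square_integrable\<close>; hence the membership hypotheses in the estimates
  below.\<close>

definition l2norm :: "(real \<Rightarrow> real) \<Rightarrow> real" where
  "l2norm f = sqrt (LBINT x. (f x)\<^sup>2)"

lemma square_integrable_measurable [measurable_dest]:
  "square_integrable f \<Longrightarrow> f \<in> borel_measurable borel"
  by (simp add: square_integrable_def)

lemma square_integrable_power2: "square_integrable f \<Longrightarrow> integrable lborel (\<lambda>x. (f x)\<^sup>2)"
  by (simp add: square_integrable_def)

lemma l2norm_power2 [simp]: "(l2norm f)\<^sup>2 = (LBINT x. (f x)\<^sup>2)"
  by (simp add: l2norm_def)

lemma l2norm_nonneg [simp]: "0 \<le> l2norm f"
  by (simp add: l2norm_def)

lemma square_integrable_bound: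
  assumes f [measurable]: "f \<in> borel_measurable borel" and g: "square_integrable g"
    and le: "\<And>x. \<bar>f x\<bar> \<le> C * \<bar>g x\<bar>"
  shows "square_integrable f"
proof -
  have "integrable lborel (\<lambda>x. C\<^sup>2 * (g x)\<^sup>2)"
    using g by (simp add: square_integrable_def)
  then have "integrable lborel (\<lambda>x. (f x)\<^sup>2)"
  proof (rule Bochner_Integration.integrable_bound)
    show "AE x in lborel. norm ((f x)\<^sup>2) \<le> norm (C\<^sup>2 * (g x)\<^sup>2)"
    proof (rule AE_I2)
      fix x
      have "\<bar>f x\<bar>\<^sup>2 \<le> (C * \<bar>g x\<bar>)\<^sup>2"
        by (rule power_mono[OF le]) simp
      then show "norm ((f x)\<^sup>2) \<le> norm (C\<^sup>2 * (g x)\<^sup>2)"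
        by (simp add: power_mult_distrib)
    qed
  qed simp
  with f show ?thesis by (simp add: square_integrable_def)
qed

lemma square_integrable_mult_integrable:
  assumes "square_integrable f" "square_integrable g"
  shows "integrable lborel (\<lambda>x. f x * g x)"
proof -
  note [measurable] = assms[THEN square_integrable_measurable]
  have "integrable lborel (\<lambda>x. (f x)\<^sup>2 + (g x)\<^sup>2)"
    using assms by (simp add: square_integrable_def)
  then show ?thesis
  proof (rule Bochner_Integration.integrable_bound)
    show "AE x in lborel. norm (f x * g x) \<le> norm ((f x)\<^sup>2 + (g x)\<^sup>2)"
    proof (rule AE_I2)
      fix x
      have "2 * (\<bar>f x\<bar> * \<bar>g x\<bar>) \<le> (f x)\<^sup>2 + (g x)\<^sup>2"
        using sum_squares_bound[of "\<bar>f x\<bar>" "\<bar>g x\<bar>"] by (simp add: mult.assoc)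
      moreover have "0 \<le> \<bar>f x\<bar> * \<bar>g x\<bar>" by simp
      ultimately show "norm (f x * g x) \<le> norm ((f x)\<^sup>2 + (g x)\<^sup>2)"
        unfolding real_norm_def abs_mult by linarith
    qed
  qed simp
qed

lemma square_integrable_add:
  assumes "square_integrable f" "square_integrable g"
  shows "square_integrable (\<lambda>x. f x + g x)"
proof -
  note [measurable] = assms[THEN square_integrable_measurable]
  have "integrable lborel (\<lambda>x. (f x)\<^sup>2 + 2 * (f x * g x) + (g x)\<^sup>2)"
    using assms square_integrable_mult_integrable[OF assms]
    by (simp add: square_integrable_def)
  then show ?thesis
    by (simp add: square_integrable_def power2_sum algebra_simps)
qed

lemma square_integrable_cmult: "square_integrable f \<Longrightarrow> square_integrable (\<lambda>x. c * f x)"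
  by (rule square_integrable_bound[where g = f and C = "\<bar>c\<bar>"])
    (auto simp: abs_mult square_integrable_def)

lemma square_integrable_diff:
  assumes "square_integrable f" "square_integrable g"
  shows "square_integrable (\<lambda>x. f x - g x)"
  using square_integrable_add[OF assms(1) square_integrable_cmult[OF assms(2), of "-1"]] by simp

lemma square_integrable_bounded_mult:
  assumes "b \<in> borel_measurable borel" "\<And>x. \<bar>b x\<bar> \<le> M" "square_integrable f"
  shows "square_integrable (\<lambda>x. b x * f x)"
proof (rule square_integrable_bound[where g = f and C = M])
  show "(\<lambda>x. b x * f x) \<in> borel_measurable borel"
    using assms(1) square_integrable_measurable[OF assms(3)] by (rule borel_measurable_times)
  show "\<bar>b x * f x\<bar> \<le> M * \<bar>f x\<bar>" for x
    unfolding abs_mult using assms(2) by (rule mult_right_mono) simp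
qed (rule assms(3))

lemma square_integrable_shift:
  assumes "square_integrable f"
  shows "square_integrable (\<lambda>x. f (x + d))"
    and "(LBINT x. (f (x + d))\<^sup>2) = (LBINT x. (f x)\<^sup>2)"
proof -
  note [measurable] = assms[THEN square_integrable_measurable]
  show "square_integrable (\<lambda>x. f (x + d))"
    using assms lborel_integrable_real_affine[of "\<lambda>x. (f x)\<^sup>2" 1 d]
    by (auto simp: square_integrable_def add.commute)
  show "(LBINT x. (f (x + d))\<^sup>2) = (LBINT x. (f x)\<^sup>2)"
    using lborel_integral_real_affine[of 1 "\<lambda>x. (f x)\<^sup>2" d]
    by (simp add: add.commute)
qed

lemma Cauchy_Schwarz_integral:
  assumes "square_integrable f" "square_integrable g"
  shows "\<bar>LBINT x. f x * g x\<bar> \<le> l2norm f * l2norm g"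
proof -
  note [measurable] = assms[THEN square_integrable_measurable]
  let ?F = "LBINT x. (f x)\<^sup>2" and ?G = "LBINT x. (g x)\<^sup>2" and ?H = "LBINT x. f x * g x"
  note i = square_integrable_power2[OF assms(1)] square_integrable_power2[OF assms(2)]
    square_integrable_mult_integrable[OF assms]
  \<comment> \<open>The integral of (f - t g)^2 as a quadratic polynomial in t; both cases below
    pick a value of t.\<close>
  have q: "0 \<le> ?F - 2 * t * ?H + t\<^sup>2 * ?G" for t
  proof -
    have "0 \<le> (LBINT x. (f x - t * g x)\<^sup>2)" by simp
    also have "\<dots> = (LBINT x. (f x)\<^sup>2 - 2 * t * (f x * g x) + t\<^sup>2 * (g x)\<^sup>2)"
      by (rule Bochner_Integration.integral_cong) (auto simp: power2_diff power_mult_distrib algebra_simps)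
    also have "\<dots> = ?F - 2 * t * ?H + t\<^sup>2 * ?G"
      using i by simp
    finally show ?thesis .
  qed
  have "?H\<^sup>2 \<le> ?F * ?G"
  proof (cases "?G = 0")
    case True
    have "?H = 0"
    proof (rule ccontr)
      assume "?H \<noteq> 0"
      \<comment> \<open>With \<open>?G = 0\<close> the polynomial is linear in t, and this t gives
        it the value -1.\<close>
      with q[of "(?F + 1) / (2 * ?H)"] True show False by (simp add: field_simps)
    qed
    then show ?thesis using True by simp
  next
    case False
    then have "0 < ?G" by (simp add: less_le)
    with q[of "?H / ?G"] show ?thesis
      by (simp add: field_simps power2_eq_square)
  qed
  then have "sqrt (?H\<^sup>2) \<le> sqrt (?F * ?G)" by (rule real_sqrt_le_mono)
  then show ?thesis by (simp add: l2norm_def real_sqrt_mult)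
qed

lemma l2norm_triangle:
  assumes "square_integrable f" "square_integrable g"
  shows "l2norm (\<lambda>x. f x + g x) \<le> l2norm f + l2norm g"
proof -
  have "(LBINT x. (f x + g x)\<^sup>2) = (LBINT x. (f x)\<^sup>2 + 2 * (f x * g x) + (g x)\<^sup>2)"
    by (rule Bochner_Integration.integral_cong) (auto simp: power2_sum algebra_simps)
  also have "\<dots> = (l2norm f)\<^sup>2 + 2 * (LBINT x. f x * g x) + (l2norm g)\<^sup>2"
    using assms square_integrable_mult_integrable[OF assms] by (simp add: square_integrable_def)
  also have "\<dots> \<le> (l2norm f + l2norm g)\<^sup>2"
    using Cauchy_Schwarz_integral[OF assms] by (simp add: power2_sum)
  finally show ?thesis
    unfolding l2norm_def[of "\<lambda>x. f x + g x"]
    by (intro real_le_lsqrt) auto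
qed

lemma l2norm_cmult: "l2norm (\<lambda>x. c * f x) = \<bar>c\<bar> * l2norm f"
  by (simp add: l2norm_def power_mult_distrib real_sqrt_mult)

lemma l2norm_mono:
  assumes "square_integrable g" "f \<in> borel_measurable borel" "\<And>x. \<bar>f x\<bar> \<le> \<bar>g x\<bar>"
  shows "l2norm f \<le> l2norm g"
proof -
  have "(LBINT x. (f x)\<^sup>2) \<le> (LBINT x. (g x)\<^sup>2)"
    using square_integrable_bound[of f g 1] assms
    by (intro integral_mono) (auto simp: square_integrable_def abs_le_square_iff)
  then show ?thesis by (simp add: l2norm_def)
qed

lemma l2norm_tendsto:
  fixes b :: "nat \<Rightarrow> real \<Rightarrow> real"
  assumes b: "\<And>k. square_integrable (b k)" "square_integrable b'"
    and lim: "(\<lambda>k. l2norm (\<lambda>x. b k x - b' x)) \<longlonglongrightarrow> 0"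
  shows "(\<lambda>k. l2norm (b k)) \<longlonglongrightarrow> l2norm b'"
proof -
  have "\<bar>l2norm (b k) - l2norm b'\<bar> \<le> l2norm (\<lambda>x. b k x - b' x)" for k
  proof -
    have "l2norm (b k) \<le> l2norm (\<lambda>x. b k x - b' x) + l2norm b'"
      using l2norm_triangle[OF square_integrable_diff[OF b(1) b(2)] b(2), of k] by simp
    moreover have "l2norm b' \<le> l2norm (\<lambda>x. b' x - b k x) + l2norm (b k)"
      using l2norm_triangle[OF square_integrable_diff[OF b(2) b(1)] b(1), of k k] by simp
    moreover have "l2norm (\<lambda>x. b' x - b k x) = l2norm (\<lambda>x. b k x - b' x)"
      by (simp add: l2norm_def power2_commute)
    ultimately show ?thesis by linarith
  qed
  then have "(\<lambda>k. l2norm (b k) - l2norm b') \<longlonglongrightarrow> 0"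
    by (intro tendsto_0_le[OF lim, where K = 1]) auto
  then show ?thesis by (simp add: LIM_zero_iff)
qed

text \<open>Telescoping: a_k b_k c_k - a' b' c' = a_k (b_k - b') c_k + a_k b' (c_k - c') + (a_k -
  a') b' c'. The first two terms vanish in the limit by Cauchy-Schwarz, the last by dominated
  convergence. Powers of difference quotients and translates of the slope will be the a_k, for which
  bounded pointwise convergence is what is at hand.\<close>

lemma tendsto_integral_triple:
  fixes a b c :: "nat \<Rightarrow> real \<Rightarrow> real"
  assumes a [measurable]: "\<And>k. a k \<in> borel_measurable borel"
    and a_le: "\<And>k x. \<bar>a k x\<bar> \<le> M" and a_lim: "\<And>x. (\<lambda>k. a k x) \<longlonglongrightarrow> a' x"
    and b: "\<And>k. square_integrable (b k)" "square_integrable b'"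
    and c: "\<And>k. square_integrable (c k)" "square_integrable c'"
    and b_lim: "(\<lambda>k. l2norm (\<lambda>x. b k x - b' x)) \<longlonglongrightarrow> 0"
    and c_lim: "(\<lambda>k. l2norm (\<lambda>x. c k x - c' x)) \<longlonglongrightarrow> 0"
  shows "(\<lambda>k. LBINT x. a k x * b k x * c k x) \<longlonglongrightarrow> (LBINT x. a' x * b' x * c' x)"
proof -
  note [measurable] = b[THEN square_integrable_measurable] c[THEN square_integrable_measurable]
  have [measurable]: "a' \<in> borel_measurable borel"
    by (rule borel_measurable_LIMSEQ_real[where u = a]) (use a_lim in auto)
  have M: "0 \<le> M" using a_le[of 0 0] by linarith
  have a'_le: "\<bar>a' x\<bar> \<le> M" for x
    by (rule LIMSEQ_le_const2[OF tendsto_rabs[OF a_lim]]) (use a_le in auto)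
  have db: "square_integrable (\<lambda>x. b k x - b' x)" and dc: "square_integrable (\<lambda>x. c k x - c' x)" for k
    using b c by (auto intro: square_integrable_diff)
  have est: "\<bar>LBINT x. a k x * (f x * g x)\<bar> \<le> M * l2norm f * l2norm g"
    and int: "integrable lborel (\<lambda>x. a k x * (f x * g x))"
    if f: "square_integrable f" and g: "square_integrable g" for f g k
  proof -
    note [measurable] = f[THEN square_integrable_measurable] g[THEN square_integrable_measurable]
    have af: "square_integrable (\<lambda>x. a k x * f x)"
      by (rule square_integrable_bounded_mult[OF a a_le f])
    have "l2norm (\<lambda>x. a k x * f x) \<le> l2norm (\<lambda>x. M * f x)"
      using a_le[of k] M by (intro l2norm_mono square_integrable_cmult f)
        (auto simp: abs_mult intro!: mult_right_mono)
    also have "\<dots> = M * l2norm f" using M by (simp add: l2norm_cmult)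
    finally have "l2norm (\<lambda>x. a k x * f x) * l2norm g \<le> M * l2norm f * l2norm g"
      by (intro mult_right_mono) auto
    with Cauchy_Schwarz_integral[OF af g] show "\<bar>LBINT x. a k x * (f x * g x)\<bar> \<le> M * l2norm f * l2norm g"
      by (simp add: mult.assoc)
    show "integrable lborel (\<lambda>x. a k x * (f x * g x))"
      using square_integrable_mult_integrable[OF af g] by (simp add: mult.assoc)
  qed
  have bc: "integrable lborel (\<lambda>x. b' x * c' x)"
    by (rule square_integrable_mult_integrable[OF b(2) c(2)])
  have dct: "(\<lambda>k. LBINT x. a k x * (b' x * c' x)) \<longlonglongrightarrow> (LBINT x. a' x * (b' x * c' x))"
  proof (rule integral_dominated_convergence[where w = "\<lambda>x. M * \<bar>b' x * c' x\<bar>"])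
    show "integrable lborel (\<lambda>x. M * \<bar>b' x * c' x\<bar>)" using bc by simp
    show "AE x in lborel. (\<lambda>k. a k x * (b' x * c' x)) \<longlonglongrightarrow> a' x * (b' x * c' x)"
      by (intro AE_I2 tendsto_mult_right a_lim)
    show "AE x in lborel. norm (a k x * (b' x * c' x)) \<le> M * \<bar>b' x * c' x\<bar>" for k
      using a_le by (auto simp: abs_mult intro!: mult_right_mono)
  qed measurable
  have t1: "(\<lambda>k. LBINT x. a k x * ((b k x - b' x) * c k x)) \<longlonglongrightarrow> 0"
  proof (rule tendsto_0_le[where K = 1])
    show "(\<lambda>k. M * l2norm (\<lambda>x. b k x - b' x) * l2norm (c k)) \<longlonglongrightarrow> 0"
      using tendsto_mult[OF tendsto_mult_left[OF b_lim, of M] l2norm_tendsto[OF c c_lim]]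
      by simp
    show "\<forall>\<^sub>F k in sequentially. norm (LBINT x. a k x * ((b k x - b' x) * c k x))
        \<le> norm (M * l2norm (\<lambda>x. b k x - b' x) * l2norm (c k)) * 1"
      using est[OF db c(1)] M by (auto intro!: always_eventually simp: abs_mult)
  qed
  have t2: "(\<lambda>k. LBINT x. a k x * (b' x * (c k x - c' x))) \<longlonglongrightarrow> 0"
  proof (rule tendsto_0_le[where K = 1])
    show "(\<lambda>k. M * l2norm b' * l2norm (\<lambda>x. c k x - c' x)) \<longlonglongrightarrow> 0"
      using tendsto_mult_left[OF c_lim, of "M * l2norm b'"] by simp
    show "\<forall>\<^sub>F k in sequentially. norm (LBINT x. a k x * (b' x * (c k x - c' x)))
        \<le> norm (M * l2norm b' * l2norm (\<lambda>x. c k x - c' x)) * 1"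
      using est[OF b(2) dc] M by (auto intro!: always_eventually simp: abs_mult)
  qed
  have eq: "(LBINT x. a k x * b k x * c k x) =
      (LBINT x. a k x * ((b k x - b' x) * c k x)) + (LBINT x. a k x * (b' x * (c k x - c' x)))
        + (LBINT x. a k x * (b' x * c' x))" for k
  proof -
    have "(LBINT x. a k x * b k x * c k x) =
      (LBINT x. a k x * ((b k x - b' x) * c k x) + a k x * (b' x * (c k x - c' x))
        + a k x * (b' x * c' x))"
      by (rule Bochner_Integration.integral_cong) (auto simp: algebra_simps)
    also have "\<dots> = (LBINT x. a k x * ((b k x - b' x) * c k x) + a k x * (b' x * (c k x - c' x)))
        + (LBINT x. a k x * (b' x * c' x))"
      by (intro Bochner_Integration.integral_add Bochner_Integration.integrable_add
          int[OF db c(1)] int[OF b(2) dc] int[OF b(2) c(2)])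
    also have "(LBINT x. a k x * ((b k x - b' x) * c k x) + a k x * (b' x * (c k x - c' x)))
       = (LBINT x. a k x * ((b k x - b' x) * c k x)) + (LBINT x. a k x * (b' x * (c k x - c' x)))"
      by (intro Bochner_Integration.integral_add int[OF db c(1)] int[OF b(2) dc])
    finally show ?thesis .
  qed
  have "(\<lambda>k. (LBINT x. a k x * ((b k x - b' x) * c k x))
        + (LBINT x. a k x * (b' x * (c k x - c' x)))
        + (LBINT x. a k x * (b' x * c' x))) \<longlonglongrightarrow> 0 + 0 + (LBINT x. a' x * (b' x * c' x))"
    by (intro tendsto_add t1 t2 dct)
  moreover have "(LBINT x. a' x * (b' x * c' x)) = (LBINT x. a' x * b' x * c' x)"
    by (simp only: mult.assoc)
  ultimately show ?thesis unfolding eq by (simp only: add_0)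
qed

section \<open>Integrals of derivatives\<close>

lemma continuous_imp_set_integrable_Icc:
  fixes f :: "real \<Rightarrow> 'a::{banach, second_countable_topology}"
  assumes "continuous_on UNIV f"
  shows "set_integrable lborel {a..b} f"
  using assms by (intro borel_integrable_atLeastAtMost') (rule continuous_on_subset, auto)

lemma not_set_integrable_atMost:
  fixes f :: "real \<Rightarrow> real"
  assumes "0 < e" "\<And>x. x \<le> c \<Longrightarrow> e \<le> \<bar>f x\<bar>"
  shows "\<not> set_integrable lborel {..b} f"
proof
  assume i0: "set_integrable lborel {..b} f"
  obtain m where m: "m \<le> b" "m \<le> c" by (meson min.cobounded1 min.cobounded2)
  from i0 have i: "set_integrable lborel {..m} f"
    by (rule set_integrable_subset) (use m in auto)
  define I where "I = (LBINT x:{..m}. \<bar>f x\<bar>)"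
  have i': "set_integrable lborel {..m} (\<lambda>x. \<bar>f x\<bar>)"
    using i by (rule set_integrable_abs)
  have le: "e * real n \<le> I" for n
  proof -
    have "e * real n = (LBINT x:{m - real n..m}. e)"
      by (simp add: set_lebesgue_integral_def)
    also have "\<dots> \<le> I"
      unfolding I_def set_lebesgue_integral_def
    proof (rule integral_mono)
      show "integrable lborel (\<lambda>x. indicat_real {..m} x *\<^sub>R \<bar>f x\<bar>)"
        using i' by (simp add: set_integrable_def)
      show "integrable lborel (\<lambda>x. indicat_real {m - real n..m} x *\<^sub>R e)"
        by (auto intro!: integrable_mult_left simp: integrable_indicator_iff)
      show "indicat_real {m - real n..m} x *\<^sub>R e \<le> indicat_real {..m} x *\<^sub>R \<bar>f x\<bar>" for x
        using assms(2)[of x] m by (auto simp: indicator_def)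
    qed
    finally show ?thesis .
  qed
  obtain n :: nat where "I / e < real n" using reals_Archimedean2 by blast
  with le[of n] \<open>0 < e\<close> show False by (simp add: field_simps)
qed

text \<open>No decay is assumed. Integrability of \<open>f\<close> makes \<open>F\<close> converge
  at minus infinity, and integrability of \<open>F\<close> forces the limit to be 0.\<close>

lemma set_integral_deriv_atMost:
  fixes F f :: "real \<Rightarrow> real"
  assumes F: "\<And>x. (F has_real_derivative f x) (at x)" and f: "continuous_on UNIV f"
    and if': "set_integrable lborel {..b} f" and iF: "set_integrable lborel {..b} F"
  shows "(LBINT x:{..b}. f x) = F b"
proof -
  have [measurable]: "f \<in> borel_measurable borel"
    using f by (rule borel_measurable_continuous_onI)
  have ftc: "(LBINT x:{a..b}. f x) = F b - F a" if "a \<le> b" for a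
    using that F f unfolding set_lebesgue_integral_def
    by (intro integral_FTC_atLeastAtMost)
      (auto intro: continuous_on_subset has_vector_derivative_at_within
        simp: has_real_derivative_iff_has_vector_derivative)
  have "((\<lambda>t. LBINT x. indicator {- t..b} x * f x) \<longlongrightarrow> (LBINT x. indicator {..b} x * f x)) at_top"
  proof (rule integral_dominated_convergence_at_top[where w = "\<lambda>x. \<bar>indicator {..b} x * f x\<bar>"])
    show "AE x in lborel. ((\<lambda>t. indicator {- t..b} x * f x) \<longlongrightarrow> indicator {..b} x * f x) at_top"
    proof (intro AE_I2 tendsto_eventually)
      fix x :: real
      show "\<forall>\<^sub>F t in at_top. indicator {- t..b} x * f x = indicator {..b} x * f x"
        using eventually_ge_at_top[of "- x"] by eventually_elim (auto simp: indicator_def)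
    qed
    show "integrable lborel (\<lambda>x. \<bar>indicator {..b} x * f x\<bar>)"
      using if' by (auto simp: set_integrable_def)
  qed (auto simp: indicator_def)
  then have "((\<lambda>t. LBINT x:{- t..b}. f x) \<longlongrightarrow> (LBINT x:{..b}. f x)) at_top"
    by (simp add: set_lebesgue_integral_def)
  moreover have "\<forall>\<^sub>F t in at_top. (LBINT x:{- t..b}. f x) = F b - F (- t)"
    using eventually_ge_at_top[of "- b"] by eventually_elim (auto intro!: ftc)
  ultimately have lim: "((\<lambda>t. F b - F (- t)) \<longlongrightarrow> (LBINT x:{..b}. f x)) at_top"
    using tendsto_cong by force
  define L where "L = F b - (LBINT x:{..b}. f x)"
  have lim': "((\<lambda>t. F (- t)) \<longlongrightarrow> L) at_top"
    using tendsto_diff[OF tendsto_const[of "F b"] lim] by (simp add: L_def)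
  have "L = 0"
  proof (rule ccontr)
    assume "L \<noteq> 0"
    then have "\<forall>\<^sub>F t in at_top. dist (F (- t)) L < \<bar>L\<bar> / 2"
      by (intro tendstoD[OF lim']) auto
    then obtain c where c: "\<And>t. t \<ge> c \<Longrightarrow> dist (F (- t)) L < \<bar>L\<bar> / 2"
      by (auto simp: eventually_at_top_linorder)
    have "\<bar>L\<bar> / 2 \<le> \<bar>F x\<bar>" if "x \<le> - c" for x
      using c[of "- x"] that unfolding dist_real_def minus_minus by linarith
    with not_set_integrable_atMost[of "\<bar>L\<bar> / 2" "- c" F b] iF \<open>L \<noteq> 0\<close> show False by auto
  qed
  then show ?thesis by (simp add: L_def)
qed

lemma set_integrable_reflect:
  fixes f :: "real \<Rightarrow> real"
  shows "set_integrable lborel {..- b} (\<lambda>x. f (- x)) \<longleftrightarrow> set_integrable lborel {b..} f"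
    and set_integral_reflect: "(LBINT x:{..- b}. f (- x)) = (LBINT x:{b..}. f x)"
proof -
  have e: "indicat_real {..- b} x *\<^sub>R f (- x) = (\<lambda>y. indicat_real {b..} y *\<^sub>R f y) (0 + (- 1) * x)" for x
    by (auto simp: indicator_def)
  show "set_integrable lborel {..- b} (\<lambda>x. f (- x)) \<longleftrightarrow> set_integrable lborel {b..} f"
    unfolding set_integrable_def e by (rule lborel_integrable_real_affine_iff) simp
  show "(LBINT x:{..- b}. f (- x)) = (LBINT x:{b..}. f x)"
    unfolding set_lebesgue_integral_def e
    using lborel_integral_real_affine[of "- 1" "\<lambda>y. indicat_real {b..} y *\<^sub>R f y" 0] by simp
qed

lemma set_integral_deriv_atLeast:
  fixes F f :: "real \<Rightarrow> real"
  assumes F: "\<And>x. (F has_real_derivative f x) (at x)" and f: "continuous_on UNIV f"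
    and if': "set_integrable lborel {b..} f" and iF: "set_integrable lborel {b..} F"
  shows "(LBINT x:{b..}. f x) = - F b"
proof -
  have "(LBINT x:{..- b}. - f (- x)) = F (- (- b))"
  proof (rule set_integral_deriv_atMost)
    show "((\<lambda>x. F (- x)) has_real_derivative - f (- x)) (at x)" for x
      using DERIV_chain2[OF F DERIV_minus[OF DERIV_ident], of x UNIV] by simp
    show "continuous_on UNIV (\<lambda>x. - f (- x))"
      by (intro continuous_intros continuous_on_compose2[OF f]) auto
    show "set_integrable lborel {..- b} (\<lambda>x. - f (- x))"
      using set_integrable_reflect[of b "\<lambda>x. - f x"] if' by (simp add: set_integrable_def)
    show "set_integrable lborel {..- b} (\<lambda>x. F (- x))"
      using set_integrable_reflect[of b F] iF by simp
  qed
  moreover have "(LBINT x:{..- b}. - f (- x)) = - (LBINT x:{b..}. f x)"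
    using set_integral_reflect[of b "\<lambda>x. - f x"] by (simp add: set_lebesgue_integral_def)
  ultimately show ?thesis by simp
qed

lemma integral_split_halflines:
  fixes f :: "real \<Rightarrow> real"
  assumes "integrable lborel f"
  shows "set_integrable lborel {..b} f" "set_integrable lborel {b..} f"
    and "(LBINT x. f x) = (LBINT x:{..b}. f x) + (LBINT x:{b..}. f x)"
proof -
  have u: "set_integrable lborel UNIV f"
    using assms by (simp add: set_integrable_def)
  show l: "set_integrable lborel {..b} f" and r: "set_integrable lborel {b..} f"
    by (rule set_integrable_subset[OF u]; simp)+
  have "(LBINT x:{..b} \<union> {b..}. f x) = (LBINT x:{..b}. f x) + (LBINT x:{b..}. f x)"
    by (rule set_integral_Un_AE[OF _ _ _ l r])
      (use AE_lborel_singleton[of b] in \<open>auto elim!: eventually_mono\<close>)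
  moreover have "{..b} \<union> {b..} = (UNIV :: real set)" by auto
  ultimately show "(LBINT x. f x) = (LBINT x:{..b}. f x) + (LBINT x:{b..}. f x)"
    by (simp add: set_lebesgue_integral_def)
qed

text \<open>Integration by parts over the whole line takes this form below, with the product as
  \<open>F\<close>: membership in L1, supplied by L2 bounds of the factors, takes the place of
  boundary terms.\<close>

lemma integral_deriv_eq_0:
  fixes F f :: "real \<Rightarrow> real"
  assumes "\<And>x. (F has_real_derivative f x) (at x)" "continuous_on UNIV f"
    "integrable lborel f" "integrable lborel F"
  shows "(LBINT x. f x) = 0"
  using set_integral_deriv_atMost[OF assms(1,2), of 0] set_integral_deriv_atLeast[OF assms(1,2), of 0]
    integral_split_halflines[OF assms(3), of 0] integral_split_halflines[OF assms(4), of 0]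
  by simp

text \<open>\<open>F x\<close> is the integral of \<open>f\<close> from the left and minus the
  integral to the right; adding the two bounds gains the factor 2, which becomes the 1/2 in sup u^2
  <= N^2 / 2.\<close>

lemma abs_le_half_integral_deriv:
  fixes F f :: "real \<Rightarrow> real"
  assumes "\<And>x. (F has_real_derivative f x) (at x)" "continuous_on UNIV f"
    "integrable lborel f" "integrable lborel F"
  shows "2 * \<bar>F x\<bar> \<le> (LBINT x. \<bar>f x\<bar>)"
proof -
  note s = integral_split_halflines[OF assms(3), of x] integral_split_halflines[OF assms(4), of x]
    integral_split_halflines[OF integrable_abs[OF assms(3)], of x]
  have "\<bar>F x\<bar> \<le> (LBINT x:{..x}. \<bar>f x\<bar>)"
    using set_integral_deriv_atMost[OF assms(1,2), of x] s
      integral_abs_bound[of lborel "\<lambda>y. indicat_real {..x} y *\<^sub>R f y"]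
    by (simp add: set_lebesgue_integral_def abs_mult)
  moreover have "\<bar>F x\<bar> \<le> (LBINT x:{x..}. \<bar>f x\<bar>)"
    using set_integral_deriv_atLeast[OF assms(1,2), of x] s
      integral_abs_bound[of lborel "\<lambda>y. indicat_real {x..} y *\<^sub>R f y"]
    by (simp add: set_lebesgue_integral_def abs_mult)
  ultimately show ?thesis using s by simp
qed

section \<open>Convolution estimates\<close>

text \<open>Cauchy-Schwarz for the splitting \<rho> |f| = sqrt \<rho> * (sqrt \<rho> |f|), then
  Tonelli and translation invariance. With nonnegative integrals nothing has to be known to be
  finite beforehand.\<close>

lemma Young_nn_integral:
  fixes \<rho> f :: "real \<Rightarrow> real"
  assumes [measurable]: "\<rho> \<in> borel_measurable borel" "f \<in> borel_measurable borel"
    and \<rho>: "\<And>y. 0 \<le> \<rho> y"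
  shows "(\<integral>\<^sup>+x. (\<integral>\<^sup>+y. ennreal (\<rho> y * \<bar>f (x + y)\<bar>) \<partial>lborel)\<^sup>2 \<partial>lborel)
    \<le> (\<integral>\<^sup>+y. ennreal (\<rho> y) \<partial>lborel)\<^sup>2 * (\<integral>\<^sup>+x. ennreal ((f x)\<^sup>2) \<partial>lborel)"
proof -
  let ?R = "\<integral>\<^sup>+y. ennreal (\<rho> y) \<partial>lborel"
  have cs: "(\<integral>\<^sup>+y. ennreal (\<rho> y * \<bar>f (x + y)\<bar>) \<partial>lborel)\<^sup>2
      \<le> ?R * (\<integral>\<^sup>+y. ennreal (\<rho> y) * ennreal ((f (x + y))\<^sup>2) \<partial>lborel)" for x
  proof -
    have "(\<integral>\<^sup>+y. ennreal (sqrt (\<rho> y)) * ennreal (sqrt (\<rho> y) * \<bar>f (x + y)\<bar>) \<partial>lborel)\<^sup>2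
      \<le> (\<integral>\<^sup>+y. (ennreal (sqrt (\<rho> y)))\<^sup>2 \<partial>lborel)
        * (\<integral>\<^sup>+y. (ennreal (sqrt (\<rho> y) * \<bar>f (x + y)\<bar>))\<^sup>2 \<partial>lborel)"
      by (rule Cauchy_Schwarz_nn_integral) auto
    moreover have "ennreal (sqrt (\<rho> y)) * ennreal (sqrt (\<rho> y) * \<bar>f (x + y)\<bar>)
        = ennreal (\<rho> y * \<bar>f (x + y)\<bar>)" for y
      using \<rho>[of y] by (simp add: ennreal_mult[symmetric] mult.assoc[symmetric])
    moreover have "(ennreal (sqrt (\<rho> y)))\<^sup>2 = ennreal (\<rho> y)" for y
      using \<rho>[of y] by (simp add: ennreal_power)
    moreover have "(ennreal (sqrt (\<rho> y) * \<bar>f (x + y)\<bar>))\<^sup>2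
        = ennreal (\<rho> y) * ennreal ((f (x + y))\<^sup>2)" for y
      using \<rho>[of y] by (simp add: ennreal_power ennreal_mult[symmetric] power_mult_distrib)
    ultimately show ?thesis by simp
  qed
  have "(\<integral>\<^sup>+x. (\<integral>\<^sup>+y. ennreal (\<rho> y * \<bar>f (x + y)\<bar>) \<partial>lborel)\<^sup>2 \<partial>lborel)
      \<le> (\<integral>\<^sup>+x. ?R * (\<integral>\<^sup>+y. ennreal (\<rho> y) * ennreal ((f (x + y))\<^sup>2) \<partial>lborel) \<partial>lborel)"
    by (intro nn_integral_mono cs)
  also have "\<dots> = ?R * (\<integral>\<^sup>+x. (\<integral>\<^sup>+y. ennreal (\<rho> y) * ennreal ((f (x + y))\<^sup>2) \<partial>lborel) \<partial>lborel)"
    by (rule nn_integral_cmult) measurable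
  also have "(\<integral>\<^sup>+x. (\<integral>\<^sup>+y. ennreal (\<rho> y) * ennreal ((f (x + y))\<^sup>2) \<partial>lborel) \<partial>lborel)
      = (\<integral>\<^sup>+y. (\<integral>\<^sup>+x. ennreal (\<rho> y) * ennreal ((f (x + y))\<^sup>2) \<partial>lborel) \<partial>lborel)"
    by (rule lborel_pair.Fubini') measurable
  also have "\<dots> = (\<integral>\<^sup>+y. ennreal (\<rho> y) * (\<integral>\<^sup>+x. ennreal ((f x)\<^sup>2) \<partial>lborel) \<partial>lborel)"
  proof (rule nn_integral_cong)
    fix y
    have "(\<integral>\<^sup>+x. ennreal ((f (x + y))\<^sup>2) \<partial>lborel) = (\<integral>\<^sup>+x. ennreal ((f x)\<^sup>2) \<partial>lborel)"
      using nn_integral_real_affine[of "\<lambda>x. ennreal ((f x)\<^sup>2)" 1 y] by (simp add: add.commute)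
    then show "(\<integral>\<^sup>+x. ennreal (\<rho> y) * ennreal ((f (x + y))\<^sup>2) \<partial>lborel)
        = ennreal (\<rho> y) * (\<integral>\<^sup>+x. ennreal ((f x)\<^sup>2) \<partial>lborel)"
      by (simp add: nn_integral_cmult)
  qed
  also have "\<dots> = ?R * (\<integral>\<^sup>+x. ennreal ((f x)\<^sup>2) \<partial>lborel)"
    by (rule nn_integral_multc) measurable
  finally show ?thesis by (simp add: power2_eq_square mult.assoc)
qed

text \<open>The last hypothesis is a pointwise majorant and not an identity, so that the same lemma
  serves difference quotients, \<open>Lambda_inv2\<close>, its derivative and Gaussian averages. The
  constant is 1 because \<rho> is a probability density.\<close>

lemma Young_square_integrable:
  fixes \<rho> f g :: "real \<Rightarrow> real"
  assumes \<rho>: "integrable lborel \<rho>" "\<And>y. 0 \<le> \<rho> y" "(LBINT y. \<rho> y) = 1"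
    and f: "square_integrable f" and g [measurable]: "g \<in> borel_measurable borel"
    and le: "\<And>x. ennreal \<bar>g x\<bar> \<le> (\<integral>\<^sup>+y. ennreal (\<rho> y * \<bar>f (x + y)\<bar>) \<partial>lborel)"
  shows "square_integrable g" and "l2norm g \<le> l2norm f"
proof -
  note [measurable] = square_integrable_measurable[OF f] borel_measurable_integrable[OF \<rho>(1)]
  have f2: "(\<integral>\<^sup>+x. ennreal ((f x)\<^sup>2) \<partial>lborel) = ennreal (LBINT x. (f x)\<^sup>2)"
    by (rule nn_integral_eq_integral) (use f in \<open>auto simp: square_integrable_def\<close>)
  have r: "(\<integral>\<^sup>+y. ennreal (\<rho> y) \<partial>lborel) = 1"
    using \<rho> by (subst nn_integral_eq_integral) auto
  have "(\<integral>\<^sup>+x. ennreal ((g x)\<^sup>2) \<partial>lborel)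
      \<le> (\<integral>\<^sup>+x. (\<integral>\<^sup>+y. ennreal (\<rho> y * \<bar>f (x + y)\<bar>) \<partial>lborel)\<^sup>2 \<partial>lborel)"
  proof (rule nn_integral_mono)
    fix x
    have "ennreal ((g x)\<^sup>2) = (ennreal \<bar>g x\<bar>)\<^sup>2" by (simp add: ennreal_power)
    also have "\<dots> \<le> (\<integral>\<^sup>+y. ennreal (\<rho> y * \<bar>f (x + y)\<bar>) \<partial>lborel)\<^sup>2"
      by (rule power_mono[OF le]) simp
    finally show "ennreal ((g x)\<^sup>2) \<le> (\<integral>\<^sup>+y. ennreal (\<rho> y * \<bar>f (x + y)\<bar>) \<partial>lborel)\<^sup>2" .
  qed
  also have "\<dots> \<le> (\<integral>\<^sup>+y. ennreal (\<rho> y) \<partial>lborel)\<^sup>2 * (\<integral>\<^sup>+x. ennreal ((f x)\<^sup>2) \<partial>lborel)"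
    by (rule Young_nn_integral) (use \<rho> in auto)
  finally have le': "(\<integral>\<^sup>+x. ennreal ((g x)\<^sup>2) \<partial>lborel) \<le> ennreal (LBINT x. (f x)\<^sup>2)"
    by (simp add: r f2)
  then have i: "integrable lborel (\<lambda>x. (g x)\<^sup>2)"
    using le_less_trans[OF le' ennreal_less_top] by (intro integrableI_bounded) auto
  then show "square_integrable g" by (simp add: square_integrable_def)
  have "ennreal (LBINT x. (g x)\<^sup>2) \<le> ennreal (LBINT x. (f x)\<^sup>2)"
    using le' nn_integral_eq_integral[OF i] by simp
  then show "l2norm g \<le> l2norm f"
    by (simp add: l2norm_def ennreal_le_iff)
qed

section \<open>Difference quotients\<close>

definition diffquot :: "real \<Rightarrow> (real \<Rightarrow> real) \<Rightarrow> real \<Rightarrow> real" where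
  "diffquot d u x = (u (x + d) - u x) / d"

lemma diffquot_abs_le:
  assumes d: "0 < d" and u: "\<And>x. (u has_real_derivative v x) (at x)"
    and v: "\<And>x. \<bar>v x\<bar> \<le> M"
  shows "\<bar>diffquot d u x\<bar> \<le> M"
proof -
  obtain z where "u (x + d) - u x = (x + d - x) * v z"
    using MVT2[of x "x + d" u v] d u by auto
  then have "diffquot d u x = v z" using d by (simp add: diffquot_def)
  then show ?thesis using v by simp
qed

text \<open>The quotient is the average of v over [x, x + d], a convolution with a uniform density.
  That the bound is \<open>l2norm v\<close> itself, without a factor, is what
  \<open>l2norm_tendsto_0_of_pointwise\<close> asks for.\<close>

lemma diffquot_square_integrable:
  assumes d: "0 < d" and u: "\<And>x. (u has_real_derivative v x) (at x)"
    and v: "continuous_on UNIV v" "square_integrable v"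
  shows "square_integrable (diffquot d u)" and "l2norm (diffquot d u) \<le> l2norm v"
proof -
  define \<rho> where "\<rho> y = indicator {0..d} y / d" for y :: real
  have cu: "continuous_on UNIV u"
    using u by (meson DERIV_isCont continuous_at_imp_continuous_on)
  have m [measurable]: "diffquot d u \<in> borel_measurable borel"
    unfolding diffquot_def using d
    by (intro borel_measurable_continuous_onI continuous_intros
        continuous_on_compose2[OF cu]) auto
  have \<rho>i: "integrable lborel \<rho>" "\<And>y. 0 \<le> \<rho> y" "(LBINT y. \<rho> y) = 1"
    unfolding \<rho>_def using d
    by (auto simp: integrable_indicator_iff intro!: integrable_divide_zero)
  note [measurable] = square_integrable_measurable[OF v(2)]
  have le: "ennreal \<bar>diffquot d u x\<bar> \<le> (\<integral>\<^sup>+y. ennreal (\<rho> y * \<bar>v (x + y)\<bar>) \<partial>lborel)" for x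
  proof -
    have "(LBINT y. indicator {x..x + d} y *\<^sub>R v y) = u (x + d) - u x"
      using d v u
      by (intro integral_FTC_atLeastAtMost)
        (auto intro: continuous_on_subset has_vector_derivative_at_within
          simp: has_real_derivative_iff_has_vector_derivative)
    moreover have "(LBINT y. indicator {x..x + d} y *\<^sub>R v y)
        = (LBINT y. indicator {x..x + d} (x + y) * v (x + y))"
      using lborel_integral_real_affine[of 1 "\<lambda>y. indicator {x..x + d} y *\<^sub>R v y" x] by simp
    moreover have "indicator {x..x + d} (x + y) * v (x + y) = d * (\<rho> y * v (x + y))" for y
      using d by (simp add: \<rho>_def indicator_def)
    ultimately have "diffquot d u x = (LBINT y. \<rho> y * v (x + y))"
      using d by (simp add: diffquot_def)
    moreover have "ennreal (norm (LBINT y. \<rho> y * v (x + y)))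
        \<le> (\<integral>\<^sup>+y. ennreal (norm (\<rho> y * v (x + y))) \<partial>lborel)"
    proof (rule integral_norm_bound_ennreal)
      have "set_integrable lborel {0..d} (\<lambda>y. v (x + y))"
        by (intro continuous_imp_set_integrable_Icc continuous_on_compose2[OF v(1)] continuous_intros) auto
      then have "integrable lborel (\<lambda>y. (indicator {0..d} y *\<^sub>R v (x + y)) / d)"
        unfolding set_integrable_def by (rule integrable_divide_zero)
      then show "integrable lborel (\<lambda>y. \<rho> y * v (x + y))"
        by (simp add: \<rho>_def)
    qed
    ultimately show ?thesis using \<rho>i(2) by (simp add: abs_mult)
  qed
  show "square_integrable (diffquot d u)" "l2norm (diffquot d u) \<le> l2norm v"
    by (rule Young_square_integrable[OF \<rho>i v(2) m le])+
qed

lemma diffquot_tendsto: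
  assumes u: "\<And>x. (u has_real_derivative v x) (at x)"
    and d: "d \<longlonglongrightarrow> (0::real)" "\<And>k::nat. 0 < d k"
  shows "(\<lambda>k. diffquot (d k) u x) \<longlonglongrightarrow> v x"
proof -
  have "((\<lambda>h. (u (x + h) - u x) / h) \<longlongrightarrow> v x) (at 0)"
    using u[of x] by (simp add: DERIV_def)
  moreover have "filterlim d (at 0) sequentially"
    using d by (simp add: filterlim_at less_imp_neq[symmetric] always_eventually)
  ultimately show ?thesis
    unfolding diffquot_def by (rule filterlim_compose)
qed

text \<open>Pointwise convergence together with \<open>l2norm w\<^sub>k \<le> l2norm v\<close> gives convergence in the mean,
  by Fatou's lemma for \<open>2 v\<^sup>2 + 2 w\<^sub>k\<^sup>2 - (w\<^sub>k - v)\<^sup>2 \<ge> 0\<close>.\<close>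

lemma l2norm_tendsto_0_of_pointwise:
  fixes w :: "nat \<Rightarrow> real \<Rightarrow> real"
  assumes w: "\<And>k. square_integrable (w k)" and v: "square_integrable v"
    and le: "\<And>k. l2norm (w k) \<le> l2norm v" and lim: "\<And>x. (\<lambda>k. w k x) \<longlonglongrightarrow> v x"
  shows "(\<lambda>k. l2norm (\<lambda>x. w k x - v x)) \<longlonglongrightarrow> 0"
proof -
  note [measurable] = w[THEN square_integrable_measurable] v[THEN square_integrable_measurable]
  define a where "a k = (LBINT x. (w k x - v x)\<^sup>2)" for k
  define V where "V = (LBINT x. (v x)\<^sup>2)"
  define g where "g k x = 2 * (v x)\<^sup>2 + 2 * (w k x)\<^sup>2 - (w k x - v x)\<^sup>2" for k x
  have g0: "0 \<le> g k x" for k x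
  proof -
    have "g k x = (w k x + v x)\<^sup>2" by (simp add: g_def power2_eq_square algebra_simps)
    then show ?thesis by simp
  qed
  have [measurable]: "g k \<in> borel_measurable borel" for k unfolding g_def by measurable
  have a0: "0 \<le> a k" and V0: "0 \<le> V" for k by (simp_all add: a_def V_def)
  have wV: "(LBINT x. (w k x)\<^sup>2) \<le> V" for k
    using le[of k] by (simp add: l2norm_def V_def)
  have int: "integrable lborel (\<lambda>x. (v x)\<^sup>2)" "integrable lborel (\<lambda>x. (w k x)\<^sup>2)"
    "integrable lborel (\<lambda>x. (w k x - v x)\<^sup>2)" for k
    using w v square_integrable_diff[OF w v] by (auto simp: square_integrable_def)
  have gi: "integrable lborel (g k)" for k
    unfolding g_def using int by auto
  have gint: "(LBINT x. g k x) \<le> 4 * V - a k" for k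
    using int(1) int(2,3)[of k] wV[of k] by (simp add: g_def V_def a_def)
  have "ennreal (4 * V) = (\<integral>\<^sup>+x. ennreal (4 * (v x)\<^sup>2) \<partial>lborel)"
    using int(1) by (subst nn_integral_eq_integral) (auto simp: V_def)
  also have "\<dots> = (\<integral>\<^sup>+x. liminf (\<lambda>k. ennreal (g k x)) \<partial>lborel)"
  proof (rule nn_integral_cong)
    fix x
    have "(\<lambda>k. g k x) \<longlonglongrightarrow> 2 * (v x)\<^sup>2 + 2 * (v x)\<^sup>2 - (v x - v x)\<^sup>2"
      unfolding g_def by (intro tendsto_intros lim)
    then have "(\<lambda>k. ennreal (g k x)) \<longlonglongrightarrow> ennreal (4 * (v x)\<^sup>2)"
      by (intro tendsto_ennrealI) simp
    then show "ennreal (4 * (v x)\<^sup>2) = liminf (\<lambda>k. ennreal (g k x))"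
      using lim_imp_Liminf trivial_limit_sequentially by metis
  qed
  also have "\<dots> \<le> liminf (\<lambda>k. \<integral>\<^sup>+x. ennreal (g k x) \<partial>lborel)"
    by (rule nn_integral_liminf) measurable
  also have "\<dots> \<le> liminf (\<lambda>k. ennreal (4 * V - a k))"
  proof (rule Liminf_mono, rule always_eventually, rule allI)
    fix k
    show "(\<integral>\<^sup>+x. ennreal (g k x) \<partial>lborel) \<le> ennreal (4 * V - a k)"
      using gint[of k] g0 by (subst nn_integral_eq_integral[OF gi]) (auto intro!: ennreal_leI)
  qed
  finally have fatou: "ennreal (4 * V) \<le> liminf (\<lambda>k. ennreal (4 * V - a k))" .
  have "a \<longlonglongrightarrow> 0"
  proof (rule LIMSEQ_I)
    fix e :: real assume e: "0 < e"
    have ev: "\<forall>\<^sub>F k in sequentially. a k < e"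
    proof (cases "V = 0")
      \<comment> \<open>A separate case because \<open>ennreal (4 * V - e)\<close> would be
        truncated to 0 here, and the strict inequality used in the other case would fail.\<close>
      case True
      have "a k = 0" for k
      proof -
        have "0 \<le> (LBINT x. g k x)" using g0 by simp
        with gint[of k] a0[of k] True show ?thesis by simp
      qed
      then show ?thesis using e by simp
    next
      case False
      with V0 have V: "0 < V" by simp
      with e have "ennreal (4 * V - e) < ennreal (4 * V)"
        by (simp add: ennreal_less_iff ennreal_lessI)
      with fatou have "ennreal (4 * V - e) < liminf (\<lambda>k. ennreal (4 * V - a k))"
        by (rule less_le_trans[rotated])
      then have "\<forall>\<^sub>F k in sequentially. ennreal (4 * V - e) < ennreal (4 * V - a k)"
        by (rule less_LiminfD)
      then show ?thesis
      proof eventually_elim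
        case (elim k)
        then show "a k < e"
          using ennreal_leI[of "4 * V - a k" "4 * V - e"] by (meson not_le diff_left_mono)
      qed
    qed
    then show "\<exists>k0. \<forall>k\<ge>k0. norm (a k - 0) < e"
      using a0 by (auto simp: eventually_sequentially)
  qed
  then have "(\<lambda>k. sqrt (a k)) \<longlonglongrightarrow> sqrt 0" by (rule tendsto_real_sqrt)
  then show ?thesis by (simp add: a_def l2norm_def)
qed

lemma diffquot_l2norm_tendsto:
  assumes u: "\<And>x. (u has_real_derivative v x) (at x)"
    and v: "continuous_on UNIV v" "square_integrable v"
    and d: "d \<longlonglongrightarrow> (0::real)" "\<And>k::nat. 0 < d k"
  shows "(\<lambda>k. l2norm (\<lambda>x. diffquot (d k) u x - v x)) \<longlonglongrightarrow> 0"
  using diffquot_square_integrable[OF d(2) u v] diffquot_tendsto[OF u d]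
  by (intro l2norm_tendsto_0_of_pointwise v) auto

section \<open>A Sobolev inequality for the positive and negative parts\<close>

text \<open>Squaring removes the corner of the positive part, so that the squared positive and
  negative parts of a C^1 function are again C^1 and the fundamental theorem applies to
  them.\<close>

lemma has_real_derivative_max_0_power2:
  "((\<lambda>r::real. (max r 0)\<^sup>2) has_real_derivative 2 * max r 0) (at r)"
proof -
  consider "r < 0" | "0 < r" | "r = 0" by linarith
  then show ?thesis
  proof cases
    case 1
    have "((\<lambda>r::real. 0) has_real_derivative 0) (at r)" by simp
    then have "((\<lambda>r::real. (max r 0)\<^sup>2) has_real_derivative 0) (at r)"
      by (rule has_field_derivative_transform_within_open[where S = "{..<0}"]) (use 1 in auto)
    with 1 show ?thesis by simp
  next
    case 2
    have "((\<lambda>r::real. r\<^sup>2) has_real_derivative 2 * r) (at r)"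
      by (auto intro!: derivative_eq_intros)
    then have "((\<lambda>r::real. (max r 0)\<^sup>2) has_real_derivative 2 * r) (at r)"
      by (rule has_field_derivative_transform_within_open[where S = "{0<..}"]) (use 2 in auto)
    with 2 show ?thesis by simp
  next
    case 3
    have "((\<lambda>h::real. (max h 0)\<^sup>2 / h) \<longlongrightarrow> 0) (at 0)"
    proof (rule tendsto_0_le[where K = 1])
      show "((\<lambda>h::real. h) \<longlongrightarrow> 0) (at 0)" by (rule tendsto_ident_at)
      show "\<forall>\<^sub>F h::real in at 0. norm ((max h 0)\<^sup>2 / h) \<le> norm h * 1"
        by (rule always_eventually) (auto simp: max_def power2_eq_square)
    qed
    then show ?thesis using 3 by (simp add: DERIV_def)
  qed
qed

text \<open>The bound with the factor 2 is applied to the squares of the positive and of the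
  negative part separately; the two right-hand sides add up to the integral of |u| |v| without
  overlap. As x and y are independent, the suprema of the two parts are controlled jointly, and this
  joint bound is what keeps the cubic term within its constant.\<close>

lemma sup_positive_negative_part_le:
  assumes u: "\<And>x. (u has_real_derivative v x) (at x)"
    and v: "continuous_on UNIV v" "square_integrable v" and su: "square_integrable u"
  shows "(max (u x) 0)\<^sup>2 + (max (- u y) 0)\<^sup>2 \<le> l2norm u * l2norm v"
proof -
  have cu: "continuous_on UNIV u"
    using u by (meson DERIV_isCont continuous_at_imp_continuous_on)
  have half: "(max (w x) 0)\<^sup>2 \<le> (LBINT x. max (w x) 0 * \<bar>w' x\<bar>)"
    and half_int: "integrable lborel (\<lambda>x. max (w x) 0 * \<bar>w' x\<bar>)"
    if w: "\<And>x. (w has_real_derivative w' x) (at x)" and w': "continuous_on UNIV w'" "square_integrable w'"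
      and sw: "square_integrable w" and cw: "continuous_on UNIV w" for w w' x
  proof -
    have [measurable]: "w \<in> borel_measurable borel" "w' \<in> borel_measurable borel"
      using sw w' by (auto dest: square_integrable_measurable)
    have sm: "square_integrable (\<lambda>x. max (w x) 0)"
      by (rule square_integrable_bound[OF _ sw, of _ 1]) auto
    have i1: "integrable lborel (\<lambda>x. 2 * max (w x) 0 * w' x)"
      using square_integrable_mult_integrable[OF square_integrable_cmult[OF sm, of 2] w'(2)] by simp
    have "2 * \<bar>(max (w x) 0)\<^sup>2\<bar> \<le> (LBINT x. \<bar>2 * max (w x) 0 * w' x\<bar>)"
    proof (rule abs_le_half_integral_deriv[where F = "\<lambda>x. (max (w x) 0)\<^sup>2"])
      show "((\<lambda>x. (max (w x) 0)\<^sup>2) has_real_derivative 2 * max (w x) 0 * w' x) (at x)" for x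
        using DERIV_chain2[OF has_real_derivative_max_0_power2 w] by simp
      show "continuous_on UNIV (\<lambda>x. 2 * max (w x) 0 * w' x)"
        using w' cw by (intro continuous_intros) auto
      show "integrable lborel (\<lambda>x. (max (w x) 0)\<^sup>2)"
        by (rule square_integrable_power2[OF sm])
    qed (rule i1)
    also have "\<dots> = (LBINT x. 2 * (max (w x) 0 * \<bar>w' x\<bar>))"
      by (rule Bochner_Integration.integral_cong) (auto simp: abs_mult)
    finally show "(max (w x) 0)\<^sup>2 \<le> (LBINT x. max (w x) 0 * \<bar>w' x\<bar>)" by simp
    have "integrable lborel (\<lambda>x. \<bar>2 * max (w x) 0 * w' x\<bar> / 2)" using i1 by simp
    then show "integrable lborel (\<lambda>x. max (w x) 0 * \<bar>w' x\<bar>)"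
      by (simp add: abs_mult)
  qed
  have neg: "((\<lambda>x. - u x) has_real_derivative - v x) (at x)" "continuous_on UNIV (\<lambda>x. - v x)"
    "square_integrable (\<lambda>x. - v x)" "square_integrable (\<lambda>x. - u x)" "continuous_on UNIV (\<lambda>x. - u x)" for x
    using u v su cu square_integrable_cmult[OF v(2), of "-1"] square_integrable_cmult[OF su, of "-1"]
    by (auto intro!: derivative_eq_intros continuous_intros)
  note p = half[OF u v su cu] half_int[OF u v su cu]
  note n = half[OF neg] half_int[OF neg]
  note [measurable] = su[THEN square_integrable_measurable] v(2)[THEN square_integrable_measurable]
  have "(max (u x) 0)\<^sup>2 + (max (- u y) 0)\<^sup>2
      \<le> (LBINT x. max (u x) 0 * \<bar>v x\<bar>) + (LBINT x. max (- u x) 0 * \<bar>- v x\<bar>)"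
    by (intro add_mono p n)
  also have "\<dots> = (LBINT x. max (u x) 0 * \<bar>v x\<bar> + max (- u x) 0 * \<bar>- v x\<bar>)"
    by (rule Bochner_Integration.integral_add[symmetric]) (rule p n)+
  also have "\<dots> = (LBINT x. \<bar>u x\<bar> * \<bar>v x\<bar>)"
    by (rule Bochner_Integration.integral_cong) (auto simp: max_def)
  also have "\<dots> \<le> \<bar>LBINT x. \<bar>u x\<bar> * \<bar>v x\<bar>\<bar>" by simp
  also have "\<dots> \<le> l2norm (\<lambda>x. \<bar>u x\<bar>) * l2norm (\<lambda>x. \<bar>v x\<bar>)"
    by (intro Cauchy_Schwarz_integral square_integrable_bound[OF _ su, of _ 1]
        square_integrable_bound[OF _ v(2), of _ 1]) auto
  finally show ?thesis by (simp add: l2norm_def)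
qed

section \<open>Convolution with the exponential kernel\<close>

lemma exp_atMost_integrable: "integrable lborel (\<lambda>y. indicator {..x} y * exp (y - x :: real))"
  and exp_atMost_integral: "(LBINT y. indicator {..x} y * exp (y - x :: real)) = 1"
  and exp_atLeast_integrable: "integrable lborel (\<lambda>y. indicator {x..} y * exp (x - y :: real))"
  and exp_atLeast_integral: "(LBINT y. indicator {x..} y * exp (x - y :: real)) = 1"
proof -
  let ?g = "\<lambda>z::real. indicator {0..} z * exp (- z)"
  have nn: "(\<integral>\<^sup>+z. ennreal (?g z) \<partial>lborel) = ennreal 1"
  proof -
    have "(\<integral>\<^sup>+z. ennreal (?g z) \<partial>lborel) = (\<integral>\<^sup>+z. ennreal (z ^ 0 * exp (- z)) * indicator {0..} z \<partial>lborel)"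
      by (rule nn_integral_cong) (auto simp: indicator_def)
    also have "\<dots> = ennreal 1"
      by (subst nn_intergal_power_times_exp_Ici) simp
    finally show ?thesis .
  qed
  have g: "has_bochner_integral lborel ?g 1"
    by (rule has_bochner_integral_nn_integral) (use nn in auto)
  then have gi: "integrable lborel ?g" and g1: "integral\<^sup>L lborel ?g = 1"
    by (auto simp: has_bochner_integral_iff)
  have e1: "indicator {..x} y * exp (y - x) = ?g (x + (- 1) * y)" for y
    by (auto simp: indicator_def)
  have e2: "indicator {x..} y * exp (x - y) = ?g (- x + 1 * y)" for y
    by (auto simp: indicator_def)
  show "integrable lborel (\<lambda>y. indicator {..x} y * exp (y - x))"
    unfolding e1 by (rule lborel_integrable_real_affine[OF gi]) simp
  show "(LBINT y. indicator {..x} y * exp (y - x)) = 1"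
    unfolding e1 using lborel_integral_real_affine[of "- 1" ?g x] g1 by simp
  show "integrable lborel (\<lambda>y. indicator {x..} y * exp (x - y))"
    unfolding e2 by (rule lborel_integrable_real_affine[OF gi]) simp
  show "(LBINT y. indicator {x..} y * exp (x - y)) = 1"
    unfolding e2 using lborel_integral_real_affine[of 1 ?g "- x"] g1 by simp
qed

lemma set_integrable_exp_atMost:
  fixes G :: "real \<Rightarrow> real"
  assumes [measurable]: "G \<in> borel_measurable borel" and G: "\<And>y. \<bar>G y\<bar> \<le> M"
  shows "set_integrable lborel {..b} (\<lambda>y. exp (y - x) * G y)"
proof -
  have "integrable lborel (\<lambda>y. M * exp (b - x) * (indicator {..b} y * exp (y - b)))"
    by (intro integrable_mult_right exp_atMost_integrable)
  then show ?thesis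
    unfolding set_integrable_def
  proof (rule Bochner_Integration.integrable_bound)
    show "AE y in lborel. norm (indicat_real {..b} y *\<^sub>R (exp (y - x) * G y))
        \<le> norm (M * exp (b - x) * (indicator {..b} y * exp (y - b)))"
    proof (rule AE_I2)
      fix y
      have "exp (y - x) * \<bar>G y\<bar> \<le> exp (y - x) * \<bar>M\<bar>"
        using G[of y] by (intro mult_left_mono) auto
      then show "norm (indicat_real {..b} y *\<^sub>R (exp (y - x) * G y))
        \<le> norm (M * exp (b - x) * (indicator {..b} y * exp (y - b)))"
        by (auto simp: indicator_def abs_mult exp_add[symmetric] mult.assoc mult.commute)
    qed
  qed measurable
qed

lemma set_integrable_exp_atLeast:
  fixes G :: "real \<Rightarrow> real"
  assumes [measurable]: "G \<in> borel_measurable borel" and G: "\<And>y. \<bar>G y\<bar> \<le> M"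
  shows "set_integrable lborel {b..} (\<lambda>y. exp (x - y) * G y)"
proof -
  have "set_integrable lborel {..- b} (\<lambda>y. exp (y - (- x)) * G (- y))"
    by (rule set_integrable_exp_atMost[where M = M]) (use G in auto)
  then show ?thesis
    using set_integrable_reflect[of b "\<lambda>y. exp (x - y) * G y"] by (simp add: add.commute)
qed

text \<open>Beyond the fixed point x - 1 the half-line integral is an ordinary integral with
  variable upper limit, and differentiation only concerns points near x.\<close>

lemma set_integral_atMost_has_derivative:
  fixes f :: "real \<Rightarrow> real"
  assumes f: "continuous_on UNIV f" and int: "\<And>b. set_integrable lborel {..b} f"
  shows "((\<lambda>b. LBINT y:{..b}. f y) has_real_derivative f x) (at x)"
proof -
  let ?a = "x - 1"
  have "((\<lambda>u. integral {?a..u} f) has_real_derivative f x) (at x within {?a..x + 1})"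
    by (rule integral_has_real_derivative) (auto intro: continuous_on_subset[OF f])
  then have "((\<lambda>u. integral {?a..u} f) has_real_derivative f x) (at x)"
    by (simp add: at_within_Icc_at)
  then have "((\<lambda>u. (LBINT y:{..?a}. f y) + integral {?a..u} f) has_real_derivative f x) (at x)"
    by (auto intro!: derivative_eq_intros)
  then show ?thesis
  proof (rule has_field_derivative_transform_within_open[where S = "{?a<..}"])
    fix u assume u: "u \<in> {?a<..}"
    have s: "set_integrable lborel {?a..u} f"
      by (rule set_integrable_subset[OF int[of u]]) auto
    have "(LBINT y:{..?a} \<union> {?a..u}. f y) = (LBINT y:{..?a}. f y) + (LBINT y:{?a..u}. f y)"
      by (rule set_integral_Un_AE[OF _ _ _ int s])
        (use AE_lborel_singleton[of ?a] in \<open>auto elim!: eventually_mono\<close>)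
    moreover have "{..?a} \<union> {?a..u} = {..u}" using u by auto
    ultimately show "(LBINT y:{..?a}. f y) + integral {?a..u} f = (LBINT y:{..u}. f y)"
      using set_borel_integral_eq_integral(2)[OF s] by simp
  qed auto
qed

text \<open>The kernel exp (- |x - y|) / 2 is cut at y = x. Each half solves a first-order equation
  with \<open>G\<close> as source, so the sum \<open>Lambda_inv2\<close> and the difference
  \<open>dLambda_inv2\<close> can be differentiated classically, and the jump in the derivative of
  the kernel appears as the term \<open>- G\<close>.\<close>

definition exp_left :: "(real \<Rightarrow> real) \<Rightarrow> real \<Rightarrow> real" where
  "exp_left G x = (LBINT y:{..x}. exp (y - x) * G y) / 2"

definition exp_right :: "(real \<Rightarrow> real) \<Rightarrow> real \<Rightarrow> real" where
  "exp_right G x = (LBINT y:{x..}. exp (x - y) * G y) / 2"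

definition dLambda_inv2 :: "(real \<Rightarrow> real) \<Rightarrow> real \<Rightarrow> real" where
  "dLambda_inv2 G x = exp_right G x - exp_left G x"

lemma exp_right_reflect: "exp_right G x = exp_left (\<lambda>y. G (- y)) (- x)"
  using set_integral_reflect[of x "\<lambda>y. exp (x - y) * G y"]
  by (simp add: exp_right_def exp_left_def add.commute)

locale bounded_continuous =
  fixes G :: "real \<Rightarrow> real" and M :: real
  assumes cont: "continuous_on UNIV G" and bdd: "\<And>y. \<bar>G y\<bar> \<le> M"
begin

lemma measurable_G [measurable]: "G \<in> borel_measurable borel"
  using cont by (rule borel_measurable_continuous_onI)

lemma reflect: "bounded_continuous (\<lambda>y. G (- y)) M"
  by unfold_locales (auto intro!: bdd continuous_on_compose2[OF cont] continuous_intros)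

lemma exp_left_has_derivative:
  "(exp_left G has_real_derivative G x / 2 - exp_left G x) (at x)"
proof -
  let ?I = "\<lambda>b. LBINT y:{..b}. exp y * G y"
  have "(?I has_real_derivative exp x * G x) (at x)"
    using cont set_integrable_exp_atMost[OF measurable_G bdd, of _ 0]
    by (intro set_integral_atMost_has_derivative continuous_intros) auto
  then have "((\<lambda>x. exp (- x) * ?I x / 2) has_real_derivative
      (- exp (- x) * ?I x + exp x * G x * exp (- x)) / 2) (at x)"
    by (auto intro!: derivative_eq_intros)
  moreover have e: "exp_left G = (\<lambda>x. exp (- x) * ?I x / 2)"
  proof
    fix x
    have "(LBINT y:{..x}. exp (y - x) * G y) = (LBINT y:{..x}. exp (- x) * (exp y * G y))"
      by (simp add: exp_diff exp_minus field_simps)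
    then show "exp_left G x = exp (- x) * ?I x / 2"
      by (simp add: exp_left_def)
  qed
  moreover have "(- exp (- x) * ?I x + exp x * G x * exp (- x)) / 2 = G x / 2 - exp_left G x"
    unfolding e by (simp add: exp_minus field_simps)
  ultimately show ?thesis by (simp only:)
qed

lemma exp_right_has_derivative:
  "(exp_right G has_real_derivative exp_right G x - G x / 2) (at x)"
proof -
  interpret r: bounded_continuous "\<lambda>y. G (- y)" M by (rule reflect)
  have "((\<lambda>x. exp_left (\<lambda>y. G (- y)) (- x)) has_real_derivative
      (G (- (- x)) / 2 - exp_left (\<lambda>y. G (- y)) (- x)) * (- 1)) (at x)"
    by (rule DERIV_chain2[OF r.exp_left_has_derivative]) (auto intro!: derivative_eq_intros)
  then show ?thesis
    by (simp add: exp_right_reflect[abs_def])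
qed

lemma Lambda_inv2_eq: "Lambda_inv2 G x = exp_left G x + exp_right G x"
  and Lambda_inv2_integrable: "integrable lborel (\<lambda>y. 1 / 2 * exp (- \<bar>x - y\<bar>) * G y)"
proof -
  let ?k = "\<lambda>y. 1 / 2 * exp (- \<bar>x - y\<bar>) * G y"
  have "integrable lborel (\<lambda>y. M / 2 * (indicator {..x} y * exp (y - x)) + M / 2 * (indicator {x..} y * exp (x - y)))"
    by (intro Bochner_Integration.integrable_add integrable_mult_right exp_atMost_integrable exp_atLeast_integrable)
  then show i: "integrable lborel ?k"
  proof (rule Bochner_Integration.integrable_bound)
    show "AE y in lborel. norm (?k y) \<le> norm (M / 2 * (indicator {..x} y * exp (y - x))
        + M / 2 * (indicator {x..} y * exp (x - y)))"
    proof (rule AE_I2)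
      fix y
      have M: "0 \<le> M" using bdd[of 0] by linarith
      have "exp (- \<bar>x - y\<bar>) * \<bar>G y\<bar> \<le> exp (- \<bar>x - y\<bar>) * M"
        using bdd[of y] by (intro mult_left_mono) auto
      moreover have "0 \<le> exp (- \<bar>x - y\<bar>) * M" using M by simp
      ultimately show "norm (?k y) \<le> norm (M / 2 * (indicator {..x} y * exp (y - x))
        + M / 2 * (indicator {x..} y * exp (x - y)))"
        using M by (cases x y rule: linorder_cases) (auto simp: abs_mult mult.commute)
    qed
  qed measurable
  have "(LBINT y:{..x}. ?k y) = (LBINT y:{..x}. (exp (y - x) * G y) / 2)"
    by (rule set_lebesgue_integral_cong) (auto simp: field_simps)
  moreover have "(LBINT y:{x..}. ?k y) = (LBINT y:{x..}. (exp (x - y) * G y) / 2)"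
    by (rule set_lebesgue_integral_cong) (auto simp: field_simps)
  ultimately show "Lambda_inv2 G x = exp_left G x + exp_right G x"
    unfolding Lambda_inv2_def integral_split_halflines(3)[OF i, of x] exp_left_def exp_right_def
    by (simp only: set_integral_divide_zero)
qed

lemma Lambda_inv2_has_derivative: "(Lambda_inv2 G has_real_derivative dLambda_inv2 G x) (at x)"
proof -
  have "((\<lambda>x. exp_left G x + exp_right G x) has_real_derivative
      (G x / 2 - exp_left G x) + (exp_right G x - G x / 2)) (at x)"
    by (intro derivative_intros exp_left_has_derivative exp_right_has_derivative)
  then show ?thesis
    by (simp add: Lambda_inv2_eq[abs_def] dLambda_inv2_def)
qed

text \<open>The identity (1 - d^2/dx^2) \<open>Lambda_inv2 G\<close> = \<open>G\<close> in
  first-order form, classical because \<open>G\<close> is continuous.\<close>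

lemma dLambda_inv2_has_derivative:
  "(dLambda_inv2 G has_real_derivative Lambda_inv2 G x - G x) (at x)"
proof -
  have "((\<lambda>x. exp_right G x - exp_left G x) has_real_derivative
      (exp_right G x - G x / 2) - (G x / 2 - exp_left G x)) (at x)"
    by (intro derivative_intros exp_left_has_derivative exp_right_has_derivative)
  then show ?thesis
    by (simp add: Lambda_inv2_eq dLambda_inv2_def[abs_def] algebra_simps)
qed

lemma continuous_on_Lambda_inv2: "continuous_on UNIV (Lambda_inv2 G)"
  using Lambda_inv2_has_derivative by (meson DERIV_isCont continuous_at_imp_continuous_on)

lemma continuous_on_dLambda_inv2: "continuous_on UNIV (dLambda_inv2 G)"
  using dLambda_inv2_has_derivative by (meson DERIV_isCont continuous_at_imp_continuous_on)

end

lemma Lambda_inv2_const: "Lambda_inv2 (\<lambda>_. c) x = c"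
proof -
  interpret bounded_continuous "\<lambda>_. c" "\<bar>c\<bar>" by unfold_locales auto
  show ?thesis
    using exp_atMost_integral[of x] exp_atLeast_integral[of x]
    by (simp add: Lambda_inv2_eq exp_left_def exp_right_def set_lebesgue_integral_def
        mult.assoc[symmetric])
qed

lemma Lambda_inv2_mono:
  assumes "bounded_continuous G M" "bounded_continuous H M'" "\<And>y. G y \<le> H y"
  shows "Lambda_inv2 G x \<le> Lambda_inv2 H x"
  unfolding Lambda_inv2_def
  by (intro integral_mono bounded_continuous.Lambda_inv2_integrable[OF assms(1)]
      bounded_continuous.Lambda_inv2_integrable[OF assms(2)] mult_left_mono assms(3)) auto

lemma Lambda_inv2_add:
  assumes "bounded_continuous G M" "bounded_continuous H M'"
  shows "Lambda_inv2 (\<lambda>y. G y + H y) x = Lambda_inv2 G x + Lambda_inv2 H x"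
  unfolding Lambda_inv2_def distrib_left
  by (intro Bochner_Integration.integral_add bounded_continuous.Lambda_inv2_integrable[OF assms(1)]
      bounded_continuous.Lambda_inv2_integrable[OF assms(2)])

lemma Lambda_inv2_cmult: "Lambda_inv2 (\<lambda>y. c * G y) x = c * Lambda_inv2 G x"
  unfolding Lambda_inv2_def by (simp add: mult.left_commute)

lemma bounded_continuous_const: "bounded_continuous (\<lambda>_. c) \<bar>c\<bar>"
  by unfold_locales auto

context bounded_continuous
begin

lemma Lambda_inv2_bounds:
  assumes "\<And>y. a \<le> G y" "\<And>y. G y \<le> b"
  shows "a \<le> Lambda_inv2 G x" "Lambda_inv2 G x \<le> b"
  using Lambda_inv2_mono[OF bounded_continuous_const bounded_continuous_axioms, of a x]
    Lambda_inv2_mono[OF bounded_continuous_axioms bounded_continuous_const, of b x] assms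
  by (auto simp: Lambda_inv2_const)

lemma abs_bounded_continuous: "bounded_continuous (\<lambda>y. \<bar>G y\<bar>) M"
  by unfold_locales (auto intro!: bdd continuous_intros cont)

lemma dLambda_inv2_abs_le: "\<bar>dLambda_inv2 G x\<bar> \<le> Lambda_inv2 (\<lambda>y. \<bar>G y\<bar>) x"
  and Lambda_inv2_abs_le: "\<bar>Lambda_inv2 G x\<bar> \<le> Lambda_inv2 (\<lambda>y. \<bar>G y\<bar>) x"
  and exp_diff_abs_le: "\<bar>exp_left G x - exp_right G x\<bar> \<le> Lambda_inv2 (\<lambda>y. \<bar>G y\<bar>) x"
proof -
  interpret a: bounded_continuous "\<lambda>y. \<bar>G y\<bar>" M by (rule abs_bounded_continuous)
  have "\<bar>exp_left G x\<bar> \<le> exp_left (\<lambda>y. \<bar>G y\<bar>) x"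
    using integral_abs_bound[of lborel "\<lambda>y. indicat_real {..x} y *\<^sub>R (exp (y - x) * G y)"]
    by (simp add: exp_left_def set_lebesgue_integral_def abs_mult)
  moreover have "\<bar>exp_right G x\<bar> \<le> exp_right (\<lambda>y. \<bar>G y\<bar>) x"
    using integral_abs_bound[of lborel "\<lambda>y. indicat_real {x..} y *\<^sub>R (exp (x - y) * G y)"]
    by (simp add: exp_right_def set_lebesgue_integral_def abs_mult)
  ultimately show "\<bar>dLambda_inv2 G x\<bar> \<le> Lambda_inv2 (\<lambda>y. \<bar>G y\<bar>) x"
    "\<bar>Lambda_inv2 G x\<bar> \<le> Lambda_inv2 (\<lambda>y. \<bar>G y\<bar>) x"
    "\<bar>exp_left G x - exp_right G x\<bar> \<le> Lambda_inv2 (\<lambda>y. \<bar>G y\<bar>) x"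
    unfolding dLambda_inv2_def Lambda_inv2_eq a.Lambda_inv2_eq by linarith+
qed

lemma Lambda_inv2_bounded: "\<bar>Lambda_inv2 G x\<bar> \<le> M" and dLambda_inv2_bounded: "\<bar>dLambda_inv2 G x\<bar> \<le> M"
proof -
  interpret a: bounded_continuous "\<lambda>y. \<bar>G y\<bar>" M by (rule abs_bounded_continuous)
  have "Lambda_inv2 (\<lambda>y. \<bar>G y\<bar>) x \<le> M"
    by (rule a.Lambda_inv2_bounds(2)[where a = 0]) (auto simp: bdd)
  then show "\<bar>Lambda_inv2 G x\<bar> \<le> M" "\<bar>dLambda_inv2 G x\<bar> \<le> M"
    using Lambda_inv2_abs_le[of x] dLambda_inv2_abs_le[of x] by linarith+
qed

text \<open>The kernel is moved to the origin, which is the shape that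
  \<open>Young_square_integrable\<close> expects.\<close>

lemma Lambda_inv2_abs_le_conv:
  "ennreal (Lambda_inv2 (\<lambda>y. \<bar>G y\<bar>) x) \<le> (\<integral>\<^sup>+y. ennreal (1 / 2 * exp (- \<bar>y\<bar>) * \<bar>G (x + y)\<bar>) \<partial>lborel)"
proof -
  interpret a: bounded_continuous "\<lambda>y. \<bar>G y\<bar>" M by (rule abs_bounded_continuous)
  have "ennreal (Lambda_inv2 (\<lambda>y. \<bar>G y\<bar>) x)
      = (\<integral>\<^sup>+y. ennreal (1 / 2 * exp (- \<bar>x - y\<bar>) * \<bar>G y\<bar>) \<partial>lborel)"
    unfolding Lambda_inv2_def
    by (rule nn_integral_eq_integral[symmetric, OF a.Lambda_inv2_integrable]) auto
  also have "\<dots> = (\<integral>\<^sup>+y. ennreal (1 / 2 * exp (- \<bar>y\<bar>) * \<bar>G (x + y)\<bar>) \<partial>lborel)"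
    by (subst nn_integral_real_affine[of _ 1 x]) auto
  finally show ?thesis by simp
qed

lemma exp_kernel:
  "integrable lborel (\<lambda>y. 1 / 2 * exp (- \<bar>y\<bar>) :: real)" "(LBINT y. 1 / 2 * exp (- \<bar>y\<bar>) :: real) = 1"
proof -
  interpret c: bounded_continuous "\<lambda>_. 1" 1 by unfold_locales auto
  show "integrable lborel (\<lambda>y. 1 / 2 * exp (- \<bar>y\<bar>) :: real)"
    using c.Lambda_inv2_integrable[of 0] by simp
  show "(LBINT y. 1 / 2 * exp (- \<bar>y\<bar>) :: real) = 1"
    using Lambda_inv2_const[of 1 0] by (simp add: Lambda_inv2_def)
qed

lemma Lambda_inv2_square_integrable:
  assumes "square_integrable G"
  shows "square_integrable (Lambda_inv2 G)" "l2norm (Lambda_inv2 G) \<le> l2norm G"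
    and "square_integrable (dLambda_inv2 G)" "l2norm (dLambda_inv2 G) \<le> l2norm G"
proof -
  have [measurable]: "Lambda_inv2 G \<in> borel_measurable borel" "dLambda_inv2 G \<in> borel_measurable borel"
    using continuous_on_Lambda_inv2 continuous_on_dLambda_inv2 by (auto intro: borel_measurable_continuous_onI)
  have k: "0 \<le> (1 / 2 * exp (- \<bar>y\<bar>) :: real)" for y by simp
  have le1: "ennreal \<bar>Lambda_inv2 G x\<bar> \<le> (\<integral>\<^sup>+y. ennreal (1 / 2 * exp (- \<bar>y\<bar>) * \<bar>G (x + y)\<bar>) \<partial>lborel)" for x
    using order_trans[OF ennreal_leI[OF Lambda_inv2_abs_le] Lambda_inv2_abs_le_conv] .
  have le2: "ennreal \<bar>dLambda_inv2 G x\<bar> \<le> (\<integral>\<^sup>+y. ennreal (1 / 2 * exp (- \<bar>y\<bar>) * \<bar>G (x + y)\<bar>) \<partial>lborel)" for x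
    using order_trans[OF ennreal_leI[OF dLambda_inv2_abs_le] Lambda_inv2_abs_le_conv] .
  show "square_integrable (Lambda_inv2 G)" "l2norm (Lambda_inv2 G) \<le> l2norm G"
    by (rule Young_square_integrable[OF exp_kernel(1) k exp_kernel(2) assms _ le1]; measurable)+
  show "square_integrable (dLambda_inv2 G)" "l2norm (dLambda_inv2 G) \<le> l2norm G"
    by (rule Young_square_integrable[OF exp_kernel(1) k exp_kernel(2) assms _ le2]; measurable)+
qed

text \<open>Writing \<open>W = Lambda_inv2 G\<close>, one has \<open>G = W - W''\<close> and \<open>G - W = - W''\<close>, so that
  \<open>\<integral> G\<^sup>2 - (G - W)\<^sup>2 = \<integral> W\<^sup>2 + 2 W'\<^sup>2 \<ge> 0\<close>.\<close>

lemma l2norm_diff_Lambda_inv2_le: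
  assumes "square_integrable G"
  shows "square_integrable (\<lambda>x. G x - Lambda_inv2 G x)"
    and "l2norm (\<lambda>x. G x - Lambda_inv2 G x) \<le> l2norm G"
proof -
  let ?W = "Lambda_inv2 G" and ?P = "dLambda_inv2 G"
  note W = Lambda_inv2_square_integrable[OF assms]
  show d: "square_integrable (\<lambda>x. G x - ?W x)"
    by (rule square_integrable_diff[OF assms W(1)])
  have i1: "integrable lborel (\<lambda>x. ?P x * ?P x + ?W x * (?W x - G x))"
    using square_integrable_mult_integrable[OF W(3,3)]
      square_integrable_mult_integrable[OF W(1) square_integrable_diff[OF W(1) assms]] by simp
  have z: "(LBINT x. ?P x * ?P x + ?W x * (?W x - G x)) = 0"
  proof (rule integral_deriv_eq_0[where F = "\<lambda>x. ?W x * ?P x"])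
    show "((\<lambda>x. ?W x * ?P x) has_real_derivative ?P x * ?P x + ?W x * (?W x - G x)) (at x)" for x
      by (auto intro!: derivative_eq_intros Lambda_inv2_has_derivative dLambda_inv2_has_derivative)
    show "continuous_on UNIV (\<lambda>x. ?P x * ?P x + ?W x * (?W x - G x))"
      by (intro continuous_intros continuous_on_Lambda_inv2 continuous_on_dLambda_inv2 cont)
  qed (use i1 square_integrable_mult_integrable[OF W(1,3)] in auto)
  have "(LBINT x. (G x - ?W x)\<^sup>2) \<le> (LBINT x. (G x)\<^sup>2)"
  proof -
    have "(LBINT x. (G x - ?W x)\<^sup>2) \<le> (LBINT x. (G x)\<^sup>2 + 2 * (?P x * ?P x + ?W x * (?W x - G x)))"
    proof (rule integral_mono)
      fix x
      have "(G x)\<^sup>2 + 2 * (?P x * ?P x + ?W x * (?W x - G x))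
          = (G x - ?W x)\<^sup>2 + 2 * (?P x)\<^sup>2 + (?W x)\<^sup>2"
        by (simp add: power2_eq_square algebra_simps)
      then show "(G x - ?W x)\<^sup>2 \<le> (G x)\<^sup>2 + 2 * (?P x * ?P x + ?W x * (?W x - G x))"
        by simp
    qed (intro Bochner_Integration.integrable_add integrable_mult_right i1
        square_integrable_power2 assms d)+
    also have "\<dots> = (LBINT x. (G x)\<^sup>2)"
      using z by (subst Bochner_Integration.integral_add)
        (simp_all only: integral_mult_right_zero mult_zero_right add_0_right
          square_integrable_power2[OF assms] integrable_mult_right[OF i1])
    finally show ?thesis .
  qed
  then show "l2norm (\<lambda>x. G x - ?W x) \<le> l2norm G"
    by (simp add: l2norm_def)
qed

end

text \<open>Integrating exp (- |x - y|) u by parts on both half-lines gives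
  \<open>u - Lambda_inv2 u\<close> = \<open>exp_left v - exp_right v\<close>, a convolution of v
  with a kernel of modulus exp (- |x - y|) / 2. The L2 norm of that kernel is 1/2.\<close>

lemma diff_Lambda_inv2_abs_le:
  assumes u: "\<And>x. (u has_real_derivative v x) (at x)" and bu: "\<And>x. \<bar>u x\<bar> \<le> M"
    and v: "continuous_on UNIV v" "square_integrable v" "\<And>x. \<bar>v x\<bar> \<le> M"
  shows "\<bar>u x - Lambda_inv2 u x\<bar> \<le> l2norm v / 2"
proof -
  have cu: "continuous_on UNIV u"
    using u by (meson DERIV_isCont continuous_at_imp_continuous_on)
  interpret u: bounded_continuous u M by unfold_locales (rule cu bu)+
  interpret v: bounded_continuous v M by unfold_locales (rule v)+
  note ii = set_integrable_exp_atMost[OF u.measurable_G bu] set_integrable_exp_atMost[OF v.measurable_G v(3)]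
    set_integrable_exp_atLeast[OF u.measurable_G bu] set_integrable_exp_atLeast[OF v.measurable_G v(3)]
  have "(LBINT y:{..x}. exp (y - x) * u y + exp (y - x) * v y) = exp (x - x) * u x"
  proof (rule set_integral_deriv_atMost[where F = "\<lambda>y. exp (y - x) * u y"])
    show "((\<lambda>y. exp (y - x) * u y) has_real_derivative exp (y - x) * u y + exp (y - x) * v y) (at y)" for y
      by (auto intro!: derivative_eq_intros u)
    show "continuous_on UNIV (\<lambda>y. exp (y - x) * u y + exp (y - x) * v y)"
      by (intro continuous_intros cu v)
  qed (use ii in auto)
  then have l: "exp_left u x + exp_left v x = u x / 2"
    using ii unfolding exp_left_def by (subst (asm) set_integral_add) auto
  have "(LBINT y:{x..}. exp (x - y) * v y - exp (x - y) * u y) = - (exp (x - x) * u x)"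
  proof (rule set_integral_deriv_atLeast[where F = "\<lambda>y. exp (x - y) * u y"])
    show "((\<lambda>y. exp (x - y) * u y) has_real_derivative exp (x - y) * v y - exp (x - y) * u y) (at y)" for y
      by (auto intro!: derivative_eq_intros u)
    show "continuous_on UNIV (\<lambda>y. exp (x - y) * v y - exp (x - y) * u y)"
      by (intro continuous_intros cu v)
  qed (use ii in auto)
  then have r: "exp_right v x - exp_right u x = - u x / 2"
    using ii unfolding exp_right_def by (subst (asm) set_integral_diff) (auto simp: field_simps)
  have "\<bar>u x - Lambda_inv2 u x\<bar> = \<bar>exp_left v x - exp_right v x\<bar>"
    using l r by (simp add: u.Lambda_inv2_eq)
  also have "\<dots> \<le> Lambda_inv2 (\<lambda>y. \<bar>v y\<bar>) x"
    by (rule v.exp_diff_abs_le)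
  also have "\<dots> \<le> l2norm v / 2"
  proof -
    define k where "k y = 1 / 2 * exp (- \<bar>x - y\<bar>)" for y :: real
    \<comment> \<open>The square of the kernel is half the kernel at twice the distance, so that its
      integral 1/4 follows by scaling from the integral 1 of the kernel.\<close>
    have ke: "(k y)\<^sup>2 = (\<lambda>z. 1 / 4 * exp (- \<bar>z\<bar>)) (- (2 * x) + 2 * y)" for y
    proof -
      have "\<bar>- (2 * x) + 2 * y\<bar> = 2 * \<bar>x - y\<bar>" by (simp add: abs_if)
      then show ?thesis
        by (simp only: k_def power_mult_distrib exp_double[symmetric]) (simp add: power2_eq_square)
    qed
    have i: "integrable lborel (\<lambda>z. 1 / 4 * exp (- \<bar>z\<bar>) :: real)"
      using integrable_mult_right[OF v.exp_kernel(1), of "1 / 2"] by simp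
    have I: "(LBINT z. 1 / 4 * exp (- \<bar>z\<bar>) :: real) = 1 / 2"
    proof -
      have "(LBINT z. 1 / 4 * exp (- \<bar>z\<bar>) :: real) = (LBINT z. 1 / 2 * (1 / 2 * exp (- \<bar>z\<bar>)))" by simp
      also have "\<dots> = 1 / 2" using v.exp_kernel(2) by (subst integral_mult_right_zero) simp
      finally show ?thesis .
    qed
    have [measurable]: "k \<in> borel_measurable borel"
      unfolding k_def by measurable
    have "integrable lborel (\<lambda>y. (k y)\<^sup>2)"
      unfolding ke by (rule lborel_integrable_real_affine[OF i]) simp
    then have ki: "square_integrable k"
      by (simp add: square_integrable_def)
    have k2: "(LBINT y. (k y)\<^sup>2) = 1 / 4"
      unfolding ke using lborel_integral_real_affine[of 2 "\<lambda>z. 1 / 4 * exp (- \<bar>z\<bar>) :: real" "- (2 * x)"] I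
      by simp
    have lk: "l2norm k = 1 / 2"
      unfolding l2norm_def k2 by (simp add: real_sqrt_divide)
    have av: "square_integrable (\<lambda>y. \<bar>v y\<bar>)"
      by (rule square_integrable_bound[OF _ v(2), of _ 1]) auto
    have "Lambda_inv2 (\<lambda>y. \<bar>v y\<bar>) x \<le> \<bar>LBINT y. k y * \<bar>v y\<bar>\<bar>"
      by (simp add: Lambda_inv2_def k_def)
    also have "\<dots> \<le> l2norm k * l2norm (\<lambda>y. \<bar>v y\<bar>)"
      by (rule Cauchy_Schwarz_integral[OF ki av])
    also have "\<dots> = l2norm v / 2"
      unfolding lk by (simp add: l2norm_def)
    finally show ?thesis .
  qed
  finally show ?thesis .
qed

text \<open>On the left half-line u(x)^2 / 2 is the integral of exp (y - x) (u^2 / 2 + u v), and u v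
  <= (u^2 + v^2) / 2; hence \<open>exp_left\<close> of u^2 + v^2 / 2 is at least u(x)^2 / 4. The
  right half-line gives the other quarter.\<close>

lemma Lambda_inv2_lower_bound:
  assumes u: "\<And>x. (u has_real_derivative v x) (at x)" and bu: "\<And>x. \<bar>u x\<bar> \<le> M"
    and v: "continuous_on UNIV v" "\<And>x. \<bar>v x\<bar> \<le> M"
  shows "(u x)\<^sup>2 / 2 \<le> Lambda_inv2 (\<lambda>y. (u y)\<^sup>2 + (v y)\<^sup>2 / 2) x"
proof -
  have cu: "continuous_on UNIV u"
    using u by (meson DERIV_isCont continuous_at_imp_continuous_on)
  let ?G = "\<lambda>y. (u y)\<^sup>2 + (v y)\<^sup>2 / 2" and ?F = "\<lambda>y. (u y)\<^sup>2 / 2" and ?g = "\<lambda>y. u y * v y"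
  have M: "0 \<le> M" using bu[of 0] by linarith
  have b2: "(u y)\<^sup>2 \<le> M\<^sup>2" "(v y)\<^sup>2 \<le> M\<^sup>2" "\<bar>u y * v y\<bar> \<le> M * M" for y
    using bu[of y] v(2)[of y] M by (auto simp: abs_le_square_iff[symmetric] abs_mult intro!: mult_mono)
  interpret G: bounded_continuous ?G "2 * M\<^sup>2"
  proof unfold_locales
    show "\<bar>?G y\<bar> \<le> 2 * M\<^sup>2" for y
      using b2[of y] zero_le_power2[of M] zero_le_power2[of "u y"] zero_le_power2[of "v y"]
      unfolding abs_le_iff by linarith
  qed (intro continuous_intros cu v, simp)
  interpret F: bounded_continuous ?F "M\<^sup>2"
  proof unfold_locales
    show "\<bar>?F y\<bar> \<le> M\<^sup>2" for y
      using b2[of y] zero_le_power2[of M] zero_le_power2[of "u y"]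
      unfolding abs_le_iff by linarith
  qed (intro continuous_intros cu v, simp)
  interpret g: bounded_continuous ?g "M * M"
    by unfold_locales (intro continuous_intros cu v, rule b2)
  have cs: "\<bar>?g y\<bar> \<le> ?F y + (v y)\<^sup>2 / 2" for y
    using sum_squares_bound[of "\<bar>u y\<bar>" "\<bar>v y\<bar>"] by (simp add: abs_mult)
  note ii = set_integrable_exp_atMost[OF F.measurable_G F.bdd] set_integrable_exp_atMost[OF g.measurable_G g.bdd]
    set_integrable_exp_atLeast[OF F.measurable_G F.bdd] set_integrable_exp_atLeast[OF g.measurable_G g.bdd]
  have "?F x = (LBINT y:{..x}. exp (y - x) * ?F y + exp (y - x) * ?g y)"
  proof -
    have "(LBINT y:{..x}. exp (y - x) * ?F y + exp (y - x) * ?g y) = exp (x - x) * ?F x"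
    proof (rule set_integral_deriv_atMost[where F = "\<lambda>y. exp (y - x) * ?F y"])
      show "((\<lambda>y. exp (y - x) * ?F y) has_real_derivative exp (y - x) * ?F y + exp (y - x) * ?g y) (at y)" for y
        by (auto intro!: derivative_eq_intros u)
      show "continuous_on UNIV (\<lambda>y. exp (y - x) * ?F y + exp (y - x) * ?g y)"
        by (intro continuous_intros cu v) auto
    qed (use ii in auto)
    then show ?thesis by simp
  qed
  also have "\<dots> \<le> (LBINT y:{..x}. exp (y - x) * ?G y)"
  proof (rule set_integral_mono)
    show "exp (y - x) * ?F y + exp (y - x) * ?g y \<le> exp (y - x) * ?G y" for y
      unfolding distrib_left[symmetric] using cs[of y] by (intro mult_left_mono) auto
  qed (use ii set_integrable_exp_atMost[OF G.measurable_G G.bdd] in auto)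
  finally have l: "?F x / 2 \<le> exp_left ?G x" by (simp add: exp_left_def)
  have "?F x = (LBINT y:{x..}. exp (x - y) * ?F y - exp (x - y) * ?g y)"
  proof -
    have "(LBINT y:{x..}. exp (x - y) * ?g y - exp (x - y) * ?F y) = - (exp (x - x) * ?F x)"
    proof (rule set_integral_deriv_atLeast[where F = "\<lambda>y. exp (x - y) * ?F y"])
      show "((\<lambda>y. exp (x - y) * ?F y) has_real_derivative exp (x - y) * ?g y - exp (x - y) * ?F y) (at y)" for y
        by (auto intro!: derivative_eq_intros u)
      show "continuous_on UNIV (\<lambda>y. exp (x - y) * ?g y - exp (x - y) * ?F y)"
        by (intro continuous_intros cu v) auto
    qed (use ii in auto)
    then have "?F x = - (LBINT y:{x..}. exp (x - y) * ?g y - exp (x - y) * ?F y)" by simp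
    also have "\<dots> = (LBINT y:{x..}. exp (x - y) * ?F y - exp (x - y) * ?g y)"
      using ii by (subst set_integral_uminus[symmetric]) auto
    finally show ?thesis .
  qed
  also have "\<dots> \<le> (LBINT y:{x..}. exp (x - y) * ?G y)"
  proof (rule set_integral_mono)
    show "exp (x - y) * ?F y - exp (x - y) * ?g y \<le> exp (x - y) * ?G y" for y
      unfolding right_diff_distrib[symmetric] using cs[of y] by (intro mult_left_mono) auto
  qed (use ii set_integrable_exp_atLeast[OF G.measurable_G G.bdd] in auto)
  finally have r: "?F x / 2 \<le> exp_right ?G x" by (simp add: exp_right_def)
  show ?thesis using l r unfolding G.Lambda_inv2_eq by simp
qed

section \<open>The Fourier transform on \<open>L\<^sup>2\<close>\<close>

lemma integrable_pair_bound:
  fixes H :: "real \<Rightarrow> real \<Rightarrow> 'a::{banach, second_countable_topology}" and f g :: "real \<Rightarrow> real"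
  assumes H [measurable]: "case_prod H \<in> borel_measurable (lborel \<Otimes>\<^sub>M lborel)"
    and f: "integrable lborel f" "\<And>x. 0 \<le> f x" and g: "integrable lborel g" "\<And>y. 0 \<le> g y"
    and le: "\<And>x y. norm (H x y) \<le> f x * g y"
  shows "integrable (lborel \<Otimes>\<^sub>M lborel) (case_prod H)"
proof (rule integrableI_bounded[OF H])
  note [measurable] = borel_measurable_integrable[OF f(1)] borel_measurable_integrable[OF g(1)]
  have "(\<integral>\<^sup>+p. norm (case_prod H p) \<partial>(lborel \<Otimes>\<^sub>M lborel))
      = (\<integral>\<^sup>+x. \<integral>\<^sup>+y. norm (H x y) \<partial>lborel \<partial>lborel)"
    using lborel.nn_integral_fst[of "\<lambda>p. ennreal (norm (case_prod H p))" lborel] by simp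
  also have "\<dots> \<le> (\<integral>\<^sup>+x. \<integral>\<^sup>+y. ennreal (f x) * ennreal (g y) \<partial>lborel \<partial>lborel)"
    using le f(2) g(2) by (intro nn_integral_mono) (simp add: ennreal_mult[symmetric] ennreal_leI)
  also have "\<dots> = (\<integral>\<^sup>+x. ennreal (f x) \<partial>lborel) * (\<integral>\<^sup>+y. ennreal (g y) \<partial>lborel)"
    by (simp add: nn_integral_cmult nn_integral_multc)
  also have "\<dots> < \<infinity>"
    using f g by (simp add: nn_integral_eq_integral ennreal_mult[symmetric])
  finally show "(\<integral>\<^sup>+p. norm (case_prod H p) \<partial>(lborel \<Otimes>\<^sub>M lborel)) < \<infinity>" .
qed

section \<open>Plancherel's inequality by Gaussian weights\<close>

definition ftr :: "(real \<Rightarrow> complex) \<Rightarrow> real \<Rightarrow> complex" where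
  "ftr G \<xi> = (LBINT x. cis (- (\<xi> * x)) * G x)"

lemma measurable_cis [measurable]: "cis \<in> borel_measurable borel"
  by (intro borel_measurable_continuous_onI continuous_intros)

lemma measurable_cnj [measurable]: "cnj \<in> borel_measurable borel"
  by (intro borel_measurable_continuous_onI continuous_intros)

lemma ftr_measurable [measurable]:
  assumes [measurable]: "G \<in> borel_measurable borel"
  shows "ftr G \<in> borel_measurable borel"
  unfolding ftr_def[abs_def] by measurable

lemma cis_mult_integrable:
  assumes "integrable lborel G" and [measurable]: "\<theta> \<in> borel_measurable borel"
  shows "integrable lborel (\<lambda>x. cis (\<theta> x) * G x)"
proof -
  note [measurable] = borel_measurable_integrable[OF assms(1)]
  show ?thesis
    by (rule Bochner_Integration.integrable_bound[OF assms(1)]) (auto simp: norm_mult)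
qed

lemma ftr_norm_le: "cmod (ftr G \<xi>) \<le> (LBINT x. cmod (G x))"
  unfolding ftr_def by (rule order_trans[OF integral_norm_bound]) (simp add: norm_mult)

text \<open>Not normalised: the value at 0 is 1, and for k > 0 the functions increase to 1 as k
  grows, so that multiplication by \<open>gauss k\<close> is a removable cutoff.\<close>

definition gauss :: "real \<Rightarrow> real \<Rightarrow> real" where
  "gauss k x = exp (- (x / k)\<^sup>2 / 2)"

lemma gauss_pos: "0 < gauss k x" and gauss_le_1: "gauss k x \<le> 1" and gauss_minus: "gauss k (- x) = gauss k x"
  by (simp_all add: gauss_def)

lemma gauss_measurable [measurable]: "gauss k \<in> borel_measurable borel"
  unfolding gauss_def by measurable

lemma gauss_integrable: "0 < k \<Longrightarrow> integrable lborel (gauss k)"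
proof -
  assume k: "0 < k"
  have e: "gauss k x = sqrt (2 * pi * k\<^sup>2) * normal_density 0 k x" for x
    using k by (simp add: gauss_def normal_density_def power_divide)
  show ?thesis
    unfolding e[abs_def] using k by (intro integrable_mult_right integrable_normal_density) 
qed

text \<open>The characteristic function of the standard normal law, evaluated at \<xi> k and
  rescaled by x = k z. The result is \<open>2 * pi\<close> times a probability density of width 1 /
  k: a wide cutoff in frequency is a narrow average in space.\<close>

lemma gauss_fourier:
  assumes k: "0 < k"
  shows "(LBINT x. cis (\<xi> * x) * complex_of_real (gauss k x))
    = complex_of_real (2 * pi * normal_density 0 (1 / k) \<xi>)"
proof -
  let ?g = "\<lambda>x. cis (\<xi> * x) * complex_of_real (gauss k x)"
  have "complex_of_real (exp (- ((\<xi> * k)\<^sup>2) / 2)) = char std_normal_distribution (\<xi> * k)"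
    by (simp add: char_std_normal_distribution)
  also have "\<dots> = (LBINT z. std_normal_density z *\<^sub>R iexp (\<xi> * k * z))"
    unfolding char_def by (subst integral_density) auto
  also have "\<dots> = (LBINT z. complex_of_real (1 / sqrt (2 * pi)) * ?g (0 + k * z))"
    using k by (intro Bochner_Integration.integral_cong refl)
      (simp add: std_normal_density_def gauss_def cis_conv_exp scaleR_conv_of_real power_mult_distrib mult_ac)
  also have "\<dots> = complex_of_real (1 / sqrt (2 * pi)) * (LBINT z. ?g (0 + k * z))"
    by (rule integral_mult_right_zero)
  finally have "(LBINT z. ?g (0 + k * z)) = complex_of_real (sqrt (2 * pi)) * complex_of_real (exp (- ((\<xi> * k)\<^sup>2) / 2))"
    by (simp add: field_simps)
  moreover have "(LBINT x. ?g x) = \<bar>k\<bar> *\<^sub>R (LBINT z. ?g (0 + k * z))"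
    using k by (intro lborel_integral_real_affine) simp
  moreover have "2 * pi * normal_density 0 (1 / k) \<xi> = k * (sqrt (2 * pi) * exp (- ((\<xi> * k)\<^sup>2) / 2))"
  proof -
    have "sqrt (2 * pi * (1 / k)\<^sup>2) = sqrt (2 * pi) / k"
      using k by (simp add: real_sqrt_mult real_sqrt_divide power_divide)
    moreover have "2 * pi = sqrt (2 * pi) * sqrt (2 * pi)" by simp
    ultimately show ?thesis
      using k unfolding normal_density_def
      by (simp add: power_divide power_mult_distrib) (simp add: field_simps)
  qed
  ultimately show ?thesis
    using k by (simp add: scaleR_conv_of_real)
qed

text \<open>Plancherel's theorem as an inequality: after inserting the weight \<open>gauss k\<close>, the kernel of the
  quadratic form becomes \<open>2\<pi>\<close> times a probability density, and \<open>k \<rightarrow> \<infinity>\<close>.\<close>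

lemma ftr_weighted_le:
  assumes G: "integrable lborel G" and G2: "integrable lborel (\<lambda>x. (cmod (G x))\<^sup>2)" and k: "0 < k"
  shows "(LBINT \<xi>. (cmod (ftr G \<xi>))\<^sup>2 * gauss k \<xi>) \<le> 2 * pi * (LBINT x. (cmod (G x))\<^sup>2)"
proof -
  note [measurable] = borel_measurable_integrable[OF G]
  define B where "B = (LBINT x. cmod (G x))"
  have B0: "0 \<le> B" by (simp add: B_def)
  have Gi: "integrable lborel (\<lambda>x. cmod (G x))" using G by simp
  define nd where "nd = normal_density 0 (1 / k)"
  have nd: "integrable lborel nd" "\<And>y. 0 \<le> nd y" "(LBINT y. nd y) = 1"
    using k by (auto simp: nd_def)
  have [measurable]: "nd \<in> borel_measurable borel" by (simp add: nd_def)
  \<comment> \<open>The second factor of |ftr G|^2 together with the weight; \<open>I\<close> below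
    is the inner integral that arises when the first factor is written out and the order of
    integration is exchanged.\<close>
  define H where "H \<xi> = cnj (ftr G \<xi>) * complex_of_real (gauss k \<xi>)" for \<xi>
  have [measurable]: "H \<in> borel_measurable borel" unfolding H_def by measurable
  have H_le: "cmod (H \<xi>) \<le> B * gauss k \<xi>" for \<xi>
    using ftr_norm_le[of G \<xi>] gauss_pos[of k \<xi>]
    by (auto simp: H_def norm_mult B_def intro!: mult_right_mono)
  define I where "I x = (LBINT \<xi>. cis (- (\<xi> * x)) * H \<xi>)" for x
  define C where "C x = (LBINT y. nd y * cmod (G (x + y)))" for x
  have [measurable]: "C \<in> borel_measurable borel" "I \<in> borel_measurable borel"
    unfolding C_def I_def by measurable
  \<comment> \<open>Written out, \<open>I\<close> is \<open>2 * pi\<close> times the average of the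
    conjugate of \<open>G\<close> with the density \<open>nd\<close>, and \<open>C\<close> is the
    same average of |G|.\<close>
  have I_le: "cmod (I x) \<le> 2 * pi * C x" for x
  proof -
    have "I x = (LBINT \<xi>. LBINT y. cis (\<xi> * (y - x)) * cnj (G y) * complex_of_real (gauss k \<xi>))"
      unfolding I_def
    proof (rule Bochner_Integration.integral_cong[OF refl])
      fix \<xi>
      have cnj_ftr: "cnj (ftr G \<xi>) = (LBINT y. cis (\<xi> * y) * cnj (G y))"
        unfolding ftr_def Bochner_Integration.integral_cnj[symmetric] by (simp add: cis_cnj)
      have "cis (- (\<xi> * x)) * H \<xi> = (LBINT y. cis (- (\<xi> * x)) * complex_of_real (gauss k \<xi>) * (cis (\<xi> * y) * cnj (G y)))"
        unfolding H_def cnj_ftr integral_mult_right_zero by (simp only: mult_ac)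
      also have "\<dots> = (LBINT y. cis (\<xi> * (y - x)) * cnj (G y) * complex_of_real (gauss k \<xi>))"
      proof (rule Bochner_Integration.integral_cong[OF refl])
        fix y
        have "cis (\<xi> * (y - x)) = cis (- (\<xi> * x)) * cis (\<xi> * y)"
          by (simp add: cis_mult algebra_simps)
        then show "cis (- (\<xi> * x)) * complex_of_real (gauss k \<xi>) * (cis (\<xi> * y) * cnj (G y))
          = cis (\<xi> * (y - x)) * cnj (G y) * complex_of_real (gauss k \<xi>)" by (simp add: mult_ac)
      qed
      finally show "cis (- (\<xi> * x)) * H \<xi> = (LBINT y. cis (\<xi> * (y - x)) * cnj (G y) * complex_of_real (gauss k \<xi>))" .
    qed
    also have "\<dots> = (LBINT y. LBINT \<xi>. cis (\<xi> * (y - x)) * cnj (G y) * complex_of_real (gauss k \<xi>))"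
    proof (rule lborel_pair.Fubini_integral)
      show "integrable (lborel \<Otimes>\<^sub>M lborel) (\<lambda>(y, \<xi>). cis (\<xi> * (y - x)) * cnj (G y) * complex_of_real (gauss k \<xi>))"
        by (rule integrable_pair_bound[OF _ Gi _ gauss_integrable[OF k]])
          (auto simp: norm_mult gauss_pos less_imp_le)
    qed
    also have "\<dots> = (LBINT y. cnj (G y) * complex_of_real (2 * pi * nd (y - x)))"
    proof (rule Bochner_Integration.integral_cong[OF refl])
      fix y
      have "(LBINT \<xi>. cis (\<xi> * (y - x)) * cnj (G y) * complex_of_real (gauss k \<xi>))
        = (LBINT \<xi>. cnj (G y) * (cis ((y - x) * \<xi>) * complex_of_real (gauss k \<xi>)))"
        by (simp add: mult_ac)
      then show "(LBINT \<xi>. cis (\<xi> * (y - x)) * cnj (G y) * complex_of_real (gauss k \<xi>))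
        = cnj (G y) * complex_of_real (2 * pi * nd (y - x))"
        by (simp only: integral_mult_right_zero gauss_fourier[OF k] nd_def)
    qed
    also have "cmod \<dots> \<le> (LBINT y. cmod (cnj (G y) * complex_of_real (2 * pi * nd (y - x))))"
      by (rule integral_norm_bound)
    also have "\<dots> = (LBINT y. 2 * pi * (nd (y - x) * cmod (G y)))"
      using nd(2) by (simp add: norm_mult mult_ac)
    also have "\<dots> = 2 * pi * (LBINT y. nd (y - x) * cmod (G y))" by simp
    also have "(LBINT y. nd (y - x) * cmod (G y)) = C x"
      unfolding C_def using lborel_integral_real_affine[of 1 "\<lambda>y. nd (y - x) * cmod (G y)" x] by simp
    finally show ?thesis .
  qed
  have sG: "square_integrable (\<lambda>x. cmod (G x))"
    using G2 by (simp add: square_integrable_def)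
  have C_le: "ennreal \<bar>C x\<bar> \<le> (\<integral>\<^sup>+y. ennreal (nd y * \<bar>cmod (G (x + y))\<bar>) \<partial>lborel)" for x
  proof (cases "integrable lborel (\<lambda>y. nd y * cmod (G (x + y)))")
    case True
    then show ?thesis
      using integral_norm_bound_ennreal[OF True] nd(2) by (simp add: C_def)
  next
    \<comment> \<open>A product that is not integrable has integral 0, so \<open>C x = 0\<close> and
      the bound is trivial.\<close>
    case False
    then show ?thesis by (simp add: C_def not_integrable_integral_eq)
  qed
  have sC: "square_integrable C" "l2norm C \<le> l2norm (\<lambda>x. cmod (G x))"
    by (rule Young_square_integrable[OF nd sG _ C_le]; measurable)+
  have Ci: "integrable lborel (\<lambda>x. cmod (G x) * C x)"
    by (rule square_integrable_mult_integrable[OF sG sC(1)])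
  have "complex_of_real (LBINT \<xi>. (cmod (ftr G \<xi>))\<^sup>2 * gauss k \<xi>)
      = (LBINT \<xi>. ftr G \<xi> * H \<xi>)"
    unfolding integral_complex_of_real[symmetric]
    by (intro Bochner_Integration.integral_cong refl)
      (simp add: H_def mult.assoc[symmetric] complex_norm_square[symmetric])
  also have "\<dots> = (LBINT \<xi>. LBINT x. cis (- (\<xi> * x)) * G x * H \<xi>)"
    by (simp add: ftr_def)
  also have "\<dots> = (LBINT x. LBINT \<xi>. cis (- (\<xi> * x)) * G x * H \<xi>)"
  proof (rule lborel_pair.Fubini_integral)
    have "integrable lborel (\<lambda>\<xi>. B * gauss k \<xi>)"
      using gauss_integrable[OF k] by simp
    then show "integrable (lborel \<Otimes>\<^sub>M lborel) (\<lambda>(x, \<xi>). cis (- (\<xi> * x)) * G x * H \<xi>)"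
      by (intro integrable_pair_bound[OF _ Gi, where g = "\<lambda>\<xi>. B * gauss k \<xi>"])
        (use H_le B0 in \<open>auto simp: norm_mult gauss_pos less_imp_le intro!: mult_left_mono\<close>)
  qed
  also have "\<dots> = (LBINT x. G x * I x)"
  proof (rule Bochner_Integration.integral_cong[OF refl])
    fix x
    have "(LBINT \<xi>. cis (- (\<xi> * x)) * G x * H \<xi>) = (LBINT \<xi>. G x * (cis (- (\<xi> * x)) * H \<xi>))"
      by (simp add: mult_ac)
    then show "(LBINT \<xi>. cis (- (\<xi> * x)) * G x * H \<xi>) = G x * I x"
      unfolding I_def by (simp only: integral_mult_right_zero)
  qed
  finally have eq: "complex_of_real (LBINT \<xi>. (cmod (ftr G \<xi>))\<^sup>2 * gauss k \<xi>) = (LBINT x. G x * I x)" .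
  have "(LBINT \<xi>. (cmod (ftr G \<xi>))\<^sup>2 * gauss k \<xi>) \<le> cmod (LBINT x. G x * I x)"
    unfolding eq[symmetric] by simp
  also have "\<dots> \<le> (LBINT x. 2 * pi * (cmod (G x) * C x))"
  proof (rule Bochner_Integration.integral_norm_bound_integral)
    have "integrable lborel (\<lambda>x. 2 * pi * (cmod (G x) * C x))" using Ci by simp
    then show "integrable lborel (\<lambda>x. G x * I x)"
    proof (rule Bochner_Integration.integrable_bound)
      show "AE x in lborel. norm (G x * I x) \<le> norm (2 * pi * (cmod (G x) * C x))"
      proof (rule AE_I2)
        fix x
        have "cmod (G x) * cmod (I x) \<le> cmod (G x) * (2 * pi * C x)"
          by (intro mult_left_mono I_le) simp
        also have "\<dots> \<le> \<bar>2 * pi * (cmod (G x) * C x)\<bar>" by (simp add: mult_ac)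
        finally show "norm (G x * I x) \<le> norm (2 * pi * (cmod (G x) * C x))"
          by (simp add: norm_mult)
      qed
    qed measurable
    show "norm (G x * I x) \<le> 2 * pi * (cmod (G x) * C x)" for x
      using mult_left_mono[OF I_le[of x], of "cmod (G x)"] by (simp add: norm_mult mult_ac)
  qed (use Ci in auto)
  also have "\<dots> = 2 * pi * (LBINT x. cmod (G x) * C x)" by simp
  also have "\<dots> \<le> 2 * pi * (LBINT x. (cmod (G x))\<^sup>2)"
  proof -
    have "(LBINT x. cmod (G x) * C x) \<le> l2norm (\<lambda>x. cmod (G x)) * l2norm C"
      using Cauchy_Schwarz_integral[OF sG sC(1)] by simp
    also have "\<dots> \<le> (l2norm (\<lambda>x. cmod (G x)))\<^sup>2"
      unfolding power2_eq_square by (intro mult_left_mono sC) simp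
    finally show ?thesis by simp
  qed
  finally show ?thesis .
qed

text \<open>Fatou's lemma removes the weight, which tends to 1 pointwise; the nonnegative integral
  on the left makes finiteness part of the claim.\<close>

lemma ftr_Plancherel_le:
  assumes G: "integrable lborel G" and G2: "integrable lborel (\<lambda>x. (cmod (G x))\<^sup>2)"
  shows "(\<integral>\<^sup>+\<xi>. ennreal ((cmod (ftr G \<xi>))\<^sup>2) \<partial>lborel) \<le> ennreal (2 * pi * (LBINT x. (cmod (G x))\<^sup>2))"
proof -
  note [measurable] = borel_measurable_integrable[OF G]
  define B where "B = (LBINT x. cmod (G x))"
  have "(\<integral>\<^sup>+\<xi>. ennreal ((cmod (ftr G \<xi>))\<^sup>2) \<partial>lborel)
      = (\<integral>\<^sup>+\<xi>. liminf (\<lambda>k. ennreal ((cmod (ftr G \<xi>))\<^sup>2 * gauss (real (Suc k)) \<xi>)) \<partial>lborel)"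
  proof (rule nn_integral_cong)
    fix \<xi>
    have "(\<lambda>k. \<xi> / real (Suc k)) \<longlonglongrightarrow> 0"
      by (rule LIMSEQ_Suc[OF lim_const_over_n])
    then have "(\<lambda>k. gauss (real (Suc k)) \<xi>) \<longlonglongrightarrow> exp (- 0\<^sup>2 / 2)"
      unfolding gauss_def by (intro tendsto_intros) auto
    then have "(\<lambda>k. ennreal ((cmod (ftr G \<xi>))\<^sup>2 * gauss (real (Suc k)) \<xi>)) \<longlonglongrightarrow> ennreal ((cmod (ftr G \<xi>))\<^sup>2 * 1)"
      by (intro tendsto_ennrealI tendsto_mult_left) simp
    then show "ennreal ((cmod (ftr G \<xi>))\<^sup>2) = liminf (\<lambda>k. ennreal ((cmod (ftr G \<xi>))\<^sup>2 * gauss (real (Suc k)) \<xi>))"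
      using lim_imp_Liminf trivial_limit_sequentially by (metis mult.right_neutral)
  qed
  also have "\<dots> \<le> liminf (\<lambda>k. \<integral>\<^sup>+\<xi>. ennreal ((cmod (ftr G \<xi>))\<^sup>2 * gauss (real (Suc k)) \<xi>) \<partial>lborel)"
    by (rule nn_integral_liminf) measurable
  also have "\<dots> \<le> liminf (\<lambda>k::nat. ennreal (2 * pi * (LBINT x. (cmod (G x))\<^sup>2)))"
  proof (rule Liminf_mono, rule always_eventually, rule allI)
    fix k :: nat
    have k: "0 < real (Suc k)" by simp
    have "integrable lborel (\<lambda>\<xi>. B\<^sup>2 * gauss (real (Suc k)) \<xi>)"
      using gauss_integrable[OF k] by simp
    then have "integrable lborel (\<lambda>\<xi>. (cmod (ftr G \<xi>))\<^sup>2 * gauss (real (Suc k)) \<xi>)"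
      by (rule Bochner_Integration.integrable_bound)
        (auto simp: abs_mult gauss_pos B_def intro!: mult_right_mono power_mono ftr_norm_le)
    then have "(\<integral>\<^sup>+\<xi>. ennreal ((cmod (ftr G \<xi>))\<^sup>2 * gauss (real (Suc k)) \<xi>) \<partial>lborel)
      = ennreal (LBINT \<xi>. (cmod (ftr G \<xi>))\<^sup>2 * gauss (real (Suc k)) \<xi>)"
      by (intro nn_integral_eq_integral) (auto simp: gauss_pos less_imp_le)
    also have "\<dots> \<le> ennreal (2 * pi * (LBINT x. (cmod (G x))\<^sup>2))"
      by (intro ennreal_leI ftr_weighted_le[OF G G2 k])
    finally show "(\<integral>\<^sup>+\<xi>. ennreal ((cmod (ftr G \<xi>))\<^sup>2 * gauss (real (Suc k)) \<xi>) \<partial>lborel)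
      \<le> ennreal (2 * pi * (LBINT x. (cmod (G x))\<^sup>2))" .
  qed
  also have "\<dots> = ennreal (2 * pi * (LBINT x. (cmod (G x))\<^sup>2))"
    by (simp add: Liminf_const)
  finally show ?thesis .
qed

lemma cmod_add_power2_le: "(cmod (a + b))\<^sup>2 \<le> 2 * (cmod a)\<^sup>2 + 2 * (cmod b)\<^sup>2"
proof -
  have "(cmod (a + b))\<^sup>2 \<le> (cmod a + cmod b)\<^sup>2"
    by (intro power_mono norm_triangle_ineq) simp
  also have "\<dots> \<le> 2 * (cmod a)\<^sup>2 + 2 * (cmod b)\<^sup>2"
    using zero_le_power2[of "cmod a - cmod b"] by (simp add: power2_eq_square algebra_simps)
  finally show ?thesis .
qed

lemma nn_integral_cmod_add_le:
  assumes [measurable]: "A \<in> borel_measurable borel" "B \<in> borel_measurable borel"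
  shows "(\<integral>\<^sup>+x. ennreal ((cmod (A x + B x))\<^sup>2) \<partial>lborel)
    \<le> 2 * (\<integral>\<^sup>+x. ennreal ((cmod (A x))\<^sup>2) \<partial>lborel) + 2 * (\<integral>\<^sup>+x. ennreal ((cmod (B x))\<^sup>2) \<partial>lborel)"
proof -
  have "(\<integral>\<^sup>+x. ennreal ((cmod (A x + B x))\<^sup>2) \<partial>lborel)
      \<le> (\<integral>\<^sup>+x. 2 * ennreal ((cmod (A x))\<^sup>2) + 2 * ennreal ((cmod (B x))\<^sup>2) \<partial>lborel)"
  proof (rule nn_integral_mono)
    fix x
    have "ennreal ((cmod (A x + B x))\<^sup>2) \<le> ennreal (2 * (cmod (A x))\<^sup>2 + 2 * (cmod (B x))\<^sup>2)"
      by (rule ennreal_leI[OF cmod_add_power2_le])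
    also have "\<dots> = 2 * ennreal ((cmod (A x))\<^sup>2) + 2 * ennreal ((cmod (B x))\<^sup>2)"
      by (simp add: ennreal_mult)
    finally show "ennreal ((cmod (A x + B x))\<^sup>2) \<le> 2 * ennreal ((cmod (A x))\<^sup>2) + 2 * ennreal ((cmod (B x))\<^sup>2)" .
  qed
  also have "\<dots> = 2 * (\<integral>\<^sup>+x. ennreal ((cmod (A x))\<^sup>2) \<partial>lborel) + 2 * (\<integral>\<^sup>+x. ennreal ((cmod (B x))\<^sup>2) \<partial>lborel)"
    by (subst nn_integral_add) (auto simp: nn_integral_cmult)
  finally show ?thesis .
qed

section \<open>Existence, uniqueness and linearity of the L2 transform\<close>

lemma square_integrable_truncate:
  assumes f: "square_integrable f"
  shows "set_integrable lborel {a..b} f" and "integrable lborel (\<lambda>x. indicator {a..b} x * f x)"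
proof -
  note [measurable] = square_integrable_measurable[OF f]
  have e: "(\<lambda>x. (indicator {a..b} x :: real)\<^sup>2) = indicator {a..b}"
    by (auto simp: indicator_def)
  have "integrable lborel (\<lambda>x. (indicator {a..b} x :: real)\<^sup>2)"
    unfolding e by (simp add: integrable_indicator_iff emeasure_lborel_Icc_eq)
  then have "square_integrable (\<lambda>x. indicator {a..b} x)"
    by (simp add: square_integrable_def)
  from square_integrable_mult_integrable[OF this f]
  show "integrable lborel (\<lambda>x. indicator {a..b} x * f x)" .
  then show "set_integrable lborel {a..b} f" by (simp add: set_integrable_def)
qed

definition truncated_ftr :: "(real \<Rightarrow> real) \<Rightarrow> real \<Rightarrow> real \<Rightarrow> complex" where
  "truncated_ftr f R \<xi> = (LBINT x:{- R..R}. cis (- (\<xi> * x)) * complex_of_real (f x))"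

lemma is_fourier_transform_alt:
  "is_fourier_transform f F \<longleftrightarrow> F \<in> borel_measurable borel \<and>
    ((\<lambda>R. \<integral>\<^sup>+\<xi>. ennreal ((cmod (truncated_ftr f R \<xi> - F \<xi>))\<^sup>2) \<partial>lborel) \<longlongrightarrow> 0) at_top"
  by (simp add: is_fourier_transform_def truncated_ftr_def)

lemma truncated_ftr_eq_ftr:
  "truncated_ftr f R = ftr (\<lambda>x. complex_of_real (indicator {- R..R} x * f x))"
  by (auto simp: truncated_ftr_def ftr_def set_lebesgue_integral_def fun_eq_iff
      intro!: Bochner_Integration.integral_cong split: split_indicator)

lemma truncated_ftr_measurable [measurable]:
  "f \<in> borel_measurable borel \<Longrightarrow> truncated_ftr f R \<in> borel_measurable borel"
  unfolding truncated_ftr_eq_ftr by measurable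

lemma truncated_ftr_linear:
  assumes "square_integrable f" "square_integrable g"
  shows "truncated_ftr (\<lambda>x. a * f x + b * g x) R \<xi> = a * truncated_ftr f R \<xi> + b * truncated_ftr g R \<xi>"
proof -
  have i: "integrable lborel (\<lambda>x. cis (- (\<xi> * x)) * complex_of_real (indicator {- R..R} x * f x))"
    if "square_integrable f" for f
    by (rule cis_mult_integrable[OF integrable_of_real[OF square_integrable_truncate(2)[OF that]]]) measurable
  have "truncated_ftr (\<lambda>x. a * f x + b * g x) R \<xi> =
      (LBINT x. a * (cis (- (\<xi> * x)) * complex_of_real (indicator {- R..R} x * f x))
        + b * (cis (- (\<xi> * x)) * complex_of_real (indicator {- R..R} x * g x)))"
    unfolding truncated_ftr_eq_ftr ftr_def
    by (intro Bochner_Integration.integral_cong refl) (simp add: algebra_simps)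
  also have "\<dots> = (LBINT x. a * (cis (- (\<xi> * x)) * complex_of_real (indicator {- R..R} x * f x)))
        + (LBINT x. b * (cis (- (\<xi> * x)) * complex_of_real (indicator {- R..R} x * g x)))"
    by (intro Bochner_Integration.integral_add integrable_mult_right i assms)
  finally show ?thesis
    unfolding truncated_ftr_eq_ftr ftr_def by (simp only: integral_mult_right_zero)
qed

definition l2_tail :: "(real \<Rightarrow> real) \<Rightarrow> real \<Rightarrow> real" where
  "l2_tail f R = (LBINT x. indicator {x. R < \<bar>x\<bar>} x * (f x)\<^sup>2)"

lemma l2_tail_integrable:
  assumes f: "square_integrable f"
  shows "integrable lborel (\<lambda>x. indicator {x. R < \<bar>x\<bar>} x * (f x)\<^sup>2)"
proof -
  note [measurable] = square_integrable_measurable[OF f]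
  show ?thesis
    by (rule Bochner_Integration.integrable_bound[OF square_integrable_power2[OF f]])
      (auto simp: indicator_def)
qed

lemma l2_tail_tendsto_0:
  assumes f: "square_integrable f"
  shows "(l2_tail f \<longlongrightarrow> 0) at_top"
proof -
  note [measurable] = square_integrable_measurable[OF f]
  have "((\<lambda>R. integral\<^sup>L lborel (\<lambda>x. indicator {x. R < \<bar>x\<bar>} x * (f x)\<^sup>2)) \<longlongrightarrow> integral\<^sup>L lborel (\<lambda>x::real. 0 :: real)) at_top"
  proof (rule integral_dominated_convergence_at_top)
    show "AE x in lborel. ((\<lambda>R. indicator {x. R < \<bar>x\<bar>} x * (f x)\<^sup>2) \<longlongrightarrow> 0) at_top"
    proof (intro AE_I2 tendsto_eventually)
      fix x :: real
      show "\<forall>\<^sub>F R in at_top. indicator {x. R < \<bar>x\<bar>} x * (f x)\<^sup>2 = 0"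
        using eventually_ge_at_top[of "\<bar>x\<bar>"] by eventually_elim (auto simp: indicator_def)
    qed
    show "\<forall>\<^sub>F R in at_top. AE x in lborel. norm (indicator {x. R < \<bar>x\<bar>} x * (f x)\<^sup>2) \<le> (f x)\<^sup>2"
      by (auto simp: indicator_def)
  qed (auto intro!: square_integrable_power2[OF f])
  then show ?thesis by (simp add: l2_tail_def[abs_def])
qed

text \<open>Plancherel's inequality for the piece of f with R < |x| <= R'. The bound does not
  involve R', so it is a Cauchy estimate.\<close>

lemma truncated_ftr_diff_le:
  assumes f: "square_integrable f" and R: "R \<le> R'"
  shows "(\<integral>\<^sup>+\<xi>. ennreal ((cmod (truncated_ftr f R' \<xi> - truncated_ftr f R \<xi>))\<^sup>2) \<partial>lborel)
    \<le> ennreal (2 * pi * l2_tail f R)"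
proof -
  note [measurable] = square_integrable_measurable[OF f]
  define G where "G x = complex_of_real (indicator {- R'..R'} x * f x - indicator {- R..R} x * f x)" for x
  note i = square_integrable_truncate(2)[OF f]
  have G: "integrable lborel G"
    unfolding G_def by (intro integrable_of_real Bochner_Integration.integrable_diff i)
  have le: "(cmod (G x))\<^sup>2 \<le> indicator {x. R < \<bar>x\<bar>} x * (f x)\<^sup>2" for x
    using R by (auto simp: G_def indicator_def norm_of_real abs_le_iff)
  have G2: "integrable lborel (\<lambda>x. (cmod (G x))\<^sup>2)"
    by (rule Bochner_Integration.integrable_bound[OF l2_tail_integrable[OF f, of R]])
      (use le in \<open>auto simp: G_def\<close>)
  have "truncated_ftr f R' \<xi> - truncated_ftr f R \<xi> = ftr G \<xi>" for \<xi>
  proof -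
    have "ftr G \<xi> = (LBINT x. cis (- (\<xi> * x)) * complex_of_real (indicator {- R'..R'} x * f x)
        - cis (- (\<xi> * x)) * complex_of_real (indicator {- R..R} x * f x))"
      unfolding ftr_def G_def by (simp add: right_diff_distrib)
    also have "\<dots> = truncated_ftr f R' \<xi> - truncated_ftr f R \<xi>"
      unfolding truncated_ftr_eq_ftr ftr_def
      by (intro Bochner_Integration.integral_diff cis_mult_integrable integrable_of_real i) measurable
    finally show ?thesis by simp
  qed
  then have "(\<integral>\<^sup>+\<xi>. ennreal ((cmod (truncated_ftr f R' \<xi> - truncated_ftr f R \<xi>))\<^sup>2) \<partial>lborel)
    \<le> ennreal (2 * pi * (LBINT x. (cmod (G x))\<^sup>2))"
    using ftr_Plancherel_le[OF G G2] by simp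
  also have "\<dots> \<le> ennreal (2 * pi * l2_tail f R)"
    unfolding l2_tail_def by (intro ennreal_leI mult_left_mono integral_mono G2 l2_tail_integrable f le) simp
  finally show ?thesis .
qed

text \<open>Turns smallness in L2, measured by a nonnegative integral, into smallness of an ordinary
  integral against a square integrable weight; the weight will be a Gaussian.\<close>

lemma L1_le_of_weighted_L2:
  fixes D :: "real \<Rightarrow> complex"
  assumes [measurable]: "D \<in> borel_measurable borel" and g: "square_integrable g" "\<And>x. 0 \<le> g x"
    and le: "(\<integral>\<^sup>+x. ennreal ((cmod (D x))\<^sup>2) \<partial>lborel) \<le> ennreal c" and c: "0 \<le> c"
  shows "integrable lborel (\<lambda>x. cmod (D x) * g x)" "(LBINT x. cmod (D x) * g x) \<le> sqrt c * l2norm g"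
proof -
  have i: "integrable lborel (\<lambda>x. (cmod (D x))\<^sup>2)"
    using le_less_trans[OF le ennreal_less_top] by (intro integrableI_bounded) auto
  then have s: "square_integrable (\<lambda>x. cmod (D x))" by (simp add: square_integrable_def)
  show "integrable lborel (\<lambda>x. cmod (D x) * g x)"
    by (rule square_integrable_mult_integrable[OF s g(1)])
  have "(LBINT x. (cmod (D x))\<^sup>2) \<le> c"
    using le c nn_integral_eq_integral[OF i] by (simp add: ennreal_le_iff)
  then have "l2norm (\<lambda>x. cmod (D x)) \<le> sqrt c" by (simp add: l2norm_def)
  then have "l2norm (\<lambda>x. cmod (D x)) * l2norm g \<le> sqrt c * l2norm g"
    by (intro mult_right_mono) auto
  then show "(LBINT x. cmod (D x) * g x) \<le> sqrt c * l2norm g"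
    using Cauchy_Schwarz_integral[OF s g(1)] by linarith
qed

lemma gauss_square_integrable: "0 < k \<Longrightarrow> square_integrable (gauss k)"
proof -
  assume k: "0 < k"
  have "integrable lborel (\<lambda>x. (gauss k x)\<^sup>2)"
  proof (rule Bochner_Integration.integrable_bound[OF gauss_integrable[OF k]])
    show "AE x in lborel. norm ((gauss k x)\<^sup>2) \<le> norm (gauss k x)"
    proof (rule AE_I2)
      fix x
      have "gauss k x * gauss k x \<le> gauss k x * 1"
        by (intro mult_left_mono gauss_le_1 less_imp_le gauss_pos)
      then show "norm ((gauss k x)\<^sup>2) \<le> norm (gauss k x)"
        using gauss_pos[of k x] by (simp add: power2_eq_square)
    qed
  qed measurable
  then show ?thesis by (simp add: square_integrable_def)
qed

text \<open>A subsequence of the truncated transforms converges almost everywhere: multiplied by \<open>gauss 1\<close>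
  they form a Cauchy sequence in \<open>L\<^sup>1\<close>.\<close>

lemma is_fourier_transform_exists:
  assumes f: "square_integrable f"
  shows "\<exists>F. is_fourier_transform f F"
proof -
  note [measurable] = square_integrable_measurable[OF f]
  define S where "S n = truncated_ftr f (real n)" for n
  have [measurable]: "S n \<in> borel_measurable borel" for n unfolding S_def by measurable
  have t0: "0 \<le> l2_tail f R" for R by (simp add: l2_tail_def)
  have S_le: "(\<integral>\<^sup>+\<xi>. ennreal ((cmod (S i \<xi> - S j \<xi>))\<^sup>2) \<partial>lborel) \<le> ennreal (2 * pi * l2_tail f (real n))"
    if "n \<le> i" "n \<le> j" for i j n
  proof -
    have mono: "l2_tail f R' \<le> l2_tail f R" if "R \<le> R'" for R R'
      unfolding l2_tail_def
      by (intro integral_mono l2_tail_integrable f) (use that in \<open>auto simp: indicator_def\<close>)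
    have *: "(\<integral>\<^sup>+\<xi>. ennreal ((cmod (S i \<xi> - S j \<xi>))\<^sup>2) \<partial>lborel) \<le> ennreal (2 * pi * l2_tail f (real n))"
      if "n \<le> j" "j \<le> i" for i j
    proof -
      have "(\<integral>\<^sup>+\<xi>. ennreal ((cmod (S i \<xi> - S j \<xi>))\<^sup>2) \<partial>lborel) \<le> ennreal (2 * pi * l2_tail f (real j))"
        unfolding S_def using that by (intro truncated_ftr_diff_le f) simp
      also have "\<dots> \<le> ennreal (2 * pi * l2_tail f (real n))"
        using that by (intro ennreal_leI mult_left_mono mono) auto
      finally show ?thesis .
    qed
    show ?thesis
    proof (cases "j \<le> i")
      case True
      with * that show ?thesis by blast
    next
      case False
      have "(\<integral>\<^sup>+\<xi>. ennreal ((cmod (S i \<xi> - S j \<xi>))\<^sup>2) \<partial>lborel) = (\<integral>\<^sup>+\<xi>. ennreal ((cmod (S j \<xi> - S i \<xi>))\<^sup>2) \<partial>lborel)"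
        by (simp add: norm_minus_commute)
      with *[of i j] False that show ?thesis by simp
    qed
  qed
  have lim: "(\<lambda>n. l2_tail f (real n)) \<longlonglongrightarrow> 0"
    by (rule filterlim_compose[OF l2_tail_tendsto_0[OF f] filterlim_real_sequentially])
  define s where "s n \<xi> = S n \<xi> * complex_of_real (gauss 1 \<xi>)" for n \<xi>
  have s_int: "integrable lborel (s n)" for n
  proof -
    define B where "B = (LBINT x. cmod (complex_of_real (indicator {- real n..real n} x * f x)))"
    have "integrable lborel (\<lambda>\<xi>. B * gauss 1 \<xi>)"
      using gauss_integrable[of 1] by simp
    then show ?thesis
    proof (rule Bochner_Integration.integrable_bound)
      show "AE \<xi> in lborel. norm (s n \<xi>) \<le> norm (B * gauss 1 \<xi>)"
      proof (rule AE_I2)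
        fix \<xi>
        have "cmod (S n \<xi>) \<le> B"
          unfolding S_def B_def truncated_ftr_eq_ftr by (rule ftr_norm_le)
        then have "cmod (S n \<xi>) * gauss 1 \<xi> \<le> B * gauss 1 \<xi>"
          using gauss_pos[of 1 \<xi>] by (intro mult_right_mono) auto
        then show "norm (s n \<xi>) \<le> norm (B * gauss 1 \<xi>)"
          using gauss_pos[of 1 \<xi>] order_trans[OF _ abs_ge_self[of "B * gauss 1 \<xi>"]]
          by (simp add: s_def norm_mult)
      qed
    qed (unfold s_def, measurable)
  qed
  have "\<exists>N. \<forall>i\<ge>N. \<forall>j\<ge>N. (LBINT \<xi>. norm (s i \<xi> - s j \<xi>)) < e" if e: "0 < e" for e
  proof -
    have "(\<lambda>n. sqrt (2 * pi * l2_tail f (real n)) * l2norm (gauss 1)) \<longlonglongrightarrow> sqrt (2 * pi * 0) * l2norm (gauss 1)"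
      by (intro tendsto_intros lim)
    then have "\<forall>\<^sub>F n in sequentially. sqrt (2 * pi * l2_tail f (real n)) * l2norm (gauss 1) < e"
      by (rule order_tendstoD(2)) (use e in simp)
    then obtain N where N: "sqrt (2 * pi * l2_tail f (real N)) * l2norm (gauss 1) < e"
      by (auto simp: eventually_sequentially)
    show ?thesis
    proof (intro exI[of _ N] allI impI)
      fix i j assume "N \<le> i" "N \<le> j"
      then have "(LBINT \<xi>. cmod (S i \<xi> - S j \<xi>) * gauss 1 \<xi>) \<le> sqrt (2 * pi * l2_tail f (real N)) * l2norm (gauss 1)"
        by (intro L1_le_of_weighted_L2 S_le gauss_square_integrable)
          (auto simp: gauss_pos less_imp_le t0)
      moreover have "norm (s i \<xi> - s j \<xi>) = cmod (S i \<xi> - S j \<xi>) * gauss 1 \<xi>" for \<xi>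
        using gauss_pos[of 1 \<xi>] by (simp add: s_def norm_mult left_diff_distrib[symmetric])
      ultimately show "(LBINT \<xi>. norm (s i \<xi> - s j \<xi>)) < e" using N by simp
    qed
  qed
  from cauchy_L1_AE_cauchy_subseq[OF s_int this]
  obtain r where r: "strict_mono r" "AE \<xi> in lborel. Cauchy (\<lambda>i. s (r i) \<xi>)" by blast
  \<comment> \<open>The limit is taken of the subsequence without the weight. This F is measurable
    whatever the sequence does on the exceptional null set.\<close>
  define F where "F \<xi> = lim (\<lambda>i. S (r i) \<xi>)" for \<xi>
  have [measurable]: "F \<in> borel_measurable borel" unfolding F_def by measurable
  have conv: "AE \<xi> in lborel. (\<lambda>i. S (r i) \<xi>) \<longlonglongrightarrow> F \<xi>"
    using r(2)
  proof eventually_elim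
    case (elim \<xi>)
    then obtain L where "(\<lambda>i. s (r i) \<xi>) \<longlonglongrightarrow> L" by (auto simp: Cauchy_convergent_iff convergent_def)
    then have "(\<lambda>i. s (r i) \<xi> * complex_of_real (1 / gauss 1 \<xi>)) \<longlonglongrightarrow> L * complex_of_real (1 / gauss 1 \<xi>)"
      by (rule tendsto_mult_right)
    moreover have "s (r i) \<xi> * complex_of_real (1 / gauss 1 \<xi>) = S (r i) \<xi>" for i
      using gauss_pos[of 1 \<xi>] by (simp add: s_def)
    ultimately have T: "(\<lambda>i. S (r i) \<xi>) \<longlonglongrightarrow> L * complex_of_real (1 / gauss 1 \<xi>)" by simp
    then have "F \<xi> = L * complex_of_real (1 / gauss 1 \<xi>)" unfolding F_def by (rule limI)
    with T show ?case by simp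
  qed
  \<comment> \<open>Fatou's lemma along the subsequence carries the Cauchy estimate over to F, and
    for every real R at once, as the definition of the transform requires.\<close>
  have bound: "(\<integral>\<^sup>+\<xi>. ennreal ((cmod (truncated_ftr f R \<xi> - F \<xi>))\<^sup>2) \<partial>lborel) \<le> ennreal (2 * pi * l2_tail f R)" for R
  proof -
    have "(\<integral>\<^sup>+\<xi>. ennreal ((cmod (truncated_ftr f R \<xi> - F \<xi>))\<^sup>2) \<partial>lborel)
        = (\<integral>\<^sup>+\<xi>. liminf (\<lambda>i. ennreal ((cmod (S (r i) \<xi> - truncated_ftr f R \<xi>))\<^sup>2)) \<partial>lborel)"
    proof (rule nn_integral_cong_AE, use conv in eventually_elim)
      case (elim \<xi>)
      then have "(\<lambda>i. ennreal ((cmod (S (r i) \<xi> - truncated_ftr f R \<xi>))\<^sup>2))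
          \<longlonglongrightarrow> ennreal ((cmod (F \<xi> - truncated_ftr f R \<xi>))\<^sup>2)"
        by (intro tendsto_ennrealI tendsto_intros)
      then show ?case
        using lim_imp_Liminf trivial_limit_sequentially by (metis norm_minus_commute)
    qed
    also have "\<dots> \<le> liminf (\<lambda>i. \<integral>\<^sup>+\<xi>. ennreal ((cmod (S (r i) \<xi> - truncated_ftr f R \<xi>))\<^sup>2) \<partial>lborel)"
      by (rule nn_integral_liminf) measurable
    also have "\<dots> \<le> liminf (\<lambda>i::nat. ennreal (2 * pi * l2_tail f R))"
    proof (rule Liminf_mono)
      obtain N :: nat where N: "R \<le> real N" using real_arch_simple by blast
      show "\<forall>\<^sub>F i in sequentially. (\<integral>\<^sup>+\<xi>. ennreal ((cmod (S (r i) \<xi> - truncated_ftr f R \<xi>))\<^sup>2) \<partial>lborel)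
          \<le> ennreal (2 * pi * l2_tail f R)"
        using eventually_ge_at_top[of N]
      proof eventually_elim
        case (elim i)
        have "N \<le> r i" using elim seq_suble[OF r(1), of i] by linarith
        then show ?case
          unfolding S_def using N by (intro truncated_ftr_diff_le f) simp
      qed
    qed
    finally show ?thesis by (simp add: Liminf_const)
  qed
  have "((\<lambda>R. \<integral>\<^sup>+\<xi>. ennreal ((cmod (truncated_ftr f R \<xi> - F \<xi>))\<^sup>2) \<partial>lborel) \<longlongrightarrow> 0) at_top"
  proof (rule tendsto_sandwich[where f = "\<lambda>_. 0"])
    have "((\<lambda>R. ennreal (2 * pi * l2_tail f R)) \<longlongrightarrow> ennreal (2 * pi * 0)) at_top"
      by (intro tendsto_ennrealI tendsto_mult_left l2_tail_tendsto_0 f)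
    then show "((\<lambda>R. ennreal (2 * pi * l2_tail f R)) \<longlongrightarrow> 0) at_top" by simp
  qed (use bound in \<open>auto intro: always_eventually\<close>)
  then show ?thesis
    unfolding is_fourier_transform_alt by (intro exI[of _ F]) simp
qed

lemma is_fourier_transform_unique:
  assumes "square_integrable f" "is_fourier_transform f F" "is_fourier_transform f F'"
  shows "AE \<xi> in lborel. F \<xi> = F' \<xi>"
proof -
  have [measurable]: "F \<in> borel_measurable borel" "F' \<in> borel_measurable borel"
    "f \<in> borel_measurable borel"
    using assms by (auto simp: is_fourier_transform_def square_integrable_def)
  let ?n = "\<lambda>A. \<integral>\<^sup>+\<xi>. ennreal ((cmod (A \<xi>))\<^sup>2) \<partial>lborel"
  have "?n (\<lambda>\<xi>. F' \<xi> - F \<xi>) \<le> 2 * ?n (\<lambda>\<xi>. truncated_ftr f R \<xi> - F \<xi>) + 2 * ?n (\<lambda>\<xi>. truncated_ftr f R \<xi> - F' \<xi>)" for R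
    using nn_integral_cmod_add_le[of "\<lambda>\<xi>. truncated_ftr f R \<xi> - F \<xi>" "\<lambda>\<xi>. F' \<xi> - truncated_ftr f R \<xi>"]
    by (simp add: norm_minus_commute)
  moreover have "((\<lambda>R. 2 * ?n (\<lambda>\<xi>. truncated_ftr f R \<xi> - F \<xi>) + 2 * ?n (\<lambda>\<xi>. truncated_ftr f R \<xi> - F' \<xi>)) \<longlongrightarrow> 2 * 0 + 2 * 0) at_top"
    using assms unfolding is_fourier_transform_alt by (intro tendsto_add tendsto_mult_ennreal tendsto_const) auto
  ultimately have "?n (\<lambda>\<xi>. F' \<xi> - F \<xi>) \<le> 2 * 0 + 2 * 0"
    by (intro tendsto_lowerbound[of _ _ at_top]) (auto intro: always_eventually)
  then have "?n (\<lambda>\<xi>. F' \<xi> - F \<xi>) = 0" by simp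
  then have "AE \<xi> in lborel. ennreal ((cmod (F' \<xi> - F \<xi>))\<^sup>2) = 0"
    by (subst (asm) nn_integral_0_iff_AE) auto
  then show ?thesis by eventually_elim auto
qed

lemma is_fourier_transform_linear:
  assumes f: "square_integrable f" "is_fourier_transform f F"
    and g: "square_integrable g" "is_fourier_transform g G"
  shows "is_fourier_transform (\<lambda>x. a * f x + b * g x) (\<lambda>\<xi>. of_real a * F \<xi> + of_real b * G \<xi>)"
proof -
  have [measurable]: "F \<in> borel_measurable borel" "G \<in> borel_measurable borel"
    "f \<in> borel_measurable borel" "g \<in> borel_measurable borel"
    using assms by (auto simp: is_fourier_transform_def square_integrable_def)
  let ?n = "\<lambda>A. \<integral>\<^sup>+\<xi>. ennreal ((cmod (A \<xi>))\<^sup>2) \<partial>lborel"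
  have nc: "?n (\<lambda>\<xi>. of_real c * A \<xi>) = ennreal (c\<^sup>2) * ?n A"
    if [measurable]: "A \<in> borel_measurable borel" for c :: real and A
    by (subst nn_integral_cmult[symmetric]) (auto simp: norm_mult power_mult_distrib ennreal_mult)
  have "((\<lambda>R. ?n (\<lambda>\<xi>. truncated_ftr (\<lambda>x. a * f x + b * g x) R \<xi> - (of_real a * F \<xi> + of_real b * G \<xi>))) \<longlongrightarrow> 0) at_top"
  proof (rule tendsto_sandwich[where f = "\<lambda>_. 0"])
    have "((\<lambda>R. 2 * (ennreal (a\<^sup>2) * ?n (\<lambda>\<xi>. truncated_ftr f R \<xi> - F \<xi>))
        + 2 * (ennreal (b\<^sup>2) * ?n (\<lambda>\<xi>. truncated_ftr g R \<xi> - G \<xi>))) \<longlongrightarrow> 2 * (ennreal (a\<^sup>2) * 0) + 2 * (ennreal (b\<^sup>2) * 0)) at_top"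
      using assms unfolding is_fourier_transform_alt
      by (intro tendsto_add tendsto_mult_ennreal tendsto_const) auto
    then show "((\<lambda>R. 2 * (ennreal (a\<^sup>2) * ?n (\<lambda>\<xi>. truncated_ftr f R \<xi> - F \<xi>))
        + 2 * (ennreal (b\<^sup>2) * ?n (\<lambda>\<xi>. truncated_ftr g R \<xi> - G \<xi>))) \<longlongrightarrow> 0) at_top" by simp
    show "\<forall>\<^sub>F R in at_top. ?n (\<lambda>\<xi>. truncated_ftr (\<lambda>x. a * f x + b * g x) R \<xi> - (of_real a * F \<xi> + of_real b * G \<xi>))
      \<le> 2 * (ennreal (a\<^sup>2) * ?n (\<lambda>\<xi>. truncated_ftr f R \<xi> - F \<xi>))
        + 2 * (ennreal (b\<^sup>2) * ?n (\<lambda>\<xi>. truncated_ftr g R \<xi> - G \<xi>))"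
    proof (rule always_eventually, rule allI)
      fix R
      have "?n (\<lambda>\<xi>. truncated_ftr (\<lambda>x. a * f x + b * g x) R \<xi> - (of_real a * F \<xi> + of_real b * G \<xi>))
        = ?n (\<lambda>\<xi>. of_real a * (truncated_ftr f R \<xi> - F \<xi>) + of_real b * (truncated_ftr g R \<xi> - G \<xi>))"
        by (simp add: truncated_ftr_linear[OF f(1) g(1)] algebra_simps)
      also have "\<dots> \<le> 2 * ?n (\<lambda>\<xi>. of_real a * (truncated_ftr f R \<xi> - F \<xi>)) + 2 * ?n (\<lambda>\<xi>. of_real b * (truncated_ftr g R \<xi> - G \<xi>))"
        by (rule nn_integral_cmod_add_le) measurable
      finally show "?n (\<lambda>\<xi>. truncated_ftr (\<lambda>x. a * f x + b * g x) R \<xi> - (of_real a * F \<xi> + of_real b * G \<xi>))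
      \<le> 2 * (ennreal (a\<^sup>2) * ?n (\<lambda>\<xi>. truncated_ftr f R \<xi> - F \<xi>))
        + 2 * (ennreal (b\<^sup>2) * ?n (\<lambda>\<xi>. truncated_ftr g R \<xi> - G \<xi>))"
        by (simp add: nc)
    qed
  qed (auto intro: always_eventually)
  then show ?thesis unfolding is_fourier_transform_alt by simp
qed

section \<open>Fourier inversion\<close>

text \<open>A regularised inversion formula. For truncated f it is Fubini's theorem with
  \<open>gauss_fourier\<close>. The truncation is removed in space by dominated convergence, and in
  frequency by the L2 convergence of the truncated transforms, tested against the Gaussian.\<close>

lemma gauss_pairing:
  assumes f: "square_integrable f" and F: "is_fourier_transform f F" "integrable lborel F" and k: "0 < k"
  shows "(LBINT \<xi>. F \<xi> * (cis (y * \<xi>) * complex_of_real (gauss k \<xi>)))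
    = complex_of_real (2 * pi * (LBINT x. f x * normal_density 0 (1 / k) (x - y)))"
proof -
  note [measurable] = square_integrable_measurable[OF f] borel_measurable_integrable[OF F(2)]
  define nd where "nd = normal_density 0 (1 / k)"
  define E where "E \<xi> = cis (y * \<xi>) * complex_of_real (gauss k \<xi>)" for \<xi>
  have [measurable]: "E \<in> borel_measurable borel" unfolding E_def by measurable
  have [measurable]: "nd \<in> borel_measurable borel" unfolding nd_def by measurable
  have E_norm: "cmod (E \<xi>) = gauss k \<xi>" for \<xi>
    using gauss_pos[of k \<xi>] by (simp add: E_def norm_mult)
  define fR where "fR n x = complex_of_real (indicator {- real n..real n} x * f x)" for n :: nat and x
  define S where "S n = truncated_ftr f (real n)" for n :: nat
  have S_eq: "S n = ftr (fR n)" for n unfolding S_def fR_def truncated_ftr_eq_ftr ..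
  have fR: "integrable lborel (fR n)" for n
    unfolding fR_def by (intro integrable_of_real square_integrable_truncate(2)[OF f])
  have [measurable]: "fR n \<in> borel_measurable borel" "S n \<in> borel_measurable borel" for n
    using fR by (auto simp: S_eq)
  have step: "(LBINT \<xi>. S n \<xi> * E \<xi>) = complex_of_real (2 * pi * (LBINT x. indicator {- real n..real n} x * (f x * nd (x - y))))" for n
  proof -
    have "(LBINT \<xi>. S n \<xi> * E \<xi>) = (LBINT \<xi>. LBINT x. cis (- (\<xi> * x)) * fR n x * E \<xi>)"
      unfolding S_eq ftr_def by simp
    also have "\<dots> = (LBINT x. LBINT \<xi>. cis (- (\<xi> * x)) * fR n x * E \<xi>)"
    proof (rule lborel_pair.Fubini_integral)
      show "integrable (lborel \<Otimes>\<^sub>M lborel) (\<lambda>(x, \<xi>). cis (- (\<xi> * x)) * fR n x * E \<xi>)"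
        by (rule integrable_pair_bound[OF _ integrable_norm[OF fR[of n]] _ gauss_integrable[OF k]])
          (auto simp: norm_mult E_norm gauss_pos less_imp_le)
    qed
    also have "\<dots> = (LBINT x. fR n x * complex_of_real (2 * pi * nd (y - x)))"
    proof (rule Bochner_Integration.integral_cong[OF refl])
      fix x
      have "cis (- (\<xi> * x)) * fR n x * E \<xi> = fR n x * (cis ((y - x) * \<xi>) * complex_of_real (gauss k \<xi>))" for \<xi>
      proof -
        have "cis ((y - x) * \<xi>) = cis (- (\<xi> * x)) * cis (y * \<xi>)"
          by (simp add: cis_mult algebra_simps)
        then show ?thesis by (simp add: E_def mult_ac)
      qed
      then show "(LBINT \<xi>. cis (- (\<xi> * x)) * fR n x * E \<xi>) = fR n x * complex_of_real (2 * pi * nd (y - x))"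
        by (simp only: integral_mult_right_zero gauss_fourier[OF k] nd_def)
    qed
    also have "\<dots> = (LBINT x. complex_of_real (2 * pi * (indicator {- real n..real n} x * (f x * nd (x - y)))))"
      by (intro Bochner_Integration.integral_cong refl)
        (simp add: fR_def nd_def normal_density_def power2_commute mult_ac)
    finally show ?thesis
      by (simp only: integral_complex_of_real integral_mult_right_zero)
  qed
  have si_nd: "square_integrable (\<lambda>x. nd (x - y))"
  proof -
    have nd_eq: "nd x = (1 / sqrt (2 * pi * (1 / k)\<^sup>2)) * gauss (1 / k) x" for x
      by (simp add: nd_def normal_density_def gauss_def power_divide power_mult_distrib)
    have "square_integrable nd"
      unfolding nd_eq[abs_def] using k by (intro square_integrable_cmult gauss_square_integrable) simp
    from square_integrable_shift(1)[OF this, of "- y"] show ?thesis by simp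
  qed
  have "(\<lambda>n. LBINT x. indicator {- real n..real n} x * (f x * nd (x - y))) \<longlonglongrightarrow> (LBINT x. f x * nd (x - y))"
  proof (rule integral_dominated_convergence[where w = "\<lambda>x. \<bar>f x * nd (x - y)\<bar>"])
    show "integrable lborel (\<lambda>x. \<bar>f x * nd (x - y)\<bar>)"
      using square_integrable_mult_integrable[OF f si_nd] by simp
    show "AE x in lborel. (\<lambda>n. indicator {- real n..real n} x * (f x * nd (x - y))) \<longlonglongrightarrow> f x * nd (x - y)"
    proof (intro AE_I2 tendsto_eventually)
      fix x :: real
      obtain N :: nat where N: "\<bar>x\<bar> \<le> real N" using real_arch_simple by blast
      show "\<forall>\<^sub>F n in sequentially. indicator {- real n..real n} x * (f x * nd (x - y)) = f x * nd (x - y)"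
      proof (rule eventually_mono[OF eventually_ge_at_top[of N]])
        fix n assume "N \<le> n"
        with N have "x \<in> {- real n..real n}" by (simp add: abs_le_iff)
        then show "indicator {- real n..real n} x * (f x * nd (x - y)) = f x * nd (x - y)" by simp
      qed
    qed
    show "AE x in lborel. norm (indicator {- real n..real n} x * (f x * nd (x - y))) \<le> \<bar>f x * nd (x - y)\<bar>" for n
      by (intro AE_I2) (simp add: indicator_def)
  qed measurable
  then have lim1: "(\<lambda>n. LBINT \<xi>. S n \<xi> * E \<xi>) \<longlonglongrightarrow> complex_of_real (2 * pi * (LBINT x. f x * nd (x - y)))"
    unfolding step by (intro tendsto_intros)
  have "(\<lambda>n. LBINT \<xi>. S n \<xi> * E \<xi>) \<longlonglongrightarrow> (LBINT \<xi>. F \<xi> * E \<xi>)"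
  proof (rule LIMSEQ_I)
    fix e :: real assume e: "0 < e"
    \<comment> \<open>Chosen so that \<open>sqrt c * l2norm (gauss k)\<close> is less than e; the
      added 1 keeps the denominator positive without a lower bound for the norm.\<close>
    define c where "c = (e / (l2norm (gauss k) + 1))\<^sup>2"
    have p: "0 < l2norm (gauss k) + 1" using l2norm_nonneg[of "gauss k"] by linarith
    have c: "0 < c" unfolding c_def by (intro zero_less_power divide_pos_pos e p)
    have "((\<lambda>R. \<integral>\<^sup>+\<xi>. ennreal ((cmod (truncated_ftr f R \<xi> - F \<xi>))\<^sup>2) \<partial>lborel) \<longlongrightarrow> 0) at_top"
      using F(1) by (simp add: is_fourier_transform_alt)
    then have "(\<lambda>n. \<integral>\<^sup>+\<xi>. ennreal ((cmod (S n \<xi> - F \<xi>))\<^sup>2) \<partial>lborel) \<longlonglongrightarrow> 0"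
      unfolding S_def by (rule filterlim_compose[OF _ filterlim_real_sequentially])
    then have "\<forall>\<^sub>F n in sequentially. (\<integral>\<^sup>+\<xi>. ennreal ((cmod (S n \<xi> - F \<xi>))\<^sup>2) \<partial>lborel) < ennreal c"
      by (rule order_tendstoD(2)) (use c in simp)
    then obtain N where N: "\<And>n. N \<le> n \<Longrightarrow> (\<integral>\<^sup>+\<xi>. ennreal ((cmod (S n \<xi> - F \<xi>))\<^sup>2) \<partial>lborel) \<le> ennreal c"
      unfolding eventually_sequentially by (meson less_imp_le)
    show "\<exists>N. \<forall>n\<ge>N. norm ((LBINT \<xi>. S n \<xi> * E \<xi>) - (LBINT \<xi>. F \<xi> * E \<xi>)) < e"
    proof (intro exI[of _ N] allI impI)
      fix n assume n: "N \<le> n"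
      define B where "B = (LBINT x. cmod (fR n x))"
      have "integrable lborel (\<lambda>\<xi>. B * gauss k \<xi>)"
        using gauss_integrable[OF k] by simp
      then have i1: "integrable lborel (\<lambda>\<xi>. S n \<xi> * E \<xi>)"
      proof (rule Bochner_Integration.integrable_bound)
        show "AE \<xi> in lborel. norm (S n \<xi> * E \<xi>) \<le> norm (B * gauss k \<xi>)"
        proof (rule AE_I2)
          fix \<xi>
          have "cmod (S n \<xi>) * gauss k \<xi> \<le> B * gauss k \<xi>"
            using gauss_pos[of k \<xi>] ftr_norm_le[of "fR n" \<xi>] by (intro mult_right_mono) (auto simp: S_eq B_def)
          then show "norm (S n \<xi> * E \<xi>) \<le> norm (B * gauss k \<xi>)"
            using order_trans[OF _ abs_ge_self[of "B * gauss k \<xi>"]] by (simp add: norm_mult E_norm)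
        qed
      qed measurable
      have i2: "integrable lborel (\<lambda>\<xi>. F \<xi> * E \<xi>)"
      proof (rule Bochner_Integration.integrable_bound[OF F(2)])
        show "AE \<xi> in lborel. norm (F \<xi> * E \<xi>) \<le> norm (F \<xi>)"
          using gauss_le_1[of k] by (intro AE_I2) (simp add: norm_mult E_norm mult_left_le)
      qed measurable
      have "norm ((LBINT \<xi>. S n \<xi> * E \<xi>) - (LBINT \<xi>. F \<xi> * E \<xi>)) = norm (LBINT \<xi>. (S n \<xi> - F \<xi>) * E \<xi>)"
        unfolding left_diff_distrib using i1 i2 by simp
      also have "\<dots> \<le> (LBINT \<xi>. norm ((S n \<xi> - F \<xi>) * E \<xi>))"
        by (rule integral_norm_bound)
      also have "\<dots> = (LBINT \<xi>. cmod (S n \<xi> - F \<xi>) * gauss k \<xi>)"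
        by (simp add: norm_mult E_norm)
      also have "\<dots> \<le> sqrt c * l2norm (gauss k)"
        by (rule L1_le_of_weighted_L2(2)[OF _ gauss_square_integrable[OF k]])
          (use N[OF n] c in \<open>auto simp: gauss_pos less_imp_le\<close>)
      also have "\<dots> < e"
      proof -
        have "sqrt c * l2norm (gauss k) = e * (l2norm (gauss k) / (l2norm (gauss k) + 1))"
          using e p by (simp add: c_def)
        also have "\<dots> < e * 1"
          using e p by (intro mult_strict_left_mono) (auto simp: divide_less_eq_1)
        finally show ?thesis by simp
      qed
      finally show "norm ((LBINT \<xi>. S n \<xi> * E \<xi>) - (LBINT \<xi>. F \<xi> * E \<xi>)) < e" .
    qed
  qed
  from LIMSEQ_unique[OF this lim1] show ?thesis by (simp add: E_def nd_def)
qed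

text \<open>On a bounded interval the positive and negative parts of d are densities of two finite
  measures that agree on all right half-lines and therefore coincide; densities of the same finite
  measure agree almost everywhere.\<close>

lemma AE_eq_0_of_interval_integrals:
  fixes d :: "real \<Rightarrow> real"
  assumes [measurable]: "d \<in> borel_measurable borel"
    and int: "\<And>a b. set_integrable lborel {a..b} d"
    and zero: "\<And>a b. a \<le> b \<Longrightarrow> (LBINT x:{a..b}. d x) = 0"
  shows "AE x in lborel. d x = 0"
proof -
  have "AE x in lborel. x \<in> {- real n..real n} \<longrightarrow> d x = 0" for n :: nat
  proof -
    define e where "e x = indicator {- real n..real n} x * d x" for x
    have ei: "integrable lborel e"
      using int[of "- real n" "real n"] by (simp add: e_def[abs_def] set_integrable_def)
    have [measurable]: "e \<in> borel_measurable borel" unfolding e_def by measurable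
    have eq: "(\<integral>\<^sup>+x. ennreal (e x) * indicator {t<..} x \<partial>lborel) = (\<integral>\<^sup>+x. ennreal (- e x) * indicator {t<..} x \<partial>lborel)"
      and fin: "(\<integral>\<^sup>+x. ennreal (e x) * indicator {t<..} x \<partial>lborel) < \<infinity>" for t
    proof -
      let ?g = "\<lambda>x. indicator {t<..} x * e x"
      have gi: "integrable lborel ?g"
        by (rule Bochner_Integration.integrable_bound[OF ei]) (auto simp: indicator_def)
      have "(LBINT x. ?g x) = 0"
      proof (cases "t \<le> real n")
        case True
        have "(LBINT x. ?g x) = (LBINT x:{max t (- real n)..real n}. d x)"
          unfolding set_lebesgue_integral_def e_def
          using AE_lborel_singleton[of t]
          by (intro integral_cong_AE) (auto simp: indicator_def elim!: eventually_mono)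
        then show ?thesis using zero[of "max t (- real n)" "real n"] True by simp
      next
        case False
        have "?g = (\<lambda>x. 0)" using False by (auto simp: e_def indicator_def)
        then show ?thesis by simp
      qed
      then have ee: "enn2real (\<integral>\<^sup>+x. ennreal (?g x) \<partial>lborel) = enn2real (\<integral>\<^sup>+x. ennreal (- ?g x) \<partial>lborel)"
        unfolding real_lebesgue_integral_def[OF gi] by simp
      have f1: "(\<integral>\<^sup>+x. ennreal (?g x) \<partial>lborel) \<noteq> \<infinity>" "(\<integral>\<^sup>+x. ennreal (- ?g x) \<partial>lborel) \<noteq> \<infinity>"
        using gi unfolding real_integrable_def by auto
      have "(\<integral>\<^sup>+x. ennreal (?g x) \<partial>lborel) = (\<integral>\<^sup>+x. ennreal (- ?g x) \<partial>lborel)"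
        using arg_cong[OF ee, of ennreal] f1
        by (subst (asm) (1 2) ennreal_enn2real) (simp_all add: top.not_eq_extremum)
      moreover have "(\<integral>\<^sup>+x. ennreal (?g x) \<partial>lborel) = (\<integral>\<^sup>+x. ennreal (e x) * indicator {t<..} x \<partial>lborel)"
        by (rule nn_integral_cong) (auto simp: indicator_def)
      moreover have "(\<integral>\<^sup>+x. ennreal (- ?g x) \<partial>lborel) = (\<integral>\<^sup>+x. ennreal (- e x) * indicator {t<..} x \<partial>lborel)"
        by (rule nn_integral_cong) (auto simp: indicator_def)
      ultimately show "(\<integral>\<^sup>+x. ennreal (e x) * indicator {t<..} x \<partial>lborel) = (\<integral>\<^sup>+x. ennreal (- e x) * indicator {t<..} x \<partial>lborel)"
        "(\<integral>\<^sup>+x. ennreal (e x) * indicator {t<..} x \<partial>lborel) < \<infinity>"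
        using f1 by (auto simp: less_top)
    qed
    \<comment> \<open>\<open>ennreal\<close> sends negative numbers to 0, so these two densities are
      the positive and the negative part of e.\<close>
    have "density lborel (\<lambda>x. ennreal (e x)) = density lborel (\<lambda>x. ennreal (- e x))"
      by (rule measure_eqI_lessThan) (use eq fin in \<open>auto simp: emeasure_density\<close>)
    then have "AE x in lborel. ennreal (e x) = ennreal (- e x)"
      using ei by (subst (asm) finite_density_unique) (auto simp: real_integrable_def)
    moreover have "x \<in> {- real n..real n} \<longrightarrow> d x = 0" if "ennreal (e x) = ennreal (- e x)" for x
    proof
      assume x: "x \<in> {- real n..real n}"
      have "e x = 0"
      proof (cases "0 \<le> e x")
        case True
        then have "ennreal (- e x) = 0" by (intro ennreal_neg) simp
        with that True show ?thesis by (simp add: ennreal_eq_0_iff)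
      next
        case False
        then have "ennreal (e x) = 0" by (intro ennreal_neg) simp
        with that False show ?thesis by (simp add: ennreal_eq_0_iff)
      qed
      with x show "d x = 0" by (simp add: e_def)
    qed
    ultimately show ?thesis by (rule eventually_mono)
  qed
  then have "AE x in lborel. \<forall>n. x \<in> {- real n..real n} \<longrightarrow> d x = 0"
    by (subst AE_all_countable) (rule allI)
  then show ?thesis
  proof eventually_elim
    case (elim x)
    obtain n :: nat where "\<bar>x\<bar> \<le> real n" using real_arch_simple by blast
    then have "x \<in> {- real n..real n}" by (simp add: abs_le_iff)
    with elim show ?case by blast
  qed
qed

text \<open>The inverse transform of an integrable F. The real part is taken to obtain a real
  function; for the transform of a real function the regularised integrals in the proof of the
  inversion formula are real, so nothing is lost.\<close>

definition ift :: "(real \<Rightarrow> complex) \<Rightarrow> real \<Rightarrow> real" where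
  "ift F x = Re (ftr F (- x)) / (2 * pi)"

lemma ift_measurable [measurable]: "F \<in> borel_measurable borel \<Longrightarrow> ift F \<in> borel_measurable borel"
proof -
  assume F: "F \<in> borel_measurable borel"
  have u: "(\<lambda>x::real. - x) \<in> borel_measurable borel" by simp
  have [measurable]: "(\<lambda>x. ftr F (- x)) \<in> borel_measurable borel"
    by (rule measurable_compose[OF u ftr_measurable[OF F]])
  show ?thesis unfolding ift_def[abs_def] by measurable
qed

lemma ift_abs_le:
  "\<bar>ift F x\<bar> \<le> (LBINT \<xi>. cmod (F \<xi>))"
proof -
  have "\<bar>Re (ftr F (- x))\<bar> \<le> (LBINT \<xi>. cmod (F \<xi>))"
    by (rule order_trans[OF abs_Re_le_cmod ftr_norm_le])
  moreover have "\<bar>Re (ftr F (- x))\<bar> / (2 * pi) \<le> \<bar>Re (ftr F (- x))\<bar> / 1"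
    using pi_gt3 by (intro divide_left_mono) auto
  ultimately show ?thesis by (simp add: ift_def)
qed

text \<open>The factor is (1 / (2 pi))^2 from the definition of \<open>ift\<close> times the 2 pi of
  Plancherel's inequality.\<close>

lemma ift_l2:
  assumes F: "integrable lborel F" "integrable lborel (\<lambda>\<xi>. (cmod (F \<xi>))\<^sup>2)"
  shows "square_integrable (ift F)" "(LBINT x. (ift F x)\<^sup>2) \<le> 1 / (2 * pi) * (LBINT \<xi>. (cmod (F \<xi>))\<^sup>2)"
proof -
  note [measurable] = borel_measurable_integrable[OF F(1)]
  let ?J = "LBINT \<xi>. (cmod (F \<xi>))\<^sup>2"
  have "(\<integral>\<^sup>+x. ennreal ((ift F x)\<^sup>2) \<partial>lborel) \<le> (\<integral>\<^sup>+x. ennreal (1 / (2 * pi)\<^sup>2) * ennreal ((cmod (ftr F (- x)))\<^sup>2) \<partial>lborel)"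
  proof (rule nn_integral_mono)
    fix x
    have "(Re (ftr F (- x)))\<^sup>2 \<le> (cmod (ftr F (- x)))\<^sup>2"
      by (simp add: cmod_power2)
    then have "(ift F x)\<^sup>2 \<le> 1 / (2 * pi)\<^sup>2 * (cmod (ftr F (- x)))\<^sup>2"
      by (simp add: ift_def power_divide divide_right_mono)
    then show "ennreal ((ift F x)\<^sup>2) \<le> ennreal (1 / (2 * pi)\<^sup>2) * ennreal ((cmod (ftr F (- x)))\<^sup>2)"
      by (subst ennreal_mult[symmetric]) (auto intro: ennreal_leI)
  qed
  also have "\<dots> = ennreal (1 / (2 * pi)\<^sup>2) * (\<integral>\<^sup>+x. ennreal ((cmod (ftr F (- x)))\<^sup>2) \<partial>lborel)"
    by (rule nn_integral_cmult) measurable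
  also have "(\<integral>\<^sup>+x. ennreal ((cmod (ftr F (- x)))\<^sup>2) \<partial>lborel) = (\<integral>\<^sup>+x. ennreal ((cmod (ftr F x))\<^sup>2) \<partial>lborel)"
    by (subst nn_integral_real_affine[of "\<lambda>x. ennreal ((cmod (ftr F x))\<^sup>2)" "- 1" 0]) auto
  also have "ennreal (1 / (2 * pi)\<^sup>2) * \<dots> \<le> ennreal (1 / (2 * pi)\<^sup>2) * ennreal (2 * pi * ?J)"
    by (intro mult_left_mono ftr_Plancherel_le F) simp
  also have "\<dots> = ennreal (1 / (2 * pi) * ?J)"
    by (subst ennreal_mult[symmetric]) (auto simp: power2_eq_square)
  finally have le: "(\<integral>\<^sup>+x. ennreal ((ift F x)\<^sup>2) \<partial>lborel) \<le> ennreal (1 / (2 * pi) * ?J)" .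
  then have i: "integrable lborel (\<lambda>x. (ift F x)\<^sup>2)"
    using le_less_trans[OF le ennreal_less_top] by (intro integrableI_bounded) auto
  then show "square_integrable (ift F)" by (simp add: square_integrable_def)
  show "(LBINT x. (ift F x)\<^sup>2) \<le> 1 / (2 * pi) * ?J"
    using le nn_integral_eq_integral[OF i] by (simp add: ennreal_le_iff)
qed

text \<open>The translation is moved from f to the interval. Then only the indicator varies, and
  dominated convergence applies away from the two endpoints.\<close>

lemma translated_interval_integral_tendsto:
  assumes f: "square_integrable f"
  shows "(\<lambda>n. LBINT y. indicator {a..b} y * f (y + z / real (Suc n))) \<longlonglongrightarrow> (LBINT y. indicator {a..b} y * f y)"
proof -
  note [measurable] = square_integrable_measurable[OF f]
  define h where "h n = z / real (Suc n)" for n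
  have h0: "h \<longlonglongrightarrow> 0" unfolding h_def by (rule LIMSEQ_Suc[OF lim_const_over_n])
  have hz: "\<bar>h n\<bar> \<le> \<bar>z\<bar>" for n by (simp add: h_def field_simps mult_left_le)
  have e: "(LBINT y. indicator {a..b} y * f (y + h n)) = (LBINT x. indicator {a + h n..b + h n} x * f x)" for n
  proof -
    have "(LBINT x. indicator {a + h n..b + h n} x * f x) = (LBINT y. indicator {a + h n..b + h n} (h n + 1 * y) * f (h n + 1 * y))"
      using lborel_integral_real_affine[of 1 "\<lambda>x. indicator {a + h n..b + h n} x * f x" "h n"] by simp
    also have "\<dots> = (LBINT y. indicator {a..b} y * f (y + h n))"
      by (rule Bochner_Integration.integral_cong) (auto simp: indicator_def add.commute)
    finally show ?thesis by simp
  qed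
  have "(\<lambda>n. LBINT x. indicator {a + h n..b + h n} x * f x) \<longlonglongrightarrow> (LBINT x. indicator {a..b} x * f x)"
  proof (rule integral_dominated_convergence[where w = "\<lambda>x. \<bar>indicator {a - \<bar>z\<bar>..b + \<bar>z\<bar>} x * f x\<bar>"])
    show "integrable lborel (\<lambda>x. \<bar>indicator {a - \<bar>z\<bar>..b + \<bar>z\<bar>} x * f x\<bar>)"
      by (intro integrable_abs square_integrable_truncate(2)[OF f])
    show "AE x in lborel. norm (indicator {a + h n..b + h n} x * f x) \<le> \<bar>indicator {a - \<bar>z\<bar>..b + \<bar>z\<bar>} x * f x\<bar>" for n
      using hz[of n] by (intro AE_I2) (auto simp: indicator_def)
    show "AE x in lborel. (\<lambda>n. indicator {a + h n..b + h n} x * f x) \<longlonglongrightarrow> indicator {a..b} x * f x"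
      using AE_lborel_singleton[of a] AE_lborel_singleton[of b]
    proof eventually_elim
      case (elim x)
      have "\<forall>\<^sub>F n in sequentially. (x \<in> {a + h n..b + h n}) = (x \<in> {a..b})"
      proof -
        have l: "(\<lambda>n. a + h n) \<longlonglongrightarrow> a" "(\<lambda>n. b + h n) \<longlonglongrightarrow> b"
          using tendsto_add[OF tendsto_const h0] by auto
        have "\<forall>\<^sub>F n in sequentially. (a + h n \<le> x) = (a \<le> x)"
        proof (cases "a < x")
          case True
          then show ?thesis using order_tendstoD(2)[OF l(1) True] by (auto elim!: eventually_mono)
        next
          case False
          with elim have "x < a" by simp
          then show ?thesis using order_tendstoD(1)[OF l(1) \<open>x < a\<close>] by (auto elim!: eventually_mono)
        qed
        moreover have "\<forall>\<^sub>F n in sequentially. (x \<le> b + h n) = (x \<le> b)"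
        proof (cases "x < b")
          case True
          then show ?thesis using order_tendstoD(1)[OF l(2) True] by (auto elim!: eventually_mono)
        next
          case False
          with elim have "b < x" by simp
          then show ?thesis using order_tendstoD(2)[OF l(2) \<open>b < x\<close>] by (auto elim!: eventually_mono)
        qed
        ultimately show ?thesis by eventually_elim auto
      qed
      then show ?case by (intro tendsto_eventually) (auto elim!: eventually_mono simp: indicator_def)
    qed
  qed measurable
  then show ?thesis unfolding e[symmetric] by (simp only: h_def)
qed

lemma interval_translate_le:
  assumes f: "square_integrable f" and ab: "a \<le> b"
  shows "(LBINT y. indicator {a..b} y * \<bar>f (y + \<eta>)\<bar>) \<le> sqrt (b - a) * l2norm f"
    and "integrable lborel (\<lambda>y. indicator {a..b} y * \<bar>f (y + \<eta>)\<bar>)"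
proof -
  have e: "(\<lambda>x. (indicator {a..b} x :: real)\<^sup>2) = indicator {a..b}"
    by (auto simp: indicator_def)
  have s1: "square_integrable (\<lambda>x. indicator {a..b} x)"
    unfolding square_integrable_def e by (simp add: integrable_indicator_iff emeasure_lborel_Icc_eq)
  have l1: "l2norm (\<lambda>x. indicator {a..b} x) = sqrt (b - a)"
    unfolding l2norm_def e using ab by simp
  note fs = square_integrable_shift[OF f, of \<eta>]
  have s2: "square_integrable (\<lambda>y. \<bar>f (y + \<eta>)\<bar>)"
    using square_integrable_measurable[OF fs(1)] by (intro square_integrable_bound[OF _ fs(1), of _ 1]) auto
  have l2: "l2norm (\<lambda>y. \<bar>f (y + \<eta>)\<bar>) = l2norm f"
    using fs(2) by (simp add: l2norm_def)
  show "(LBINT y. indicator {a..b} y * \<bar>f (y + \<eta>)\<bar>) \<le> sqrt (b - a) * l2norm f"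
    using Cauchy_Schwarz_integral[OF s1 s2] unfolding l1 l2 by linarith
  show "integrable lborel (\<lambda>y. indicator {a..b} y * \<bar>f (y + \<eta>)\<bar>)"
    by (rule square_integrable_mult_integrable[OF s1 s2])
qed

text \<open>The substitution x = y + z / (n + 1) makes the Gaussian independent of n. Fubini's
  theorem leaves an average over z of translated interval integrals, which converge for each z and
  are bounded uniformly in z by Cauchy-Schwarz.\<close>

lemma gaussian_average_interval_tendsto:
  assumes f: "square_integrable f" and ab: "a \<le> b"
  shows "(\<lambda>n. LBINT y. indicator {a..b} y * (LBINT x. f x * normal_density 0 (1 / real (Suc n)) (x - y)))
    \<longlonglongrightarrow> (LBINT y. indicator {a..b} y * f y)"
proof -
  note [measurable] = square_integrable_measurable[OF f]
  let ?nd = "std_normal_density"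
  have nd: "integrable lborel ?nd" "(LBINT z. ?nd z) = 1" by auto
  define c where "c = sqrt (b - a) * l2norm f"
  have c0: "0 \<le> c" using ab by (simp add: c_def)
  have eq: "(LBINT y. indicator {a..b} y * (LBINT x. f x * normal_density 0 (1 / real (Suc n)) (x - y)))
    = (LBINT z. ?nd z * (LBINT y. indicator {a..b} y * f (y + z / real (Suc n))))" for n
  proof -
    define k where "k = real (Suc n)"
    have k: "0 < k" by (simp add: k_def)
    have "(LBINT x. f x * normal_density 0 (1 / k) (x - y)) = (LBINT z. f (y + z / k) * ?nd z)" for y
    proof -
      have "(LBINT x. f x * normal_density 0 (1 / k) (x - y))
        = \<bar>1 / k\<bar> *\<^sub>R (LBINT z. f (y + 1 / k * z) * normal_density 0 (1 / k) (y + 1 / k * z - y))"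
        using k by (intro lborel_integral_real_affine) simp
      also have "\<dots> = (LBINT z. 1 / k * (f (y + 1 / k * z) * normal_density 0 (1 / k) (y + 1 / k * z - y)))"
        using k by simp
      also have "\<dots> = (LBINT z. f (y + z / k) * ?nd z)"
      proof (rule Bochner_Integration.integral_cong[OF refl])
        fix z
        have "1 / k * normal_density 0 (1 / k) (1 / k * z) = ?nd z"
          using k by (simp add: normal_density_def real_sqrt_mult real_sqrt_divide power_divide field_simps)
        then show "1 / k * (f (y + 1 / k * z) * normal_density 0 (1 / k) (y + 1 / k * z - y)) = f (y + z / k) * ?nd z"
          using k by (simp add: field_simps)
      qed
      finally show ?thesis .
    qed
    then have "(LBINT y. indicator {a..b} y * (LBINT x. f x * normal_density 0 (1 / k) (x - y)))
      = (LBINT y. LBINT z. indicator {a..b} y * (f (y + z / k) * ?nd z))"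
      by simp
    also have "\<dots> = (LBINT z. LBINT y. indicator {a..b} y * (f (y + z / k) * ?nd z))"
    proof (rule lborel_pair.Fubini_integral)
      let ?H = "\<lambda>z y. indicator {a..b} y * (f (y + z / k) * ?nd z)"
      show "integrable (lborel \<Otimes>\<^sub>M lborel) (case_prod ?H)"
      proof (rule integrableI_bounded)
        show m: "case_prod ?H \<in> borel_measurable (lborel \<Otimes>\<^sub>M lborel)" by measurable
        have "(\<integral>\<^sup>+p. norm (case_prod ?H p) \<partial>(lborel \<Otimes>\<^sub>M lborel)) = (\<integral>\<^sup>+z. \<integral>\<^sup>+y. norm (?H z y) \<partial>lborel \<partial>lborel)"
          using lborel.nn_integral_fst[of "\<lambda>p. ennreal (norm (case_prod ?H p))" lborel] m by simp
        also have "\<dots> \<le> (\<integral>\<^sup>+z. ennreal (?nd z) * ennreal c \<partial>lborel)"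
        proof (rule nn_integral_mono)
          fix z
          have "(\<integral>\<^sup>+y. norm (?H z y) \<partial>lborel) = (\<integral>\<^sup>+y. ennreal (?nd z) * ennreal (indicator {a..b} y * \<bar>f (y + z / k)\<bar>) \<partial>lborel)"
            by (intro nn_integral_cong) (auto simp: ennreal_mult[symmetric] abs_mult indicator_def mult_ac)
          also have "\<dots> = ennreal (?nd z) * (\<integral>\<^sup>+y. ennreal (indicator {a..b} y * \<bar>f (y + z / k)\<bar>) \<partial>lborel)"
            by (rule nn_integral_cmult) measurable
          also have "(\<integral>\<^sup>+y. ennreal (indicator {a..b} y * \<bar>f (y + z / k)\<bar>) \<partial>lborel) \<le> ennreal c"
            using interval_translate_le[OF f ab, of "z / k"]
            by (subst nn_integral_eq_integral) (auto simp: c_def intro!: ennreal_leI)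
          finally show "(\<integral>\<^sup>+y. norm (?H z y) \<partial>lborel) \<le> ennreal (?nd z) * ennreal c"
            by (simp add: mult_left_mono)
        qed
        also have "\<dots> = (\<integral>\<^sup>+z. ennreal (?nd z) \<partial>lborel) * ennreal c"
          by (rule nn_integral_multc) measurable
        also have "\<dots> < \<infinity>"
          by (subst nn_integral_eq_integral[OF nd(1)]) (auto simp: ennreal_mult[symmetric])
        finally show "(\<integral>\<^sup>+p. norm (case_prod ?H p) \<partial>(lborel \<Otimes>\<^sub>M lborel)) < \<infinity>" .
      qed
    qed
    also have "\<dots> = (LBINT z. ?nd z * (LBINT y. indicator {a..b} y * f (y + z / k)))"
    proof (rule Bochner_Integration.integral_cong[OF refl])
      fix z
      have "(LBINT y. indicator {a..b} y * (f (y + z / k) * ?nd z)) = (LBINT y. ?nd z * (indicator {a..b} y * f (y + z / k)))"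
        by (simp add: mult_ac)
      then show "(LBINT y. indicator {a..b} y * (f (y + z / k) * ?nd z)) = ?nd z * (LBINT y. indicator {a..b} y * f (y + z / k))"
        by (simp only: integral_mult_right_zero)
    qed
    finally show ?thesis by (simp add: k_def)
  qed
  have "(\<lambda>n. LBINT z. ?nd z * (LBINT y. indicator {a..b} y * f (y + z / real (Suc n))))
    \<longlonglongrightarrow> (LBINT z. ?nd z * (LBINT y. indicator {a..b} y * f y))"
  proof (rule integral_dominated_convergence[where w = "\<lambda>z. ?nd z * c"])
    show "integrable lborel (\<lambda>z. ?nd z * c)" using nd(1) by simp
    show "AE z in lborel. (\<lambda>n. ?nd z * (LBINT y. indicator {a..b} y * f (y + z / real (Suc n))))
        \<longlonglongrightarrow> ?nd z * (LBINT y. indicator {a..b} y * f y)"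
      by (intro AE_I2 tendsto_mult_left translated_interval_integral_tendsto f)
    show "AE z in lborel. norm (?nd z * (LBINT y. indicator {a..b} y * f (y + z / real (Suc n)))) \<le> ?nd z * c" for n
    proof (rule AE_I2)
      fix z
      have "\<bar>LBINT y. indicator {a..b} y * f (y + z / real (Suc n))\<bar> \<le> (LBINT y. \<bar>indicator {a..b} y * f (y + z / real (Suc n))\<bar>)"
        by (rule integral_abs_bound)
      also have "\<dots> \<le> c"
        using interval_translate_le(1)[OF f ab, of "z / real (Suc n)"] by (simp add: c_def abs_mult)
      finally show "norm (?nd z * (LBINT y. indicator {a..b} y * f (y + z / real (Suc n)))) \<le> ?nd z * c"
        by (simp add: abs_mult mult_left_mono)
    qed
  qed measurable
  then show ?thesis unfolding eq using nd(2) by simp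
qed

text \<open>Tested on an interval, the Gaussian-regularised integrals have two limits: f, because
  they are averages of f over shrinking widths, and \<open>ift F\<close>, because the cutoff on the
  integrable F disappears. Equality of all interval integrals gives equality almost
  everywhere.\<close>

lemma fourier_inversion:
  assumes f: "square_integrable f" and F: "is_fourier_transform f F" "integrable lborel F"
  shows "AE x in lborel. f x = ift F x"
proof -
  note [measurable] = square_integrable_measurable[OF f] borel_measurable_integrable[OF F(2)]
  define B where "B = (LBINT \<xi>. cmod (F \<xi>))"
  have int_ift: "integrable lborel (\<lambda>x. indicator {a..b} x * ift F x)" for a b
  proof -
    have "integrable lborel (\<lambda>x. indicator {a..b} x * B)"
      by (auto simp: integrable_indicator_iff emeasure_lborel_Icc_eq intro!: integrable_mult_left)
    then show ?thesis
    proof (rule Bochner_Integration.integrable_bound)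
      show "AE x in lborel. norm (indicat_real {a..b} x * ift F x) \<le> norm (indicat_real {a..b} x * B)"
        using ift_abs_le[of F] order_trans[OF _ abs_ge_self[of B]]
        by (intro AE_I2) (auto simp: indicator_def B_def)
    qed measurable
  qed
  have key: "(LBINT y. indicator {a..b} y * f y) = (LBINT y. indicator {a..b} y * ift F y)" if ab: "a \<le> b" for a b
  proof -
    define L where "L n y = (LBINT \<xi>. F \<xi> * (cis (y * \<xi>) * complex_of_real (gauss (real (Suc n)) \<xi>)))" for n y
    have [measurable]: "L n \<in> borel_measurable borel" for n unfolding L_def by measurable
    have L_eq: "L n y = complex_of_real (2 * pi * (LBINT x. f x * normal_density 0 (1 / real (Suc n)) (x - y)))" for n y
      unfolding L_def by (rule gauss_pairing[OF f F]) simp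
    have L_lim: "(\<lambda>n. L n y) \<longlonglongrightarrow> ftr F (- y)" for y
      unfolding L_def ftr_def
    proof (rule integral_dominated_convergence[where w = "\<lambda>\<xi>. cmod (F \<xi>)"])
      show "integrable lborel (\<lambda>\<xi>. cmod (F \<xi>))" using F(2) by simp
      show "AE \<xi> in lborel. (\<lambda>n. F \<xi> * (cis (y * \<xi>) * complex_of_real (gauss (real (Suc n)) \<xi>))) \<longlonglongrightarrow> cis (- (- y * \<xi>)) * F \<xi>"
      proof (rule AE_I2)
        fix \<xi>
        have "(\<lambda>k. \<xi> / real (Suc k)) \<longlonglongrightarrow> 0"
          by (rule LIMSEQ_Suc[OF lim_const_over_n])
        then have "(\<lambda>k. gauss (real (Suc k)) \<xi>) \<longlonglongrightarrow> exp (- 0\<^sup>2 / 2)"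
          unfolding gauss_def by (intro tendsto_intros) auto
        then have "(\<lambda>n. F \<xi> * (cis (y * \<xi>) * complex_of_real (gauss (real (Suc n)) \<xi>))) \<longlonglongrightarrow> F \<xi> * (cis (y * \<xi>) * complex_of_real (exp (- 0\<^sup>2 / 2)))"
          by (intro tendsto_mult_left tendsto_of_real)
        then show "(\<lambda>n. F \<xi> * (cis (y * \<xi>) * complex_of_real (gauss (real (Suc n)) \<xi>))) \<longlonglongrightarrow> cis (- (- y * \<xi>)) * F \<xi>"
          by (simp add: mult_ac)
      qed
      show "AE \<xi> in lborel. norm (F \<xi> * (cis (y * \<xi>) * complex_of_real (gauss (real (Suc n)) \<xi>))) \<le> cmod (F \<xi>)" for n
        using gauss_le_1 gauss_pos by (intro AE_I2) (auto simp: norm_mult mult_left_le less_imp_le)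
    qed measurable
    have L_le: "cmod (L n y) \<le> B" for n y
      unfolding L_def
    proof (rule order_trans[OF integral_norm_bound])
      have "integrable lborel (\<lambda>\<xi>. F \<xi> * (cis (y * \<xi>) * complex_of_real (gauss (real (Suc n)) \<xi>)))"
        by (rule Bochner_Integration.integrable_bound[OF F(2)])
          (use gauss_le_1 gauss_pos in \<open>auto simp: norm_mult mult_left_le less_imp_le\<close>)
      then show "(LBINT \<xi>. norm (F \<xi> * (cis (y * \<xi>) * complex_of_real (gauss (real (Suc n)) \<xi>)))) \<le> B"
        unfolding B_def
        by (intro integral_mono integrable_norm F(2))
          (use gauss_le_1 gauss_pos in \<open>auto simp: norm_mult mult_left_le less_imp_le\<close>)
    qed
    have "(\<lambda>n. LBINT y. indicator {a..b} y * (Re (L n y) / (2 * pi))) \<longlonglongrightarrow> (LBINT y. indicator {a..b} y * ift F y)"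
    proof (rule integral_dominated_convergence[where w = "\<lambda>y. indicator {a..b} y * B"])
      show "integrable lborel (\<lambda>y. indicator {a..b} y * B)"
        by (auto simp: integrable_indicator_iff emeasure_lborel_Icc_eq intro!: integrable_mult_left)
      show "AE y in lborel. (\<lambda>n. indicator {a..b} y * (Re (L n y) / (2 * pi))) \<longlonglongrightarrow> indicator {a..b} y * ift F y"
        unfolding ift_def by (intro AE_I2 tendsto_intros L_lim) simp
      show "AE y in lborel. norm (indicator {a..b} y * (Re (L n y) / (2 * pi))) \<le> indicator {a..b} y * B" for n
      proof (rule AE_I2)
        fix y
        have "\<bar>Re (L n y)\<bar> \<le> B" by (rule order_trans[OF abs_Re_le_cmod L_le])
        moreover have "\<bar>Re (L n y)\<bar> / (2 * pi) \<le> \<bar>Re (L n y)\<bar> / 1"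
          using pi_gt3 by (intro divide_left_mono) auto
        ultimately show "norm (indicator {a..b} y * (Re (L n y) / (2 * pi))) \<le> indicator {a..b} y * B"
          by (auto simp: indicator_def)
      qed
    qed measurable
    moreover have "Re (L n y) / (2 * pi) = (LBINT x. f x * normal_density 0 (1 / real (Suc n)) (x - y))" for n y
      unfolding L_eq by simp
    ultimately show ?thesis
      using LIMSEQ_unique[OF gaussian_average_interval_tendsto[OF f ab]] by simp
  qed
  have "AE x in lborel. f x - ift F x = 0"
  proof (rule AE_eq_0_of_interval_integrals)
    show "set_integrable lborel {a..b} (\<lambda>x. f x - ift F x)" for a b
      using square_integrable_truncate(2)[OF f] int_ift by (simp add: set_integrable_def right_diff_distrib)
    show "(LBINT x:{a..b}. f x - ift F x) = 0" if "a \<le> b" for a b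
      using square_integrable_truncate(2)[OF f, of a b] int_ift[of a b] key[OF that]
      by (simp add: set_lebesgue_integral_def right_diff_distrib)
  qed measurable
  then show ?thesis by eventually_elim simp
qed

section \<open>Sobolev functions have classical representatives\<close>

lemma has_real_derivative_integral:
  fixes p p' :: "real \<Rightarrow> real \<Rightarrow> real"
  assumes der: "\<And>x \<xi>. ((\<lambda>x. p x \<xi>) has_real_derivative p' x \<xi>) (at x)"
    and int: "\<And>x. integrable lborel (p x)" and [measurable]: "\<And>x. p' x \<in> borel_measurable borel"
    and le: "\<And>x \<xi>. \<bar>p' x \<xi>\<bar> \<le> w \<xi>" and w: "integrable lborel w"
  shows "((\<lambda>x. LBINT \<xi>. p x \<xi>) has_real_derivative (LBINT \<xi>. p' x \<xi>)) (at x)"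
  unfolding DERIV_def tendsto_at_iff_sequentially comp_def
proof (intro allI impI)
  fix d :: "nat \<Rightarrow> real"
  assume d: "\<forall>i. d i \<in> UNIV - {0}" "d \<longlonglongrightarrow> 0"
  note [measurable] = borel_measurable_integrable[OF int]
  have "(\<lambda>i. LBINT \<xi>. (p (x + d i) \<xi> - p x \<xi>) / d i) \<longlonglongrightarrow> (LBINT \<xi>. p' x \<xi>)"
  proof (rule integral_dominated_convergence[where w = w])
    show "AE \<xi> in lborel. (\<lambda>i. (p (x + d i) \<xi> - p x \<xi>) / d i) \<longlonglongrightarrow> p' x \<xi>"
    proof (rule AE_I2)
      fix \<xi>
      have "((\<lambda>h. (p (x + h) \<xi> - p x \<xi>) / h) \<longlongrightarrow> p' x \<xi>) (at 0)"
        using der[of \<xi> x] by (simp add: DERIV_def)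
      then show "(\<lambda>i. (p (x + d i) \<xi> - p x \<xi>) / d i) \<longlonglongrightarrow> p' x \<xi>"
        unfolding tendsto_at_iff_sequentially comp_def using d by blast
    qed
    show "AE \<xi> in lborel. norm ((p (x + d i) \<xi> - p x \<xi>) / d i) \<le> w \<xi>" for i
    proof (rule AE_I2)
      fix \<xi>
      have "norm (p (x + d i) \<xi> - p x \<xi>) \<le> w \<xi> * norm (x + d i - x)"
        by (rule field_differentiable_bound[of UNIV _ "\<lambda>x. p' x \<xi>"]) (use der le in auto)
      then show "norm ((p (x + d i) \<xi> - p x \<xi>) / d i) \<le> w \<xi>"
        using d(1) by (simp add: field_simps)
    qed
  qed (use w in measurable)
  then show "(\<lambda>i. ((LBINT \<xi>. p (x + d i) \<xi>) - (LBINT \<xi>. p x \<xi>)) / d i) \<longlonglongrightarrow> (LBINT \<xi>. p' x \<xi>)"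
    using int by simp
qed

lemma ift_eq_integral:
  assumes "integrable lborel F"
  shows "ift F x = (LBINT \<xi>. Re (cis (x * \<xi>) * F \<xi>)) / (2 * pi)"
    and "integrable lborel (\<lambda>\<xi>. Re (cis (x * \<xi>) * F \<xi>))"
proof -
  have i: "integrable lborel (\<lambda>\<xi>. cis (x * \<xi>) * F \<xi>)"
    by (rule cis_mult_integrable[OF assms]) measurable
  show "integrable lborel (\<lambda>\<xi>. Re (cis (x * \<xi>) * F \<xi>))"
    using i by (rule integrable_Re)
  show "ift F x = (LBINT \<xi>. Re (cis (x * \<xi>) * F \<xi>)) / (2 * pi)"
    using integral_Re[OF i] by (simp add: ift_def ftr_def)
qed

lemma ift_has_derivative:
  assumes F: "integrable lborel F" "integrable lborel (\<lambda>\<xi>. \<i> * of_real \<xi> * F \<xi>)"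
  shows "(ift F has_real_derivative ift (\<lambda>\<xi>. \<i> * of_real \<xi> * F \<xi>) x) (at x)"
proof -
  note [measurable] = borel_measurable_integrable[OF F(1)]
  have "((\<lambda>x. LBINT \<xi>. Re (cis (x * \<xi>) * F \<xi>)) has_real_derivative
      (LBINT \<xi>. Re (cis (x * \<xi>) * (\<i> * of_real \<xi> * F \<xi>)))) (at x)"
  proof (rule has_real_derivative_integral)
    show "((\<lambda>x. Re (cis (x * \<xi>) * F \<xi>)) has_real_derivative Re (cis (x * \<xi>) * (\<i> * of_real \<xi> * F \<xi>))) (at x)" for x \<xi>
      by (auto intro!: derivative_eq_intros simp: algebra_simps)
    show "\<bar>Re (cis (x * \<xi>) * (\<i> * of_real \<xi> * F \<xi>))\<bar> \<le> cmod (\<i> * of_real \<xi> * F \<xi>)" for x \<xi>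
      by (rule order_trans[OF abs_Re_le_cmod]) (simp add: norm_mult)
    show "integrable lborel (\<lambda>\<xi>. cmod (\<i> * of_real \<xi> * F \<xi>))" using F(2) by (rule integrable_norm)
  qed (use ift_eq_integral(2)[OF F(1)] in \<open>auto\<close>)
  then have "((\<lambda>x. (LBINT \<xi>. Re (cis (x * \<xi>) * F \<xi>)) / (2 * pi)) has_real_derivative
      (LBINT \<xi>. Re (cis (x * \<xi>) * (\<i> * of_real \<xi> * F \<xi>))) / (2 * pi)) (at x)"
    by (rule DERIV_cdivide)
  then show ?thesis
    unfolding ift_eq_integral(1)[OF F(2)] ift_eq_integral(1)[OF F(1), abs_def] .
qed

lemma ift_continuous:
  assumes F: "integrable lborel F"
  shows "continuous_on UNIV (ift F)"
proof (intro continuous_at_imp_continuous_on ballI)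
  fix x :: real
  note [measurable] = borel_measurable_integrable[OF F]
  show "isCont (ift F) x"
    unfolding continuous_at_sequentially comp_def
  proof (intro allI impI)
    fix y assume y: "y \<longlonglongrightarrow> x"
    have "(\<lambda>n. LBINT \<xi>. Re (cis (y n * \<xi>) * F \<xi>)) \<longlonglongrightarrow> (LBINT \<xi>. Re (cis (x * \<xi>) * F \<xi>))"
    proof (rule integral_dominated_convergence[where w = "\<lambda>\<xi>. cmod (F \<xi>)"])
      show "AE \<xi> in lborel. (\<lambda>n. Re (cis (y n * \<xi>) * F \<xi>)) \<longlonglongrightarrow> Re (cis (x * \<xi>) * F \<xi>)"
        by (intro AE_I2 tendsto_intros y)
      show "AE \<xi> in lborel. norm (Re (cis (y n * \<xi>) * F \<xi>)) \<le> cmod (F \<xi>)" for n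
      proof (rule AE_I2)
        fix \<xi>
        show "norm (Re (cis (y n * \<xi>) * F \<xi>)) \<le> cmod (F \<xi>)"
          using abs_Re_le_cmod[of "cis (y n * \<xi>) * F \<xi>"] by (simp only: real_norm_def norm_mult norm_cis mult_1)
      qed
    qed (use F in \<open>auto\<close>)
    then show "(\<lambda>n. ift F (y n)) \<longlonglongrightarrow> ift F x"
      unfolding ift_eq_integral(1)[OF F] by (intro tendsto_intros) auto
  qed
qed

section \<open>Sobolev functions through weighted transforms\<close>

lemma weight_integrable:
  assumes r: "1 / 2 < r"
  shows "integrable lborel (\<lambda>\<xi>::real. (1 + \<xi>\<^sup>2) powr (- r))"
proof -
  let ?w = "\<lambda>\<xi>::real. (1 + \<xi>\<^sup>2) powr (- r)"
  have p: "1 + \<xi>\<^sup>2 \<noteq> 0" for \<xi> :: real using zero_le_power2[of \<xi>] by linarith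
  have cont: "continuous_on UNIV ?w" using p by (intro continuous_intros) auto
  have [measurable]: "?w \<in> borel_measurable borel" by measurable
  \<comment> \<open>For x >= 1 the weight is at most \<open>x powr (- 2 * r)\<close>, which is
    integrable as 2 r > 1; the left half-line follows by symmetry, and the rest is a compact
    interval.\<close>
  have "((\<lambda>x::real. x powr (- 2 * r)) has_integral - (1 powr (- 2 * r + 1)) / (- 2 * r + 1)) {1..}"
    by (rule has_integral_powr_to_inf) (use r in auto)
  then have "(\<lambda>x::real. x powr (- 2 * r)) absolutely_integrable_on {1..}"
    by (intro nonnegative_absolutely_integrable_1) (auto simp: has_integral_integrable)
  then have s: "set_integrable lborel {1..} (\<lambda>x::real. x powr (- 2 * r))"
    unfolding set_integrable_def by (subst (asm) integrable_completion) auto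
  have right: "set_integrable lborel {1..} ?w"
    unfolding set_integrable_def
  proof (rule Bochner_Integration.integrable_bound[OF s[unfolded set_integrable_def]])
    show "AE x in lborel. norm (indicat_real {1..} x *\<^sub>R ?w x) \<le> norm (indicat_real {1..} x *\<^sub>R x powr (- 2 * r))"
    proof (rule AE_I2)
      fix x :: real
      have "?w x \<le> x powr (- 2 * r)" if "1 \<le> x"
      proof -
        have "?w x \<le> (x\<^sup>2) powr (- r)"
          using that r by (intro powr_mono2') auto
        also have "\<dots> = x powr (- 2 * r)"
          using that powr_powr[of x 2 "- r"] by (simp add: powr_numeral)
        finally show ?thesis .
      qed
      then show "norm (indicat_real {1..} x *\<^sub>R ?w x) \<le> norm (indicat_real {1..} x *\<^sub>R x powr (- 2 * r))"
        by (auto simp: indicator_def)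
    qed
  qed measurable
  have "set_integrable lborel {..- 1} (\<lambda>x. ?w (- x))"
    using set_integrable_reflect[of 1 ?w] right by simp
  then have left: "set_integrable lborel {..- 1} ?w" by simp
  have mid: "set_integrable lborel {- 1..1} ?w"
    by (rule continuous_imp_set_integrable_Icc[OF cont])
  have "set_integrable lborel (({..- 1} \<union> {- 1..1}) \<union> {1..}) ?w"
    by (intro set_integrable_Un left mid right) auto
  moreover have "({..- 1} \<union> {- 1..1}) \<union> {1..} = (UNIV :: real set)" by auto
  ultimately show ?thesis by (simp add: set_integrable_def)
qed

definition weight_const :: "real \<Rightarrow> real" where
  "weight_const r = sqrt (LBINT \<xi>. (1 + \<xi>\<^sup>2) powr (- r))"

lemma one_plus_power2_pos: "0 < 1 + (\<xi>::real)\<^sup>2"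
  using zero_le_power2[of \<xi>] by linarith

text \<open>Cauchy-Schwarz after inserting (1 + \<xi>^2)^(-r/2), which is square integrable for r >
  1/2. With r = s this makes the transform of an H^s function integrable, with r = s - 1 also \<xi>
  times the transform; this is where s > 3/2 enters.\<close>

lemma weighted_L2_imp_L1:
  assumes [measurable]: "F \<in> borel_measurable borel"
    and i: "integrable lborel (\<lambda>\<xi>. (1 + \<xi>\<^sup>2) powr r * (cmod (F \<xi>))\<^sup>2)" and r: "1 / 2 < r"
  shows "integrable lborel F"
    and "(LBINT \<xi>. cmod (F \<xi>)) \<le> weight_const r * sqrt (LBINT \<xi>. (1 + \<xi>\<^sup>2) powr r * (cmod (F \<xi>))\<^sup>2)"
proof -
  define a where "a \<xi> = (1 + \<xi>\<^sup>2) powr (- r / 2)" for \<xi> :: real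
  define b where "b \<xi> = (1 + \<xi>\<^sup>2) powr (r / 2) * cmod (F \<xi>)" for \<xi> :: real
  have [measurable]: "a \<in> borel_measurable borel" "b \<in> borel_measurable borel"
    unfolding a_def b_def by measurable
  have a2: "(a \<xi>)\<^sup>2 = (1 + \<xi>\<^sup>2) powr (- r)" and b2: "(b \<xi>)\<^sup>2 = (1 + \<xi>\<^sup>2) powr r * (cmod (F \<xi>))\<^sup>2"
    and ab: "a \<xi> * b \<xi> = cmod (F \<xi>)" for \<xi>
    using one_plus_power2_pos[of \<xi>]
    by (simp_all add: a_def b_def power2_eq_square powr_add[symmetric] mult_ac)
  have sa: "square_integrable a" using weight_integrable[OF r] by (simp add: square_integrable_def a2)
  have sb: "square_integrable b" using i by (simp add: square_integrable_def b2)
  have "integrable lborel (\<lambda>\<xi>. cmod (F \<xi>))"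
    using square_integrable_mult_integrable[OF sa sb] by (simp add: ab)
  then show "integrable lborel F" by (simp add: integrable_norm_iff)
  have "\<bar>LBINT \<xi>. a \<xi> * b \<xi>\<bar> \<le> l2norm a * l2norm b" by (rule Cauchy_Schwarz_integral[OF sa sb])
  then show "(LBINT \<xi>. cmod (F \<xi>)) \<le> weight_const r * sqrt (LBINT \<xi>. (1 + \<xi>\<^sup>2) powr r * (cmod (F \<xi>))\<^sup>2)"
    by (simp add: ab l2norm_def a2 b2 weight_const_def)
qed

text \<open>\<open>fourier\<close> is a choice; existence of the transform for square integrable
  functions is what makes the chosen function satisfy its specification.\<close>

lemma sobolevD:
  assumes "f \<in> sobolev r"
  shows "square_integrable f" "is_fourier_transform f (fourier f)" "fourier f \<in> borel_measurable borel"
    "integrable lborel (\<lambda>\<xi>. (1 + \<xi>\<^sup>2) powr r * (cmod (fourier f \<xi>))\<^sup>2)"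
proof -
  show s: "square_integrable f" and "integrable lborel (\<lambda>\<xi>. (1 + \<xi>\<^sup>2) powr r * (cmod (fourier f \<xi>))\<^sup>2)"
    using assms by (auto simp: sobolev_def square_integrable_def)
  show "is_fourier_transform f (fourier f)"
    unfolding fourier_def using is_fourier_transform_exists[OF s] by (rule someI_ex)
  then show "fourier f \<in> borel_measurable borel" by (simp add: is_fourier_transform_def)
qed

lemma sobolev_mono:
  assumes f: "f \<in> sobolev r" and q: "q \<le> r"
  shows "f \<in> sobolev q" "sobolev_norm q f \<le> sobolev_norm r f"
proof -
  note [measurable] = sobolevD(3)[OF f]
  have le: "(1 + \<xi>\<^sup>2) powr q * (cmod (fourier f \<xi>))\<^sup>2 \<le> (1 + \<xi>\<^sup>2) powr r * (cmod (fourier f \<xi>))\<^sup>2" for \<xi>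
    using q by (intro mult_right_mono powr_mono) auto
  have i: "integrable lborel (\<lambda>\<xi>. (1 + \<xi>\<^sup>2) powr q * (cmod (fourier f \<xi>))\<^sup>2)"
    by (rule Bochner_Integration.integrable_bound[OF sobolevD(4)[OF f]]) (use le in auto)
  then show "f \<in> sobolev q" using f by (simp add: sobolev_def)
  show "sobolev_norm q f \<le> sobolev_norm r f"
    unfolding sobolev_norm_def
    by (intro real_sqrt_le_mono mult_left_mono integral_mono i sobolevD(4)[OF f] le) auto
qed

text \<open>The chosen transform of a combination agrees with the combination of the chosen
  transforms only almost everywhere, which is enough for the weighted integral.\<close>

lemma sobolev_lincomb:
  assumes f: "f \<in> sobolev r" and g: "g \<in> sobolev r"
  shows "(\<lambda>x. a * f x + b * g x) \<in> sobolev r"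
proof -
  let ?k = "\<lambda>x. a * f x + b * g x"
  let ?w = "\<lambda>\<xi>::real. (1 + \<xi>\<^sup>2) powr r"
  note [measurable] = sobolevD(3)[OF f] sobolevD(3)[OF g]
  have s: "square_integrable ?k"
    by (intro square_integrable_add square_integrable_cmult sobolevD(1)[OF f] sobolevD(1)[OF g])
  have "is_fourier_transform ?k (fourier ?k)"
    unfolding fourier_def using is_fourier_transform_exists[OF s] by (rule someI_ex)
  from is_fourier_transform_unique[OF s this is_fourier_transform_linear[OF sobolevD(1,2)[OF f] sobolevD(1,2)[OF g]]]
  have ae: "AE \<xi> in lborel. fourier ?k \<xi> = of_real a * fourier f \<xi> + of_real b * fourier g \<xi>" .
  have [measurable]: "fourier ?k \<in> borel_measurable borel"
    using \<open>is_fourier_transform ?k (fourier ?k)\<close> by (simp add: is_fourier_transform_def)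
  have i: "integrable lborel (\<lambda>\<xi>. 2 * a\<^sup>2 * (?w \<xi> * (cmod (fourier f \<xi>))\<^sup>2) + 2 * b\<^sup>2 * (?w \<xi> * (cmod (fourier g \<xi>))\<^sup>2))"
    by (intro Bochner_Integration.integrable_add integrable_mult_right sobolevD(4)[OF f] sobolevD(4)[OF g])
  have "integrable lborel (\<lambda>\<xi>. ?w \<xi> * (cmod (fourier ?k \<xi>))\<^sup>2)"
  proof (rule Bochner_Integration.integrable_bound[OF i])
    show "AE \<xi> in lborel. norm (?w \<xi> * (cmod (fourier ?k \<xi>))\<^sup>2)
      \<le> norm (2 * a\<^sup>2 * (?w \<xi> * (cmod (fourier f \<xi>))\<^sup>2) + 2 * b\<^sup>2 * (?w \<xi> * (cmod (fourier g \<xi>))\<^sup>2))"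
      using ae
    proof eventually_elim
      case (elim \<xi>)
      have "?w \<xi> * (cmod (fourier ?k \<xi>))\<^sup>2 \<le> ?w \<xi> * (2 * (cmod (of_real a * fourier f \<xi>))\<^sup>2 + 2 * (cmod (of_real b * fourier g \<xi>))\<^sup>2)"
        unfolding elim by (intro mult_left_mono cmod_add_power2_le) simp
      also have "\<dots> = 2 * a\<^sup>2 * (?w \<xi> * (cmod (fourier f \<xi>))\<^sup>2) + 2 * b\<^sup>2 * (?w \<xi> * (cmod (fourier g \<xi>))\<^sup>2)"
        by (simp add: norm_mult power_mult_distrib algebra_simps)
      finally show ?case by simp
    qed
  qed measurable
  with s show ?thesis by (simp add: sobolev_def square_integrable_def)
qed

lemma sobolev_diff: "f \<in> sobolev r \<Longrightarrow> g \<in> sobolev r \<Longrightarrow> (\<lambda>x. f x - g x) \<in> sobolev r"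
  using sobolev_lincomb[of f r g 1 "- 1"] by simp

lemma sobolev_cmult: "f \<in> sobolev r \<Longrightarrow> (\<lambda>x. c * f x) \<in> sobolev r"
  using sobolev_lincomb[of f r f c 0] by simp

text \<open>An equality of functions, not just almost everywhere: the choice in
  \<open>fourier\<close> is applied to a predicate that sees f only through its truncated
  integrals.\<close>

lemma fourier_cong_AE:
  assumes "AE x in lborel. f x = g x" and [measurable]: "f \<in> borel_measurable borel" "g \<in> borel_measurable borel"
  shows "fourier f = fourier g"
proof -
  have "truncated_ftr f = truncated_ftr g"
  proof (intro ext)
    fix R \<xi>
    show "truncated_ftr f R \<xi> = truncated_ftr g R \<xi>"
      unfolding truncated_ftr_eq_ftr ftr_def
      by (intro integral_cong_AE) (use assms(1) in \<open>auto elim!: eventually_mono\<close>)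
  qed
  then have "is_fourier_transform f = is_fourier_transform g"
    by (simp add: is_fourier_transform_alt fun_eq_iff)
  then show ?thesis by (simp add: fourier_def)
qed

text \<open>The lower bound on r makes the transform integrable, so that f is \<open>ift\<close> of
  it almost everywhere and the L2 bound for \<open>ift\<close> applies.\<close>

lemma sobolev_l2norm_le:
  assumes f: "f \<in> sobolev r" and r: "1 / 2 < r"
  shows "l2norm f \<le> sobolev_norm r f"
proof -
  note fD = sobolevD[OF f]
  note [measurable] = fD(3) square_integrable_measurable[OF fD(1)]
  note L1 = weighted_L2_imp_L1[OF fD(3,4) r]
  have le: "(cmod (fourier f \<xi>))\<^sup>2 \<le> (1 + \<xi>\<^sup>2) powr r * (cmod (fourier f \<xi>))\<^sup>2" for \<xi>
    using r by (intro mult_le_cancel_right1[THEN iffD2]) (auto intro!: ge_one_powr_ge_zero)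
  have i: "integrable lborel (\<lambda>\<xi>. (cmod (fourier f \<xi>))\<^sup>2)"
    by (rule Bochner_Integration.integrable_bound[OF fD(4)]) (use le in auto)
  have "(LBINT x. (f x)\<^sup>2) = (LBINT x. (ift (fourier f) x)\<^sup>2)"
    using fourier_inversion[OF fD(1,2) L1(1)] by (intro integral_cong_AE) (auto elim!: eventually_mono)
  also have "\<dots> \<le> 1 / (2 * pi) * (LBINT \<xi>. (cmod (fourier f \<xi>))\<^sup>2)"
    by (rule ift_l2(2)[OF L1(1) i])
  also have "\<dots> \<le> 1 / (2 * pi) * (LBINT \<xi>. (1 + \<xi>\<^sup>2) powr r * (cmod (fourier f \<xi>))\<^sup>2)"
    by (intro mult_left_mono integral_mono i fD(4) le) auto
  finally show ?thesis by (simp add: l2norm_def sobolev_norm_def)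
qed

text \<open>The inversion formula read as a definition: for f in H^s with s > 3/2 this is the C^1
  representative of f, and \<open>drep\<close> is its derivative. Both are computed from the
  transform alone, so functions equal almost everywhere share them.\<close>

definition rep :: "(real \<Rightarrow> real) \<Rightarrow> real \<Rightarrow> real" where
  "rep f = ift (fourier f)"

definition drep :: "(real \<Rightarrow> real) \<Rightarrow> real \<Rightarrow> real" where
  "drep f = ift (\<lambda>\<xi>. \<i> * of_real \<xi> * fourier f \<xi>)"

context
  fixes s :: real and f :: "real \<Rightarrow> real"
  assumes s: "3 / 2 < s" and f: "f \<in> sobolev s"
begin

private abbreviation (input) "F \<equiv> fourier f"
private abbreviation (input) "F' \<equiv> \<lambda>\<xi>. \<i> * complex_of_real \<xi> * fourier f \<xi>"

text \<open>The estimate (1 + \<xi>^2)^(s - 1) \<xi>^2 <= (1 + \<xi>^2)^s, with s - 1 > 1/2, makes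
  \<open>F'\<close> integrable; the last clause splits the H1 weight 1 + \<xi>^2 into its two
  summands.\<close>

private lemma F_facts:
  "integrable lborel F" "integrable lborel F'"
  "(LBINT \<xi>. cmod (F' \<xi>)) \<le> weight_const (s - 1) * (sqrt (2 * pi) * sobolev_norm s f)"
  "integrable lborel (\<lambda>\<xi>. (cmod (F \<xi>))\<^sup>2)" "integrable lborel (\<lambda>\<xi>. (cmod (F' \<xi>))\<^sup>2)"
  "1 / (2 * pi) * (LBINT \<xi>. (cmod (F \<xi>))\<^sup>2) + 1 / (2 * pi) * (LBINT \<xi>. (cmod (F' \<xi>))\<^sup>2) = (sobolev_norm 1 f)\<^sup>2"
proof -
  note fD = sobolevD[OF f]
  note [measurable] = fD(3)
  show "integrable lborel F"
    by (rule weighted_L2_imp_L1[OF fD(3,4)]) (use s in auto)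
  have c: "(cmod (F' \<xi>))\<^sup>2 = \<xi>\<^sup>2 * (cmod (F \<xi>))\<^sup>2" for \<xi>
    by (simp add: norm_mult power_mult_distrib)
  have le: "(1 + \<xi>\<^sup>2) powr (s - 1) * (cmod (F' \<xi>))\<^sup>2 \<le> (1 + \<xi>\<^sup>2) powr s * (cmod (F \<xi>))\<^sup>2" for \<xi>
  proof -
    have "(1 + \<xi>\<^sup>2) powr s = (1 + \<xi>\<^sup>2) powr (s - 1) * (1 + \<xi>\<^sup>2)"
      using one_plus_power2_pos[of \<xi>] by (simp add: powr_diff)
    moreover have "(1 + \<xi>\<^sup>2) powr (s - 1) * \<xi>\<^sup>2 \<le> (1 + \<xi>\<^sup>2) powr (s - 1) * (1 + \<xi>\<^sup>2)"
      by (intro mult_left_mono) auto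
    ultimately show ?thesis
      unfolding c mult.assoc[symmetric] by (intro mult_right_mono) auto
  qed
  have i': "integrable lborel (\<lambda>\<xi>. (1 + \<xi>\<^sup>2) powr (s - 1) * (cmod (F' \<xi>))\<^sup>2)"
    by (rule Bochner_Integration.integrable_bound[OF fD(4)]) (use le in auto)
  have [measurable]: "F' \<in> borel_measurable borel" by measurable
  have s1: "1 / 2 < s - 1" using s by simp
  note L1 = weighted_L2_imp_L1[OF _ i' s1]
  show "integrable lborel F'" by (rule L1(1)) measurable
  have nn: "sqrt (2 * pi) * sobolev_norm s f = sqrt (LBINT \<xi>. (1 + \<xi>\<^sup>2) powr s * (cmod (F \<xi>))\<^sup>2)"
    by (simp add: sobolev_norm_def real_sqrt_mult[symmetric])
  have "(LBINT \<xi>. cmod (F' \<xi>)) \<le> weight_const (s - 1) * sqrt (LBINT \<xi>. (1 + \<xi>\<^sup>2) powr (s - 1) * (cmod (F' \<xi>))\<^sup>2)"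
    by (rule L1(2)) measurable
  also have "\<dots> \<le> weight_const (s - 1) * (sqrt (2 * pi) * sobolev_norm s f)"
    unfolding nn
    by (intro mult_left_mono real_sqrt_le_mono integral_mono i' fD(4) le) (simp add: weight_const_def)
  finally show "(LBINT \<xi>. cmod (F' \<xi>)) \<le> weight_const (s - 1) * (sqrt (2 * pi) * sobolev_norm s f)" .
  have f1: "f \<in> sobolev 1" by (rule sobolev_mono[OF f]) (use s in simp)
  have w1: "(1 + \<xi>\<^sup>2) powr 1 * (cmod (F \<xi>))\<^sup>2 = (cmod (F \<xi>))\<^sup>2 + (cmod (F' \<xi>))\<^sup>2" for \<xi>
    unfolding c using one_plus_power2_pos[of \<xi>] by (simp add: distrib_right)
  have i1: "integrable lborel (\<lambda>\<xi>. (cmod (F \<xi>))\<^sup>2 + (cmod (F' \<xi>))\<^sup>2)"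
    using sobolevD(4)[OF f1] by (simp only: w1)
  show iF: "integrable lborel (\<lambda>\<xi>. (cmod (F \<xi>))\<^sup>2)" and iF': "integrable lborel (\<lambda>\<xi>. (cmod (F' \<xi>))\<^sup>2)"
    by (rule Bochner_Integration.integrable_bound[OF i1]; auto)+
  show "1 / (2 * pi) * (LBINT \<xi>. (cmod (F \<xi>))\<^sup>2) + 1 / (2 * pi) * (LBINT \<xi>. (cmod (F' \<xi>))\<^sup>2) = (sobolev_norm 1 f)\<^sup>2"
  proof -
    have "(sobolev_norm 1 f)\<^sup>2 = 1 / (2 * pi) * (LBINT \<xi>. (cmod (F \<xi>))\<^sup>2 + (cmod (F' \<xi>))\<^sup>2)"
      unfolding sobolev_norm_def w1 by (subst real_sqrt_pow2) auto
    also have "(LBINT \<xi>. (cmod (F \<xi>))\<^sup>2 + (cmod (F' \<xi>))\<^sup>2) = (LBINT \<xi>. (cmod (F \<xi>))\<^sup>2) + (LBINT \<xi>. (cmod (F' \<xi>))\<^sup>2)"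
      by (rule Bochner_Integration.integral_add[OF iF iF'])
    finally show ?thesis by (simp add: algebra_simps)
  qed
qed

lemma rep_AE: "AE x in lborel. f x = rep f x"
  unfolding rep_def by (rule fourier_inversion[OF sobolevD(1,2)[OF f] F_facts(1)])

lemma rep_has_derivative: "(rep f has_real_derivative drep f x) (at x)"
  unfolding rep_def drep_def by (rule ift_has_derivative[OF F_facts(1,2)])

lemma drep_continuous: "continuous_on UNIV (drep f)"
  unfolding drep_def by (rule ift_continuous[OF F_facts(2)])

lemma rep_square_integrable: "square_integrable (rep f)" and drep_square_integrable: "square_integrable (drep f)"
  unfolding rep_def drep_def by (rule ift_l2[OF F_facts(1,4)], rule ift_l2[OF F_facts(2,5)])

text \<open>Plancherel's inequality for \<open>rep\<close> and for \<open>drep\<close>, added up.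
  The factor 1 / (2 pi) in \<open>sobolev_norm\<close> is what makes the constant 1.\<close>

lemma rep_H1_le: "(l2norm (rep f))\<^sup>2 + (l2norm (drep f))\<^sup>2 \<le> (sobolev_norm 1 f)\<^sup>2"
  unfolding l2norm_power2 rep_def drep_def F_facts(6)[symmetric]
  by (intro add_mono ift_l2[OF F_facts(1,4)] ift_l2[OF F_facts(2,5)])

lemma drep_abs_le: "\<bar>drep f x\<bar> \<le> weight_const (s - 1) * (sqrt (2 * pi) * sobolev_norm s f)"
  unfolding drep_def by (rule order_trans[OF ift_abs_le F_facts(3)])

end

section \<open>Weak derivatives\<close>

lemma integrable_compact_support:
  fixes \<psi> :: "real \<Rightarrow> real"
  assumes "continuous_on UNIV \<psi>" "\<And>x. R < \<bar>x\<bar> \<Longrightarrow> \<psi> x = 0"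
  shows "integrable lborel \<psi>"
proof -
  have "set_integrable lborel {- R..R} \<psi>"
    by (rule continuous_imp_set_integrable_Icc[OF assms(1)])
  moreover have "(\<lambda>x. indicator {- R..R} x *\<^sub>R \<psi> x) = \<psi>"
  proof
    fix x
    show "indicator {- R..R} x *\<^sub>R \<psi> x = \<psi> x"
      using assms(2)[of x] by (cases "R < \<bar>x\<bar>") (auto simp: indicator_def abs_if split: if_splits)
  qed
  ultimately show ?thesis by (simp add: set_integrable_def)
qed

lemma has_weak_deriv_classical:
  assumes u: "\<And>x. (u has_real_derivative v x) (at x)" and v: "continuous_on UNIV v"
    and [measurable]: "f \<in> borel_measurable borel" and f: "AE x in lborel. f x = u x"
  shows "has_weak_deriv f v"
proof -
  have cu: "continuous_on UNIV u"
    using u by (meson DERIV_isCont continuous_at_imp_continuous_on)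
  have [measurable]: "u \<in> borel_measurable borel" "v \<in> borel_measurable borel"
    using cu v by (auto intro: borel_measurable_continuous_onI)
  have i: "set_integrable lborel {- R..R} f" "set_integrable lborel {- R..R} v" for R
  proof -
    have "integrable lborel (\<lambda>x. indicator {- R..R} x *\<^sub>R u x)"
      using continuous_imp_set_integrable_Icc[OF cu] by (simp add: set_integrable_def)
    moreover have "AE x in lborel. indicator {- R..R} x *\<^sub>R u x = indicator {- R..R} x *\<^sub>R f x"
      using f by eventually_elim simp
    ultimately show "set_integrable lborel {- R..R} f"
      unfolding set_integrable_def by (subst (asm) integrable_cong_AE) auto
    show "set_integrable lborel {- R..R} v" by (rule continuous_imp_set_integrable_Icc[OF v])
  qed
  have "(LBINT x. f x * \<phi>' x) = - (LBINT x. v x * \<phi> x)"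
    if p: "\<forall>x. (\<phi> has_real_derivative \<phi>' x) (at x)" and p': "continuous_on UNIV \<phi>'"
      and R: "\<forall>x. \<bar>x\<bar> > R \<longrightarrow> \<phi> x = 0" for \<phi> \<phi>' R
  proof -
    have cp: "continuous_on UNIV \<phi>"
      using p by (meson DERIV_isCont continuous_at_imp_continuous_on)
    have [measurable]: "\<phi>' \<in> borel_measurable borel" using p' by (rule borel_measurable_continuous_onI)
    have R': "\<phi>' x = 0" if "R < \<bar>x\<bar>" for x
    proof -
      have "open {x::real. R < \<bar>x\<bar>}" by (intro open_Collect_less continuous_intros)
      then have "(\<phi> has_real_derivative 0) (at x)"
        using that R
        by (intro has_field_derivative_transform_within_open[of "\<lambda>_. 0" 0 x "{x. R < \<bar>x\<bar>}" \<phi>]) auto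
      with p show ?thesis using DERIV_unique by blast
    qed
    have i1: "integrable lborel (\<lambda>x. u x * \<phi>' x)" "integrable lborel (\<lambda>x. v x * \<phi> x)" "integrable lborel (\<lambda>x. u x * \<phi> x)"
      using R R' by (auto intro!: integrable_compact_support[where R = R] continuous_intros cu v cp p')
    have "(LBINT x. u x * \<phi>' x + v x * \<phi> x) = 0"
    proof (rule integral_deriv_eq_0[where F = "\<lambda>x. u x * \<phi> x"])
      show "((\<lambda>x. u x * \<phi> x) has_real_derivative u x * \<phi>' x + v x * \<phi> x) (at x)" for x
        using DERIV_mult[OF u p[rule_format], of x] by (simp add: algebra_simps)
      show "continuous_on UNIV (\<lambda>x. u x * \<phi>' x + v x * \<phi> x)"
        by (intro continuous_intros cu v cp p')
    qed (use i1 in auto)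
    moreover have "(LBINT x. f x * \<phi>' x) = (LBINT x. u x * \<phi>' x)"
      using f by (intro integral_cong_AE) (auto elim!: eventually_mono)
    ultimately show ?thesis using i1 by simp
  qed
  with i show ?thesis unfolding has_weak_deriv_def by auto
qed

text \<open>A \<open>C\<^sup>1\<close> step from \<open>0\<close> on \<open>{..0}\<close> to \<open>1\<close> on \<open>{1..}\<close>.\<close>

definition smooth_step :: "real \<Rightarrow> real" where
  "smooth_step t = 1 - (max (1 - (max t 0)\<^sup>2) 0)\<^sup>2"

lemma smooth_step_has_derivative:
  "(smooth_step has_real_derivative 2 * max (1 - (max t 0)\<^sup>2) 0 * (2 * max t 0)) (at t)"
proof -
  have "((\<lambda>t. 1 - (max t 0)\<^sup>2) has_real_derivative 0 - 2 * max t 0) (at t)"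
    by (intro DERIV_diff DERIV_const has_real_derivative_max_0_power2)
  from DERIV_chain2[OF has_real_derivative_max_0_power2 this]
  have "((\<lambda>t. 1 - (max (1 - (max t 0)\<^sup>2) 0)\<^sup>2) has_real_derivative 0 - 2 * max (1 - (max t 0)\<^sup>2) 0 * (0 - 2 * max t 0)) (at t)"
    by (intro DERIV_diff DERIV_const)
  then show ?thesis unfolding smooth_step_def[abs_def] by simp
qed

lemma smooth_step_0: "t \<le> 0 \<Longrightarrow> smooth_step t = 0"
  and smooth_step_1: "1 \<le> t \<Longrightarrow> smooth_step t = 1"
  and smooth_step_bounds: "0 \<le> smooth_step t" "smooth_step t \<le> 1"
proof -
  show "t \<le> 0 \<Longrightarrow> smooth_step t = 0" by (simp add: smooth_step_def max_def)
  show "1 \<le> t \<Longrightarrow> smooth_step t = 1"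
  proof -
    assume t: "1 \<le> t"
    then have "1 \<le> t\<^sup>2" by simp
    with t show ?thesis by (simp add: smooth_step_def max_def)
  qed
  have "(max (1 - (max t 0)\<^sup>2) 0)\<^sup>2 \<le> 1\<^sup>2" by (intro power_mono) auto
  then show "0 \<le> smooth_step t" by (simp add: smooth_step_def)
  show "smooth_step t \<le> 1" by (simp add: smooth_step_def)
qed

text \<open>Products of a rising and a falling step with slopes of order n are admissible test
  functions, vanish outside (a, b) and converge to the indicator of that interval; so the difference
  of two weak derivatives has vanishing interval integrals.\<close>

lemma has_weak_deriv_unique:
  assumes g: "has_weak_deriv f g" and g': "has_weak_deriv f g'"
  shows "AE x in lborel. g x = g' x"
proof -
  have [measurable]: "g \<in> borel_measurable borel" "g' \<in> borel_measurable borel"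
    using g g' by (auto simp: has_weak_deriv_def)
  define d where "d x = g x - g' x" for x
  have [measurable]: "d \<in> borel_measurable borel" unfolding d_def by measurable
  have di: "set_integrable lborel {a..b} d" for a b
  proof -
    have "set_integrable lborel {- max \<bar>a\<bar> \<bar>b\<bar>..max \<bar>a\<bar> \<bar>b\<bar>} d"
      using g g' unfolding d_def[abs_def] by (intro set_integral_diff) (auto simp: has_weak_deriv_def)
    then show ?thesis by (rule set_integrable_subset) auto
  qed
  have "AE x in lborel. d x = 0"
  proof (rule AE_eq_0_of_interval_integrals[OF _ di])
    fix a b :: real assume ab: "a \<le> b"
    define \<phi> where "\<phi> n x = smooth_step (real n * (x - a)) * smooth_step (real n * (b - x))" for n :: nat and x
    define \<sigma> where "\<sigma> t = 2 * max (1 - (max t 0)\<^sup>2) 0 * (2 * max t 0)" for t :: real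
    define \<phi>' where "\<phi>' n x = \<sigma> (real n * (x - a)) * real n * smooth_step (real n * (b - x))
        + \<sigma> (real n * (b - x)) * (- real n) * smooth_step (real n * (x - a))" for n :: nat and x
    have cs: "continuous_on UNIV smooth_step"
      using smooth_step_has_derivative by (meson DERIV_isCont continuous_at_imp_continuous_on)
    have c\<sigma>: "continuous_on UNIV \<sigma>" unfolding \<sigma>_def by (intro continuous_intros)
    have c\<phi>: "continuous_on UNIV (\<phi> n)" for n
      unfolding \<phi>_def by (intro continuous_intros continuous_on_compose2[OF cs]) auto
    have c\<phi>': "continuous_on UNIV (\<phi>' n)" for n
      unfolding \<phi>'_def by (intro continuous_intros continuous_on_compose2[OF cs] continuous_on_compose2[OF c\<sigma>]) auto
    have [measurable]: "\<phi> n \<in> borel_measurable borel" for n using c\<phi> by (rule borel_measurable_continuous_onI)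
    have der: "(\<phi> n has_real_derivative \<phi>' n x) (at x)" for n x
    proof -
      have 1: "((\<lambda>x. smooth_step (real n * (x - a))) has_real_derivative \<sigma> (real n * (x - a)) * real n) (at x)"
        unfolding \<sigma>_def by (rule DERIV_chain2[OF smooth_step_has_derivative]) (auto intro!: derivative_eq_intros)
      have 2: "((\<lambda>x. smooth_step (real n * (b - x))) has_real_derivative \<sigma> (real n * (b - x)) * (- real n)) (at x)"
        unfolding \<sigma>_def by (rule DERIV_chain2[OF smooth_step_has_derivative]) (auto intro!: derivative_eq_intros)
      show ?thesis unfolding \<phi>_def \<phi>'_def by (rule DERIV_mult[OF 1 2])
    qed
    have supp: "\<phi> n x = 0" if "x \<notin> {a<..<b}" for n x
    proof -
      have "real n * (x - a) \<le> 0 \<or> real n * (b - x) \<le> 0"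
        using that by (auto simp: mult_le_0_iff)
      then show ?thesis by (auto simp: \<phi>_def smooth_step_0)
    qed
    have supp': "\<bar>x\<bar> > max \<bar>a\<bar> \<bar>b\<bar> \<longrightarrow> \<phi> n x = 0" for n x
      by (intro impI supp) auto
    have b1: "0 \<le> \<phi> n x" "\<phi> n x \<le> 1" for n x
      using smooth_step_bounds by (auto simp: \<phi>_def intro: mult_le_one)
    have i\<phi>: "integrable lborel (\<lambda>x. q x * \<phi> n x)" if q: "has_weak_deriv f q" for q n
    proof -
      have qm [measurable]: "q \<in> borel_measurable borel" using q by (simp add: has_weak_deriv_def)
      have "integrable lborel (\<lambda>x. indicator {- max \<bar>a\<bar> \<bar>b\<bar>..max \<bar>a\<bar> \<bar>b\<bar>} x *\<^sub>R q x)"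
        using q by (simp add: has_weak_deriv_def set_integrable_def)
      then show ?thesis
      proof (rule Bochner_Integration.integrable_bound)
        show "AE x in lborel. norm (q x * \<phi> n x) \<le> norm (indicator {- max \<bar>a\<bar> \<bar>b\<bar>..max \<bar>a\<bar> \<bar>b\<bar>} x *\<^sub>R q x)"
        proof (rule AE_I2)
          fix x
          show "norm (q x * \<phi> n x) \<le> norm (indicator {- max \<bar>a\<bar> \<bar>b\<bar>..max \<bar>a\<bar> \<bar>b\<bar>} x *\<^sub>R q x)"
          proof (cases "\<bar>x\<bar> > max \<bar>a\<bar> \<bar>b\<bar>")
            case True
            then show ?thesis using supp' by simp
          next
            case False
            then have "x \<in> {- max \<bar>a\<bar> \<bar>b\<bar>..max \<bar>a\<bar> \<bar>b\<bar>}"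
              unfolding atLeastAtMost_iff by linarith
            then show ?thesis using b1[of n x] by (simp add: abs_mult mult_left_le)
          qed
        qed
      qed measurable
    qed
    have zero: "(LBINT x. d x * \<phi> n x) = 0" for n
    proof -
      have "(LBINT x. f x * \<phi>' n x) = - (LBINT x. g x * \<phi> n x)" "(LBINT x. f x * \<phi>' n x) = - (LBINT x. g' x * \<phi> n x)"
        using g g' der c\<phi>' supp' unfolding has_weak_deriv_def by blast+
      then have "(LBINT x. g x * \<phi> n x) - (LBINT x. g' x * \<phi> n x) = 0" by simp
      then show ?thesis
        unfolding d_def left_diff_distrib using i\<phi>[OF g] i\<phi>[OF g'] by simp
    qed
    have "(\<lambda>n. LBINT x. d x * \<phi> n x) \<longlonglongrightarrow> (LBINT x. indicator {a..b} x * d x)"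
    proof (rule integral_dominated_convergence[where w = "\<lambda>x. \<bar>indicator {a..b} x * d x\<bar>"])
      show "integrable lborel (\<lambda>x. \<bar>indicator {a..b} x * d x\<bar>)"
        using di[of a b] by (intro integrable_abs) (simp add: set_integrable_def)
      show "AE x in lborel. norm (d x * \<phi> n x) \<le> \<bar>indicator {a..b} x * d x\<bar>" for n
      proof (rule AE_I2)
        fix x
        show "norm (d x * \<phi> n x) \<le> \<bar>indicator {a..b} x * d x\<bar>"
          using b1[of n x] supp[of x n] by (cases "x \<in> {a..b}") (auto simp: abs_mult mult_left_le)
      qed
      show "AE x in lborel. (\<lambda>n. d x * \<phi> n x) \<longlonglongrightarrow> indicator {a..b} x * d x"
        using AE_lborel_singleton[of a] AE_lborel_singleton[of b]
      proof eventually_elim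
        case (elim x)
        show ?case
        proof (cases "x \<in> {a<..<b}")
          case True
          then have pos: "0 < x - a" "0 < b - x" by auto
          obtain N :: nat where N: "max (1 / (x - a)) (1 / (b - x)) \<le> real N" using real_arch_simple by blast
          have "\<forall>\<^sub>F n in sequentially. d x * \<phi> n x = indicator {a..b} x * d x"
          proof (rule eventually_mono[OF eventually_ge_at_top[of N]])
            fix n assume "N \<le> n"
            with N have "1 / (x - a) \<le> real n" "1 / (b - x) \<le> real n" by auto
            with pos have "1 \<le> real n * (x - a)" "1 \<le> real n * (b - x)" by (auto simp: field_simps)
            with True show "d x * \<phi> n x = indicator {a..b} x * d x"
              by (simp add: \<phi>_def smooth_step_1)
          qed
          then show ?thesis by (rule tendsto_eventually)
        next
          case False
          with elim have "x \<notin> {a..b}" by auto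
          with supp[OF False] show ?thesis by simp
        qed
      qed
    qed measurable
    then show "(LBINT x:{a..b}. d x) = 0"
      unfolding zero set_lebesgue_integral_def using LIMSEQ_unique[OF tendsto_const] by fastforce
  qed measurable
  then show ?thesis by eventually_elim (simp add: d_def)
qed

text \<open>\<open>weak_deriv\<close> is a choice; uniqueness identifies it, almost everywhere, with
  the derivative of a C^1 representative. Through this the equation and the Gagliardo-Nirenberg
  inequality are read in terms of \<open>drep\<close>.\<close>

lemma weak_deriv_classical:
  assumes u: "\<And>x. (u has_real_derivative v x) (at x)" and v: "continuous_on UNIV v"
    and f: "f \<in> borel_measurable borel" "AE x in lborel. f x = u x"
  shows "AE x in lborel. weak_deriv f x = v x" "weak_deriv f \<in> borel_measurable borel"
proof -
  have w: "has_weak_deriv f v" by (rule has_weak_deriv_classical[OF u v f])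
  then have w': "has_weak_deriv f (weak_deriv f)"
    unfolding weak_deriv_def by (rule someI[where P = "has_weak_deriv f"])
  show "AE x in lborel. weak_deriv f x = v x" by (rule has_weak_deriv_unique[OF w' w])
  show "weak_deriv f \<in> borel_measurable borel" using w' by (simp add: has_weak_deriv_def)
qed

lemma continuous_AE_eq_imp_eq:
  fixes f g :: "real \<Rightarrow> real"
  assumes f: "continuous_on UNIV f" and g: "continuous_on UNIV g" and ae: "AE x in lborel. f x = g x"
  shows "f x = g x"
proof (rule ccontr)
  assume n: "f x \<noteq> g x"
  have o: "open {x. f x \<noteq> g x}" by (intro open_Collect_neq f g)
  then obtain e where e: "0 < e" "{x - e..x + e} \<subseteq> {x. f x \<noteq> g x}"
    using n by (auto simp: open_contains_cball cball_eq_atLeastAtMost)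
  have "AE y in lborel. y \<notin> {x - e..x + e}"
    using ae by eventually_elim (use e in auto)
  then have "emeasure lborel {x - e..x + e} = 0"
    by (subst (asm) AE_iff_measurable[of "{x - e..x + e}"]) auto
  then show False using e(1) by (simp add: emeasure_lborel_Icc_eq)
qed

section \<open>Evolution of the integral of a power of the slope\<close>

lemma integral_triple_bound:
  fixes a b c :: "real \<Rightarrow> real"
  assumes [measurable]: "a \<in> borel_measurable borel" and a: "\<And>x. \<bar>a x\<bar> \<le> K"
    and b: "square_integrable b" and c: "square_integrable c"
  shows "integrable lborel (\<lambda>x. a x * b x * c x)"
    and "\<bar>LBINT x. a x * b x * c x\<bar> \<le> K * l2norm b * l2norm c"
proof -
  note [measurable] = square_integrable_measurable[OF b]
  have K: "0 \<le> K" using a[of 0] by linarith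
  have ab: "square_integrable (\<lambda>x. a x * b x)"
    by (rule square_integrable_bounded_mult[OF assms(1) a b])
  show "integrable lborel (\<lambda>x. a x * b x * c x)"
    by (rule square_integrable_mult_integrable[OF ab c])
  have "l2norm (\<lambda>x. a x * b x) \<le> l2norm (\<lambda>x. K * b x)"
    using a K by (intro l2norm_mono square_integrable_cmult b) (auto simp: abs_mult intro!: mult_right_mono)
  also have "\<dots> = K * l2norm b" using K by (simp add: l2norm_cmult)
  finally have "l2norm (\<lambda>x. a x * b x) * l2norm c \<le> K * l2norm b * l2norm c"
    by (intro mult_right_mono) auto
  with Cauchy_Schwarz_integral[OF ab c] show "\<bar>LBINT x. a x * b x * c x\<bar> \<le> K * l2norm b * l2norm c"
    by linarith
qed

text \<open>The remainders satisfy E(n + 1) = x E(n) + (n + 2) y^(n + 1) (x - y)^2. The coefficient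
  (n + 2)^2 is not sharp; it is chosen because (n + 2)^2 + (n + 2) <= (n + 3)^2 closes the
  induction.\<close>

lemma power_Taylor_bound:
  fixes x y M :: real
  assumes "\<bar>x\<bar> \<le> M" "\<bar>y\<bar> \<le> M"
  shows "\<bar>x ^ (n + 2) - y ^ (n + 2) - real (n + 2) * y ^ (n + 1) * (x - y)\<bar> \<le> (real (n + 2))\<^sup>2 * M ^ n * (x - y)\<^sup>2"
proof (induction n)
  case 0
  have "x ^ (0 + 2) - y ^ (0 + 2) - real (0 + 2) * y ^ (0 + 1) * (x - y) = (x - y)\<^sup>2"
    by (simp add: power2_eq_square algebra_simps)
  then show ?case by simp
next
  case (Suc n)
  define E where "E = x ^ (n + 2) - y ^ (n + 2) - real (n + 2) * y ^ (n + 1) * (x - y)"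
  have M: "0 \<le> M" using assms(1) by linarith
  have IH: "\<bar>E\<bar> \<le> (real (n + 2))\<^sup>2 * M ^ n * (x - y)\<^sup>2" unfolding E_def by (rule Suc.IH)
  have "x ^ (Suc n + 2) - y ^ (Suc n + 2) - real (Suc n + 2) * y ^ (Suc n + 1) * (x - y)
      = x * E + real (n + 2) * y ^ (n + 1) * (x - y)\<^sup>2"
    by (simp add: E_def power2_eq_square algebra_simps)
  also have "\<bar>\<dots>\<bar> \<le> \<bar>x\<bar> * \<bar>E\<bar> + real (n + 2) * \<bar>y\<bar> ^ (n + 1) * (x - y)\<^sup>2"
    by (rule order_trans[OF abs_triangle_ineq]) (simp add: abs_mult power_abs)
  also have "\<dots> \<le> M * ((real (n + 2))\<^sup>2 * M ^ n * (x - y)\<^sup>2) + real (n + 2) * M ^ (n + 1) * (x - y)\<^sup>2"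
    by (intro add_mono mult_mono[OF assms(1) IH M abs_ge_zero] mult_right_mono mult_left_mono
        power_mono[OF assms(2) abs_ge_zero]) auto
  also have "\<dots> = ((real (n + 2))\<^sup>2 + real (n + 2)) * (M ^ Suc n * (x - y)\<^sup>2)"
    by (simp add: algebra_simps)
  also have "\<dots> \<le> (real (Suc n + 2))\<^sup>2 * (M ^ Suc n * (x - y)\<^sup>2)"
  proof (rule mult_right_mono)
    show "(real (n + 2))\<^sup>2 + real (n + 2) \<le> (real (Suc n + 2))\<^sup>2"
      by (simp add: power2_eq_square algebra_simps)
  qed (use M in simp)
  finally show ?case by (simp only: mult.assoc)
qed

text \<open>For a path differentiable only in L2 a common sup bound suffices: in the second-order
  expansion of the power the remainder is of order |\<tau> - t| times the squared L2 norm of the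
  quotient, and the linear term is continuous in the quotient. The exponent n + 2 leaves two square
  integrable factors beside a bounded one; n = 0 will serve the energy, an odd n the integral
  f.\<close>

lemma integral_power_has_derivative:
  fixes a :: "real \<Rightarrow> real \<Rightarrow> real"
  assumes t: "t \<in> S" and a: "\<And>\<tau>. \<tau> \<in> S \<Longrightarrow> square_integrable (a \<tau>)"
    and le: "\<And>\<tau> x. \<tau> \<in> S \<Longrightarrow> \<bar>a \<tau> x\<bar> \<le> M" and b: "square_integrable b"
    and lim: "((\<lambda>\<tau>. l2norm (\<lambda>x. (a \<tau> x - a t x) / (\<tau> - t) - b x)) \<longlongrightarrow> 0) (at t within S)"
  shows "((\<lambda>\<tau>. LBINT x. a \<tau> x ^ (n + 2)) has_real_derivative
      real (n + 2) * (LBINT x. a t x ^ n * a t x * b x)) (at t within S)"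
proof -
  note [measurable] = square_integrable_measurable[OF a[OF t]] square_integrable_measurable[OF b]
  let ?y = "a t"
  define Q where "Q \<tau> = l2norm (\<lambda>x. (a \<tau> x - ?y x) / (\<tau> - t) - b x)" for \<tau>
  define C where "C = (real (n + 2))\<^sup>2 * M ^ n"
  have M: "0 \<le> M" using le[OF t, of 0] by linarith
  then have C: "0 \<le> C" by (simp add: C_def)
  define D where "D = real (n + 2) * (LBINT x. ?y x ^ n * ?y x * b x)"
  have yn: "(\<lambda>x. ?y x ^ n) \<in> borel_measurable borel" "\<bar>?y x ^ n\<bar> \<le> M ^ n" for x
    using le[OF t, of x] by (auto simp: power_abs intro: power_mono)
  have est: "\<bar>((LBINT x. a \<tau> x ^ (n + 2)) - (LBINT x. ?y x ^ (n + 2))) / (\<tau> - t) - D\<bar>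
      \<le> C * \<bar>\<tau> - t\<bar> * (Q \<tau> + l2norm b)\<^sup>2 + real (n + 2) * (M ^ n * l2norm ?y * Q \<tau>)"
    if \<tau>: "\<tau> \<in> S" "\<tau> \<noteq> t" for \<tau>
  proof -
    define q where "q x = (a \<tau> x - ?y x) / (\<tau> - t)" for x
    have d: "a \<tau> x - ?y x = (\<tau> - t) * q x" for x using \<tau> by (simp add: q_def)
    have sq: "square_integrable q"
      unfolding q_def divide_inverse mult.commute[of _ "inverse _"]
      by (intro square_integrable_cmult square_integrable_diff a \<tau> t)
    have sqb: "square_integrable (\<lambda>x. q x - b x)" by (intro square_integrable_diff sq b)
    have [measurable]: "a \<tau> \<in> borel_measurable borel" "q \<in> borel_measurable borel"
      using a[OF \<tau>(1)] sq by (auto dest: square_integrable_measurable)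
    have ip: "integrable lborel (\<lambda>x. a \<sigma> x ^ (n + 2))" if "\<sigma> \<in> S" for \<sigma>
    proof -
      note [measurable] = square_integrable_measurable[OF a[OF that]]
      have "integrable lborel (\<lambda>x. a \<sigma> x ^ n * a \<sigma> x * a \<sigma> x)"
        using le[OF that] by (intro integral_triple_bound(1)[where K = "M ^ n"] a that)
          (auto simp: power_abs intro: power_mono)
      then show ?thesis by (simp add: mult_ac power2_eq_square)
    qed
    have i1: "integrable lborel (\<lambda>x. ?y x ^ n * ?y x * q x)" "integrable lborel (\<lambda>x. ?y x ^ n * ?y x * b x)"
      by (intro integral_triple_bound(1)[OF yn] a t sq b)+
    define E where "E x = a \<tau> x ^ (n + 2) - ?y x ^ (n + 2) - real (n + 2) * (\<tau> - t) * (?y x ^ n * ?y x * q x)" for x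
    have E_eq: "E x = a \<tau> x ^ (n + 2) - ?y x ^ (n + 2) - real (n + 2) * ?y x ^ (n + 1) * (a \<tau> x - ?y x)" for x
      unfolding E_def d by (simp add: algebra_simps)
    have Ei: "integrable lborel E"
      unfolding E_def using ip[OF \<tau>(1)] ip[OF t] i1(1)
      by (intro Bochner_Integration.integrable_diff integrable_mult_right) auto
    have E_le: "\<bar>E x\<bar> \<le> C * (\<tau> - t)\<^sup>2 * (q x)\<^sup>2" for x
    proof -
      have "\<bar>E x\<bar> \<le> (real (n + 2))\<^sup>2 * M ^ n * (a \<tau> x - ?y x)\<^sup>2"
        unfolding E_eq by (rule power_Taylor_bound[OF le[OF \<tau>(1)] le[OF t]])
      also have "\<dots> = C * (\<tau> - t)\<^sup>2 * (q x)\<^sup>2"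
        unfolding d C_def power_mult_distrib by (simp only: mult.assoc)
      finally show ?thesis .
    qed
    have "\<bar>LBINT x. E x\<bar> \<le> (LBINT x. \<bar>E x\<bar>)" by (rule integral_abs_bound)
    also have "\<dots> \<le> (LBINT x. C * (\<tau> - t)\<^sup>2 * (q x)\<^sup>2)"
      using Ei sq E_le by (intro integral_mono) (auto simp: square_integrable_def)
    also have "\<dots> = C * (\<tau> - t)\<^sup>2 * (l2norm q)\<^sup>2" by simp
    also have "l2norm q \<le> Q \<tau> + l2norm b"
    proof -
      have "l2norm (\<lambda>x. q x - b x + b x) \<le> l2norm (\<lambda>x. q x - b x) + l2norm b"
        by (rule l2norm_triangle[OF sqb b])
      moreover have "Q \<tau> = l2norm (\<lambda>x. q x - b x)" by (simp add: Q_def q_def)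
      ultimately show ?thesis by simp
    qed
    then have "C * (\<tau> - t)\<^sup>2 * (l2norm q)\<^sup>2 \<le> C * (\<tau> - t)\<^sup>2 * (Q \<tau> + l2norm b)\<^sup>2"
      using C by (intro mult_left_mono power_mono) auto
    finally have E1: "\<bar>LBINT x. E x\<bar> \<le> C * (\<tau> - t)\<^sup>2 * (Q \<tau> + l2norm b)\<^sup>2" .
    have Eint: "(LBINT x. E x) = (LBINT x. a \<tau> x ^ (n + 2)) - (LBINT x. ?y x ^ (n + 2))
        - real (n + 2) * (\<tau> - t) * (LBINT x. ?y x ^ n * ?y x * q x)"
    proof -
      have "(LBINT x. E x) = (LBINT x. a \<tau> x ^ (n + 2) - ?y x ^ (n + 2))
          - (LBINT x. real (n + 2) * (\<tau> - t) * (?y x ^ n * ?y x * q x))"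
        unfolding E_def
        by (intro Bochner_Integration.integral_diff Bochner_Integration.integrable_diff integrable_mult_right ip \<tau> t i1)
      also have "(LBINT x. a \<tau> x ^ (n + 2) - ?y x ^ (n + 2)) = (LBINT x. a \<tau> x ^ (n + 2)) - (LBINT x. ?y x ^ (n + 2))"
        by (intro Bochner_Integration.integral_diff ip \<tau> t)
      finally show ?thesis by (simp only: integral_mult_right_zero)
    qed
    have "(LBINT x. ?y x ^ n * ?y x * (q x - b x)) = (LBINT x. ?y x ^ n * ?y x * q x) - (LBINT x. ?y x ^ n * ?y x * b x)"
      unfolding right_diff_distrib by (rule Bochner_Integration.integral_diff[OF i1])
    moreover have "\<bar>LBINT x. ?y x ^ n * ?y x * (q x - b x)\<bar> \<le> M ^ n * l2norm ?y * Q \<tau>"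
      using integral_triple_bound(2)[OF yn a[OF t] sqb] by (simp add: Q_def q_def)
    ultimately have E2: "\<bar>real (n + 2) * (LBINT x. ?y x ^ n * ?y x * q x) - D\<bar> \<le> real (n + 2) * (M ^ n * l2norm ?y * Q \<tau>)"
      unfolding D_def right_diff_distrib[symmetric] abs_mult by (intro mult_mono) auto
    have "((LBINT x. a \<tau> x ^ (n + 2)) - (LBINT x. ?y x ^ (n + 2))) / (\<tau> - t) - D
      = (LBINT x. E x) / (\<tau> - t) + (real (n + 2) * (LBINT x. ?y x ^ n * ?y x * q x) - D)"
      unfolding Eint using \<tau> by (simp add: field_simps)
    also have "\<bar>\<dots>\<bar> \<le> \<bar>(LBINT x. E x) / (\<tau> - t)\<bar> + \<bar>real (n + 2) * (LBINT x. ?y x ^ n * ?y x * q x) - D\<bar>"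
      by (rule abs_triangle_ineq)
    also have "\<bar>(LBINT x. E x) / (\<tau> - t)\<bar> \<le> C * \<bar>\<tau> - t\<bar> * (Q \<tau> + l2norm b)\<^sup>2"
    proof -
      define \<delta> where "\<delta> = \<bar>\<tau> - t\<bar>"
      have \<delta>: "0 < \<delta>" "(\<tau> - t)\<^sup>2 = \<delta> * \<delta>" using \<tau> by (auto simp: \<delta>_def power2_eq_square)
      have "\<bar>(LBINT x. E x) / (\<tau> - t)\<bar> \<le> C * (\<delta> * \<delta>) * (Q \<tau> + l2norm b)\<^sup>2 / \<delta>"
        unfolding abs_divide \<delta>_def[symmetric] using E1 \<delta> by (intro divide_right_mono) auto
      also have "\<dots> = C * \<delta> * (Q \<tau> + l2norm b)\<^sup>2" using \<delta>(1) by simp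
      finally show ?thesis unfolding \<delta>_def .
    qed
    finally show ?thesis using E2 by linarith
  qed
  have Qlim: "(Q \<longlongrightarrow> 0) (at t within S)" unfolding Q_def by (rule lim)
  have "((\<lambda>\<tau>. C * \<bar>\<tau> - t\<bar> * (Q \<tau> + l2norm b)\<^sup>2 + real (n + 2) * (M ^ n * l2norm ?y * Q \<tau>))
      \<longlongrightarrow> C * \<bar>t - t\<bar> * (0 + l2norm b)\<^sup>2 + real (n + 2) * (M ^ n * l2norm ?y * 0)) (at t within S)"
    by (intro tendsto_intros Qlim)
  then have z: "((\<lambda>\<tau>. C * \<bar>\<tau> - t\<bar> * (Q \<tau> + l2norm b)\<^sup>2 + real (n + 2) * (M ^ n * l2norm ?y * Q \<tau>))
      \<longlongrightarrow> 0) (at t within S)" by simp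
  have "((\<lambda>\<tau>. ((LBINT x. a \<tau> x ^ (n + 2)) - (LBINT x. ?y x ^ (n + 2))) / (\<tau> - t) - D) \<longlongrightarrow> 0) (at t within S)"
    by (rule Lim_null_comparison[OF _ z])
      (use est in \<open>auto simp: eventually_at_filter intro!: always_eventually\<close>)
  then show ?thesis
    unfolding has_field_derivative_iff D_def[symmetric] by (rule LIM_zero_cancel)
qed

text \<open>A crude bound that degenerates as d tends to 0, for functions of which only square
  integrability is known: \<open>V\<close> and the time derivative \<open>D\<close>. It is used at
  fixed d only.\<close>

lemma diffquot_l2_bound:
  assumes f: "square_integrable f" and d: "0 < d"
  shows "square_integrable (diffquot d f)" "l2norm (diffquot d f) \<le> 2 / d * l2norm f"
proof -
  note fs = square_integrable_shift[OF f, of d]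
  have e: "diffquot d f = (\<lambda>x. 1 / d * f (x + d) + (- 1 / d) * f x)"
    by (simp add: diffquot_def fun_eq_iff diff_divide_distrib)
  note s = square_integrable_cmult[OF fs(1), of "1 / d"] square_integrable_cmult[OF f, of "- 1 / d"]
  show "square_integrable (diffquot d f)" unfolding e by (rule square_integrable_add[OF s])
  have "l2norm (\<lambda>x. f (x + d)) = l2norm f" using fs(2) by (simp add: l2norm_def)
  then show "l2norm (diffquot d f) \<le> 2 / d * l2norm f"
    unfolding e using l2norm_triangle[OF s] d
    by (simp only: l2norm_cmult) (simp add: field_simps)
qed

lemma diffquot_has_derivative:
  assumes "\<And>x. (u has_real_derivative v x) (at x)"
  shows "(diffquot d u has_real_derivative diffquot d v x) (at x)"
proof -
  have "((\<lambda>x. u (x + d)) has_real_derivative v (x + d) * 1) (at x)"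
    by (rule DERIV_chain2[OF assms]) (auto intro!: derivative_eq_intros)
  from DERIV_cdivide[OF DERIV_diff[OF this assms[of x]], of d]
  show ?thesis by (simp add: diffquot_def[abs_def])
qed

lemma diffquot_continuous:
  assumes "continuous_on UNIV f"
  shows "continuous_on UNIV (diffquot d f)"
proof -
  have "continuous_on UNIV (\<lambda>x. f (x + d))"
    by (rule continuous_on_compose2[OF assms]) (auto intro!: continuous_intros)
  then have "continuous_on UNIV (\<lambda>x. (f (x + d) - f x) * inverse d)"
    using assms by (intro continuous_intros)
  then show ?thesis by (simp add: diffquot_def[abs_def] divide_inverse)
qed

lemma AE_lborel_shift:
  fixes f g :: "real \<Rightarrow> real"
  assumes "AE x in lborel. f x = g x" and [measurable]: "f \<in> borel_measurable borel" "g \<in> borel_measurable borel"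
  shows "AE x in lborel. f (x + d) = g (x + d)"
proof -
  have "AE x in lborel. f (d + 1 * x) = g (d + 1 * x)"
    by (rule AE_borel_affine[where P = "\<lambda>x. f x = g x"]) (use assms(1) in auto)
  then show ?thesis by (simp add: add.commute)
qed

section \<open>The equation for the classical representative\<close>

lemma h_abs_le:
  assumes "\<bar>r\<bar> \<le> M"
  shows "\<bar>h \<alpha> \<beta> \<gamma> \<Gamma> r\<bar> \<le> (\<bar>\<alpha> + \<Gamma>\<bar> + \<bar>\<beta>\<bar> / 3 * M\<^sup>2 + \<bar>\<gamma>\<bar> / 4 * M ^ 3) * \<bar>r\<bar>"
proof -
  have M: "0 \<le> M" using assms by linarith
  have r: "\<bar>r\<bar> ^ k \<le> M ^ k" for k using assms by (intro power_mono) auto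
  have "h \<alpha> \<beta> \<gamma> \<Gamma> r = ((\<alpha> + \<Gamma>) + \<beta> / 3 * r\<^sup>2 + \<gamma> / 4 * r ^ 3) * r"
    by (simp add: h_def algebra_simps power2_eq_square power3_eq_cube power4_eq_xxxx)
  then have "\<bar>h \<alpha> \<beta> \<gamma> \<Gamma> r\<bar> = \<bar>(\<alpha> + \<Gamma>) + \<beta> / 3 * r\<^sup>2 + \<gamma> / 4 * r ^ 3\<bar> * \<bar>r\<bar>"
    by (simp add: abs_mult)
  also have "\<bar>(\<alpha> + \<Gamma>) + \<beta> / 3 * r\<^sup>2 + \<gamma> / 4 * r ^ 3\<bar> \<le> \<bar>\<alpha> + \<Gamma>\<bar> + \<bar>\<beta> / 3 * r\<^sup>2\<bar> + \<bar>\<gamma> / 4 * r ^ 3\<bar>"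
    by linarith
  also have "\<dots> \<le> \<bar>\<alpha> + \<Gamma>\<bar> + \<bar>\<beta>\<bar> / 3 * M\<^sup>2 + \<bar>\<gamma>\<bar> / 4 * M ^ 3"
    using r[of 2] r[of 3] by (intro add_mono) (auto simp: abs_mult power_abs intro!: mult_left_mono divide_right_mono)
  finally show ?thesis by (simp add: mult_right_mono)
qed

definition nonlocal_term ::
    "real \<Rightarrow> real \<Rightarrow> real \<Rightarrow> real \<Rightarrow> (real \<Rightarrow> real) \<Rightarrow> (real \<Rightarrow> real) \<Rightarrow> real \<Rightarrow> real" where
  "nonlocal_term \<alpha> \<beta> \<gamma> \<Gamma> u v y = h \<alpha> \<beta> \<gamma> \<Gamma> (u y) - (u y)\<^sup>2 - 1 / 2 * (v y)\<^sup>2"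

text \<open>What remains of a solution once the Sobolev spaces are left behind: the C^1
  representative \<open>U\<close>, its slope \<open>V\<close> and the time derivative
  \<open>D\<close>, which is merely square integrable. One \<open>M\<close> bounds the sup norms and
  the L2 norms of \<open>U\<close> and \<open>V\<close> at all times. The equation is imposed for t
  > 0 only, as in \<open>solution_on\<close>.\<close>

locale evolution =
  fixes \<alpha> \<beta> \<gamma> \<Gamma> lam T M :: real and U V D :: "real \<Rightarrow> real \<Rightarrow> real"
  assumes T: "0 < T" and lam: "0 < lam"
    and U_deriv: "\<And>t x. t \<in> {0..T} \<Longrightarrow> (U t has_real_derivative V t x) (at x)"
    and V_cont: "\<And>t. t \<in> {0..T} \<Longrightarrow> continuous_on UNIV (V t)"
    and U_si: "\<And>t. t \<in> {0..T} \<Longrightarrow> square_integrable (U t)"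
    and V_si: "\<And>t. t \<in> {0..T} \<Longrightarrow> square_integrable (V t)"
    and U_le: "\<And>t x. t \<in> {0..T} \<Longrightarrow> \<bar>U t x\<bar> \<le> M"
    and V_le: "\<And>t x. t \<in> {0..T} \<Longrightarrow> \<bar>V t x\<bar> \<le> M"
    and U_l2: "\<And>t. t \<in> {0..T} \<Longrightarrow> l2norm (U t) \<le> M"
    and V_l2: "\<And>t. t \<in> {0..T} \<Longrightarrow> l2norm (V t) \<le> M"
    and D_si: "\<And>t. t \<in> {0..T} \<Longrightarrow> square_integrable (D t)"
    and D_lim: "\<And>t. t \<in> {0..T} \<Longrightarrow>
      ((\<lambda>\<tau>. l2norm (\<lambda>x. (U \<tau> x - U t x) / (\<tau> - t) - D t x)) \<longlongrightarrow> 0) (at t within {0..T})"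
    and D_eq: "\<And>t. t \<in> {0<..T} \<Longrightarrow> AE x in lborel. D t x =
      dLambda_inv2 (nonlocal_term \<alpha> \<beta> \<gamma> \<Gamma> (U t) (V t)) x - (U t x + \<Gamma>) * V t x - lam * U t x"
begin

abbreviation "G t \<equiv> nonlocal_term \<alpha> \<beta> \<gamma> \<Gamma> (U t) (V t)"

definition "CG = \<bar>\<alpha> + \<Gamma>\<bar> + \<bar>\<beta>\<bar> / 3 * M\<^sup>2 + \<bar>\<gamma>\<bar> / 4 * M ^ 3 + 2 * M"

lemma M_nonneg: "0 \<le> M" using U_le[of 0 0] T by (auto intro: order_trans[OF abs_ge_zero])

lemma U_cont: "t \<in> {0..T} \<Longrightarrow> continuous_on UNIV (U t)"
  using U_deriv by (meson DERIV_isCont continuous_at_imp_continuous_on)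

lemma measurable_UVD:
  assumes "t \<in> {0..T}"
  shows "U t \<in> borel_measurable borel" "V t \<in> borel_measurable borel" "D t \<in> borel_measurable borel"
  using U_si[OF assms] V_si[OF assms] D_si[OF assms] by (auto dest: square_integrable_measurable)

lemma G_cont: "t \<in> {0..T} \<Longrightarrow> continuous_on UNIV (G t)"
  unfolding nonlocal_term_def[abs_def] h_def
  by (intro continuous_intros U_cont V_cont)

lemma G_abs_le:
  assumes t: "t \<in> {0..T}"
  shows "\<bar>G t x\<bar> \<le> CG * (\<bar>U t x\<bar> + \<bar>V t x\<bar>)"
proof -
  let ?c = "\<bar>\<alpha> + \<Gamma>\<bar> + \<bar>\<beta>\<bar> / 3 * M\<^sup>2 + \<bar>\<gamma>\<bar> / 4 * M ^ 3"
  have c0: "0 \<le> ?c" using M_nonneg by simp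
  have "\<bar>h \<alpha> \<beta> \<gamma> \<Gamma> (U t x)\<bar> \<le> ?c * \<bar>U t x\<bar>" by (rule h_abs_le[OF U_le[OF t]])
  moreover have "(U t x)\<^sup>2 \<le> M * \<bar>U t x\<bar>"
    using U_le[OF t, of x] mult_right_mono[of "\<bar>U t x\<bar>" M "\<bar>U t x\<bar>"] by (simp add: power2_eq_square)
  moreover have "(V t x)\<^sup>2 \<le> M * \<bar>V t x\<bar>"
    using V_le[OF t, of x] mult_right_mono[of "\<bar>V t x\<bar>" M "\<bar>V t x\<bar>"] by (simp add: power2_eq_square)
  moreover have "\<bar>G t x\<bar> \<le> \<bar>h \<alpha> \<beta> \<gamma> \<Gamma> (U t x)\<bar> + (U t x)\<^sup>2 + (V t x)\<^sup>2"
    unfolding nonlocal_term_def using zero_le_power2[of "U t x"] zero_le_power2[of "V t x"] by linarith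
  ultimately have "\<bar>G t x\<bar> \<le> (?c + M) * \<bar>U t x\<bar> + M * \<bar>V t x\<bar>"
    by (simp add: distrib_right)
  also have "\<dots> \<le> CG * \<bar>U t x\<bar> + CG * \<bar>V t x\<bar>"
    using M_nonneg c0 by (intro add_mono mult_right_mono) (auto simp: CG_def)
  finally show ?thesis by (simp add: distrib_left)
qed

lemma CG_nonneg: "0 \<le> CG" using M_nonneg by (simp add: CG_def)

lemma G_bdd: "t \<in> {0..T} \<Longrightarrow> \<bar>G t x\<bar> \<le> CG * (2 * M)"
  using U_le[of t x] V_le[of t x] CG_nonneg
  by (intro order_trans[OF G_abs_le] mult_left_mono) auto

lemma bounded_continuous_G: "t \<in> {0..T} \<Longrightarrow> bounded_continuous (G t) (CG * (2 * M))"
  by unfold_locales (auto intro: G_cont G_bdd)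

lemma G_si: assumes t: "t \<in> {0..T}" shows "square_integrable (G t)" "l2norm (G t) \<le> CG * (2 * M)"
proof -
  note [measurable] = measurable_UVD[OF t]
  have s: "square_integrable (\<lambda>x. \<bar>U t x\<bar>)" "square_integrable (\<lambda>x. \<bar>V t x\<bar>)"
    by (rule square_integrable_bound[OF _ U_si[OF t], of _ 1] square_integrable_bound[OF _ V_si[OF t], of _ 1]; simp)+
  note sa = square_integrable_add[OF s]
  have m: "G t \<in> borel_measurable borel" using G_cont[OF t] by (rule borel_measurable_continuous_onI)
  have le: "\<bar>G t x\<bar> \<le> \<bar>CG * (\<bar>U t x\<bar> + \<bar>V t x\<bar>)\<bar>" for x
    using G_abs_le[OF t, of x] by linarith
  show "square_integrable (G t)"
    by (rule square_integrable_bound[OF m square_integrable_cmult[OF sa, of CG], of 1]) (use le in simp)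
  have "l2norm (G t) \<le> l2norm (\<lambda>x. CG * (\<bar>U t x\<bar> + \<bar>V t x\<bar>))"
    by (rule l2norm_mono[OF square_integrable_cmult[OF sa] m le])
  also have "\<dots> = CG * l2norm (\<lambda>x. \<bar>U t x\<bar> + \<bar>V t x\<bar>)"
    using CG_nonneg by (simp add: l2norm_cmult)
  also have "l2norm (\<lambda>x. \<bar>U t x\<bar> + \<bar>V t x\<bar>) \<le> 2 * M"
    using l2norm_triangle[OF s] U_l2[OF t] V_l2[OF t] by (simp add: l2norm_def)
  then have "CG * l2norm (\<lambda>x. \<bar>U t x\<bar> + \<bar>V t x\<bar>) \<le> CG * (2 * M)"
    using CG_nonneg by (intro mult_left_mono)
  finally show "l2norm (G t) \<le> CG * (2 * M)" .
qed

abbreviation "W t \<equiv> Lambda_inv2 (G t)"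
abbreviation "P t \<equiv> dLambda_inv2 (G t)"

lemma Lambda_inv2_G_facts:
  assumes t: "t \<in> {0..T}"
  shows "(W t has_real_derivative P t x) (at x)" "(P t has_real_derivative W t x - G t x) (at x)"
    "continuous_on UNIV (W t)" "continuous_on UNIV (P t)" "continuous_on UNIV (\<lambda>x. W t x - G t x)"
    "square_integrable (W t)" "square_integrable (P t)" "square_integrable (\<lambda>x. W t x - G t x)"
    "\<bar>W t x\<bar> \<le> CG * (2 * M)" "l2norm (\<lambda>x. W t x - G t x) \<le> CG * (2 * M)"
proof -
  interpret bounded_continuous "G t" "CG * (2 * M)" by (rule bounded_continuous_G[OF t])
  note si = Lambda_inv2_square_integrable[OF G_si(1)[OF t]]
  show "(W t has_real_derivative P t x) (at x)" "(P t has_real_derivative W t x - G t x) (at x)"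
    "continuous_on UNIV (W t)" "continuous_on UNIV (P t)"
    by (rule Lambda_inv2_has_derivative dLambda_inv2_has_derivative continuous_on_Lambda_inv2 continuous_on_dLambda_inv2)+
  show "continuous_on UNIV (\<lambda>x. W t x - G t x)"
    by (intro continuous_intros continuous_on_Lambda_inv2 cont)
  show "square_integrable (W t)" "square_integrable (P t)" by (rule si)+
  show "square_integrable (\<lambda>x. W t x - G t x)" by (rule square_integrable_diff[OF si(1) G_si(1)[OF t]])
  show "\<bar>W t x\<bar> \<le> CG * (2 * M)" by (rule Lambda_inv2_bounded)
  have "l2norm (\<lambda>x. W t x - G t x) = l2norm (\<lambda>x. G t x - W t x)"
    by (simp add: l2norm_def power2_commute)
  also have "\<dots> \<le> l2norm (G t)" by (rule l2norm_diff_Lambda_inv2_le(2)[OF G_si(1)[OF t]])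
  finally show "l2norm (\<lambda>x. W t x - G t x) \<le> CG * (2 * M)" using G_si(2)[OF t] by linarith
qed

text \<open>Right-hand sides of the evolution of \<open>\<integral> w ^ (n + 2)\<close>, for \<open>w\<close> the difference quotient of \<open>U t\<close>,
  and of its limit \<open>\<integral> V ^ (n + 2)\<close>.\<close>

definition rhs_diffquot :: "nat \<Rightarrow> real \<Rightarrow> real \<Rightarrow> real" where
  "rhs_diffquot n d t =
     (LBINT x. V t (x + d) * diffquot d (U t) x ^ n * diffquot d (U t) x * diffquot d (U t) x)
     - real (n + 2) * (LBINT x. V t x * diffquot d (U t) x ^ n * diffquot d (U t) x * diffquot d (U t) x)
     - lam * real (n + 2) * (LBINT x. diffquot d (U t) x ^ n * diffquot d (U t) x * diffquot d (U t) x)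
     + real (n + 2) * (LBINT x. diffquot d (U t) x ^ n * diffquot d (U t) x * diffquot d (P t) x)"

definition rhs_slope :: "nat \<Rightarrow> real \<Rightarrow> real" where
  "rhs_slope n t =
     (LBINT x. V t x * V t x ^ n * V t x * V t x)
     - real (n + 2) * (LBINT x. V t x * V t x ^ n * V t x * V t x)
     - lam * real (n + 2) * (LBINT x. V t x ^ n * V t x * V t x)
     + real (n + 2) * (LBINT x. V t x ^ n * V t x * (W t x - G t x))"

section \<open>Evolution of the difference quotients and its limit\<close>

lemma diffquot_U_facts:
  assumes t: "t \<in> {0..T}" and d: "0 < d"
  shows "\<bar>diffquot d (U t) x\<bar> \<le> M" "square_integrable (diffquot d (U t))" "l2norm (diffquot d (U t)) \<le> M"
    "continuous_on UNIV (diffquot d (U t))"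
    "square_integrable (diffquot d (P t))" "l2norm (diffquot d (P t)) \<le> CG * (2 * M)"
    "continuous_on UNIV (diffquot d (P t))"
proof -
  note U = diffquot_square_integrable[OF d U_deriv[OF t] V_cont[OF t] V_si[OF t]]
  note P = diffquot_square_integrable[OF d Lambda_inv2_G_facts(2,5,8)[OF t]]
  show "\<bar>diffquot d (U t) x\<bar> \<le> M" by (rule diffquot_abs_le[OF d U_deriv[OF t] V_le[OF t]])
  show "square_integrable (diffquot d (U t))" by (rule U)
  show "l2norm (diffquot d (U t)) \<le> M" using U(2) V_l2[OF t] by linarith
  show "continuous_on UNIV (diffquot d (U t))" by (rule diffquot_continuous[OF U_cont[OF t]])
  show "square_integrable (diffquot d (P t))" by (rule P)
  show "l2norm (diffquot d (P t)) \<le> CG * (2 * M)" using P(2) Lambda_inv2_G_facts(10)[OF t] by linarith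
  show "continuous_on UNIV (diffquot d (P t))" by (rule diffquot_continuous[OF Lambda_inv2_G_facts(4)[OF t]])
qed

text \<open>The discrete product rule splits the quotient of (U + \<Gamma>) V exactly into (U(x + d)
  + \<Gamma>) w' + w V(x), where w' is the quotient of V. The transport term is integrated by parts
  and produces V(x + d) w^(n + 2) in place of any second derivative of U.\<close>

lemma integral_diffquot_D:
  assumes t: "t \<in> {0<..T}" and d: "0 < d"
  shows "real (n + 2) * (LBINT x. diffquot d (U t) x ^ n * diffquot d (U t) x * diffquot d (D t) x) = rhs_diffquot n d t"
proof -
  have t': "t \<in> {0..T}" using t by auto
  note [measurable] = measurable_UVD[OF t']
  define w where "w = diffquot d (U t)"
  define w' where "w' = diffquot d (V t)"
  define q where "q = diffquot d (P t)"
  note wf = diffquot_U_facts[OF t' d, folded w_def q_def]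
  have w_der: "(w has_real_derivative w' x) (at x)" for x
    unfolding w_def w'_def by (rule diffquot_has_derivative[OF U_deriv[OF t']])
  have w'_cont: "continuous_on UNIV w'" unfolding w'_def by (rule diffquot_continuous[OF V_cont[OF t']])
  have w'_si: "square_integrable w'" unfolding w'_def by (rule diffquot_l2_bound[OF V_si[OF t'] d])
  have [measurable]: "w \<in> borel_measurable borel" "w' \<in> borel_measurable borel" "q \<in> borel_measurable borel"
    using wf w'_si by (auto dest: square_integrable_measurable)
  have [measurable]: "P t \<in> borel_measurable borel" using Lambda_inv2_G_facts(7)[OF t'] by (rule square_integrable_measurable)
  have wn: "\<bar>w x ^ n\<bar> \<le> M ^ n" for x using wf(1)[of x] by (auto simp: power_abs intro: power_mono)
  have ae: "AE x in lborel. diffquot d (D t) x = q x - (U t (x + d) + \<Gamma>) * w' x - w x * V t x - lam * w x"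
    using D_eq[OF t] AE_lborel_shift[OF D_eq[OF t], of d]
  proof (rule eventually_elim2)
    show "(\<lambda>x. D t x) \<in> borel_measurable borel"
      "(\<lambda>x. P t x - (U t x + \<Gamma>) * V t x - lam * U t x) \<in> borel_measurable borel"
      by measurable
    fix x
    assume e: "D t x = P t x - (U t x + \<Gamma>) * V t x - lam * U t x"
      "D t (x + d) = P t (x + d) - (U t (x + d) + \<Gamma>) * V t (x + d) - lam * U t (x + d)"
    show "diffquot d (D t) x = q x - (U t (x + d) + \<Gamma>) * w' x - w x * V t x - lam * w x"
      unfolding q_def w_def w'_def diffquot_def divide_inverse e by (simp add: algebra_simps)
  qed
  have i: "integrable lborel (\<lambda>x. w x ^ n * w x * q x)"
    "integrable lborel (\<lambda>x. (U t (x + d) + \<Gamma>) * w x ^ n * w x * w' x)"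
    "integrable lborel (\<lambda>x. V t x * w x ^ n * w x * w x)"
    "integrable lborel (\<lambda>x. V t (x + d) * w x ^ n * w x * w x)"
    "integrable lborel (\<lambda>x. w x ^ n * w x * w x)"
    "integrable lborel (\<lambda>x. (U t (x + d) + \<Gamma>) * w x ^ n * w x * w x)"
  proof -
    have Ub: "\<bar>(U t (x + d) + \<Gamma>) * w x ^ n\<bar> \<le> (M + \<bar>\<Gamma>\<bar>) * M ^ n" for x
      unfolding abs_mult using U_le[OF t', of "x + d"] wn[of x] by (intro mult_mono) auto
    have Vb: "\<bar>V t y * w x ^ n\<bar> \<le> M * M ^ n" for x y
      unfolding abs_mult using V_le[OF t', of y] wn[of x] M_nonneg by (intro mult_mono) auto
    show "integrable lborel (\<lambda>x. w x ^ n * w x * q x)" "integrable lborel (\<lambda>x. w x ^ n * w x * w x)"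
      by (rule integral_triple_bound(1)[OF _ wn wf(2)]; (rule wf)?; measurable)+
    show "integrable lborel (\<lambda>x. (U t (x + d) + \<Gamma>) * w x ^ n * w x * w' x)"
      by (rule integral_triple_bound(1)[OF _ Ub wf(2) w'_si]) measurable
    show "integrable lborel (\<lambda>x. (U t (x + d) + \<Gamma>) * w x ^ n * w x * w x)"
      by (rule integral_triple_bound(1)[OF _ Ub wf(2,2)]) measurable
    show "integrable lborel (\<lambda>x. V t x * w x ^ n * w x * w x)"
      by (rule integral_triple_bound(1)[OF _ Vb wf(2,2)]) measurable
    show "integrable lborel (\<lambda>x. V t (x + d) * w x ^ n * w x * w x)"
      by (rule integral_triple_bound(1)[OF _ Vb wf(2,2)]) measurable
  qed
  have parts: "(LBINT x. V t (x + d) * w x ^ n * w x * w x + real (n + 2) * ((U t (x + d) + \<Gamma>) * w x ^ n * w x * w' x)) = 0"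
  proof (rule integral_deriv_eq_0[where F = "\<lambda>x. (U t (x + d) + \<Gamma>) * w x ^ (n + 2)"])
    show "((\<lambda>x. (U t (x + d) + \<Gamma>) * w x ^ (n + 2)) has_real_derivative
        V t (x + d) * w x ^ n * w x * w x + real (n + 2) * ((U t (x + d) + \<Gamma>) * w x ^ n * w x * w' x)) (at x)" for x
    proof -
      have 1: "((\<lambda>x. U t (x + d) + \<Gamma>) has_real_derivative V t (x + d) * 1) (at x)"
      proof -
        have "((\<lambda>x. U t (x + d)) has_real_derivative V t (x + d) * 1) (at x)"
          by (rule DERIV_chain2[OF U_deriv[OF t']]) (auto intro!: derivative_eq_intros)
        from DERIV_add[OF this DERIV_const[of \<Gamma>]] show ?thesis by simp
      qed
      have 2: "((\<lambda>x. w x ^ (n + 2)) has_real_derivative real (n + 2) * w x ^ (n + 2 - 1) * w' x) (at x)"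
        using DERIV_power[OF w_der, of "n + 2"] by (simp add: mult_ac)
      show ?thesis using DERIV_mult[OF 1 2] by (simp add: power2_eq_square algebra_simps)
    qed
    show "continuous_on UNIV (\<lambda>x. V t (x + d) * w x ^ n * w x * w x + real (n + 2) * ((U t (x + d) + \<Gamma>) * w x ^ n * w x * w' x))"
      by (intro continuous_intros wf w'_cont continuous_on_compose2[OF U_cont[OF t']] continuous_on_compose2[OF V_cont[OF t']]) auto
    show "integrable lborel (\<lambda>x. (U t (x + d) + \<Gamma>) * w x ^ (n + 2))"
      using i(6) by (simp add: power2_eq_square mult_ac)
    show "integrable lborel (\<lambda>x. V t (x + d) * w x ^ n * w x * w x + real (n + 2) * ((U t (x + d) + \<Gamma>) * w x ^ n * w x * w' x))"
      by (intro Bochner_Integration.integrable_add integrable_mult_right i)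
  qed
  then have parts': "real (n + 2) * (LBINT x. (U t (x + d) + \<Gamma>) * w x ^ n * w x * w' x) = - (LBINT x. V t (x + d) * w x ^ n * w x * w x)"
    by (subst (asm) Bochner_Integration.integral_add) (auto intro!: integrable_mult_right i)
  have [measurable]: "diffquot d (D t) \<in> borel_measurable borel"
    using diffquot_l2_bound(1)[OF D_si[OF t'] d] by (rule square_integrable_measurable)
  have "(LBINT x. w x ^ n * w x * diffquot d (D t) x) = (LBINT x. w x ^ n * w x * q x
      - (U t (x + d) + \<Gamma>) * w x ^ n * w x * w' x - V t x * w x ^ n * w x * w x - lam * (w x ^ n * w x * w x))"
  proof (rule integral_cong_AE)
    show "AE x in lborel. w x ^ n * w x * diffquot d (D t) x = w x ^ n * w x * q x
      - (U t (x + d) + \<Gamma>) * w x ^ n * w x * w' x - V t x * w x ^ n * w x * w x - lam * (w x ^ n * w x * w x)"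
      using ae
    proof eventually_elim
      case (elim x)
      show ?case unfolding elim by (simp add: algebra_simps)
    qed
  qed measurable
  also have "\<dots> = (LBINT x. w x ^ n * w x * q x) - (LBINT x. (U t (x + d) + \<Gamma>) * w x ^ n * w x * w' x)
      - (LBINT x. V t x * w x ^ n * w x * w x) - lam * (LBINT x. w x ^ n * w x * w x)"
    using i by simp
  finally have e: "(LBINT x. w x ^ n * w x * diffquot d (D t) x) = (LBINT x. w x ^ n * w x * q x)
      - (LBINT x. (U t (x + d) + \<Gamma>) * w x ^ n * w x * w' x)
      - (LBINT x. V t x * w x ^ n * w x * w x) - lam * (LBINT x. w x ^ n * w x * w x)" .
  show ?thesis
    unfolding rhs_diffquot_def w_def[symmetric] q_def[symmetric] e
    using parts' by (simp add: algebra_simps)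
qed

text \<open>At fixed d the difference quotient is a bounded operator on L2, so that
  differentiability of the path \<open>U\<close> in L2 carries over to it.\<close>

lemma diffquot_power_derivative:
  assumes t: "t \<in> {0..T}" and d: "0 < d"
  shows "((\<lambda>\<tau>. LBINT x. diffquot d (U \<tau>) x ^ (n + 2)) has_real_derivative
      real (n + 2) * (LBINT x. diffquot d (U t) x ^ n * diffquot d (U t) x * diffquot d (D t) x)) (at t within {0..T})"
proof (rule integral_power_has_derivative[OF t])
  show "square_integrable (diffquot d (D t))" by (rule diffquot_l2_bound[OF D_si[OF t] d])
  show "((\<lambda>\<tau>. l2norm (\<lambda>x. (diffquot d (U \<tau>) x - diffquot d (U t) x) / (\<tau> - t) - diffquot d (D t) x)) \<longlongrightarrow> 0)
    (at t within {0..T})"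
  proof (rule Lim_null_comparison)
    show "((\<lambda>\<tau>. 2 / d * l2norm (\<lambda>x. (U \<tau> x - U t x) / (\<tau> - t) - D t x)) \<longlongrightarrow> 0) (at t within {0..T})"
      using tendsto_mult_left[OF D_lim[OF t], of "2 / d"] by simp
    show "\<forall>\<^sub>F \<tau> in at t within {0..T}. norm (l2norm (\<lambda>x. (diffquot d (U \<tau>) x - diffquot d (U t) x) / (\<tau> - t) - diffquot d (D t) x))
        \<le> 2 / d * l2norm (\<lambda>x. (U \<tau> x - U t x) / (\<tau> - t) - D t x)"
      unfolding eventually_at_filter
    proof (intro always_eventually allI impI)
      fix \<tau> assume \<tau>: "\<tau> \<noteq> t" "\<tau> \<in> {0..T}"
      have "square_integrable (\<lambda>x. 1 / (\<tau> - t) * (U \<tau> x - U t x) - D t x)"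
        by (intro square_integrable_diff square_integrable_cmult U_si D_si t \<tau>)
      then have "square_integrable (\<lambda>x. (U \<tau> x - U t x) / (\<tau> - t) - D t x)" by simp
      moreover have "(\<lambda>x. (diffquot d (U \<tau>) x - diffquot d (U t) x) / (\<tau> - t) - diffquot d (D t) x)
          = diffquot d (\<lambda>x. (U \<tau> x - U t x) / (\<tau> - t) - D t x)"
        unfolding diffquot_def divide_inverse fun_eq_iff by (simp add: algebra_simps)
      ultimately show "norm (l2norm (\<lambda>x. (diffquot d (U \<tau>) x - diffquot d (U t) x) / (\<tau> - t) - diffquot d (D t) x))
        \<le> 2 / d * l2norm (\<lambda>x. (U \<tau> x - U t x) / (\<tau> - t) - D t x)"
        using diffquot_l2_bound(2)[OF _ d] by simp
    qed
  qed
qed (use diffquot_U_facts[OF _ d] in auto)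

text \<open>The two rates are required to agree for t > 0 only, where the equation holds; the
  fundamental theorem for the interior of an interval tolerates the missing endpoint.\<close>

lemma has_integral_of_derivative_within:
  fixes f f' :: "real \<Rightarrow> real"
  assumes der: "\<And>t. t \<in> {0..T} \<Longrightarrow> (f has_real_derivative g t) (at t within {0..T})"
    and eq: "\<And>t. t \<in> {0<..T} \<Longrightarrow> g t = f' t" and t: "t \<in> {0..T}"
  shows "(f' has_integral (f t - f 0)) {0..t}"
proof (rule fundamental_theorem_of_calculus_interior)
  have "continuous_on {0..T} f"
    using der by (meson DERIV_continuous continuous_on_eq_continuous_within)
  then show "continuous_on {0..t} f" by (rule continuous_on_subset) (use t in auto)
  fix \<tau> assume \<tau>: "\<tau> \<in> {0<..<t}"
  then have "(f has_real_derivative g \<tau>) (at \<tau> within {0..T})" using t by (intro der) auto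
  moreover have "at \<tau> within {0..T} = at \<tau>"
    using \<tau> t by (intro at_within_Icc_at) auto
  ultimately show "(f has_vector_derivative f' \<tau>) (at \<tau>)"
    using eq[of \<tau>] \<tau> t by (simp add: has_real_derivative_iff_has_vector_derivative)
qed (use t in auto)

lemma diffquot_power_has_integral:
  assumes "t \<in> {0..T}" "0 < d"
  shows "((rhs_diffquot n d) has_integral
    ((LBINT x. diffquot d (U t) x ^ (n + 2)) - (LBINT x. diffquot d (U 0) x ^ (n + 2)))) {0..t}"
  by (rule has_integral_of_derivative_within[OF diffquot_power_derivative integral_diffquot_D])
    (use assms in auto)

text \<open>The right-hand side is free of d and t, so it dominates as d tends to 0.\<close>

lemma rhs_diffquot_bound:
  assumes t: "t \<in> {0..T}" and d: "0 < d"
  shows "\<bar>rhs_diffquot n d t\<bar> \<le> M * M ^ n * M * M + real (n + 2) * (M * M ^ n * M * M)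
    + lam * real (n + 2) * (M ^ n * M * M) + real (n + 2) * (M ^ n * M * (CG * (2 * M)))"
proof -
  note [measurable] = measurable_UVD[OF t]
  define w where "w = diffquot d (U t)"
  define q where "q = diffquot d (P t)"
  note wf = diffquot_U_facts[OF t d, folded w_def q_def]
  have [measurable]: "w \<in> borel_measurable borel" "q \<in> borel_measurable borel"
    using wf by (auto dest: square_integrable_measurable)
  have wn: "\<bar>w x ^ n\<bar> \<le> M ^ n" for x using wf(1)[of x] by (auto simp: power_abs intro: power_mono)
  have Vb: "\<bar>V t y * w x ^ n\<bar> \<le> M * M ^ n" for x y
    unfolding abs_mult using V_le[OF t, of y] wn[of x] M_nonneg by (intro mult_mono) auto
  have m: "0 \<le> M * M ^ n" "0 \<le> M ^ n" using M_nonneg by auto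
  have A1: "\<bar>LBINT x. V t (x + d) * w x ^ n * w x * w x\<bar> \<le> M * M ^ n * M * M"
  proof (rule order_trans[OF integral_triple_bound(2)[OF _ Vb wf(2,2)]])
    show "M * M ^ n * l2norm w * l2norm w \<le> M * M ^ n * M * M"
      using wf(3) m M_nonneg by (intro mult_mono mult_nonneg_nonneg) auto
  qed measurable
  have A2: "\<bar>LBINT x. V t x * w x ^ n * w x * w x\<bar> \<le> M * M ^ n * M * M"
  proof (rule order_trans[OF integral_triple_bound(2)[OF _ Vb wf(2,2)]])
    show "M * M ^ n * l2norm w * l2norm w \<le> M * M ^ n * M * M"
      using wf(3) m M_nonneg by (intro mult_mono mult_nonneg_nonneg) auto
  qed measurable
  have A3: "\<bar>LBINT x. w x ^ n * w x * w x\<bar> \<le> M ^ n * M * M"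
  proof (rule order_trans[OF integral_triple_bound(2)[OF _ wn wf(2,2)]])
    show "M ^ n * l2norm w * l2norm w \<le> M ^ n * M * M"
      using wf(3) m M_nonneg by (intro mult_mono mult_nonneg_nonneg) auto
  qed measurable
  have A4: "\<bar>LBINT x. w x ^ n * w x * q x\<bar> \<le> M ^ n * M * (CG * (2 * M))"
  proof (rule order_trans[OF integral_triple_bound(2)[OF _ wn wf(2,5)]])
    show "M ^ n * l2norm w * l2norm q \<le> M ^ n * M * (CG * (2 * M))"
      using wf(3,6) m M_nonneg by (intro mult_mono mult_nonneg_nonneg) auto
  qed measurable
  have "\<bar>rhs_diffquot n d t\<bar> \<le> \<bar>LBINT x. V t (x + d) * w x ^ n * w x * w x\<bar>
      + \<bar>real (n + 2) * (LBINT x. V t x * w x ^ n * w x * w x)\<bar>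
      + \<bar>lam * real (n + 2) * (LBINT x. w x ^ n * w x * w x)\<bar>
      + \<bar>real (n + 2) * (LBINT x. w x ^ n * w x * q x)\<bar>"
    unfolding rhs_diffquot_def w_def[symmetric] q_def[symmetric] by linarith
  also have "\<dots> \<le> M * M ^ n * M * M + real (n + 2) * (M * M ^ n * M * M)
    + lam * real (n + 2) * (M ^ n * M * M) + real (n + 2) * (M ^ n * M * (CG * (2 * M)))"
    unfolding abs_mult[of "real (n + 2)"] abs_mult[of "lam * real (n + 2)"]
    using A1 A2 A3 A4 lam by (intro add_mono mult_mono) auto
  finally show ?thesis .
qed

text \<open>In each integral the bounded factor converges pointwise and the other two in L2; the
  last integral uses that \<open>P t\<close> has the continuous, square integrable derivative
  \<open>W t - G t\<close>.\<close>

lemma rhs_diffquot_tendsto: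
  assumes t: "t \<in> {0..T}" and d: "d \<longlonglongrightarrow> 0" "\<And>k::nat. 0 < d k"
  shows "(\<lambda>k. rhs_diffquot n (d k) t) \<longlonglongrightarrow> rhs_slope n t"
    and "(\<lambda>k. LBINT x. diffquot (d k) (U t) x ^ (n + 2)) \<longlonglongrightarrow> (LBINT x. V t x ^ (n + 2))"
proof -
  note [measurable] = measurable_UVD[OF t]
  define w where "w k = diffquot (d k) (U t)" for k
  define q where "q k = diffquot (d k) (P t)" for k
  note wf = diffquot_U_facts[OF t d(2), folded w_def q_def]
  have [measurable]: "w k \<in> borel_measurable borel" "q k \<in> borel_measurable borel" for k
    using wf by (auto dest: square_integrable_measurable)
  have wn: "\<bar>w k x ^ n\<bar> \<le> M ^ n" for k x using wf(1)[of k x] by (auto simp: power_abs intro: power_mono)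
  have Vb: "\<bar>V t y * w k x ^ n\<bar> \<le> M * M ^ n" for k x y
    unfolding abs_mult using V_le[OF t, of y] wn[of k x] M_nonneg by (intro mult_mono) auto
  have w_lim: "(\<lambda>k. w k x) \<longlonglongrightarrow> V t x" for x
    unfolding w_def by (rule diffquot_tendsto[OF U_deriv[OF t] d])
  have w_l2: "(\<lambda>k. l2norm (\<lambda>x. w k x - V t x)) \<longlonglongrightarrow> 0"
    unfolding w_def by (rule diffquot_l2norm_tendsto[OF U_deriv[OF t] V_cont[OF t] V_si[OF t] d])
  have q_l2: "(\<lambda>k. l2norm (\<lambda>x. q k x - (W t x - G t x))) \<longlonglongrightarrow> 0"
    unfolding q_def by (rule diffquot_l2norm_tendsto[OF Lambda_inv2_G_facts(2,5,8)[OF t] d])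
  have V_lim: "(\<lambda>k. V t (x + d k)) \<longlonglongrightarrow> V t x" for x
  proof -
    have "(\<lambda>k. x + d k) \<longlonglongrightarrow> x" using tendsto_add[OF tendsto_const d(1), of x] by simp
    moreover have "isCont (V t) x" using V_cont[OF t] by (simp add: continuous_on_eq_continuous_at)
    ultimately show ?thesis using isCont_tendsto_compose by blast
  qed
  have L1: "(\<lambda>k. LBINT x. V t (x + d k) * w k x ^ n * w k x * w k x) \<longlonglongrightarrow> (LBINT x. V t x * V t x ^ n * V t x * V t x)"
    by (rule tendsto_integral_triple[OF _ Vb _ wf(2) V_si[OF t] wf(2) V_si[OF t] w_l2 w_l2])
      (measurable, intro tendsto_intros V_lim w_lim)
  have L2: "(\<lambda>k. LBINT x. V t x * w k x ^ n * w k x * w k x) \<longlonglongrightarrow> (LBINT x. V t x * V t x ^ n * V t x * V t x)"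
    by (rule tendsto_integral_triple[OF _ Vb _ wf(2) V_si[OF t] wf(2) V_si[OF t] w_l2 w_l2])
      (measurable, intro tendsto_intros w_lim)
  have L3: "(\<lambda>k. LBINT x. w k x ^ n * w k x * w k x) \<longlonglongrightarrow> (LBINT x. V t x ^ n * V t x * V t x)"
    by (rule tendsto_integral_triple[OF _ wn _ wf(2) V_si[OF t] wf(2) V_si[OF t] w_l2 w_l2])
      (measurable, intro tendsto_intros w_lim)
  have L4: "(\<lambda>k. LBINT x. w k x ^ n * w k x * q k x) \<longlonglongrightarrow> (LBINT x. V t x ^ n * V t x * (W t x - G t x))"
    by (rule tendsto_integral_triple[OF _ wn _ wf(2) V_si[OF t] wf(5) Lambda_inv2_G_facts(8)[OF t] w_l2 q_l2])
      (measurable, intro tendsto_intros w_lim)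
  show "(\<lambda>k. rhs_diffquot n (d k) t) \<longlonglongrightarrow> rhs_slope n t"
    unfolding rhs_diffquot_def rhs_slope_def w_def[symmetric] q_def[symmetric]
    by (intro tendsto_intros L1 L2 L3 L4)
  show "(\<lambda>k. LBINT x. diffquot (d k) (U t) x ^ (n + 2)) \<longlonglongrightarrow> (LBINT x. V t x ^ (n + 2))"
  proof -
    have e: "y ^ (n + 2) = y ^ n * y * y" for y :: real by simp
    show ?thesis using L3 unfolding w_def e .
  qed
qed

text \<open>Dominated convergence in t for the integrated identities of the difference quotients. It
  delivers the integrability of \<open>rhs_slope\<close> in t along with the value, and the integral
  on the left is never differentiated in t.\<close>

lemma slope_power_has_integral:
  assumes t: "t \<in> {0..T}"
  shows "((rhs_slope n) has_integral ((LBINT x. V t x ^ (n + 2)) - (LBINT x. V 0 x ^ (n + 2)))) {0..t}"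
proof -
  define d where "d k = 1 / real (Suc k)" for k
  have d: "d \<longlonglongrightarrow> 0" "\<And>k. 0 < d k"
    unfolding d_def by (rule LIMSEQ_Suc[OF lim_const_over_n]) simp
  define B where "B = M * M ^ n * M * M + real (n + 2) * (M * M ^ n * M * M)
    + lam * real (n + 2) * (M ^ n * M * M) + real (n + 2) * (M ^ n * M * (CG * (2 * M)))"
  have t0: "0 \<in> {0..T}" using T by simp
  show ?thesis
  proof (rule has_integral_dominated_convergence)
    show "((rhs_diffquot n (d k)) has_integral
      ((LBINT x. diffquot (d k) (U t) x ^ (n + 2)) - (LBINT x. diffquot (d k) (U 0) x ^ (n + 2)))) {0..t}" for k
      by (rule diffquot_power_has_integral[OF t d(2)])
    show "(\<lambda>_. B) integrable_on {0..t}" by (rule integrable_const_ivl)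
    show "\<forall>\<tau>\<in>{0..t}. norm (rhs_diffquot n (d k) \<tau>) \<le> B" for k
      using rhs_diffquot_bound[OF _ d(2)] t by (auto simp: B_def)
    show "\<forall>\<tau>\<in>{0..t}. (\<lambda>k. rhs_diffquot n (d k) \<tau>) \<longlonglongrightarrow> rhs_slope n \<tau>"
      using rhs_diffquot_tendsto(1)[OF _ d] t by auto
    show "(\<lambda>k. (LBINT x. diffquot (d k) (U t) x ^ (n + 2)) - (LBINT x. diffquot (d k) (U 0) x ^ (n + 2)))
      \<longlonglongrightarrow> (LBINT x. V t x ^ (n + 2)) - (LBINT x. V 0 x ^ (n + 2))"
      by (intro tendsto_diff rhs_diffquot_tendsto(2)[OF _ d] t t0)
  qed
qed

section \<open>Monotonicity of the energy\<close>

lemma U_squared_has_integral: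
  assumes t: "t \<in> {0..T}"
  shows "((\<lambda>\<tau>. - 2 * lam * (LBINT x. (U \<tau> x)\<^sup>2) - 2 * (LBINT x. V \<tau> x * W \<tau> x)) has_integral
    ((LBINT x. (U t x)\<^sup>2) - (LBINT x. (U 0 x)\<^sup>2))) {0..t}"
proof (rule has_integral_of_derivative_within[OF _ _ t])
  fix t assume t: "t \<in> {0..T}"
  show "((\<lambda>t. LBINT x. (U t x)\<^sup>2) has_real_derivative 2 * (LBINT x. U t x * D t x)) (at t within {0..T})"
    using integral_power_has_derivative[OF t U_si U_le D_si[OF t] D_lim[OF t], of 0]
    by (simp add: power2_eq_square)
next
  fix t assume t0: "t \<in> {0<..T}"
  then have t: "t \<in> {0..T}" by auto
  note [measurable] = measurable_UVD[OF t]
  note si = square_integrable_mult_integrable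
  note WP = Lambda_inv2_G_facts[OF t]
  have [measurable]: "P t \<in> borel_measurable borel" using WP(7) by (rule square_integrable_measurable)
  have UUV: "integrable lborel (\<lambda>x. U t x * U t x * V t x)" "integrable lborel (\<lambda>x. U t x * U t x * U t x)"
    using U_le[OF t] by (auto intro!: integral_triple_bound(1)[where K = M] U_si V_si t)
  \<comment> \<open>Three integrations by parts for U times the equation: both parts of the
    transport term are exact derivatives, and in the nonlocal term the derivative is moved from W to
    U.\<close>
  have 1: "(LBINT x. 3 * (U t x * U t x * V t x)) = 0"
  proof (rule integral_deriv_eq_0[where F = "\<lambda>x. U t x * U t x * U t x"])
    show "((\<lambda>x. U t x * U t x * U t x) has_real_derivative 3 * (U t x * U t x * V t x)) (at x)" for x
      by (rule derivative_eq_intros refl U_deriv[OF t])+ (simp add: algebra_simps)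
  qed (use UUV in \<open>auto intro!: continuous_intros U_cont V_cont t\<close>)
  have 2: "(LBINT x. 2 * (U t x * V t x)) = 0"
  proof (rule integral_deriv_eq_0[where F = "\<lambda>x. U t x * U t x"])
    show "((\<lambda>x. U t x * U t x) has_real_derivative 2 * (U t x * V t x)) (at x)" for x
      by (rule derivative_eq_intros refl U_deriv[OF t])+ (simp add: algebra_simps)
  qed (use si[OF U_si[OF t] V_si[OF t]] si[OF U_si[OF t] U_si[OF t]] in \<open>auto intro!: continuous_intros U_cont V_cont t\<close>)
  have 3: "(LBINT x. U t x * P t x + V t x * W t x) = 0"
  proof (rule integral_deriv_eq_0[where F = "\<lambda>x. U t x * W t x"])
    show "((\<lambda>x. U t x * W t x) has_real_derivative U t x * P t x + V t x * W t x) (at x)" for x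
      using DERIV_mult[OF U_deriv[OF t] WP(1), of x] by (simp add: algebra_simps)
  qed (use si[OF U_si[OF t] WP(7)] si[OF V_si[OF t] WP(6)] si[OF U_si[OF t] WP(6)] WP(3,4)
      in \<open>auto intro!: continuous_intros U_cont V_cont t\<close>)
  have "(LBINT x. U t x * D t x) = (LBINT x. U t x * P t x - U t x * U t x * V t x - \<Gamma> * (U t x * V t x) - lam * (U t x)\<^sup>2)"
  proof (rule integral_cong_AE)
    show "AE x in lborel. U t x * D t x = U t x * P t x - U t x * U t x * V t x - \<Gamma> * (U t x * V t x) - lam * (U t x)\<^sup>2"
      using D_eq[OF t0]
    proof eventually_elim
      case (elim x)
      show ?case unfolding elim by (simp add: algebra_simps power2_eq_square)
    qed
  qed measurable
  also have "\<dots> = (LBINT x. U t x * P t x) - (LBINT x. U t x * U t x * V t x) - \<Gamma> * (LBINT x. U t x * V t x) - lam * (LBINT x. (U t x)\<^sup>2)"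
    using si[OF U_si[OF t] WP(7)] UUV si[OF U_si[OF t] V_si[OF t]] square_integrable_power2[OF U_si[OF t]] by simp
  also have "\<dots> = - (LBINT x. V t x * W t x) - lam * (LBINT x. (U t x)\<^sup>2)"
    using 1 2 3 si[OF U_si[OF t] WP(7)] si[OF V_si[OF t] WP(6)] by simp
  finally show "2 * (LBINT x. U t x * D t x) = - 2 * lam * (LBINT x. (U t x)\<^sup>2) - 2 * (LBINT x. V t x * W t x)"
    by simp
qed

text \<open>The parts of \<open>G t\<close> that depend on U alone become exact derivatives when
  multiplied by V = U_x; only - V^2 / 2 is left.\<close>

lemma integral_V_G:
  assumes t: "t \<in> {0..T}"
  shows "2 * (LBINT x. V t x * G t x) = - (LBINT x. V t x * V t x * V t x)"
proof -
  note [measurable] = measurable_UVD[OF t]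
  note si = square_integrable_mult_integrable
  define hU where "hU x = h \<alpha> \<beta> \<gamma> \<Gamma> (U t x) - (U t x)\<^sup>2" for x
  \<comment> \<open>r^2 times this is an antiderivative of h(r) - r^2; the factor r^2 is kept apart
    so that two square integrable factors U accompany a bounded one.\<close>
  define c0 where "c0 r = (\<alpha> + \<Gamma>) / 2 + \<beta> / 12 * r\<^sup>2 + \<gamma> / 20 * r ^ 3 - r / 3" for r
  have V3: "integrable lborel (\<lambda>x. V t x * V t x * V t x)"
    using V_le[OF t] by (intro integral_triple_bound(1)[where K = M] V_si t) auto
  have VG: "integrable lborel (\<lambda>x. V t x * G t x)" by (rule si[OF V_si[OF t] G_si(1)[OF t]])
  have e: "V t x * G t x = V t x * hU x - 1 / 2 * (V t x * V t x * V t x)" for x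
    by (simp add: nonlocal_term_def hU_def power2_eq_square algebra_simps)
  have Vh: "integrable lborel (\<lambda>x. V t x * hU x)"
  proof -
    have "integrable lborel (\<lambda>x. V t x * G t x + 1 / 2 * (V t x * V t x * V t x))"
      by (intro Bochner_Integration.integrable_add integrable_mult_right VG V3)
    then show ?thesis by (simp add: e)
  qed
  have "(LBINT x. V t x * hU x) = 0"
  proof (rule integral_deriv_eq_0[where F = "\<lambda>x. c0 (U t x) * U t x * U t x"])
    show "((\<lambda>x. c0 (U t x) * U t x * U t x) has_real_derivative V t x * hU x) (at x)" for x
    proof -
      have "((\<lambda>r. c0 r * r * r) has_real_derivative h \<alpha> \<beta> \<gamma> \<Gamma> r - r\<^sup>2) (at r)" for r
        unfolding c0_def h_def
        by (auto intro!: derivative_eq_intros simp: field_simps power2_eq_square power3_eq_cube power4_eq_xxxx)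
      from DERIV_chain2[OF this U_deriv[OF t]] show ?thesis by (simp add: hU_def mult.commute)
    qed
    show "continuous_on UNIV (\<lambda>x. V t x * hU x)"
      unfolding hU_def h_def by (intro continuous_intros U_cont V_cont t)
    show "integrable lborel (\<lambda>x. c0 (U t x) * U t x * U t x)"
    proof (rule integral_triple_bound(1))
      show "(\<lambda>x. c0 (U t x)) \<in> borel_measurable borel" unfolding c0_def by measurable
      fix x
      have r: "\<bar>U t x\<bar> ^ k \<le> M ^ k" for k using U_le[OF t] by (intro power_mono) auto
      have "\<bar>c0 (U t x)\<bar> \<le> \<bar>(\<alpha> + \<Gamma>) / 2\<bar> + \<bar>\<beta> / 12 * (U t x)\<^sup>2\<bar> + \<bar>\<gamma> / 20 * U t x ^ 3\<bar> + \<bar>U t x / 3\<bar>"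
        unfolding c0_def by linarith
      also have "\<dots> \<le> \<bar>(\<alpha> + \<Gamma>) / 2\<bar> + \<bar>\<beta>\<bar> / 12 * M\<^sup>2 + \<bar>\<gamma>\<bar> / 20 * M ^ 3 + M / 3"
        using r[of 2] r[of 3] U_le[OF t, of x]
        by (intro add_mono) (auto simp: abs_mult power_abs intro!: mult_left_mono divide_right_mono)
      finally show "\<bar>c0 (U t x)\<bar> \<le> \<bar>(\<alpha> + \<Gamma>) / 2\<bar> + \<bar>\<beta>\<bar> / 12 * M\<^sup>2 + \<bar>\<gamma>\<bar> / 20 * M ^ 3 + M / 3" .
    qed (rule U_si[OF t])+
  qed (rule Vh)
  then show ?thesis
    unfolding e using Vh V3 by (subst Bochner_Integration.integral_diff) auto
qed

text \<open>The slope identity with n = 0 is added to the identity for U^2. The integrals of V W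
  cancel, the cubes of V cancel by \<open>integral_V_G\<close>, and - 2 lam times the energy remains
  as the rate.\<close>

lemma energy_le:
  assumes t: "t \<in> {0..T}"
  shows "(l2norm (U t))\<^sup>2 + (l2norm (V t))\<^sup>2 \<le> (l2norm (U 0))\<^sup>2 + (l2norm (V 0))\<^sup>2"
proof -
  note si = square_integrable_mult_integrable
  let ?f = "\<lambda>\<tau>. rhs_slope 0 \<tau> + (- 2 * lam * (LBINT x. (U \<tau> x)\<^sup>2) - 2 * (LBINT x. V \<tau> x * W \<tau> x))"
  have i: "(?f has_integral ((LBINT x. V t x ^ (0 + 2)) - (LBINT x. V 0 x ^ (0 + 2)))
      + ((LBINT x. (U t x)\<^sup>2) - (LBINT x. (U 0 x)\<^sup>2))) {0..t}"
    by (rule has_integral_add[OF slope_power_has_integral[OF t] U_squared_has_integral[OF t]])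
  have "?f \<tau> \<le> 0" if "\<tau> \<in> {0..t}" for \<tau>
  proof -
    have \<tau>: "\<tau> \<in> {0..T}" using that t by auto
    have "(LBINT x. V \<tau> x * (W \<tau> x - G \<tau> x)) = (LBINT x. V \<tau> x * W \<tau> x) - (LBINT x. V \<tau> x * G \<tau> x)"
      unfolding right_diff_distrib
      by (rule Bochner_Integration.integral_diff[OF si[OF V_si[OF \<tau>] Lambda_inv2_G_facts(6)[OF \<tau>]] si[OF V_si[OF \<tau>] G_si(1)[OF \<tau>]]])
    then have "?f \<tau> = - 2 * lam * (LBINT x. V \<tau> x * V \<tau> x) - 2 * lam * (LBINT x. (U \<tau> x)\<^sup>2)"
      using integral_V_G[OF \<tau>] by (simp add: rhs_slope_def)
    moreover have "0 \<le> lam * (LBINT x. V \<tau> x * V \<tau> x)" "0 \<le> lam * (LBINT x. (U \<tau> x)\<^sup>2)"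
      using lam by simp_all
    ultimately show ?thesis by linarith
  qed
  then have "((LBINT x. V t x ^ (0 + 2)) - (LBINT x. V 0 x ^ (0 + 2)))
      + ((LBINT x. (U t x)\<^sup>2) - (LBINT x. (U 0 x)\<^sup>2)) \<le> 0"
    by (rule has_integral_le[OF i has_integral_0])
  then show ?thesis
    unfolding l2norm_power2 add_0 by linarith
qed

end

section \<open>The Riccati inequality for the slope\<close>

text \<open>The weighted arithmetic-geometric mean inequality for integer weights. The induction
  step adds X^(n + 1) Y + X Y^(n + 1) <= X^(n + 2) + Y^(n + 2), which holds because X - Y and X^(n +
  1) - Y^(n + 1) have the same sign.\<close>

lemma Young_power:
  fixes X Y :: real
  assumes "0 \<le> X" "0 \<le> Y"
  shows "real (n + 1) * (X ^ n * Y) \<le> real n * X ^ (n + 1) + Y ^ (n + 1)"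
proof (induction n)
  case (Suc n)
  have "0 \<le> (X - Y) * (X ^ (n + 1) - Y ^ (n + 1))"
  proof (cases "X \<le> Y")
    case True
    then have "X ^ (n + 1) \<le> Y ^ (n + 1)" using assms by (intro power_mono) auto
    with True show ?thesis by (intro mult_nonpos_nonpos) auto
  next
    case False
    then have "Y ^ (n + 1) \<le> X ^ (n + 1)" using assms by (intro power_mono) auto
    with False show ?thesis by (intro mult_nonneg_nonneg) auto
  qed
  then have 1: "X ^ (n + 1) * Y + X * Y ^ (n + 1) \<le> X ^ (n + 2) + Y ^ (n + 2)"
    by (simp add: algebra_simps)
  have "X * (real (n + 1) * (X ^ n * Y)) \<le> X * (real n * X ^ (n + 1) + Y ^ (n + 1))"
    using assms(1) by (intro mult_left_mono Suc.IH)
  then have 2: "real (n + 1) * (X ^ (n + 1) * Y) \<le> real n * X ^ (n + 2) + X * Y ^ (n + 1)"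
    by (simp add: algebra_simps)
  have "real (Suc n + 1) * (X ^ Suc n * Y) = real (n + 1) * (X ^ (n + 1) * Y) + X ^ (n + 1) * Y"
    by (simp add: algebra_simps)
  also have "\<dots> \<le> real n * X ^ (n + 2) + (X ^ (n + 2) + Y ^ (n + 2))"
    using 1 2 by linarith
  also have "\<dots> = real (Suc n) * X ^ (Suc n + 1) + Y ^ (Suc n + 1)"
    by (simp add: algebra_simps)
  finally show ?case .
qed simp

text \<open>\<open>Young_power\<close> with Y = \<kappa> b; the parameter \<kappa> decides how much
  of X^(n + 1) is spent.\<close>

lemma Young_power_scaled:
  fixes X b \<kappa> :: real
  assumes "0 \<le> X" "0 \<le> b" "0 < \<kappa>"
  shows "X ^ n * b \<le> real n / real (n + 1) / \<kappa> * X ^ (n + 1) + \<kappa> ^ n / real (n + 1) * b ^ (n + 1)"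
proof -
  have "real (n + 1) * (X ^ n * (\<kappa> * b)) \<le> real n * X ^ (n + 1) + (\<kappa> * b) ^ (n + 1)"
    using assms by (intro Young_power) auto
  then have "X ^ n * b * (real (n + 1) * \<kappa>) \<le> real n * X ^ (n + 1) + \<kappa> ^ n * b ^ (n + 1) * \<kappa>"
    by (simp add: power_mult_distrib mult_ac)
  moreover have "0 < real (n + 1) * \<kappa>" using assms by simp
  ultimately have "X ^ n * b \<le> (real n * X ^ (n + 1) + \<kappa> ^ n * b ^ (n + 1) * \<kappa>) / (real (n + 1) * \<kappa>)"
    by (simp only: pos_le_divide_eq)
  also have "\<dots> = real n / real (n + 1) / \<kappa> * X ^ (n + 1) + \<kappa> ^ n / real (n + 1) * b ^ (n + 1)"
    using assms(3) by (simp add: add_divide_distrib)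
  finally show ?thesis .
qed

text \<open>The factor \<open>2n - 1\<close> times \<open>damping_share n\<close> is the part of \<open>\<integral> v ^ (2n + 2)\<close> that absorbs the damping
  term. For \<open>n = 1\<close> the constant \<open>K\<^sup>2\<close> leaves room for no smaller share than \<open>9/32\<close>, and \<open>3/32\<close> remains for the
  source terms; for \<open>n \<ge> 2\<close> the shares are \<open>1/4\<close> and \<open>1/8\<close>.\<close>

definition damping_share :: "nat \<Rightarrow> real" where
  "damping_share n = (if n = 1 then 9 / 32 else 1 / 4)"

text \<open>The binomial expansion to second order is enough from n = 2 on. For n = 1 the power is
  only (4/3)^2 = 16/9, hence the special value \<open>damping_share 1\<close>.\<close>

lemma two_le_power_ratio:
  assumes n: "2 \<le> n"
  shows "2 \<le> (2 * (real n + 1) / (2 * real n + 1)) ^ (2 * n)"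
proof -
  let ?x = "1 / (2 * real n + 1)"
  have e: "2 * (real n + 1) / (2 * real n + 1) = 1 + ?x" by (simp add: field_simps)
  have "1 + real m * x + real m * (real m - 1) / 2 * x\<^sup>2 \<le> (1 + x) ^ m" if "0 \<le> x" for m and x :: real
  proof (induction m)
    case (Suc m)
    have "1 + real (Suc m) * x + real (Suc m) * (real (Suc m) - 1) / 2 * x\<^sup>2
        \<le> (1 + x) * (1 + real m * x + real m * (real m - 1) / 2 * x\<^sup>2)"
    proof -
      have "(1 + x) * (1 + real m * x + real m * (real m - 1) / 2 * x\<^sup>2)
        - (1 + real (Suc m) * x + real (Suc m) * (real (Suc m) - 1) / 2 * x\<^sup>2)
        = real m * (real m - 1) / 2 * x ^ 3"
        by (simp add: power2_eq_square power3_eq_cube field_simps)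
      moreover have "0 \<le> real m * (real m - 1) / 2 * x ^ 3"
        using that by (cases m) auto
      ultimately show ?thesis by linarith
    qed
    also have "\<dots> \<le> (1 + x) * (1 + x) ^ m"
      using that Suc.IH by (intro mult_left_mono) auto
    finally show ?case by simp
  qed simp
  from this[of ?x "2 * n"]
  have "1 + real (2 * n) * ?x + real (2 * n) * (real (2 * n) - 1) / 2 * ?x\<^sup>2 \<le> (1 + ?x) ^ (2 * n)" by simp
  moreover have "2 \<le> 1 + real (2 * n) * ?x + real (2 * n) * (real (2 * n) - 1) / 2 * ?x\<^sup>2"
  proof -
    have "0 \<le> (real n - 2) * (2 * real n + 1) + 1"
      using n by (intro add_nonneg_nonneg mult_nonneg_nonneg) auto
    then have "2 * real n + 1 \<le> real n * (2 * real n - 1)" by (simp add: algebra_simps)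
    then have "(2 * real n + 1)\<^sup>2 \<le> 2 * real n * (2 * real n + 1) + real n * (2 * real n - 1)"
      by (simp add: power2_eq_square algebra_simps)
    moreover have p: "0 < (2 * real n + 1)\<^sup>2" by simp
    ultimately have "1 \<le> (2 * real n * (2 * real n + 1) + real n * (2 * real n - 1)) / (2 * real n + 1)\<^sup>2"
      by (simp add: le_divide_eq_1_pos)
    also have "\<dots> = real (2 * n) * ?x + real (2 * n) * (real (2 * n) - 1) / 2 * ?x\<^sup>2"
      by (simp add: add_divide_distrib power2_eq_square)
    finally show ?thesis by simp
  qed
  ultimately show ?thesis unfolding e by linarith
qed

text \<open>Young's inequality with exponents 2n and 2n / (2n - 1), applied to y = z^(2n - 1). Its
  scale is fixed by spending exactly the share allotted to the damping; the remainder then has to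
  fit below the first summand of K^2, in which B is c times N to the power 2 / (2n - 1).\<close>

lemma damping_bound:
  fixes y B :: real
  assumes n: "1 \<le> n" and B: "0 < B" and lam: "0 < lam" and y: "0 \<le> y"
  shows "lam * (2 * real n + 1) * y \<le> (2 * real n - 1) * damping_share n / B * y powr (2 * real n / (2 * real n - 1))
    + lam * (real n + 1) * (4 * B * lam * (real n + 1)) ^ (2 * n - 1) / (2 * real n ^ (2 * n))"
proof -
  define m where "m = 2 * n - 1"
  have m: "real m = 2 * real n - 1" "m + 1 = 2 * n" "0 < m" using n by (auto simp: m_def)
  define z where "z = y powr (1 / real m)"
  have z: "0 \<le> z" by (simp add: z_def)
  have zm: "z ^ m = y" "z ^ (m + 1) = y powr (2 * real n / (2 * real n - 1))"
  proof -
    show "z ^ m = y"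
    proof (cases "y = 0")
      case True then show ?thesis using m(3) by (simp add: z_def)
    next
      case False
      with y have "0 < y" by simp
      then show ?thesis unfolding z_def using m(3) by (simp add: powr_realpow[symmetric] powr_powr)
    qed
    show "z ^ (m + 1) = y powr (2 * real n / (2 * real n - 1))"
    proof (cases "y = 0")
      case True then show ?thesis by (simp add: z_def)
    next
      case False
      with y have y0: "0 < y" by simp
      have "z ^ (m + 1) = z powr real (m + 1)"
        using y0 by (intro powr_realpow[symmetric]) (simp add: z_def)
      also have "\<dots> = y powr (1 / real m * real (m + 1))" by (simp add: z_def powr_powr)
      also have "1 / real m * real (m + 1) = 2 * real n / (2 * real n - 1)"
        unfolding m(2) by (simp add: m(1))
      finally show ?thesis .
    qed
  qed
  define x where "x = damping_share n"
  have x: "0 < x" by (simp add: x_def damping_share_def)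
  define L where "L = lam * (2 * real n + 1) / (2 * real n)"
  \<comment> \<open>Gives L / Y = x / B, so that z^(m + 1) receives the prescribed coefficient m x /
    B.\<close>
  define Y where "Y = L * B / x"
  have L: "0 < L" using lam n by (simp add: L_def)
  have Y: "0 < Y" using L B x by (simp add: Y_def)
  have "real (m + 1) * (z ^ m * Y) \<le> real m * z ^ (m + 1) + Y ^ (m + 1)"
    using z Y by (intro Young_power) auto
  then have "2 * real n * (y * Y) \<le> real m * z ^ (m + 1) + Y ^ (m + 1)"
    unfolding zm(1) m(2) by simp
  then have "L * (2 * real n * (y * Y)) / Y \<le> L * (real m * z ^ (m + 1) + Y ^ (m + 1)) / Y"
    using L Y by (intro divide_right_mono mult_left_mono) auto
  moreover have "L * (2 * real n * (y * Y)) / Y = lam * (2 * real n + 1) * y"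
    using Y n by (simp add: L_def)
  moreover have "L * (real m * z ^ (m + 1) + Y ^ (m + 1)) / Y = real m * x / B * z ^ (m + 1) + L * Y ^ m"
  proof -
    have "L / Y = x / B" using L B x by (simp add: Y_def)
    then have "L * (real m * z ^ (m + 1)) / Y = real m * x / B * z ^ (m + 1)"
      using L Y B by (simp add: field_simps)
    moreover have "L * Y ^ (m + 1) / Y = L * Y ^ m" using Y by simp
    ultimately show ?thesis by (simp only: distrib_left add_divide_distrib)
  qed
  ultimately have main: "lam * (2 * real n + 1) * y \<le> real m * x / B * z ^ (m + 1) + L * Y ^ m" by linarith
  have "L * Y ^ m \<le> lam * (real n + 1) / (2 * real n) * (4 * B * lam * (real n + 1) / real n) ^ m"
  proof -
    define w where "w = 2 * real n + 1"
    \<comment> \<open>The available constant is (\<rho> / 2) (4 x \<rho>)^m times L Y^m. For n = 1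
      this factor is (2/3) (9/8) (4/3) = 1, without any slack; for n >= 2 it is \<rho>^(2n) /
      2.\<close>
    define \<rho> where "\<rho> = 2 * (real n + 1) / w"
    have w: "0 < w" by (simp add: w_def)
    have a1: "lam * (real n + 1) / (2 * real n) = \<rho> / 2 * L"
      using n w unfolding \<rho>_def L_def w_def[symmetric] by (simp add: field_simps)
    have a2: "4 * B * lam * (real n + 1) / real n = (4 * x) * \<rho> * Y"
      using n x w unfolding \<rho>_def L_def Y_def w_def[symmetric] by (simp add: field_simps)
    have "1 \<le> \<rho> / 2 * ((4 * x) * \<rho>) ^ m"
    proof (cases "n = 1")
      case True
      then show ?thesis by (simp add: m_def \<rho>_def w_def x_def damping_share_def)
    next
      case False
      with n have n2: "2 \<le> n" by simp
      have "2 \<le> \<rho> ^ (m + 1)" unfolding \<rho>_def w_def m(2) by (rule two_le_power_ratio[OF n2])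
      then show ?thesis using False by (simp add: x_def damping_share_def)
    qed
    then have "1 * (L * Y ^ m) \<le> \<rho> / 2 * ((4 * x) * \<rho>) ^ m * (L * Y ^ m)"
      using L Y by (intro mult_right_mono) auto
    also have "\<dots> = \<rho> / 2 * L * ((4 * x) * \<rho> * Y) ^ m" by (simp add: power_mult_distrib mult_ac)
    finally show ?thesis unfolding a1 a2 by simp
  qed
  also have "\<dots> = lam * (real n + 1) * (4 * B * lam * (real n + 1)) ^ (2 * n - 1) / (2 * real n ^ (2 * n))"
  proof -
    have "real n ^ (2 * n) = real n * real n ^ m" unfolding m(2)[symmetric] by simp
    then show ?thesis unfolding m_def[symmetric] by (simp add: power_divide)
  qed
  finally show ?thesis using main unfolding zm(2) x_def m(1) by linarith
qed

section \<open>Bounds at a fixed time in terms of the H1 norm\<close>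

lemma integral_abs_power_le:
  assumes Y: "square_integrable Y" and S: "\<And>x. \<bar>Y x\<bar> \<le> S" and n: "1 \<le> n"
  shows "integrable lborel (\<lambda>x. \<bar>Y x\<bar> ^ (n + 1))"
    and "(LBINT x. \<bar>Y x\<bar> ^ (n + 1)) \<le> S ^ (n - 1) * (l2norm Y)\<^sup>2"
proof -
  note [measurable] = square_integrable_measurable[OF Y]
  have le: "\<bar>Y x\<bar> ^ (n + 1) \<le> S ^ (n - 1) * (Y x)\<^sup>2" for x
  proof -
    have "\<bar>Y x\<bar> ^ (n + 1) = \<bar>Y x\<bar> ^ (n - 1) * \<bar>Y x\<bar>\<^sup>2"
      unfolding power_add[symmetric] using n by simp
    also have "\<dots> \<le> S ^ (n - 1) * (Y x)\<^sup>2"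
      using S[of x] by (simp add: mult_right_mono power_mono)
    finally show ?thesis .
  qed
  have i: "integrable lborel (\<lambda>x. S ^ (n - 1) * (Y x)\<^sup>2)"
    using Y by (simp add: square_integrable_def)
  show i': "integrable lborel (\<lambda>x. \<bar>Y x\<bar> ^ (n + 1))"
    by (rule Bochner_Integration.integrable_bound[OF i]) (use le order_trans[OF _ abs_ge_self] in auto)
  have "(LBINT x. \<bar>Y x\<bar> ^ (n + 1)) \<le> (LBINT x. S ^ (n - 1) * (Y x)\<^sup>2)"
    by (intro integral_mono i i' le)
  then show "(LBINT x. \<bar>Y x\<bar> ^ (n + 1)) \<le> S ^ (n - 1) * (l2norm Y)\<^sup>2" by simp
qed

lemma cube_sum_le:
  fixes a b A :: real
  assumes "0 \<le> a" "0 \<le> b" "0 \<le> A" "a\<^sup>2 + b\<^sup>2 \<le> A\<^sup>2"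
  shows "a ^ 3 + b ^ 3 \<le> A ^ 3"
proof -
  have "a\<^sup>2 \<le> A\<^sup>2" "b\<^sup>2 \<le> A\<^sup>2" using assms(4) zero_le_power2[of a] zero_le_power2[of b] by linarith+
  then have "a \<le> A" "b \<le> A" using assms by (auto intro: power2_le_imp_le)
  then have "a * a\<^sup>2 + b * b\<^sup>2 \<le> A * a\<^sup>2 + A * b\<^sup>2" by (intro add_mono mult_right_mono) auto
  also have "\<dots> \<le> A * A\<^sup>2" unfolding distrib_left[symmetric] using assms by (intro mult_left_mono) auto
  finally show ?thesis by (simp add: power3_eq_cube power2_eq_square)
qed

text \<open>One time slice of a solution. \<open>M\<close> provides qualitative boundedness, while
  the constants in the estimates of this locale are expressed by \<open>N\<close>, which will be the
  H1 norm of the initial value.\<close>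

locale H1_profile =
  fixes u v :: "real \<Rightarrow> real" and M N :: real
  assumes deriv: "\<And>x. (u has_real_derivative v x) (at x)" and v_cont: "continuous_on UNIV v"
    and u_si: "square_integrable u" and v_si: "square_integrable v"
    and u_bdd: "\<And>x. \<bar>u x\<bar> \<le> M" and v_bdd: "\<And>x. \<bar>v x\<bar> \<le> M"
    and N: "0 \<le> N" and H1: "(l2norm u)\<^sup>2 + (l2norm v)\<^sup>2 \<le> N\<^sup>2"
begin

lemma u_cont: "continuous_on UNIV u"
  using deriv by (meson DERIV_isCont continuous_at_imp_continuous_on)

lemma measurable_u [measurable]: "u \<in> borel_measurable borel"
  and measurable_v [measurable]: "v \<in> borel_measurable borel"
  using u_si v_si by (auto dest: square_integrable_measurable)

text \<open>The sup bound of u, from u^2 <= ||u|| ||v|| <= N^2 / 2; this is the origin of the powers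
  of sqrt 2 in C_1 + C_3.\<close>

definition "A = N / sqrt 2"

lemma A_nonneg: "0 \<le> A" and A_power2: "A\<^sup>2 = N\<^sup>2 / 2"
  using N by (auto simp: A_def power_divide)

lemma l2norm_mult_le: "l2norm u * l2norm v \<le> A\<^sup>2"
  using H1 sum_squares_bound[of "l2norm u" "l2norm v"] by (simp add: A_power2 del: l2norm_power2)

lemma l2norm_le: "(l2norm u)\<^sup>2 \<le> N\<^sup>2" "l2norm v \<le> N"
proof -
  show "(l2norm u)\<^sup>2 \<le> N\<^sup>2" using H1 zero_le_power2[of "l2norm v"] by linarith
  have "(l2norm v)\<^sup>2 \<le> N\<^sup>2" using H1 zero_le_power2[of "l2norm u"] by linarith
  then show "l2norm v \<le> N" using N by (rule power2_le_imp_le)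
qed

definition "pos_sup = (SUP x. max (u x) 0)"
definition "neg_sup = (SUP x. max (- u x) 0)"

text \<open>The joint bound for two points is passed to the supremum in one variable at a time, over
  y with x fixed and then over x.\<close>

lemma sup_bounds:
  "u x \<le> pos_sup" "- neg_sup \<le> u x" "0 \<le> pos_sup" "0 \<le> neg_sup" "pos_sup\<^sup>2 + neg_sup\<^sup>2 \<le> l2norm u * l2norm v"
proof -
  have M: "0 \<le> M" using u_bdd[of 0] by linarith
  have le: "max (u x) 0 \<le> M" "max (- u x) 0 \<le> M" for x using u_bdd[of x] M by auto
  have bp: "bdd_above (range (\<lambda>x. max (u x) 0))" and bn: "bdd_above (range (\<lambda>x. max (- u x) 0))"
    using le by (auto intro!: bdd_aboveI[of _ M])
  have p: "max (u x) 0 \<le> pos_sup" and n: "max (- u x) 0 \<le> neg_sup" for x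
    unfolding pos_sup_def neg_sup_def by (rule cSUP_upper[OF UNIV_I bp], rule cSUP_upper[OF UNIV_I bn])
  show "u x \<le> pos_sup" "- neg_sup \<le> u x" "0 \<le> pos_sup" "0 \<le> neg_sup"
    using p[of x] n[of x] by auto
  have key: "(max (u x) 0)\<^sup>2 + (max (- u y) 0)\<^sup>2 \<le> l2norm u * l2norm v" for x y
    by (rule sup_positive_negative_part_le[OF deriv v_cont v_si u_si])
  have key2: "(max (u x) 0)\<^sup>2 \<le> l2norm u * l2norm v - neg_sup\<^sup>2" for x
  proof -
    have nn: "0 \<le> l2norm u * l2norm v - (max (u x) 0)\<^sup>2"
      using key[of x x] zero_le_power2[of "max (- u x) 0"] by linarith
    have "max (- u y) 0 \<le> sqrt (l2norm u * l2norm v - (max (u x) 0)\<^sup>2)" for y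
      using key[of x y] by (intro real_le_rsqrt) linarith
    then have "neg_sup \<le> sqrt (l2norm u * l2norm v - (max (u x) 0)\<^sup>2)"
      unfolding neg_sup_def by (intro cSUP_least) auto
    then have "neg_sup\<^sup>2 \<le> (sqrt (l2norm u * l2norm v - (max (u x) 0)\<^sup>2))\<^sup>2"
      using \<open>0 \<le> neg_sup\<close> by (intro power_mono) auto
    then show ?thesis using nn by simp
  qed
  then have sq: "max (u x) 0 \<le> sqrt (l2norm u * l2norm v - neg_sup\<^sup>2)" for x
    by (intro real_le_rsqrt)
  have nn: "0 \<le> l2norm u * l2norm v - neg_sup\<^sup>2"
    using key2[of 0] zero_le_power2[of "max (u 0) 0"] by linarith
  have "pos_sup \<le> sqrt (l2norm u * l2norm v - neg_sup\<^sup>2)"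
    unfolding pos_sup_def using sq by (intro cSUP_least) auto
  then have "pos_sup\<^sup>2 \<le> (sqrt (l2norm u * l2norm v - neg_sup\<^sup>2))\<^sup>2"
    using \<open>0 \<le> pos_sup\<close> by (intro power_mono) auto
  with nn show "pos_sup\<^sup>2 + neg_sup\<^sup>2 \<le> l2norm u * l2norm v" by simp
qed

lemma u_power2_le: "(u x)\<^sup>2 \<le> l2norm u * l2norm v" "(u x)\<^sup>2 \<le> A\<^sup>2" "\<bar>u x\<bar> \<le> A"
proof -
  have "(u x)\<^sup>2 \<le> pos_sup\<^sup>2 + neg_sup\<^sup>2"
  proof (cases "0 \<le> u x")
    case True
    then have "(u x)\<^sup>2 \<le> pos_sup\<^sup>2" using sup_bounds(1)[of x] by (intro power_mono)
    then show ?thesis using zero_le_power2[of neg_sup] by linarith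
  next
    case False
    then have "(- u x)\<^sup>2 \<le> neg_sup\<^sup>2" using sup_bounds(2)[of x] by (intro power_mono) auto
    then show ?thesis unfolding power2_minus using zero_le_power2[of pos_sup] by linarith
  qed
  then show 1: "(u x)\<^sup>2 \<le> l2norm u * l2norm v" using sup_bounds(5) by linarith
  then show 2: "(u x)\<^sup>2 \<le> A\<^sup>2" using l2norm_mult_le by linarith
  have "\<bar>u x\<bar>\<^sup>2 \<le> A\<^sup>2" using 2 by simp
  then show "\<bar>u x\<bar> \<le> A" using A_nonneg by (rule power2_le_imp_le)
qed

lemma u_power_facts:
  assumes k: "1 \<le> k"
  shows "square_integrable (\<lambda>x. u x ^ k)" "(l2norm (\<lambda>x. u x ^ k))\<^sup>2 \<le> (l2norm u * l2norm v) ^ (k - 1) * (l2norm u)\<^sup>2"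
    "bounded_continuous (\<lambda>x. u x ^ k) (A ^ k)"
proof -
  show "bounded_continuous (\<lambda>x. u x ^ k) (A ^ k)"
    using u_power2_le(3) by unfold_locales (auto intro!: continuous_intros u_cont power_mono simp: power_abs)
  have le: "(u x ^ k)\<^sup>2 \<le> (l2norm u * l2norm v) ^ (k - 1) * (u x)\<^sup>2" for x
  proof -
    have "(u x ^ k)\<^sup>2 = ((u x)\<^sup>2) ^ (k - 1 + 1)"
      using k by (simp add: power_mult[symmetric] mult.commute)
    also have "\<dots> = ((u x)\<^sup>2) ^ (k - 1) * (u x)\<^sup>2" by simp
    also have "\<dots> \<le> (l2norm u * l2norm v) ^ (k - 1) * (u x)\<^sup>2"
      using u_power2_le(1) by (intro mult_right_mono power_mono) auto
    finally show ?thesis .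
  qed
  have i: "integrable lborel (\<lambda>x. (l2norm u * l2norm v) ^ (k - 1) * (u x)\<^sup>2)"
    using u_si by (simp add: square_integrable_def)
  have i': "integrable lborel (\<lambda>x. (u x ^ k)\<^sup>2)"
    by (rule Bochner_Integration.integrable_bound[OF i]) (use le order_trans[OF _ abs_ge_self] in auto)
  then show "square_integrable (\<lambda>x. u x ^ k)" by (simp add: square_integrable_def)
  have "(LBINT x. (u x ^ k)\<^sup>2) \<le> (LBINT x. (l2norm u * l2norm v) ^ (k - 1) * (u x)\<^sup>2)"
    by (intro integral_mono i i' le)
  then show "(l2norm (\<lambda>x. u x ^ k))\<^sup>2 \<le> (l2norm u * l2norm v) ^ (k - 1) * (l2norm u)\<^sup>2" by simp
qed

text \<open>Up to sign and coefficient, the contribution of u^k to \<open>Lambda_inv2 G - G\<close>.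
  Keeping the two parts together pays twice: subtracting \<open>Lambda_inv2\<close> does not
  increase the L2 norm, and in the sup norm only the range of u^k counts.\<close>

definition "defect k x = u x ^ k - Lambda_inv2 (\<lambda>y. u y ^ k) x"

lemma defect_si:
  assumes k: "1 \<le> k"
  shows "square_integrable (defect k)" "(l2norm (defect k))\<^sup>2 \<le> (l2norm u * l2norm v) ^ (k - 1) * (l2norm u)\<^sup>2"
proof -
  interpret bounded_continuous "\<lambda>x. u x ^ k" "A ^ k" by (rule u_power_facts(3)[OF k])
  note d = l2norm_diff_Lambda_inv2_le[OF u_power_facts(1)[OF k]]
  show "square_integrable (defect k)" unfolding defect_def[abs_def] by (rule d)
  have "(l2norm (defect k))\<^sup>2 \<le> (l2norm (\<lambda>x. u x ^ k))\<^sup>2"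
    unfolding defect_def[abs_def] by (rule power_mono[OF d(2)]) simp
  then show "(l2norm (defect k))\<^sup>2 \<le> (l2norm u * l2norm v) ^ (k - 1) * (l2norm u)\<^sup>2"
    using u_power_facts(2)[OF k] by linarith
qed

text \<open>Convolution with a probability kernel does not leave the interval [a, b], so that u^k
  and its average differ by at most the length of the interval.\<close>

lemma defect_range:
  assumes k: "1 \<le> k" and "\<And>y. a \<le> u y ^ k" "\<And>y. u y ^ k \<le> b"
  shows "\<bar>defect k x\<bar> \<le> b - a"
proof -
  interpret bounded_continuous "\<lambda>x. u x ^ k" "A ^ k" by (rule u_power_facts(3)[OF k])
  show ?thesis
    using Lambda_inv2_bounds(1)[OF assms(2,3), of x] Lambda_inv2_bounds(2)[OF assms(2,3), of x]
      assms(2)[of x] assms(3)[of x]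
    unfolding defect_def abs_le_iff by linarith
qed

text \<open>The range estimate would give \<open>pos_sup + neg_sup\<close>, for which the joint
  bound on the squares yields only N. Integration by parts gives N / 2, which stays below A.\<close>

lemma defect_1_le: "\<bar>defect 1 x\<bar> \<le> N / 2"
  using diff_Lambda_inv2_abs_le[OF deriv u_bdd v_cont v_si v_bdd, of x] l2norm_le(2)
  by (simp add: defect_def)

text \<open>The range of u^3 has length at most \<open>pos_sup ^ 3 + neg_sup ^ 3\<close>. Bounding
  both suprema by A would give 2 A^3; the joint bound on the squares removes the factor 2.\<close>

lemma defect_3_le: "\<bar>defect 3 x\<bar> \<le> A ^ 3"
proof -
  have "\<bar>defect 3 x\<bar> \<le> pos_sup ^ 3 - (- neg_sup) ^ 3"
  proof (rule defect_range)
    show "(- neg_sup) ^ 3 \<le> u y ^ 3" for y using sup_bounds(2)[of y] by (intro power_mono_odd) auto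
    show "u y ^ 3 \<le> pos_sup ^ 3" for y using sup_bounds(1)[of y] by (intro power_mono_odd) auto
  qed simp
  also have "\<dots> = pos_sup ^ 3 + neg_sup ^ 3" by simp
  also have "\<dots> \<le> A ^ 3"
    using sup_bounds(3-5) l2norm_mult_le A_nonneg by (intro cube_sum_le) auto
  finally show ?thesis .
qed

lemma defect_4_le: "\<bar>defect 4 x\<bar> \<le> A ^ 4"
proof -
  have "\<bar>defect 4 x\<bar> \<le> A ^ 4 - 0"
  proof (rule defect_range)
    show "u y ^ 4 \<le> A ^ 4" for y
      using power_mono[OF u_power2_le(3)[of y], of 4] by (simp add: power_even_abs)
  qed auto
  then show ?thesis by simp
qed

text \<open>The reserve \<open>3/4\<close> for \<open>n = 1\<close> compensates the larger \<open>damping_share 1\<close>; it is the reason for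
  bounding \<open>\<parallel>u\<parallel>\<^sup>4 \<parallel>v\<parallel>\<^sup>2\<close> by its maximum \<open>4/27 N\<^sup>6\<close> below.\<close>

definition source_share :: "nat \<Rightarrow> real" where
  "source_share n = (if n = 1 then 3 / 4 else 1)"

lemma N_eq: "N = sqrt 2 * A"
  by (simp add: A_def)

text \<open>Rewriting by N = sqrt 2 A shows the budget. The sources with coefficients |\<alpha>| +
  |\<Gamma>|, |\<beta>| / 3, |\<gamma>| / 4 and 1/2 may use 4, 2, 4 and 4 times the respective power
  of A, and the cubic one has in addition the surplus with N^(3n + 5).\<close>

lemma const_C13_eq:
  assumes n: "1 \<le> n"
  shows "const_C13 \<alpha> \<beta> \<gamma> \<Gamma> n N = (\<bar>\<alpha>\<bar> + \<bar>\<Gamma>\<bar>) * (4 * A ^ (n + 1))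
    + \<bar>\<beta>\<bar> / 3 * (2 * A ^ (3 * (n + 1)) + N ^ (3 * n + 5) / sqrt 2 ^ (3 * n + 1))
    + \<bar>\<gamma>\<bar> * A ^ (4 * (n + 1)) + 2 * A ^ (2 * (n + 1))"
proof -
  define r where "r = sqrt 2"
  have r: "0 < r" "r\<^sup>2 = 2" by (simp_all add: r_def)
  have two: "2 ^ k = r ^ (2 * k)" for k :: nat using r(2) by (simp add: power_mult)
  have q: "N ^ (k + j) / r ^ k = r ^ j * A ^ (k + j)" for k j
  proof -
    have "N ^ (k + j) = (r * A) ^ (k + j)" using N_eq by (simp only: r_def)
    then show ?thesis using r(1) by (simp add: power_mult_distrib power_add)
  qed
  have 1: "N ^ (n + 1) / r ^ (n - 1) = 2 * A ^ (n + 1)"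
    using q[of "n - 1" 2] n r(2) by simp
  have e: "3 * (n + 1) = 3 * n + 1 + 2" "4 * n + 4 = 2 * (2 * (n + 1)) + 0" "4 * (n + 1) = 2 * (2 * (n + 1)) + 0"
    "2 * (n + 1) = 2 * n + 2" by simp_all
  have 2: "N ^ (3 * (n + 1)) / r ^ (3 * n + 1) = 2 * A ^ (3 * (n + 1))"
    unfolding e(1) using q[of "3 * n + 1" 2] by (simp only: r(2))
  have 3: "N ^ (4 * n + 4) / 2 ^ (2 * (n + 1)) = A ^ (4 * (n + 1))"
    unfolding two e(2) e(3) using q[of "2 * (2 * (n + 1))" 0] by (simp only: power_0 mult_1)
  have 4: "N ^ (2 * (n + 1)) / 2 ^ n = 2 * A ^ (2 * (n + 1))"
    unfolding two e(4) using q[of "2 * n" 2] by (simp only: r(2))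
  have "const_C13 \<alpha> \<beta> \<gamma> \<Gamma> n N = (\<bar>\<alpha>\<bar> + \<bar>\<Gamma>\<bar>) * (2 * (N ^ (n + 1) / r ^ (n - 1)))
    + \<bar>\<beta>\<bar> / 3 * (N ^ (3 * (n + 1)) / r ^ (3 * n + 1) + N ^ (3 * n + 5) / r ^ (3 * n + 1))
    + \<bar>\<gamma>\<bar> * (N ^ (4 * n + 4) / 2 ^ (2 * (n + 1))) + N ^ (2 * (n + 1)) / 2 ^ n"
    unfolding const_C13_def r_def[symmetric] by (simp add: add_divide_distrib distrib_left)
  then show ?thesis unfolding 1 2 3 4 unfolding r_def by simp
qed

lemma l2norm_u_le: "(l2norm u)\<^sup>2 \<le> 2 * A\<^sup>2"
  using l2norm_le(1) by (simp add: A_power2)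

text \<open>Of the n + 1 factors n - 1 are bounded in the sup norm and two in L2; the factor 2 comes
  from ||u||^2 <= N^2 = 2 A^2.\<close>

lemma power_step:
  assumes Y: "square_integrable Y" "\<And>x. \<bar>Y x\<bar> \<le> A ^ k" "(l2norm Y)\<^sup>2 \<le> (l2norm u * l2norm v) ^ (k - 1) * (l2norm u)\<^sup>2"
    and k: "1 \<le> k" and n: "1 \<le> n"
  shows "(LBINT x. \<bar>Y x\<bar> ^ (n + 1)) \<le> 2 * A ^ (k * (n + 1))"
proof -
  have "(l2norm u * l2norm v) ^ (k - 1) * (l2norm u)\<^sup>2 \<le> (A\<^sup>2) ^ (k - 1) * (2 * A\<^sup>2)"
    by (intro mult_mono power_mono l2norm_mult_le l2norm_u_le) auto
  also have "\<dots> = 2 * (A\<^sup>2) ^ (k - 1 + 1)" by simp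
  also have "\<dots> = 2 * A ^ (2 * k)" using k by (simp add: power_mult[symmetric])
  finally have le: "(l2norm Y)\<^sup>2 \<le> 2 * A ^ (2 * k)" using Y(3) by linarith
  have "(LBINT x. \<bar>Y x\<bar> ^ (n + 1)) \<le> (A ^ k) ^ (n - 1) * (l2norm Y)\<^sup>2"
    by (rule integral_abs_power_le(2)[OF Y(1,2) n])
  also have "\<dots> \<le> (A ^ k) ^ (n - 1) * (2 * A ^ (2 * k))"
    using A_nonneg by (intro mult_left_mono le) auto
  also have "\<dots> = 2 * ((A ^ k) ^ (n - 1) * (A ^ k)\<^sup>2)"
    by (simp add: power_mult[symmetric] mult.commute)
  also have "(A ^ k) ^ (n - 1) * (A ^ k)\<^sup>2 = (A ^ k) ^ (n - 1 + 2)"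
    by (simp only: power_add)
  also have "n - 1 + 2 = n + 1" using n by simp
  finally show ?thesis by (simp only: power_mult)
qed

text \<open>For n = 1 a factor 3/4 has to be gained, and the cubic source is the one without a spare
  factor 2 in \<open>const_C13_eq\<close>. Its surplus N^(3n + 5) cannot provide the gain, being of
  higher order for small N.\<close>

lemma cubic_defect_integral:
  assumes n: "1 \<le> n"
  shows "(LBINT x. \<bar>defect 3 x\<bar> ^ (n + 1)) \<le> source_share n * (2 * A ^ (3 * (n + 1)))"
proof (cases "n = 1")
  case False
  then show ?thesis
    using power_step[OF defect_si(1) defect_3_le defect_si(2) _ n] by (simp add: source_share_def)
next
  case True
  let ?p = "(l2norm u)\<^sup>2" and ?r = "(l2norm v)\<^sup>2"
  have "(LBINT x. \<bar>defect 3 x\<bar> ^ (1 + 1)) \<le> (A ^ 3) ^ (1 - 1) * (l2norm (defect 3))\<^sup>2"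
    by (rule integral_abs_power_le(2)[OF defect_si(1) defect_3_le]) auto
  also have "\<dots> \<le> (l2norm u * l2norm v) ^ (3 - 1) * (l2norm u)\<^sup>2"
    using defect_si(2)[of 3] by simp
  also have "\<dots> = ?p\<^sup>2 * ?r" by (simp add: power2_eq_square power_mult_distrib mult_ac del: l2norm_power2)
  also have "27 * (?p\<^sup>2 * ?r) \<le> 4 * (?p + ?r) ^ 3"
  proof -
    \<comment> \<open>For fixed p + r the product p^2 r is largest at p = 2 r, which appears as a
      double zero of the difference.\<close>
    have "4 * (?p + ?r) ^ 3 - 27 * (?p\<^sup>2 * ?r) = (?p - 2 * ?r)\<^sup>2 * (4 * ?p + ?r)"
      by (simp add: power2_eq_square power3_eq_cube algebra_simps del: l2norm_power2)
    moreover have "0 \<le> (?p - 2 * ?r)\<^sup>2 * (4 * ?p + ?r)"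
      by (intro mult_nonneg_nonneg add_nonneg_nonneg) auto
    ultimately show ?thesis by linarith
  qed
  then have "?p\<^sup>2 * ?r \<le> 4 / 27 * (?p + ?r) ^ 3" by (simp del: l2norm_power2)
  also have "\<dots> \<le> 4 / 27 * (N\<^sup>2) ^ 3"
    by (intro mult_left_mono power_mono H1 add_nonneg_nonneg) auto
  also have "(N\<^sup>2) ^ 3 = 8 * (A\<^sup>2) ^ 3" by (simp add: A_power2 power_divide)
  also have "(A\<^sup>2) ^ 3 = A ^ 6" by (simp add: power_mult[symmetric])
  \<comment> \<open>The value 32/27 obtained here lies below the 3/2 that is available.\<close>
  also have "4 / 27 * (8 * A ^ 6) \<le> 3 / 4 * (2 * A ^ 6)"
    using A_nonneg by simp
  finally show ?thesis using True by (simp add: source_share_def)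
qed

section \<open>Absorbing the source terms\<close>

definition source :: "real \<Rightarrow> real \<Rightarrow> real \<Rightarrow> real \<Rightarrow> real \<Rightarrow> real" where
  "source \<alpha> \<beta> \<gamma> \<Gamma> x = (\<bar>\<alpha>\<bar> + \<bar>\<Gamma>\<bar>) * \<bar>defect 1 x\<bar> + \<bar>\<beta>\<bar> / 3 * \<bar>defect 3 x\<bar>
    + \<bar>\<gamma>\<bar> / 4 * \<bar>defect 4 x\<bar> + 1 / 2 * \<bar>(u x)\<^sup>2\<bar>"

lemma v_power_integrable:
  assumes "1 \<le> n"
  shows "integrable lborel (\<lambda>x. v x ^ (2 * n + 2))"
proof -
  have "integrable lborel (\<lambda>x. \<bar>v x\<bar> ^ ((2 * n + 1) + 1))"
    by (rule integral_abs_power_le(1)[OF v_si v_bdd]) simp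
  moreover have "\<bar>v x\<bar> ^ ((2 * n + 1) + 1) = v x ^ (2 * n + 2)" for x
    by (subst power_even_abs) auto
  ultimately show ?thesis by (simp only:)
qed

lemma Young_integral:
  assumes n: "1 \<le> n" and \<kappa>: "0 < \<kappa>" and [measurable]: "F \<in> borel_measurable borel"
    and Fi: "integrable lborel (\<lambda>x. \<bar>F x\<bar> ^ (n + 1))"
  shows "integrable lborel (\<lambda>x. v x ^ (2 * n) * \<bar>F x\<bar>)"
    and "(LBINT x. v x ^ (2 * n) * \<bar>F x\<bar>) \<le> real n / real (n + 1) / \<kappa> * (LBINT x. v x ^ (2 * n + 2))
      + \<kappa> ^ n / real (n + 1) * (LBINT x. \<bar>F x\<bar> ^ (n + 1))"
proof -
  let ?R = "\<lambda>x. real n / real (n + 1) / \<kappa> * v x ^ (2 * n + 2) + \<kappa> ^ n / real (n + 1) * \<bar>F x\<bar> ^ (n + 1)"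
  have le: "v x ^ (2 * n) * \<bar>F x\<bar> \<le> ?R x" for x
  proof -
    have "((v x)\<^sup>2) ^ n * \<bar>F x\<bar> \<le> real n / real (n + 1) / \<kappa> * ((v x)\<^sup>2) ^ (n + 1) + \<kappa> ^ n / real (n + 1) * \<bar>F x\<bar> ^ (n + 1)"
      by (rule Young_power_scaled) (use \<kappa> in auto)
    moreover have "((v x)\<^sup>2) ^ n = v x ^ (2 * n)" "((v x)\<^sup>2) ^ (n + 1) = v x ^ (2 * n + 2)"
      unfolding power_mult[symmetric] by simp_all
    ultimately show ?thesis by (simp only:)
  qed
  have R: "integrable lborel ?R"
    by (intro Bochner_Integration.integrable_add integrable_mult_right v_power_integrable n Fi)
  show i: "integrable lborel (\<lambda>x. v x ^ (2 * n) * \<bar>F x\<bar>)"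
  proof (rule Bochner_Integration.integrable_bound[OF R])
    show "AE x in lborel. norm (v x ^ (2 * n) * \<bar>F x\<bar>) \<le> norm (?R x)"
    proof (rule AE_I2)
      fix x
      have "norm (v x ^ (2 * n) * \<bar>F x\<bar>) = v x ^ (2 * n) * \<bar>F x\<bar>" by (simp add: abs_mult power_mult)
      then show "norm (v x ^ (2 * n) * \<bar>F x\<bar>) \<le> norm (?R x)"
        using order_trans[OF le abs_ge_self] by simp
    qed
  qed measurable
  have "(LBINT x. v x ^ (2 * n) * \<bar>F x\<bar>) \<le> (LBINT x. ?R x)"
    by (intro integral_mono i R le)
  also have "\<dots> = (LBINT x. real n / real (n + 1) / \<kappa> * v x ^ (2 * n + 2)) + (LBINT x. \<kappa> ^ n / real (n + 1) * \<bar>F x\<bar> ^ (n + 1))"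
    by (intro Bochner_Integration.integral_add integrable_mult_right v_power_integrable n Fi)
  finally show "(LBINT x. v x ^ (2 * n) * \<bar>F x\<bar>) \<le> real n / real (n + 1) / \<kappa> * (LBINT x. v x ^ (2 * n + 2))
      + \<kappa> ^ n / real (n + 1) * (LBINT x. \<bar>F x\<bar> ^ (n + 1))"
    by (simp only: integral_mult_right_zero)
qed

text \<open>Young's inequality is applied to the four sources with one common \<kappa>. Their
  coefficients add up to C_2, so the cost in the integral of v^(2n + 2) has the coefficient C_2 n /
  ((n + 1) \<kappa>), and \<kappa> is fixed by requiring that 2n + 1 times this be the share left
  for the sources.\<close>

lemma source_bound:
  assumes n: "1 \<le> n"
  shows "integrable lborel (\<lambda>x. v x ^ (2 * n) * source \<alpha> \<beta> \<gamma> \<Gamma> x)"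
    and "(2 * real n + 1) * (LBINT x. v x ^ (2 * n) * source \<alpha> \<beta> \<gamma> \<Gamma> x)
      \<le> (2 * real n - 1) * (3 / 8 - damping_share n) * (LBINT x. v x ^ (2 * n + 2))
        + (2 * real n + 1) * const_C13 \<alpha> \<beta> \<gamma> \<Gamma> n N / (real n + 1)
          * (8 * real n * (2 * real n + 1) * const_C2 \<alpha> \<beta> \<gamma> \<Gamma> / ((2 * real n - 1) * (real n + 1))) ^ n"
proof -
  let ?M = "LBINT x. v x ^ (2 * n + 2)"
  let ?C2 = "const_C2 \<alpha> \<beta> \<gamma> \<Gamma>"
  define c1 c3 c4 where "c1 = \<bar>\<alpha>\<bar> + \<bar>\<Gamma>\<bar>" and "c3 = \<bar>\<beta>\<bar> / 3" and "c4 = \<bar>\<gamma>\<bar> / 4"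
  have c: "0 \<le> c1" "0 \<le> c3" "0 \<le> c4" by (auto simp: c1_def c3_def c4_def)
  have C2: "?C2 = c1 + c3 + c4 + 1 / 2" "0 < ?C2"
    using c by (auto simp: const_C2_def c1_def c3_def c4_def)
  define \<eta> where "\<eta> = 3 / 8 - damping_share n"
  have \<eta>: "0 < \<eta>" by (simp add: \<eta>_def damping_share_def)
  \<comment> \<open>8 \<kappa>0 is the base of the n-th power in K^2. Dividing by the share \<eta>
    is forced by the cost condition, which is checked in \<open>E\<close> below.\<close>
  define \<kappa>0 where "\<kappa>0 = real n * (2 * real n + 1) * ?C2 / ((2 * real n - 1) * (real n + 1))"
  have \<kappa>0: "0 < \<kappa>0" unfolding \<kappa>0_def using n C2(2) by (intro divide_pos_pos mult_pos_pos) auto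
  define \<kappa> where "\<kappa> = \<kappa>0 / \<eta>"
  have \<kappa>: "0 < \<kappa>" using \<kappa>0 \<eta> by (simp add: \<kappa>_def)
  have NA: "N / 2 \<le> A"
  proof -
    have "sqrt 2 \<le> 2" by (rule real_le_lsqrt) auto
    then show ?thesis using N unfolding A_def by (intro divide_left_mono) auto
  qed
  have d1: "\<bar>defect 1 x\<bar> \<le> A ^ 1" for x using defect_1_le[of x] NA by simp
  have u2: "\<bar>(u x)\<^sup>2\<bar> \<le> A\<^sup>2" for x using u_power2_le(2)[of x] by simp
  have si: "square_integrable (defect 1)" "square_integrable (defect 3)" "square_integrable (defect 4)"
    "square_integrable (\<lambda>x. (u x)\<^sup>2)"
    by (intro defect_si(1) u_power_facts(1); simp)+
  note [measurable] = si[THEN square_integrable_measurable]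
  note pi = integral_abs_power_le(1)[OF si(1) d1 n] integral_abs_power_le(1)[OF si(2) defect_3_le n]
    integral_abs_power_le(1)[OF si(3) defect_4_le n] integral_abs_power_le(1)[OF si(4) u2 n]
  define I1 I3 I4 I2 where "I1 = (LBINT x. \<bar>defect 1 x\<bar> ^ (n + 1))" and "I3 = (LBINT x. \<bar>defect 3 x\<bar> ^ (n + 1))"
    and "I4 = (LBINT x. \<bar>defect 4 x\<bar> ^ (n + 1))" and "I2 = (LBINT x. \<bar>(u x)\<^sup>2\<bar> ^ (n + 1))"
  \<comment> \<open>Three of the integrals are at most 2 times a power of A while
    \<open>const_C13_eq\<close> allows 4 times it, so they also fit when the allowance is multiplied
    by \<open>source_share n\<close>.\<close>
  have th: "1 / 2 \<le> source_share n" by (simp add: source_share_def)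
  have Ik: "0 \<le> A ^ k" for k using A_nonneg by simp
  have "I1 \<le> 2 * A ^ (1 * (n + 1))"
    unfolding I1_def by (rule power_step[OF si(1) d1 defect_si(2) _ n]) auto
  also have "\<dots> = 2 * A ^ (n + 1)" by (simp only: mult_1)
  also have "\<dots> \<le> source_share n * (4 * A ^ (n + 1))"
    using mult_right_mono[OF th Ik[of "n + 1"]] by linarith
  finally have b1: "I1 \<le> source_share n * (4 * A ^ (n + 1))" .
  have "I3 \<le> source_share n * (2 * A ^ (3 * (n + 1)))"
    unfolding I3_def by (rule cubic_defect_integral[OF n])
  also have "\<dots> \<le> source_share n * (2 * A ^ (3 * (n + 1)) + N ^ (3 * n + 5) / sqrt 2 ^ (3 * n + 1))"
    using th N by (intro mult_left_mono) auto
  finally have b3: "I3 \<le> source_share n * (2 * A ^ (3 * (n + 1)) + N ^ (3 * n + 5) / sqrt 2 ^ (3 * n + 1))" .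
  have "I4 \<le> 2 * A ^ (4 * (n + 1))"
    unfolding I4_def by (rule power_step[OF si(3) defect_4_le defect_si(2) _ n]) auto
  also have "\<dots> \<le> source_share n * (4 * A ^ (4 * (n + 1)))"
    using mult_right_mono[OF th Ik[of "4 * (n + 1)"]] by linarith
  finally have b4: "I4 \<le> source_share n * (4 * A ^ (4 * (n + 1)))" .
  have "I2 \<le> 2 * A ^ (2 * (n + 1))"
    unfolding I2_def by (rule power_step[OF si(4) u2 u_power_facts(2) _ n]) auto
  also have "\<dots> \<le> source_share n * (4 * A ^ (2 * (n + 1)))"
    using mult_right_mono[OF th Ik[of "2 * (n + 1)"]] by linarith
  finally have b2: "I2 \<le> source_share n * (4 * A ^ (2 * (n + 1)))" .
  define S where "S = c1 * I1 + c3 * I3 + c4 * I4 + 1 / 2 * I2"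
  have "S \<le> c1 * (source_share n * (4 * A ^ (n + 1)))
      + c3 * (source_share n * (2 * A ^ (3 * (n + 1)) + N ^ (3 * n + 5) / sqrt 2 ^ (3 * n + 1)))
      + c4 * (source_share n * (4 * A ^ (4 * (n + 1)))) + 1 / 2 * (source_share n * (4 * A ^ (2 * (n + 1))))"
    unfolding S_def by (intro add_mono mult_left_mono b1 b2 b3 b4 c) auto
  also have "\<dots> = source_share n * const_C13 \<alpha> \<beta> \<gamma> \<Gamma> n N"
    unfolding const_C13_eq[OF n] c1_def c3_def c4_def by (simp add: distrib_left distrib_right mult_ac)
  finally have S: "S \<le> source_share n * const_C13 \<alpha> \<beta> \<gamma> \<Gamma> n N" .
  have C13: "0 \<le> const_C13 \<alpha> \<beta> \<gamma> \<Gamma> n N"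
    using N unfolding const_C13_def by (intro add_nonneg_nonneg divide_nonneg_nonneg mult_nonneg_nonneg) auto
  note y = Young_integral[OF n \<kappa> _ pi(1)] Young_integral[OF n \<kappa> _ pi(2)] Young_integral[OF n \<kappa> _ pi(3)]
    Young_integral[OF n \<kappa> _ pi(4)]
  have yi: "integrable lborel (\<lambda>x. v x ^ (2 * n) * \<bar>defect 1 x\<bar>)" "integrable lborel (\<lambda>x. v x ^ (2 * n) * \<bar>defect 3 x\<bar>)"
    "integrable lborel (\<lambda>x. v x ^ (2 * n) * \<bar>defect 4 x\<bar>)" "integrable lborel (\<lambda>x. v x ^ (2 * n) * \<bar>(u x)\<^sup>2\<bar>)"
    by (rule y; measurable)+
  define E where "E = real n / real (n + 1) / \<kappa>"
  define H where "H = \<kappa> ^ n / real (n + 1)"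
  have yb: "(LBINT x. v x ^ (2 * n) * \<bar>defect 1 x\<bar>) \<le> E * ?M + H * I1"
    "(LBINT x. v x ^ (2 * n) * \<bar>defect 3 x\<bar>) \<le> E * ?M + H * I3"
    "(LBINT x. v x ^ (2 * n) * \<bar>defect 4 x\<bar>) \<le> E * ?M + H * I4"
    "(LBINT x. v x ^ (2 * n) * \<bar>(u x)\<^sup>2\<bar>) \<le> E * ?M + H * I2"
    unfolding E_def H_def I1_def I2_def I3_def I4_def by (rule y; measurable)+
  have e: "v x ^ (2 * n) * source \<alpha> \<beta> \<gamma> \<Gamma> x = c1 * (v x ^ (2 * n) * \<bar>defect 1 x\<bar>) + c3 * (v x ^ (2 * n) * \<bar>defect 3 x\<bar>)
      + c4 * (v x ^ (2 * n) * \<bar>defect 4 x\<bar>) + 1 / 2 * (v x ^ (2 * n) * \<bar>(u x)\<^sup>2\<bar>)" for x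
    unfolding source_def c1_def[symmetric] c3_def[symmetric] c4_def[symmetric]
    by (simp only: distrib_left mult.left_commute)
  show "integrable lborel (\<lambda>x. v x ^ (2 * n) * source \<alpha> \<beta> \<gamma> \<Gamma> x)"
    unfolding e by (intro Bochner_Integration.integrable_add integrable_mult_right yi)
  have "(LBINT x. v x ^ (2 * n) * source \<alpha> \<beta> \<gamma> \<Gamma> x)
      = c1 * (LBINT x. v x ^ (2 * n) * \<bar>defect 1 x\<bar>) + c3 * (LBINT x. v x ^ (2 * n) * \<bar>defect 3 x\<bar>)
      + c4 * (LBINT x. v x ^ (2 * n) * \<bar>defect 4 x\<bar>) + 1 / 2 * (LBINT x. v x ^ (2 * n) * \<bar>(u x)\<^sup>2\<bar>)"
    unfolding e using yi
    by (simp only: Bochner_Integration.integral_add Bochner_Integration.integrable_add integrable_mult_right integral_mult_right_zero)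
  also have "\<dots> \<le> c1 * (E * ?M + H * I1) + c3 * (E * ?M + H * I3) + c4 * (E * ?M + H * I4) + 1 / 2 * (E * ?M + H * I2)"
    by (intro add_mono mult_left_mono yb c) auto
  also have "\<dots> = ?C2 * E * ?M + H * S"
    unfolding C2(1) S_def by (simp add: algebra_simps)
  finally have le: "(LBINT x. v x ^ (2 * n) * source \<alpha> \<beta> \<gamma> \<Gamma> x) \<le> ?C2 * E * ?M + H * S" .
  have E: "(2 * real n + 1) * (?C2 * E) = (2 * real n - 1) * \<eta>"
  proof -
    have "(2 * real n + 1) * (?C2 * E) = (real n * (2 * real n + 1) * ?C2 / (real n + 1)) / \<kappa>"
      by (simp add: E_def add.commute mult_ac)
    also have "real n * (2 * real n + 1) * ?C2 / (real n + 1) = (2 * real n - 1) * \<kappa>0"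
      using n by (simp add: \<kappa>0_def)
    also have "(2 * real n - 1) * \<kappa>0 / \<kappa> = (2 * real n - 1) * \<eta>"
      using \<kappa>0 \<eta> by (simp add: \<kappa>_def)
    finally show ?thesis .
  qed
  have H: "H * S \<le> const_C13 \<alpha> \<beta> \<gamma> \<Gamma> n N / (real n + 1) * (8 * \<kappa>0) ^ n"
  proof -
    have "\<kappa> ^ n * source_share n = (8 * \<kappa>0) ^ n"
    proof (cases "n = 1")
      case True
      then show ?thesis by (simp add: \<kappa>_def \<eta>_def damping_share_def source_share_def)
    next
      case False
      then show ?thesis by (simp add: \<kappa>_def \<eta>_def damping_share_def source_share_def)
    qed
    moreover have "H * S \<le> H * (source_share n * const_C13 \<alpha> \<beta> \<gamma> \<Gamma> n N)"
      using \<kappa> by (intro mult_left_mono S) (simp add: H_def)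
    moreover have "H * (source_share n * const_C13 \<alpha> \<beta> \<gamma> \<Gamma> n N)
        = const_C13 \<alpha> \<beta> \<gamma> \<Gamma> n N / (real n + 1) * (\<kappa> ^ n * source_share n)"
      by (simp add: H_def add.commute mult_ac)
    ultimately show ?thesis by simp
  qed
  have "(2 * real n + 1) * (LBINT x. v x ^ (2 * n) * source \<alpha> \<beta> \<gamma> \<Gamma> x)
      \<le> (2 * real n + 1) * (?C2 * E * ?M + const_C13 \<alpha> \<beta> \<gamma> \<Gamma> n N / (real n + 1) * (8 * \<kappa>0) ^ n)"
    using le H by (intro mult_left_mono) auto
  also have "\<dots> = ((2 * real n + 1) * (?C2 * E)) * ?M + (2 * real n + 1) * const_C13 \<alpha> \<beta> \<gamma> \<Gamma> n N / (real n + 1) * (8 * \<kappa>0) ^ n"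
    by (simp add: algebra_simps)
  also have "8 * \<kappa>0 = 8 * real n * (2 * real n + 1) * ?C2 / ((2 * real n - 1) * (real n + 1))"
    by (simp add: \<kappa>0_def mult.assoc)
  finally show "(2 * real n + 1) * (LBINT x. v x ^ (2 * n) * source \<alpha> \<beta> \<gamma> \<Gamma> x)
      \<le> (2 * real n - 1) * (3 / 8 - damping_share n) * ?M
        + (2 * real n + 1) * const_C13 \<alpha> \<beta> \<gamma> \<Gamma> n N / (real n + 1)
          * (8 * real n * (2 * real n + 1) * ?C2 / ((2 * real n - 1) * (real n + 1))) ^ n"
    unfolding E \<eta>_def .
qed

text \<open>Linearity of \<open>Lambda_inv2\<close> isolates the defects. For the quadratic part q =
  u^2 + v^2 / 2, \<open>Lambda_inv2_lower_bound\<close> bounds q minus its average by (u^2 + v^2) /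
  2, so the v^2 under the convolution never has to be estimated from above. The u^2 / 2 that stays
  behind is the last entry of \<open>source\<close> and the 1/2 in C_2.\<close>

lemma nonlocal_term_le:
  "Lambda_inv2 (nonlocal_term \<alpha> \<beta> \<gamma> \<Gamma> u v) x - nonlocal_term \<alpha> \<beta> \<gamma> \<Gamma> u v x
    \<le> source \<alpha> \<beta> \<gamma> \<Gamma> x + 1 / 2 * (v x)\<^sup>2"
proof -
  let ?q = "\<lambda>y. (u y)\<^sup>2 + (v y)\<^sup>2 / 2"
  have bc: "bounded_continuous (\<lambda>y. c * u y ^ k) (\<bar>c\<bar> * A ^ k)" for c k
    using u_power2_le(3)
    by unfold_locales (auto intro!: continuous_intros u_cont mult_left_mono power_mono simp: abs_mult power_abs)
  have bq: "bounded_continuous (\<lambda>y. - 1 * ?q y) (A\<^sup>2 + M\<^sup>2)"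
  proof unfold_locales
    fix y
    have "(v y)\<^sup>2 \<le> M\<^sup>2" using power_mono[OF v_bdd[of y], of 2] by simp
    then show "\<bar>- 1 * ?q y\<bar> \<le> A\<^sup>2 + M\<^sup>2"
      using u_power2_le(2)[of y] zero_le_power2[of "u y"] zero_le_power2[of "v y"]
      unfolding abs_le_iff mult_minus1 minus_minus by linarith
  qed (intro continuous_intros u_cont v_cont, simp)
  have bsum: "bounded_continuous (\<lambda>y. f y + g y) (B + C)" if "bounded_continuous f B" "bounded_continuous g C" for f g B C
    using that unfolding bounded_continuous_def
    by (auto intro!: continuous_intros order_trans[OF abs_triangle_ineq] add_mono)
  have e: "nonlocal_term \<alpha> \<beta> \<gamma> \<Gamma> u v = (\<lambda>y. (\<alpha> + \<Gamma>) * u y ^ 1 + (\<beta> / 3 * u y ^ 3 + (\<gamma> / 4 * u y ^ 4 + - 1 * ?q y)))"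
    by (simp add: nonlocal_term_def h_def fun_eq_iff)
  have "Lambda_inv2 (nonlocal_term \<alpha> \<beta> \<gamma> \<Gamma> u v) x = (\<alpha> + \<Gamma>) * Lambda_inv2 (\<lambda>y. u y ^ 1) x
      + (\<beta> / 3 * Lambda_inv2 (\<lambda>y. u y ^ 3) x + (\<gamma> / 4 * Lambda_inv2 (\<lambda>y. u y ^ 4) x + - 1 * Lambda_inv2 ?q x))"
    unfolding e
    by (subst Lambda_inv2_add[OF bc bsum[OF bc bsum[OF bc bq]]], subst Lambda_inv2_add[OF bc bsum[OF bc bq]],
        subst Lambda_inv2_add[OF bc bq]) (simp only: Lambda_inv2_cmult)
  then have "Lambda_inv2 (nonlocal_term \<alpha> \<beta> \<gamma> \<Gamma> u v) x - nonlocal_term \<alpha> \<beta> \<gamma> \<Gamma> u v x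
      = - ((\<alpha> + \<Gamma>) * defect 1 x) - \<beta> / 3 * defect 3 x - \<gamma> / 4 * defect 4 x + (u x)\<^sup>2 + (v x)\<^sup>2 / 2 - Lambda_inv2 ?q x"
    unfolding e defect_def by (simp add: algebra_simps)
  moreover have "(u x)\<^sup>2 / 2 \<le> Lambda_inv2 ?q x"
    by (rule Lambda_inv2_lower_bound[OF deriv u_bdd v_cont v_bdd])
  moreover have "- ((\<alpha> + \<Gamma>) * defect 1 x) \<le> (\<bar>\<alpha>\<bar> + \<bar>\<Gamma>\<bar>) * \<bar>defect 1 x\<bar>"
  proof -
    have "- ((\<alpha> + \<Gamma>) * defect 1 x) \<le> \<bar>\<alpha> + \<Gamma>\<bar> * \<bar>defect 1 x\<bar>"
      unfolding abs_mult[symmetric] by linarith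
    also have "\<dots> \<le> (\<bar>\<alpha>\<bar> + \<bar>\<Gamma>\<bar>) * \<bar>defect 1 x\<bar>" by (intro mult_right_mono) auto
    finally show ?thesis .
  qed
  moreover have "- (\<beta> / 3 * defect 3 x) \<le> \<bar>\<beta>\<bar> / 3 * \<bar>defect 3 x\<bar>" "- (\<gamma> / 4 * defect 4 x) \<le> \<bar>\<gamma>\<bar> / 4 * \<bar>defect 4 x\<bar>"
    using abs_ge_minus_self[of "\<beta> / 3 * defect 3 x"] abs_ge_minus_self[of "\<gamma> / 4 * defect 4 x"]
    by (simp_all add: abs_mult)
  moreover have "\<bar>(u x)\<^sup>2\<bar> = (u x)\<^sup>2" by simp
  ultimately show ?thesis unfolding source_def by linarith
qed

text \<open>The right-hand side of the evolution of \<open>\<integral> v ^ (2n + 1)\<close>.\<close>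

lemma slope_rate_le:
  fixes c lam :: real
  assumes n: "1 \<le> n" and c: "0 < c" and lam: "0 < lam" and N0: "0 < N"
    and GN: "\<bar>LBINT x. v x ^ (2 * n + 1)\<bar> powr (2 * real n / (2 * real n - 1))
      \<le> c * (LBINT x. (v x)\<^sup>2) powr (1 / (2 * real n - 1)) * (LBINT x. v x ^ (2 * n + 2))"
    and i: "integrable lborel (\<lambda>x. v x ^ (2 * n)
      * (Lambda_inv2 (nonlocal_term \<alpha> \<beta> \<gamma> \<Gamma> u v) x - nonlocal_term \<alpha> \<beta> \<gamma> \<Gamma> u v x))"
  shows "- (2 * real n) * (LBINT x. v x ^ (2 * n + 2)) - lam * (2 * real n + 1) * (LBINT x. v x ^ (2 * n + 1))
      + (2 * real n + 1) * (LBINT x. v x ^ (2 * n)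
          * (Lambda_inv2 (nonlocal_term \<alpha> \<beta> \<gamma> \<Gamma> u v) x - nonlocal_term \<alpha> \<beta> \<gamma> \<Gamma> u v x))
    \<le> const_Ksq \<alpha> \<beta> \<gamma> \<Gamma> lam c n N
      - (2 * real n - 1) / (8 * c) * N powr (- 2 / (2 * real n - 1))
        * \<bar>LBINT x. v x ^ (2 * n + 1)\<bar> powr (2 * real n / (2 * real n - 1))"
proof -
  let ?M = "LBINT x. v x ^ (2 * n + 2)" and ?f = "LBINT x. v x ^ (2 * n + 1)"
  let ?g = "\<lambda>x. Lambda_inv2 (nonlocal_term \<alpha> \<beta> \<gamma> \<Gamma> u v) x - nonlocal_term \<alpha> \<beta> \<gamma> \<Gamma> u v x"
  let ?s = "\<lambda>x. v x ^ (2 * n) * source \<alpha> \<beta> \<gamma> \<Gamma> x"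
  define m where "m = 2 * real n - 1"
  have m: "0 < m" using n by (simp add: m_def)
  \<comment> \<open>With this B the Gagliardo-Nirenberg inequality and the energy bound give Q <= B
    times the integral of v^(2n + 2); the first summand of K^2 contains the same B.\<close>
  define B where "B = c * N powr (2 / m)"
  have B: "0 < B" using c N0 by (simp add: B_def)
  define Q where "Q = \<bar>?f\<bar> powr (2 * real n / (2 * real n - 1))"
  have M0: "0 \<le> ?M"
    by (intro Bochner_Integration.integral_nonneg zero_le_even_power) simp
  have QB: "Q \<le> B * ?M"
  proof -
    have "(l2norm v)\<^sup>2 \<le> N\<^sup>2" using H1 zero_le_power2[of "l2norm u"] by linarith
    then have "(LBINT x. (v x)\<^sup>2) \<le> N\<^sup>2" by simp
    then have "(LBINT x. (v x)\<^sup>2) powr (1 / m) \<le> (N\<^sup>2) powr (1 / m)"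
      using m by (intro powr_mono2) auto
    also have "\<dots> = N powr (2 / m)" using N0 by (simp add: powr_powr powr_numeral[symmetric] del: powr_numeral)
    finally have "c * (LBINT x. (v x)\<^sup>2) powr (1 / m) * ?M \<le> B * ?M"
      unfolding B_def using c M0 by (intro mult_right_mono mult_left_mono) auto
    then show ?thesis using GN unfolding Q_def m_def by linarith
  qed
  have int_g: "(LBINT x. v x ^ (2 * n) * ?g x) \<le> (LBINT x. ?s x) + 1 / 2 * ?M"
  proof -
    have "(LBINT x. v x ^ (2 * n) * ?g x) \<le> (LBINT x. ?s x + 1 / 2 * v x ^ (2 * n + 2))"
    proof (rule integral_mono[OF i])
      show "integrable lborel (\<lambda>x. ?s x + 1 / 2 * v x ^ (2 * n + 2))"
        by (intro Bochner_Integration.integrable_add integrable_mult_right source_bound(1) v_power_integrable n)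
      fix x
      have "v x ^ (2 * n) * ?g x \<le> v x ^ (2 * n) * (source \<alpha> \<beta> \<gamma> \<Gamma> x + 1 / 2 * (v x)\<^sup>2)"
        by (intro mult_left_mono nonlocal_term_le) (simp add: power_mult)
      also have "\<dots> = ?s x + 1 / 2 * (v x ^ (2 * n) * (v x)\<^sup>2)"
        by (simp only: distrib_left mult.left_commute)
      also have "v x ^ (2 * n) * (v x)\<^sup>2 = v x ^ (2 * n + 2)"
        by (simp only: power_add)
      finally show "v x ^ (2 * n) * ?g x \<le> ?s x + 1 / 2 * v x ^ (2 * n + 2)" .
    qed
    also have "\<dots> = (LBINT x. ?s x) + (LBINT x. 1 / 2 * v x ^ (2 * n + 2))"
      by (intro Bochner_Integration.integral_add integrable_mult_right source_bound(1) v_power_integrable n)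
    finally show ?thesis by (simp only: integral_mult_right_zero)
  qed
  define X where "X = (2 * real n + 1) * (LBINT x. v x ^ (2 * n) * ?g x)"
  define Z where "Z = (2 * real n + 1) * (LBINT x. ?s x)"
  define L where "L = lam * (2 * real n + 1) * \<bar>?f\<bar>"
  define mM where "mM = m * ?M"
  define dM where "dM = m * damping_share n * ?M"
  define K1 where "K1 = lam * (real n + 1) * (4 * B * lam * (real n + 1)) ^ (2 * n - 1) / (2 * real n ^ (2 * n))"
  define K2 where "K2 = (2 * real n + 1) * const_C13 \<alpha> \<beta> \<gamma> \<Gamma> n N / (real n + 1)
      * (8 * real n * (2 * real n + 1) * const_C2 \<alpha> \<beta> \<gamma> \<Gamma> / ((2 * real n - 1) * (real n + 1))) ^ n"
  have nM: "2 * real n * ?M = mM + ?M" by (simp add: mM_def m_def algebra_simps)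
  have "X \<le> (2 * real n + 1) * ((LBINT x. ?s x) + 1 / 2 * ?M)"
    unfolding X_def by (rule mult_left_mono[OF int_g]) simp
  also have "\<dots> = Z + (mM + 2 * ?M) / 2"
    using nM by (simp add: Z_def distrib_left distrib_right)
  finally have 1: "X \<le> Z + (mM + 2 * ?M) / 2" .
  have "Z \<le> (2 * real n - 1) * (3 / 8 - damping_share n) * ?M + K2"
    unfolding Z_def K2_def by (rule source_bound(2)[OF n])
  also have "\<dots> = 3 / 8 * mM - dM + K2"
  proof -
    have "a * (3 / 8 - b) * y + k = 3 / 8 * (a * y) - a * b * y + k" for a b y k :: real
      by (simp add: algebra_simps)
    then show ?thesis unfolding mM_def dM_def m_def .
  qed
  finally have 2: "Z \<le> 3 / 8 * mM - dM + K2" .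
  have "lam * (2 * real n + 1) * (- ?f) \<le> L"
    unfolding L_def using lam by (intro mult_left_mono) auto
  then have 3: "- (lam * (2 * real n + 1) * ?f) \<le> L" by simp
  have 4: "L \<le> m * damping_share n / B * Q + K1"
    unfolding L_def K1_def Q_def m_def by (rule damping_bound[OF n B lam]) simp
  have 5: "m * damping_share n / B * Q \<le> dM"
  proof -
    have "m * damping_share n / B * Q \<le> m * damping_share n / B * (B * ?M)"
      using m B by (intro mult_left_mono QB) (auto simp: damping_share_def)
    then show ?thesis using B by (simp add: dM_def)
  qed
  have 6: "m / (8 * B) * Q \<le> mM / 8"
  proof -
    have "m / (8 * B) * Q \<le> m / (8 * B) * (B * ?M)"
      using m B by (intro mult_left_mono QB) auto
    then show ?thesis using B by (simp add: mM_def)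
  qed
  have 7: "const_Ksq \<alpha> \<beta> \<gamma> \<Gamma> lam c n N = K1 + K2"
  proof -
    have "4 * c * lam * (real n + 1) * N powr (2 / (2 * real n - 1)) = 4 * B * lam * (real n + 1)"
      by (simp add: B_def m_def)
    then show ?thesis unfolding const_Ksq_def K1_def K2_def by (simp only:)
  qed
  have 8: "(2 * real n - 1) / (8 * c) * N powr (- 2 / (2 * real n - 1)) * Q = m / (8 * B) * Q"
  proof -
    have "N powr (- 2 / m) = inverse (N powr (2 / m))"
      by (simp only: powr_minus[symmetric] minus_divide_left)
    then show ?thesis
      unfolding m_def[symmetric] B_def by (simp only: divide_inverse inverse_mult_distrib mult_ac)
  qed
  have "- (2 * real n) * ?M - lam * (2 * real n + 1) * ?f + X \<le> K1 + K2 - m / (8 * B) * Q"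
  proof -
    \<comment> \<open>The balance of the budget, with y the integral of v^(2n + 2) and w = m y: - (w
      + y) + (w + 2 y) / 2 + (3/8) w = - w / 8. The damping cost e is covered by the amount d set
      aside in the source estimate, and w / 8 pays for r.\<close>
    have "- p - q + x \<le> k1 + k2 - r"
      if "x \<le> z + (w + 2 * y) / 2" "z \<le> 3 / 8 * w - d + k2" "- q \<le> l" "l \<le> e + k1"
        "e \<le> d" "r \<le> w / 8" "p = w + y" for p q x k1 k2 r z w y d l e :: real
      using that by argo
    from this[OF 1 2 3 4 5 6 nM] show ?thesis unfolding mult_minus_left .
  qed
  then show ?thesis unfolding X_def 7 Q_def[symmetric] 8 .
qed

end

section \<open>Blow-up time of the Riccati inequality\<close>

lemma set_integrable_powr_atLeast:
  fixes b e :: real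
  assumes b: "0 < b" and e: "e < - 1"
  shows "set_integrable lborel {b..} (\<lambda>x. x powr e)"
proof -
  have "((\<lambda>x::real. x powr e) has_integral - (b powr (e + 1)) / (e + 1)) {b..}"
    by (rule has_integral_powr_to_inf) (use b e in auto)
  then have "(\<lambda>x::real. x powr e) absolutely_integrable_on {b..}"
    by (intro nonnegative_absolutely_integrable_1) (auto simp: has_integral_integrable)
  then show ?thesis
    unfolding set_integrable_def by (subst (asm) integrable_completion) auto
qed

text \<open>The rate \<rho> is not known to be continuous, so g itself is not differentiated.
  Instead G = y0 + integral of \<psi>(g) is C^1, stays below g and satisfies G' = \<psi>(g) >=
  \<psi>(G); separation of variables is applied to G.\<close>

lemma riccati_time_le:
  fixes g \<rho> :: "real \<Rightarrow> real"
  assumes q: "1 < q" and a: "0 < a" and K: "0 \<le> K" and y0: "0 < y0" "K < a * y0 powr q" and T: "0 < T"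
    and g0: "g 0 = y0"
    and int: "\<And>t. t \<in> {0..T} \<Longrightarrow> (\<rho> has_integral (g t - g 0)) {0..t}"
    and le: "\<And>t. t \<in> {0..T} \<Longrightarrow> a * \<bar>g t\<bar> powr q - K \<le> \<rho> t"
  shows "T \<le> (LBINT y:{y0..}. 1 / (a * y powr q - K))"
proof -
  \<comment> \<open>The positive part makes \<psi> monotone on the whole line and keeps \<psi>(y)
    below \<open>a * \<bar>y\<bar> powr q - K\<close>, whatever the sign of y.\<close>
  define \<psi> where "\<psi> y = a * (max y 0) powr q - K" for y
  have \<psi>_mono: "\<psi> x \<le> \<psi> y" if "x \<le> y" for x y
    using that a q unfolding \<psi>_def by (intro diff_right_mono mult_left_mono powr_mono2) auto
  have \<psi>_cont: "continuous_on UNIV \<psi>"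
    unfolding \<psi>_def using q by (intro continuous_intros continuous_on_powr') auto
  have \<psi>_eq: "\<psi> y = a * y powr q - K" if "y0 \<le> y" for y using that y0 by (simp add: \<psi>_def max_def)
  have \<psi>0: "0 < \<psi> y0" using y0 by (simp add: \<psi>_eq)
  have \<psi>_pos: "0 < \<psi> y" if "y0 \<le> y" for y using \<psi>0 \<psi>_mono[OF that] by linarith
  have g_eq: "g t = y0 + integral {0..t} \<rho>" if "t \<in> {0..T}" for t
    using int[OF that] g0 by (simp add: integral_unique)
  have \<rho>_int: "\<rho> integrable_on {0..T}" using int[of T] T by auto
  have g_cont: "continuous_on {0..T} g"
  proof (rule continuous_on_eq)
    show "continuous_on {0..T} (\<lambda>t. y0 + integral {0..t} \<rho>)"
      by (intro continuous_intros indefinite_integral_continuous_1 \<rho>_int)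
  qed (use g_eq in auto)
  have \<psi>g_cont: "continuous_on {0..T} (\<lambda>t. \<psi> (g t))"
    by (rule continuous_on_compose2[OF \<psi>_cont g_cont]) auto
  define G where "G t = y0 + integral {0..t} (\<lambda>\<tau>. \<psi> (g \<tau>))" for t
  have G_der: "(G has_real_derivative \<psi> (g t)) (at t within {0..T})" if "t \<in> {0..T}" for t
  proof -
    have "((\<lambda>t. integral {0..t} (\<lambda>\<tau>. \<psi> (g \<tau>))) has_real_derivative \<psi> (g t)) (at t within {0..T})"
      by (rule integral_has_real_derivative[OF \<psi>g_cont that])
    then show ?thesis unfolding G_def by (auto intro!: derivative_eq_intros)
  qed
  have G_cont: "continuous_on {0..T} G"
    using G_der by (meson DERIV_continuous continuous_on_eq_continuous_within)
  have G_le: "G t \<le> g t" if t: "t \<in> {0..T}" for t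
  proof -
    have "integral {0..t} (\<lambda>\<tau>. \<psi> (g \<tau>)) \<le> integral {0..t} \<rho>"
    proof (rule integral_le)
      show "(\<lambda>\<tau>. \<psi> (g \<tau>)) integrable_on {0..t}"
        using t by (intro integrable_continuous_interval continuous_on_subset[OF \<psi>g_cont]) auto
      show "\<rho> integrable_on {0..t}" using int[OF t] by auto
      fix \<tau> assume "\<tau> \<in> {0..t}"
      then have "a * \<bar>g \<tau>\<bar> powr q - K \<le> \<rho> \<tau>" using t by (intro le) auto
      moreover have "\<psi> (g \<tau>) \<le> a * \<bar>g \<tau>\<bar> powr q - K"
        unfolding \<psi>_def using a q by (intro diff_right_mono mult_left_mono powr_mono2) auto
      ultimately show "\<psi> (g \<tau>) \<le> \<rho> \<tau>" by linarith
    qed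
    then show ?thesis using g_eq[OF t] by (simp add: G_def)
  qed
  have G0: "G 0 = y0" by (simp add: G_def)
  have G_ge: "y0 \<le> G t" if t: "t \<in> {0..T}" for t
  proof (rule ccontr)
    assume n: "\<not> y0 \<le> G t"
    \<comment> \<open>The last time up to t at which G is at least y0 leads to a contradiction: G'
      is positive there, so G would stay above y0 a little longer.\<close>
    define S where "S = {\<tau> \<in> {0..t}. y0 \<le> G \<tau>}"
    have ct: "continuous_on {0..t} G" using t by (intro continuous_on_subset[OF G_cont]) auto
    have "S = {0..t} \<inter> G -` {y0..}" by (auto simp: S_def)
    then have "closed S" by (simp add: continuous_closed_preimage[OF ct])
    moreover have S0: "0 \<in> S" using t G0 by (auto simp: S_def)
    moreover have "bdd_above S" by (auto simp: S_def intro!: bdd_aboveI[of _ t])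
    ultimately have s: "Sup S \<in> S" by (intro closed_contains_Sup) auto
    define t0 where "t0 = Sup S"
    have t0: "0 \<le> t0" "t0 \<le> t" "y0 \<le> G t0" using s by (auto simp: S_def t0_def)
    have "t0 \<noteq> t" using t0(3) n by auto
    with t0 have t0t: "t0 < t" by simp
    have "\<psi> (G t0) \<le> \<psi> (g t0)" using t0 t by (intro \<psi>_mono G_le) auto
    then have "0 < \<psi> (g t0)" using \<psi>_pos[OF t0(3)] by linarith
    moreover have "(G has_real_derivative \<psi> (g t0)) (at t0 within {0..T})"
      using t0 t by (intro G_der) auto
    ultimately obtain d where d: "0 < d" "\<And>h. 0 < h \<Longrightarrow> t0 + h \<in> {0..T} \<Longrightarrow> h < d \<Longrightarrow> G t0 < G (t0 + h)"
      using has_real_derivative_pos_inc_right by blast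
    define e where "e = min (d / 2) (t - t0)"
    have e: "0 < e" "e < d" "t0 + e \<le> t" using d(1) t0t by (auto simp: e_def)
    then have "G t0 < G (t0 + e)" using t0 t by (intro d(2)) auto
    then have "t0 + e \<in> S" using t0 e by (auto simp: S_def)
    then have "t0 + e \<le> t0" unfolding t0_def using \<open>bdd_above S\<close> by (rule cSup_upper)
    with e show False by simp
  qed
  obtain b where b: "\<And>t. t \<in> {0..T} \<Longrightarrow> G t \<le> b"
    using continuous_attains_sup[OF compact_Icc _ G_cont] T by fastforce
  define \<phi> where "\<phi> y = 1 / \<psi> y" for y
  have \<phi>_cont: "continuous_on {y0..c} \<phi>" for c
    unfolding \<phi>_def by (intro continuous_intros continuous_on_subset[OF \<psi>_cont]) (use \<psi>_pos in force)+
  \<comment> \<open>The elapsed time as a function of the level reached. It is differentiable only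
    one-sidedly at y0, so the chain rule is used within the image of G, which lies to the right of
    y0 by \<open>G_ge\<close>.\<close>
  define \<Phi> where "\<Phi> y = integral {y0..y} \<phi>" for y
  have FTC: "((\<lambda>t. \<phi> (G t) * \<psi> (g t)) has_integral (\<Phi> (G T) - \<Phi> (G 0))) {0..T}"
  proof (rule fundamental_theorem_of_calculus)
    fix t assume t: "t \<in> {0..T}"
    have "(\<Phi> has_real_derivative \<phi> (G t)) (at (G t) within {y0..b})"
      unfolding \<Phi>_def by (rule integral_has_real_derivative[OF \<phi>_cont]) (use b G_ge t in auto)
    then have "(\<Phi> has_real_derivative \<phi> (G t)) (at (G t) within G ` {0..T})"
      by (rule DERIV_subset) (use b G_ge in auto)
    from DERIV_image_chain[OF this G_der[OF t]]
    show "((\<lambda>t. \<Phi> (G t)) has_vector_derivative \<phi> (G t) * \<psi> (g t)) (at t within {0..T})"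
      by (simp add: has_real_derivative_iff_has_vector_derivative o_def)
  qed (use T in simp)
  have one: "((\<lambda>t. 1 :: real) has_integral T) {0..T}"
    using has_integral_const_real[of "1 :: real" 0 T] T by simp
  have "1 \<le> \<phi> (G t) * \<psi> (g t)" if t: "t \<in> {0..T}" for t
  proof -
    have "\<psi> (G t) \<le> \<psi> (g t)" by (rule \<psi>_mono[OF G_le[OF t]])
    then show ?thesis using \<psi>_pos[OF G_ge[OF t]] by (simp add: \<phi>_def)
  qed
  from has_integral_le[OF one FTC this] have "T \<le> \<Phi> (G T) - \<Phi> (G 0)" .
  also have "\<Phi> (G 0) = 0" by (simp add: \<Phi>_def G0)
  finally have T_le: "T \<le> \<Phi> (G T)" by simp
  \<comment> \<open>Makes \<open>\<theta> * y powr q\<close> a lower bound of \<psi> on the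
    half-line, with equality at y0; thus 1 / \<psi> is dominated by a multiple of
    \<open>y powr (- q)\<close>, and q > 1 gives integrability.\<close>
  define \<theta> where "\<theta> = \<psi> y0 / y0 powr q"
  have \<theta>: "0 < \<theta>" using \<psi>0 y0 by (simp add: \<theta>_def)
  have \<psi>_ge: "\<theta> * y powr q \<le> \<psi> y" if y: "y0 \<le> y" for y
  proof -
    have p: "0 < y0 powr q" using y0 by simp
    have "y0 powr q \<le> y powr q" using y y0 q by (intro powr_mono2) auto
    then have "K * 1 \<le> K * (y powr q / y0 powr q)" using K p by (intro mult_left_mono) auto
    moreover have "\<theta> * y powr q = a * y powr q - K * (y powr q / y0 powr q)"
      using p unfolding \<theta>_def \<psi>_eq[OF order_refl] by (simp add: field_simps)
    ultimately show ?thesis unfolding \<psi>_eq[OF y] by linarith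
  qed
  \<comment> \<open>If this failed, the integral over the half-line would be 0 by convention and
    could not bound T.\<close>
  have int_\<phi>: "set_integrable lborel {y0..} \<phi>"
    unfolding set_integrable_def
  proof (rule Bochner_Integration.integrable_bound)
    have "set_integrable lborel {y0..} (\<lambda>y. 1 / \<theta> * y powr (- q))"
      by (intro set_integrable_mult_right set_integrable_powr_atLeast) (use y0 q in auto)
    then show "integrable lborel (\<lambda>y. indicator {y0..} y *\<^sub>R (1 / \<theta> * y powr (- q)))"
      by (simp add: set_integrable_def)
    have "\<psi> \<in> borel_measurable borel" using \<psi>_cont by (rule borel_measurable_continuous_onI)
    then show "(\<lambda>y. indicator {y0..} y *\<^sub>R \<phi> y) \<in> borel_measurable lborel"
      unfolding \<phi>_def by measurable
    show "AE y in lborel. norm (indicator {y0..} y *\<^sub>R \<phi> y) \<le> norm (indicator {y0..} y *\<^sub>R (1 / \<theta> * y powr (- q)))"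
    proof (rule AE_I2)
      fix y
      show "norm (indicator {y0..} y *\<^sub>R \<phi> y) \<le> norm (indicator {y0..} y *\<^sub>R (1 / \<theta> * y powr (- q)))"
      proof (cases "y0 \<le> y")
        case True
        then have p: "0 < \<theta> * y powr q" using \<theta> y0 by simp
        have "1 / \<psi> y \<le> 1 / (\<theta> * y powr q)"
          using \<psi>_ge[OF True] p by (intro divide_left_mono) (use \<psi>_pos[OF True] in auto)
        also have "\<dots> = 1 / \<theta> * y powr (- q)" by (simp add: powr_minus divide_inverse)
        finally show ?thesis using True \<psi>_pos[OF True] \<theta> by (simp add: \<phi>_def)
      qed simp
    qed
  qed
  have "\<Phi> (G T) = (LBINT y:{y0..G T}. \<phi> y)"
    unfolding \<Phi>_def
    by (rule set_borel_integral_eq_integral(2)[symmetric, OF set_integrable_subset[OF int_\<phi>]]) auto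
  also have "\<dots> \<le> (LBINT y:{y0..}. \<phi> y)"
    unfolding set_lebesgue_integral_def
  proof (rule integral_mono)
    show "integrable lborel (\<lambda>y. indicator {y0..G T} y *\<^sub>R \<phi> y)"
      using set_integrable_subset[OF int_\<phi>, of "{y0..G T}"] by (simp add: set_integrable_def)
    show "integrable lborel (\<lambda>y. indicator {y0..} y *\<^sub>R \<phi> y)"
      using int_\<phi> by (simp add: set_integrable_def)
    show "indicator {y0..G T} y *\<^sub>R \<phi> y \<le> indicator {y0..} y *\<^sub>R \<phi> y" for y
      using \<psi>_pos[of y] by (auto simp: indicator_def \<phi>_def)
  qed
  also have "\<dots> = (LBINT y:{y0..}. 1 / (a * y powr q - K))"
    by (rule set_lebesgue_integral_cong) (auto simp: \<phi>_def \<psi>_eq)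
  finally show ?thesis using T_le by linarith
qed

section \<open>Solutions of the equation\<close>

lemma nonlocal_term_bounded_continuous:
  assumes u: "continuous_on UNIV u" "\<And>x. \<bar>u x\<bar> \<le> M" and v: "continuous_on UNIV v" "\<And>x. \<bar>v x\<bar> \<le> M"
  shows "\<exists>B. bounded_continuous (nonlocal_term \<alpha> \<beta> \<gamma> \<Gamma> u v) B"
proof -
  let ?c = "\<bar>\<alpha> + \<Gamma>\<bar> + \<bar>\<beta>\<bar> / 3 * M\<^sup>2 + \<bar>\<gamma>\<bar> / 4 * M ^ 3"
  have M: "0 \<le> M" using u(2)[of 0] by linarith
  have "\<bar>nonlocal_term \<alpha> \<beta> \<gamma> \<Gamma> u v x\<bar> \<le> ?c * M + 2 * M\<^sup>2" for x
  proof -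
    have "\<bar>h \<alpha> \<beta> \<gamma> \<Gamma> (u x)\<bar> \<le> ?c * \<bar>u x\<bar>" by (rule h_abs_le[OF u(2)])
    also have "\<dots> \<le> ?c * M" using u(2)[of x] M by (intro mult_left_mono) auto
    finally have "\<bar>h \<alpha> \<beta> \<gamma> \<Gamma> (u x)\<bar> \<le> ?c * M" .
    moreover have "(u x)\<^sup>2 \<le> M\<^sup>2" "(v x)\<^sup>2 \<le> M\<^sup>2"
      using power_mono[OF u(2)[of x], of 2] power_mono[OF v(2)[of x], of 2] by auto
    ultimately show ?thesis
      unfolding nonlocal_term_def abs_le_iff
      using zero_le_power2[of "u x"] zero_le_power2[of "v x"] zero_le_power2[of M] by linarith
  qed
  moreover have "continuous_on UNIV (nonlocal_term \<alpha> \<beta> \<gamma> \<Gamma> u v)"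
    unfolding nonlocal_term_def[abs_def] h_def by (intro continuous_intros u v)
  ultimately show ?thesis unfolding bounded_continuous_def by blast
qed

text \<open>Both sides are continuous and agree almost everywhere, hence everywhere; the statement
  on slopes follows by uniqueness of the derivative.\<close>

lemma rep_diff:
  assumes s: "3 / 2 < s" and f: "f \<in> sobolev s" and g: "g \<in> sobolev s"
  shows "rep (\<lambda>x. f x - g x) x = rep f x - rep g x" "drep (\<lambda>x. f x - g x) x = drep f x - drep g x"
proof -
  let ?k = "\<lambda>x. f x - g x"
  have k: "?k \<in> sobolev s" by (rule sobolev_diff[OF f g])
  have c: "continuous_on UNIV (rep f')" if "f' \<in> sobolev s" for f'
    using rep_has_derivative[OF s that] by (meson DERIV_isCont continuous_at_imp_continuous_on)
  have "AE x in lborel. rep ?k x = rep f x - rep g x"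
    using rep_AE[OF s k] rep_AE[OF s f] rep_AE[OF s g] by eventually_elim simp
  then have eq: "rep ?k x = rep f x - rep g x" for x
    by (intro continuous_AE_eq_imp_eq[of "rep ?k" "\<lambda>x. rep f x - rep g x"] continuous_intros c k f g)
  show "rep ?k x = rep f x - rep g x" by (rule eq)
  have "((\<lambda>x. rep f x - rep g x) has_real_derivative drep f x - drep g x) (at x)"
    by (intro DERIV_diff rep_has_derivative[OF s f] rep_has_derivative[OF s g])
  then have "(rep ?k has_real_derivative drep f x - drep g x) (at x)"
    unfolding eq[abs_def] .
  then show "drep ?k x = drep f x - drep g x"
    using rep_has_derivative[OF s k, of x] by (intro DERIV_unique)
qed

lemma rep_l2norm_le:
  assumes s: "3 / 2 < s" and f: "f \<in> sobolev s"
  shows "l2norm (rep f) \<le> sobolev_norm s f" "l2norm (drep f) \<le> sobolev_norm s f"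
proof -
  have n0: "0 \<le> sobolev_norm r f" for r by (simp add: sobolev_norm_def)
  have "sobolev_norm 1 f \<le> sobolev_norm s f" by (rule sobolev_mono(2)[OF f]) (use s in simp)
  then have "(sobolev_norm 1 f)\<^sup>2 \<le> (sobolev_norm s f)\<^sup>2" by (intro power_mono n0)
  then have "(l2norm (rep f))\<^sup>2 \<le> (sobolev_norm s f)\<^sup>2" "(l2norm (drep f))\<^sup>2 \<le> (sobolev_norm s f)\<^sup>2"
    using rep_H1_le[OF s f] zero_le_power2[of "l2norm (rep f)"] zero_le_power2[of "l2norm (drep f)"] by linarith+
  then show "l2norm (rep f) \<le> sobolev_norm s f" "l2norm (drep f) \<le> sobolev_norm s f"
    using n0 by (auto intro: power2_le_imp_le simp del: l2norm_power2)
qed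

text \<open>\<open>evolution\<close> asks for one bound on the whole time interval. Continuity into
  H^s gives a bound near every time, and bisection of the interval joins these local bounds.\<close>

lemma sobolev_path_bounded:
  assumes s: "3 / 2 < s" and T: "0 < T" and u: "continuous_into_sobolev s T u"
  shows "\<exists>M. \<forall>t\<in>{0..T}. (\<forall>x. \<bar>drep (u t) x\<bar> \<le> M) \<and> l2norm (rep (u t)) \<le> M \<and> l2norm (drep (u t)) \<le> M"
proof -
  define Q where "Q M t \<longleftrightarrow> (\<forall>x. \<bar>drep (u t) x\<bar> \<le> M) \<and> l2norm (rep (u t)) \<le> M \<and> l2norm (drep (u t)) \<le> M" for M t
  have Q_mono: "Q M t \<Longrightarrow> M \<le> M' \<Longrightarrow> Q M' t" for M M' t
    unfolding Q_def by (meson order_trans)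
  define P where "P a b \<longleftrightarrow> (\<exists>M. \<forall>t\<in>{a..b} \<inter> {0..T}. Q M t)" for a b
  define w where "w = weight_const (s - 1) * sqrt (2 * pi)"
  have w: "0 \<le> w" by (simp add: w_def weight_const_def)
  have uS: "u t \<in> sobolev s" if "t \<in> {0..T}" for t
    using u that by (simp add: continuous_into_sobolev_def)
  have "P 0 T"
  proof (rule Bolzano)
    show "0 \<le> T" using T by simp
    show "P a c" if ab: "P a b" and bc: "P b c" and "a \<le> b" "b \<le> c" for a b c
    proof -
      obtain M1 M2 where "\<forall>t\<in>{a..b} \<inter> {0..T}. Q M1 t" "\<forall>t\<in>{b..c} \<inter> {0..T}. Q M2 t"
        using ab bc unfolding P_def by blast
      then have "\<forall>t\<in>{a..c} \<inter> {0..T}. Q (max M1 M2) t"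
        by (metis IntD1 IntD2 IntI Q_mono atLeastAtMost_iff linear max.cobounded1 max.cobounded2)
      then show ?thesis unfolding P_def by blast
    qed
    fix t assume "0 \<le> t" "t \<le> T"
    then have t: "t \<in> {0..T}" by simp
    have "((\<lambda>\<tau>. sobolev_norm s (\<lambda>x. u \<tau> x - u t x)) \<longlongrightarrow> 0) (at t within {0..T})"
      using u t by (simp add: continuous_into_sobolev_def)
    then have "\<forall>\<^sub>F \<tau> in at t within {0..T}. sobolev_norm s (\<lambda>x. u \<tau> x - u t x) < 1"
      by (rule order_tendstoD) simp
    then obtain d where d: "0 < d" "\<And>\<tau>. \<tau> \<in> {0..T} \<Longrightarrow> \<tau> \<noteq> t \<Longrightarrow> dist \<tau> t < d \<Longrightarrow> sobolev_norm s (\<lambda>x. u \<tau> x - u t x) < 1"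
      unfolding eventually_at by auto
    define n where "n = sobolev_norm s (u t)"
    \<comment> \<open>Large enough both for n + 1, which bounds the L2 norms within H^s distance 1
      of \<open>u t\<close>, and for w n + w, which bounds the slopes there.\<close>
    define M where "M = (w + 1) * (n + 1)"
    have n0: "0 \<le> n" by (simp add: n_def sobolev_norm_def)
    have Mge: "n + 1 \<le> M" "w * n + w \<le> M" using w n0 by (auto simp: M_def algebra_simps)
    have Qt: "Q M t"
      unfolding Q_def
    proof (intro conjI allI)
      fix x
      have "\<bar>drep (u t) x\<bar> \<le> w * n"
        using drep_abs_le[OF s uS[OF t], of x] by (simp add: w_def n_def mult.assoc)
      then show "\<bar>drep (u t) x\<bar> \<le> M" using Mge w by linarith
    qed (use rep_l2norm_le[OF s uS[OF t]] Mge in \<open>auto simp: n_def\<close>)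
    have Q\<tau>: "Q M \<tau>" if \<tau>: "\<tau> \<in> {0..T}" "dist \<tau> t < d" for \<tau>
    proof (cases "\<tau> = t")
      case True then show ?thesis using Qt by simp
    next
      case False
      let ?k = "\<lambda>x. u \<tau> x - u t x"
      have k: "?k \<in> sobolev s" by (rule sobolev_diff[OF uS[OF \<tau>(1)] uS[OF t]])
      have k1: "sobolev_norm s ?k \<le> 1" using d(2)[OF \<tau>(1) False \<tau>(2)] by simp
      note df = rep_diff[OF s uS[OF \<tau>(1)] uS[OF t]]
      have r: "rep (u \<tau>) = (\<lambda>x. rep ?k x + rep (u t) x)" "drep (u \<tau>) = (\<lambda>x. drep ?k x + drep (u t) x)"
        by (simp_all add: df)
      note tri = l2norm_triangle[OF rep_square_integrable[OF s k] rep_square_integrable[OF s uS[OF t]]]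
        l2norm_triangle[OF drep_square_integrable[OF s k] drep_square_integrable[OF s uS[OF t]]]
      show ?thesis
        unfolding Q_def
      proof (intro conjI allI)
        fix x
        have "\<bar>drep ?k x\<bar> \<le> w * sobolev_norm s ?k"
          using drep_abs_le[OF s k, of x] by (simp add: w_def mult.assoc)
        also have "\<dots> \<le> w * 1" by (intro mult_left_mono k1 w)
        finally have "\<bar>drep ?k x\<bar> \<le> w" by simp
        moreover have "\<bar>drep (u t) x\<bar> \<le> w * n"
          using drep_abs_le[OF s uS[OF t], of x] by (simp add: w_def n_def mult.assoc)
        moreover have "drep (u \<tau>) x = drep ?k x + drep (u t) x" by (simp add: df)
        ultimately show "\<bar>drep (u \<tau>) x\<bar> \<le> M" using Mge by linarith
      next
        show "l2norm (rep (u \<tau>)) \<le> M"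
          using tri(1) rep_l2norm_le(1)[OF s k] rep_l2norm_le(1)[OF s uS[OF t]] k1 Mge
          unfolding r(1)[symmetric] n_def by linarith
        show "l2norm (drep (u \<tau>)) \<le> M"
          using tri(2) rep_l2norm_le(2)[OF s k] rep_l2norm_le(2)[OF s uS[OF t]] k1 Mge
          unfolding r(2)[symmetric] n_def by linarith
      qed
    qed
    show "\<exists>d>0. \<forall>a b. a \<le> t \<and> t \<le> b \<and> b - a < d \<longrightarrow> P a b"
    proof (intro exI[of _ d] conjI d(1) allI impI)
      fix a b assume ab: "a \<le> t \<and> t \<le> b \<and> b - a < d"
      have "\<forall>\<tau>\<in>{a..b} \<inter> {0..T}. Q M \<tau>"
      proof
        fix \<tau> assume "\<tau> \<in> {a..b} \<inter> {0..T}"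
        then show "Q M \<tau>" using ab by (intro Q\<tau>) (auto simp: dist_real_def)
      qed
      then show "P a b" unfolding P_def by blast
    qed
  qed
  then show ?thesis unfolding P_def Q_def by auto
qed

lemma l2norm_cong_AE:
  assumes "AE x in lborel. f x = g x" "f \<in> borel_measurable borel" "g \<in> borel_measurable borel"
  shows "l2norm f = l2norm g"
proof -
  have "(LBINT x. (f x)\<^sup>2) = (LBINT x. (g x)\<^sup>2)"
    using assms by (intro integral_cong_AE) (auto elim!: eventually_mono)
  then show ?thesis by (simp add: l2norm_def)
qed

text \<open>The time derivative lives in H^(s - 1), whose norm dominates the L2 norm because s - 1 >
  1/2. The functions \<open>u t\<close>, \<open>weak_deriv (u t)\<close> and the weak derivative of
  the convolution are replaced by classical ones, which affects the equation on null sets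
  only.\<close>

lemma solution_evolution:
  assumes s: "3 / 2 < s" and lam: "0 < lam" and sol: "solution_on \<alpha> \<beta> \<gamma> \<Gamma> lam s u0 T u"
  shows "\<exists>M D. evolution \<alpha> \<beta> \<gamma> \<Gamma> lam T M (\<lambda>t. rep (u t)) (\<lambda>t. drep (u t)) D"
proof -
  from sol have T: "0 < T" and cu: "continuous_into_sobolev s T u"
    by (auto simp: solution_on_def)
  from sol obtain D where C1: "C1_into_sobolev (s - 1) T u D"
    and pde: "\<forall>t\<in>{0<..T}. AE x in lborel.
          D t x + (u t x + \<Gamma>) * weak_deriv (u t) x + lam * u t x =
          weak_deriv (Lambda_inv2
            (\<lambda>y. h \<alpha> \<beta> \<gamma> \<Gamma> (u t y) - (u t y)\<^sup>2 - 1 / 2 * (weak_deriv (u t) y)\<^sup>2)) x"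
    by (auto simp: solution_on_def)
  obtain M0 where M0: "\<And>t x. t \<in> {0..T} \<Longrightarrow> \<bar>drep (u t) x\<bar> \<le> M0"
    "\<And>t. t \<in> {0..T} \<Longrightarrow> l2norm (rep (u t)) \<le> M0" "\<And>t. t \<in> {0..T} \<Longrightarrow> l2norm (drep (u t)) \<le> M0"
    using sobolev_path_bounded[OF s T cu] by blast
  have M0_nonneg: "0 \<le> M0" using M0(1)[of 0 0] T by (auto intro: order_trans[OF abs_ge_zero])
  have uS: "u t \<in> sobolev s" if "t \<in> {0..T}" for t
    using cu that by (simp add: continuous_into_sobolev_def)
  have s1: "1 / 2 < s - 1" using s by simp
  have uS1: "u t \<in> sobolev (s - 1)" if "t \<in> {0..T}" for t by (rule sobolev_mono[OF uS[OF that]]) simp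
  have DS: "D t \<in> sobolev (s - 1)" if "t \<in> {0..T}" for t
    using C1 that by (simp add: C1_into_sobolev_def continuous_into_sobolev_def)
  note R = rep_has_derivative[OF s uS] drep_continuous[OF s uS] rep_square_integrable[OF s uS]
    drep_square_integrable[OF s uS] rep_AE[OF s uS]
  have U_le: "\<bar>rep (u t) x\<bar> \<le> M0" if t: "t \<in> {0..T}" for t x
  proof -
    have "(max (rep (u t) x) 0)\<^sup>2 + (max (- rep (u t) x) 0)\<^sup>2 \<le> l2norm (rep (u t)) * l2norm (drep (u t))"
      by (rule sup_positive_negative_part_le[OF R(1)[OF t] R(2)[OF t] R(4)[OF t] R(3)[OF t]])
    also have "\<dots> \<le> M0 * M0" using M0(2,3)[OF t] M0_nonneg by (intro mult_mono) auto
    finally have "\<bar>rep (u t) x\<bar>\<^sup>2 \<le> M0\<^sup>2" by (auto simp: max_def power2_eq_square split: if_splits)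
    then show ?thesis using M0_nonneg by (rule power2_le_imp_le)
  qed
  have ut: "u t \<in> borel_measurable borel" if "t \<in> {0..T}" for t
    using sobolevD(1)[OF uS[OF that]] by (rule square_integrable_measurable)
  have cU: "continuous_on UNIV (rep (u t))" if "t \<in> {0..T}" for t
    using R(1)[OF that] by (meson DERIV_isCont continuous_at_imp_continuous_on)
  have "evolution \<alpha> \<beta> \<gamma> \<Gamma> lam T M0 (\<lambda>t. rep (u t)) (\<lambda>t. drep (u t)) D"
  proof (unfold_locales)
    show "square_integrable (D t)" if "t \<in> {0..T}" for t by (rule sobolevD(1)[OF DS[OF that]])
    show "((\<lambda>\<tau>. l2norm (\<lambda>x. (rep (u \<tau>) x - rep (u t) x) / (\<tau> - t) - D t x)) \<longlongrightarrow> 0) (at t within {0..T})"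
      if t: "t \<in> {0..T}" for t
    proof (rule Lim_null_comparison)
      show "((\<lambda>\<tau>. sobolev_norm (s - 1) (\<lambda>x. (u \<tau> x - u t x) / (\<tau> - t) - D t x)) \<longlongrightarrow> 0) (at t within {0..T})"
        using C1 t by (simp add: C1_into_sobolev_def)
      show "\<forall>\<^sub>F \<tau> in at t within {0..T}. norm (l2norm (\<lambda>x. (rep (u \<tau>) x - rep (u t) x) / (\<tau> - t) - D t x))
          \<le> sobolev_norm (s - 1) (\<lambda>x. (u \<tau> x - u t x) / (\<tau> - t) - D t x)"
        unfolding eventually_at_filter
      proof (intro always_eventually allI impI)
        fix \<tau> assume \<tau>: "\<tau> \<noteq> t" "\<tau> \<in> {0..T}"
        note [measurable] = ut[OF t] ut[OF \<tau>(2)] sobolevD(1)[OF DS[OF t], THEN square_integrable_measurable]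
          R(3)[OF t, THEN square_integrable_measurable] R(3)[OF \<tau>(2), THEN square_integrable_measurable]
        have "(\<lambda>x. 1 / (\<tau> - t) * (u \<tau> x - u t x) - D t x) \<in> sobolev (s - 1)"
          by (intro sobolev_diff sobolev_cmult uS1 DS t \<tau>)
        then have "l2norm (\<lambda>x. (u \<tau> x - u t x) / (\<tau> - t) - D t x) \<le> sobolev_norm (s - 1) (\<lambda>x. (u \<tau> x - u t x) / (\<tau> - t) - D t x)"
          by (intro sobolev_l2norm_le s1) simp
        moreover have "l2norm (\<lambda>x. (rep (u \<tau>) x - rep (u t) x) / (\<tau> - t) - D t x) = l2norm (\<lambda>x. (u \<tau> x - u t x) / (\<tau> - t) - D t x)"
        proof (rule l2norm_cong_AE)
          show "AE x in lborel. (rep (u \<tau>) x - rep (u t) x) / (\<tau> - t) - D t x = (u \<tau> x - u t x) / (\<tau> - t) - D t x"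
            using R(5)[OF t] R(5)[OF \<tau>(2)] by eventually_elim simp
        qed measurable
        ultimately show "norm (l2norm (\<lambda>x. (rep (u \<tau>) x - rep (u t) x) / (\<tau> - t) - D t x))
          \<le> sobolev_norm (s - 1) (\<lambda>x. (u \<tau> x - u t x) / (\<tau> - t) - D t x)" by simp
      qed
    qed
    fix t assume t0: "t \<in> {0<..T}"
    then have t: "t \<in> {0..T}" by auto
    note wd = weak_deriv_classical[OF R(1)[OF t] R(2)[OF t] ut[OF t] R(5)[OF t]]
    let ?G = "nonlocal_term \<alpha> \<beta> \<gamma> \<Gamma> (rep (u t)) (drep (u t))"
    obtain B where "bounded_continuous ?G B"
      using nonlocal_term_bounded_continuous[OF cU[OF t] U_le[OF t] R(2)[OF t] M0(1)[OF t]] by blast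
    then interpret bounded_continuous ?G B .
    note [measurable] = ut[OF t] wd(2)
    have hm: "h \<alpha> \<beta> \<gamma> \<Gamma> \<in> borel_measurable borel" unfolding h_def[abs_def] by measurable
    have "Lambda_inv2 (\<lambda>y. h \<alpha> \<beta> \<gamma> \<Gamma> (u t y) - (u t y)\<^sup>2 - 1 / 2 * (weak_deriv (u t) y)\<^sup>2) = Lambda_inv2 ?G"
    proof
      fix x
      show "Lambda_inv2 (\<lambda>y. h \<alpha> \<beta> \<gamma> \<Gamma> (u t y) - (u t y)\<^sup>2 - 1 / 2 * (weak_deriv (u t) y)\<^sup>2) x = Lambda_inv2 ?G x"
        unfolding Lambda_inv2_def
      proof (rule integral_cong_AE)
        show "AE y in lborel. 1 / 2 * exp (- \<bar>x - y\<bar>) * (h \<alpha> \<beta> \<gamma> \<Gamma> (u t y) - (u t y)\<^sup>2 - 1 / 2 * (weak_deriv (u t) y)\<^sup>2)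
            = 1 / 2 * exp (- \<bar>x - y\<bar>) * ?G y"
          using R(5)[OF t] wd(1) by eventually_elim (simp add: nonlocal_term_def)
        show "(\<lambda>y. 1 / 2 * exp (- \<bar>x - y\<bar>) * (h \<alpha> \<beta> \<gamma> \<Gamma> (u t y) - (u t y)\<^sup>2 - 1 / 2 * (weak_deriv (u t) y)\<^sup>2)) \<in> borel_measurable lborel"
          unfolding h_def by measurable
      qed measurable
    qed
    moreover have "AE x in lborel. weak_deriv (Lambda_inv2 ?G) x = dLambda_inv2 ?G x"
      by (rule weak_deriv_classical(1)[OF Lambda_inv2_has_derivative continuous_on_dLambda_inv2
          borel_measurable_continuous_onI[OF continuous_on_Lambda_inv2]]) simp
    ultimately show "AE x in lborel. D t x = dLambda_inv2 ?G x - (rep (u t) x + \<Gamma>) * drep (u t) x - lam * rep (u t) x"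
      using pde[rule_format, OF t0] R(5)[OF t] wd(1)
    proof -
      assume e: "Lambda_inv2 (\<lambda>y. h \<alpha> \<beta> \<gamma> \<Gamma> (u t y) - (u t y)\<^sup>2 - 1 / 2 * (weak_deriv (u t) y)\<^sup>2) = Lambda_inv2 ?G"
        and w: "AE x in lborel. weak_deriv (Lambda_inv2 ?G) x = dLambda_inv2 ?G x"
      show ?thesis
        using pde[rule_format, OF t0, unfolded e] w R(5)[OF t] wd(1)
      proof eventually_elim
        case (elim x)
        then show ?case by simp
      qed
    qed
  qed (use T lam R M0 U_le in auto)
  then show ?thesis by blast
qed

section \<open>The bound on the existence time\<close>

lemma const_Ksq_nonneg:
  assumes "0 < lam" "0 < c" "0 \<le> N" "1 \<le> n"
  shows "0 \<le> const_Ksq \<alpha> \<beta> \<gamma> \<Gamma> lam c n N"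
proof -
  have "0 \<le> const_C13 \<alpha> \<beta> \<gamma> \<Gamma> n N"
    using assms unfolding const_C13_def by (intro add_nonneg_nonneg divide_nonneg_nonneg mult_nonneg_nonneg) auto
  moreover have "0 \<le> const_C2 \<alpha> \<beta> \<gamma> \<Gamma>" by (simp add: const_C2_def)
  ultimately show ?thesis
    using assms unfolding const_Ksq_def
    by (intro add_nonneg_nonneg divide_nonneg_nonneg mult_nonneg_nonneg zero_le_power) auto
qed

text \<open>The bound concerns an arbitrary existence time and an arbitrary solution realising it,
  so that it passes to the supremum defining the lifespan.\<close>

lemma solution_time_le:
  assumes lam: "0 < lam" and s: "3 / 2 < s" and u0: "u0 \<in> sobolev s" and n: "1 \<le> n"
    and GN: "gagliardo_nirenberg_constant n c"
    and f0: "(LBINT x. weak_deriv u0 x ^ (2 * n + 1))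
      < - ((8 * c * const_Ksq \<alpha> \<beta> \<gamma> \<Gamma> lam c n (sobolev_norm 1 u0) * sobolev_norm 1 u0 powr (2 / (2 * real n - 1)) / (2 * real n - 1))
          powr ((2 * real n - 1) / (2 * real n)))"
    and sol: "solution_on \<alpha> \<beta> \<gamma> \<Gamma> lam s u0 T u"
  shows "T \<le> (LBINT y:{- (LBINT x. weak_deriv u0 x ^ (2 * n + 1))..}.
    1 / ((2 * real n - 1) / (8 * c) * sobolev_norm 1 u0 powr (- 2 / (2 * real n - 1)) * y powr (2 * real n / (2 * real n - 1))
      - const_Ksq \<alpha> \<beta> \<gamma> \<Gamma> lam c n (sobolev_norm 1 u0)))"
proof -
  define N where "N = sobolev_norm 1 u0"
  define K where "K = const_Ksq \<alpha> \<beta> \<gamma> \<Gamma> lam c n N"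
  define y0 where "y0 = - (LBINT x. weak_deriv u0 x ^ (2 * n + 1))"
  define q where "q = 2 * real n / (2 * real n - 1)"
  define a where "a = (2 * real n - 1) / (8 * c) * N powr (- 2 / (2 * real n - 1))"
  have c: "0 < c" using GN by (simp add: gagliardo_nirenberg_constant_def)
  have n1: "0 < 2 * real n - 1" using n by simp
  have q: "1 < q" using n1 by (simp add: q_def)
  have N: "0 \<le> N" by (simp add: N_def sobolev_norm_def)
  have K: "0 \<le> K" unfolding K_def by (rule const_Ksq_nonneg[OF lam c N n])
  obtain M D where ev: "evolution \<alpha> \<beta> \<gamma> \<Gamma> lam T M (\<lambda>t. rep (u t)) (\<lambda>t. drep (u t)) D"
    using solution_evolution[OF s lam sol] by blast
  then interpret evolution \<alpha> \<beta> \<gamma> \<Gamma> lam T M "\<lambda>t. rep (u t)" "\<lambda>t. drep (u t)" D .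
  have t0: "0 \<in> {0..T}" using T by simp
  have uS: "u t \<in> sobolev s" if "t \<in> {0..T}" for t
    using sol that by (simp add: solution_on_def continuous_into_sobolev_def)
  have ut: "u t \<in> borel_measurable borel" if "t \<in> {0..T}" for t
    using sobolevD(1)[OF uS[OF that]] by (rule square_integrable_measurable)
  \<comment> \<open>\<open>u 0\<close> and \<open>u0\<close> agree only almost everywhere, but their
    chosen transforms are the same function, and with them \<open>rep\<close>, \<open>drep\<close>
    and the H1 norm.\<close>
  have "fourier (u 0) = fourier u0"
    using sol ut[OF t0] u0 by (intro fourier_cong_AE) (auto simp: solution_on_def sobolev_def)
  then have reps: "rep (u 0) = rep u0" "drep (u 0) = drep u0" and norms: "sobolev_norm 1 (u 0) = N"
    by (simp_all add: rep_def drep_def N_def sobolev_norm_def)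
  have u0m: "u0 \<in> borel_measurable borel" using u0 by (simp add: sobolev_def)
  note wd0 = weak_deriv_classical[OF rep_has_derivative[OF s u0] drep_continuous[OF s u0] u0m rep_AE[OF s u0]]
  define f where "f t = (LBINT x. drep (u t) x ^ (2 * n + 1))" for t
  have f_0: "f 0 = - y0"
  proof -
    note [measurable] = wd0(2) drep_square_integrable[OF s u0, THEN square_integrable_measurable]
    have "(LBINT x. weak_deriv u0 x ^ (2 * n + 1)) = (LBINT x. drep u0 x ^ (2 * n + 1))"
      using wd0(1) by (intro integral_cong_AE) (auto elim!: eventually_mono)
    then show ?thesis by (simp add: f_def reps y0_def)
  qed
  \<comment> \<open>The results on powers n + 2 are used with 2n - 1 in place of n; subtraction is
    truncated, and n >= 1 makes the exponent the intended 2n + 1.\<close>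
  have idx: "2 * n - 1 + 2 = 2 * n + 1" using n by simp
  have energy: "(l2norm (rep (u t)))\<^sup>2 + (l2norm (drep (u t)))\<^sup>2 \<le> N\<^sup>2" if "t \<in> {0..T}" for t
  proof -
    have "(l2norm (rep (u 0)))\<^sup>2 + (l2norm (drep (u 0)))\<^sup>2 \<le> N\<^sup>2"
      using rep_H1_le[OF s uS[OF t0]] unfolding norms .
    then show ?thesis using energy_le[OF that] by linarith
  qed
  have y0_gt: "(8 * c * K * N powr (2 / (2 * real n - 1)) / (2 * real n - 1)) powr ((2 * real n - 1) / (2 * real n)) < y0"
    using f0 unfolding y0_def K_def N_def by linarith
  \<comment> \<open>N has a negative exponent in the coefficient a, and 0 to any real power is 0, so
    N = 0 has to be excluded: the slope would vanish and with it f(0), against the strict hypothesis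
    on f(0).\<close>
  have N_pos: "0 < N"
  proof (rule ccontr)
    assume "\<not> 0 < N"
    with N have N0: "N = 0" by simp
    have "(l2norm (drep (u 0)))\<^sup>2 \<le> 0"
      using energy[OF t0] zero_le_power2[of "l2norm (rep (u 0))"]
      unfolding N0 zero_power2 by linarith
    then have z: "l2norm (drep (u 0)) = 0" by (simp del: l2norm_power2)
    have "\<bar>LBINT x. drep (u 0) x ^ (2 * n - 1) * drep (u 0) x * drep (u 0) x\<bar>
        \<le> M ^ (2 * n - 1) * l2norm (drep (u 0)) * l2norm (drep (u 0))"
      using measurable_UVD(2)[OF t0] V_le[OF t0]
      by (intro integral_triple_bound(2) V_si t0) (auto simp: power_abs intro: power_mono)
    then have "(LBINT x. drep (u 0) x ^ (2 * n - 1) * drep (u 0) x * drep (u 0) x) = 0"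
      unfolding z by simp
    moreover have "drep (u 0) x ^ (2 * n - 1) * drep (u 0) x * drep (u 0) x = drep (u 0) x ^ (2 * n + 1)" for x
      unfolding idx[symmetric] by simp
    ultimately have "f 0 = 0" by (simp only: f_def)
    with f_0 y0_gt show False unfolding N0 by simp
  qed
  have a: "0 < a" using n1 c N_pos by (simp add: a_def)
  have y0: "0 < y0" using y0_gt powr_ge_zero order_le_less_trans by blast
  \<comment> \<open>Raised to the power q, the hypothesis on f(0) says that the Riccati right-hand
    side is positive at the starting value.\<close>
  have y0K: "K < a * y0 powr q"
  proof -
    have e: "8 * c * K * N powr (2 / (2 * real n - 1)) / (2 * real n - 1) = K / a"
      using N_pos c n1 by (simp add: a_def powr_minus field_simps)
    have "((K / a) powr ((2 * real n - 1) / (2 * real n))) powr q < y0 powr q"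
      using y0_gt q unfolding e by (intro powr_less_mono2) auto
    moreover have "(2 * real n - 1) / (2 * real n) * q = 1" using n n1 by (simp add: q_def)
    ultimately have "K / a < y0 powr q" using K a by (simp add: powr_powr)
    then show ?thesis using a by (simp add: divide_less_eq mult.commute)
  qed
  have rate: "rhs_slope (2 * n - 1) t \<le> K - a * \<bar>f t\<bar> powr q" if t: "t \<in> {0..T}" for t
  proof -
    let ?v = "drep (u t)"
    interpret p: H1_profile "rep (u t)" ?v M N
      by unfold_locales (use U_deriv[OF t] V_cont[OF t] U_si[OF t] V_si[OF t] U_le[OF t] V_le[OF t] N energy[OF t] in auto)
    note wd = weak_deriv_classical[OF U_deriv[OF t] V_cont[OF t] ut[OF t] rep_AE[OF s uS[OF t]]]
    note [measurable] = wd(2) measurable_UVD(2)[OF t]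
    have cong: "(LBINT x. weak_deriv (u t) x ^ k) = (LBINT x. ?v x ^ k)" for k
      using wd(1) by (intro integral_cong_AE) (auto elim!: eventually_mono)
    have "integrable lborel (\<lambda>x. weak_deriv (u t) x ^ (2 * n + 2))"
    proof (rule integrable_cong_AE_imp[OF p.v_power_integrable[OF n]])
      show "AE x in lborel. ?v x ^ (2 * n + 2) = weak_deriv (u t) x ^ (2 * n + 2)"
        using wd(1) by eventually_elim simp
    qed measurable
    moreover have "u t \<in> sobolev 1" by (rule sobolev_mono[OF uS[OF t]]) (use s in simp)
    ultimately have gn: "\<bar>LBINT x. ?v x ^ (2 * n + 1)\<bar> powr (2 * real n / (2 * real n - 1))
          \<le> c * (LBINT x. (?v x)\<^sup>2) powr (1 / (2 * real n - 1)) * (LBINT x. ?v x ^ (2 * n + 2))"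
      using GN unfolding gagliardo_nirenberg_constant_def cong[symmetric] by blast
    have pw: "?v x * ?v x ^ (2 * n - 1) * ?v x * ?v x = ?v x ^ (2 * n + 2)"
      "?v x ^ (2 * n - 1) * ?v x * ?v x = ?v x ^ (2 * n + 1)"
      "?v x ^ (2 * n - 1) * ?v x = ?v x ^ (2 * n)" for x
    proof -
      have "2 * n = Suc (2 * n - 1)" using n by simp
      then show 1: "?v x ^ (2 * n - 1) * ?v x = ?v x ^ (2 * n)" by (metis power_Suc2)
      show "?v x ^ (2 * n - 1) * ?v x * ?v x = ?v x ^ (2 * n + 1)" unfolding 1 by simp
      have "?v x * ?v x ^ (2 * n - 1) * ?v x * ?v x = (?v x ^ (2 * n - 1) * ?v x) * ?v x * ?v x"
        by (simp only: mult_ac)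
      also have "\<dots> = ?v x ^ (2 * n + 2)" unfolding 1 by simp
      finally show "?v x * ?v x ^ (2 * n - 1) * ?v x * ?v x = ?v x ^ (2 * n + 2)" .
    qed
    have i: "integrable lborel (\<lambda>x. ?v x ^ (2 * n) * (W t x - G t x))"
    proof -
      have "integrable lborel (\<lambda>x. ?v x ^ (2 * n - 1) * ?v x * (W t x - G t x))"
        using V_le[OF t] by (intro integral_triple_bound(1)[where K = "M ^ (2 * n - 1)"] V_si[OF t] Lambda_inv2_G_facts(8)[OF t])
          (auto simp: power_abs intro: power_mono)
      then show ?thesis by (simp only: pw)
    qed
    have "rhs_slope (2 * n - 1) t = - (2 * real n) * (LBINT x. ?v x ^ (2 * n + 2))
        - lam * (2 * real n + 1) * (LBINT x. ?v x ^ (2 * n + 1))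
        + (2 * real n + 1) * (LBINT x. ?v x ^ (2 * n) * (W t x - G t x))"
    proof -
      have r: "real (2 * n - 1 + 2) = 2 * real n + 1" unfolding idx by simp
      show ?thesis unfolding rhs_slope_def pw r by (simp add: algebra_simps)
    qed
    also have "\<dots> \<le> K - a * \<bar>f t\<bar> powr q"
      unfolding K_def a_def q_def f_def by (rule p.slope_rate_le[OF n c lam N_pos gn i])
    finally show ?thesis .
  qed
  \<comment> \<open>The comparison is made for - f, which starts at y0 > 0.\<close>
  have "T \<le> (LBINT y:{y0..}. 1 / (a * y powr q - K))"
  proof (rule riccati_time_le[OF q a K y0 y0K T])
    show "- f 0 = y0" using f_0 by simp
    show "((\<lambda>t. - rhs_slope (2 * n - 1) t) has_integral (- f t - - f 0)) {0..t}" if "t \<in> {0..T}" for t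
    proof -
      have "(rhs_slope (2 * n - 1) has_integral (f t - f 0)) {0..t}"
        using slope_power_has_integral[OF that, of "2 * n - 1"] unfolding idx f_def .
      from has_integral_neg[OF this] show ?thesis by simp
    qed
    show "a * \<bar>- f t\<bar> powr q - K \<le> - rhs_slope (2 * n - 1) t" if "t \<in> {0..T}" for t
      using rate[OF that] by simp
  qed
  then show ?thesis unfolding y0_def a_def q_def K_def N_def .
qed

theorem theorem4p7:
  fixes \<alpha> \<beta> \<gamma> \<Gamma> lam s c N Ksq f0 :: real
    and n :: nat
    and u0 :: "real \<Rightarrow> real"
    and u :: "real \<Rightarrow> real \<Rightarrow> real"
  defines "N \<equiv> sobolev_norm 1 u0"
    and "Ksq \<equiv> const_Ksq \<alpha> \<beta> \<gamma> \<Gamma> lam c n N"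
    and "f0 \<equiv> (LBINT x. weak_deriv u0 x ^ (2 * n + 1))"
  assumes "lam > 0"
    and "s > 3 / 2"
    and "u0 \<in> sobolev s"
    and "corresponding_solution \<alpha> \<beta> \<gamma> \<Gamma> lam s u0 u"
    and "n \<ge> 1"
    and "gagliardo_nirenberg_constant n c"
    and "f0 < - ((8 * c * Ksq * N powr (2 / (2 * real n - 1)) / (2 * real n - 1))
                   powr ((2 * real n - 1) / (2 * real n)))"
  shows "\<exists>T. blows_up_in_finite_time \<alpha> \<beta> \<gamma> \<Gamma> lam s u0 u T \<and>
    T \<le> (LBINT y:{- f0..}. 1 / ((2 * real n - 1) / (8 * c) * N powr (- 2 / (2 * real n - 1))
                                  * y powr (2 * real n / (2 * real n - 1)) - Ksq))"
proof -
  let ?I = "LBINT y:{- f0..}. 1 / ((2 * real n - 1) / (8 * c) * N powr (- 2 / (2 * real n - 1))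
                                  * y powr (2 * real n / (2 * real n - 1)) - Ksq)"
  let ?L = "lifespan \<alpha> \<beta> \<gamma> \<Gamma> lam s u0"
  \<comment> \<open>Any solution u' has to be considered here, since the lifespan is a supremum over
    all of them and not only over restrictions of u.\<close>
  have "T \<le> ?I" if "solution_on \<alpha> \<beta> \<gamma> \<Gamma> lam s u0 T u'" for T u'
    unfolding N_def Ksq_def f0_def
    by (rule solution_time_le[OF assms(4-6,8,9) _ that]) (use assms(10) in \<open>simp only: N_def Ksq_def f0_def\<close>)
  then have "?L \<le> ereal ?I"
    unfolding lifespan_def by (intro Sup_least) auto
  moreover have "0 < ?L" using assms(7) by (simp add: corresponding_solution_def)
  \<comment> \<open>Positive and bounded by a real number, the extended real lifespan is itself
    real.\<close>
  ultimately obtain T where T: "?L = ereal T" "T \<le> ?I" by (cases ?L) auto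
  then show ?thesis using assms(7) unfolding blows_up_in_finite_time_def by blast
qed

end
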